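(* Let $n,N\ge 2$ and $k$ be integers with $2\le k\le\min\{n,N\}$, and let $1\le p<k$. Suppose $f\colon\mathbb{R}^{N\times n}\to\mathbb{R}$ is continuous, bounded below and $W^{1,p}$-quasiconvex. Suppose also that there are an exponent $1\le q<k$ and a constant $L>0$ such that $$f(\xi)\le L(1+|\xi|^q)\qquad\text{for all }\xi\in\mathbb{R}^{N\times n}\text{ with }\operatorname{rank}(\xi)\le k-1.$$ Then there is a constant $L'>0$ (perhaps larger than $L$) such that $$f(\xi)\le L'(1+|\xi|^q)\qquad\text{for all }\xi\in\mathbb{R}^{N\times n},$$ and hence $f$ is $W^{1,q}$-quasiconvex.
   Context: $\mathbb{R}^{N\times n}$ is the space of real $N\times n$ matrices, $|\cdot|$ is any fixed norm on it (for example the Euclidean norm $|\xi|=(\sum_{i,j}\xi_{ij}^2)^{1/2}$), and $\mathscr{L}^n$ is Lebesgue measure on $\mathbb{R}^n$. Definition ($W^{1,p}$-quasiconvexity). Let $f\colon\mathbb{R}^{N\times n}\to\mathbb{R}\cup\{+\infty\}$ be Borel measurable and bounded below, and let $1\le p\le\infty$. $f$ is $W^{1,p}$-quasiconvex at $\xi\in\mathbb{R}^{N\times n}$ if for some nonempty bounded open set $\Omega\subset\mathbb{R}^n$ with $\mathscr{L}^n(\partial\Omega)=0$ one has $$\int_\Omega f(\xi+\nabla\phi(x))\,dx\ \ge\ \mathscr{L}^n(\Omega)\,f(\xi)\qquad\text{for all }\phi\in W^{1,p}_0(\Omega;\mathbb{R}^N).$$ $f$ is $W^{1,p}$-quasiconvex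 if this holds at every $\xi\in\mathbb{R}^{N\times n}$. (If the inequality holds for one such set $\Omega$, it holds for all bounded open sets $D\subset\mathbb{R}^n$ with $\mathscr{L}^n(\partial D)=0$.) *)

theory Defs
  imports "HOL-Analysis.Analysis"
begin

definition is_norm :: "('a::real_vector \<Rightarrow> real) \<Rightarrow> bool" where
  "is_norm \<nu> \<longleftrightarrow>
     (\<forall>x. 0 \<le> \<nu> x) \<and> (\<forall>x. \<nu> x = 0 \<longleftrightarrow> x = 0) \<and>
     (\<forall>c x. \<nu> (c *\<^sub>R x) = \<bar>c\<bar> * \<nu> x) \<and>
     (\<forall>x y. \<nu> (x + y) \<le> \<nu> x + \<nu> y)"


subsection \<open>Test functions and derivatives\<close>

primrec C_k :: "nat \<Rightarrow> ('a::euclidean_space \<Rightarrow> 'b::real_normed_vector) \<Rightarrow> bool" where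
  "C_k 0 g \<longleftrightarrow> continuous_on UNIV g"
| "C_k (Suc m) g \<longleftrightarrow> (\<forall>x. g differentiable (at x)) \<and>
     (\<forall>b\<in>Basis. C_k m (\<lambda>x. frechet_derivative g (at x) b))"

text \<open>The space of smooth functions with compact support contained in \<open>\<Omega>\<close>, extended by zero
  to the whole space.\<close>
definition test_functions :: "'a::euclidean_space set \<Rightarrow> ('a \<Rightarrow> 'b::real_normed_vector) set" where
  "test_functions \<Omega> = {\<psi>. (\<forall>m. C_k m \<psi>) \<and>
     compact (closure {x. \<psi> x \<noteq> 0}) \<and> closure {x. \<psi> x \<noteq> 0} \<subseteq> \<Omega>}"

definition partial :: "'n::finite \<Rightarrow> (real^'n \<Rightarrow> 'b::real_normed_vector) \<Rightarrow> real^'n \<Rightarrow> 'b" where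
  "partial j g x = frechet_derivative g (at x) (axis j 1)"

text \<open>A map from $n$-space to $N$-space has an $N \times n$ gradient, whose type is
  \<open>real^'n^'N\<close> (columns first).\<close>
definition grad :: "(real^'n \<Rightarrow> real^'N) \<Rightarrow> real^'n \<Rightarrow> real^'n^'N" where
  "grad g x = (\<chi> i j. partial j g x $ i)"


subsection \<open>Sobolev spaces\<close>

definition locally_integrable ::
  "'a::euclidean_space set \<Rightarrow> ('a \<Rightarrow> 'b::euclidean_space) \<Rightarrow> bool" where
  "locally_integrable \<Omega> u \<longleftrightarrow> (\<forall>K. compact K \<and> K \<subseteq> \<Omega> \<longrightarrow> u absolutely_integrable_on K)"

definition weak_grad ::
  "(real^'n) set \<Rightarrow> (real^'n \<Rightarrow> real^'N) \<Rightarrow> (real^'n \<Rightarrow> real^'n^'N) \<Rightarrow> bool" where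
  "weak_grad \<Omega> u G \<longleftrightarrow> locally_integrable \<Omega> u \<and> locally_integrable \<Omega> G \<and>
     (\<forall>\<psi> :: real^'n \<Rightarrow> real. \<psi> \<in> test_functions \<Omega> \<longrightarrow>
        (\<forall>i j. (\<integral>x. u x $ i * partial j \<psi> x \<partial>lebesgue_on \<Omega>) =
             - (\<integral>x. G x $ i $ j * \<psi> x \<partial>lebesgue_on \<Omega>)))"

definition Lp :: "real \<Rightarrow> 'a::euclidean_space set \<Rightarrow> ('a \<Rightarrow> 'b::euclidean_space) set" where
  "Lp p \<Omega> = {u. u \<in> borel_measurable (lebesgue_on \<Omega>) \<and>
                 integrable (lebesgue_on \<Omega>) (\<lambda>x. norm (u x) powr p)}"

definition Lp_norm :: "real \<Rightarrow> 'a::euclidean_space set \<Rightarrow> ('a \<Rightarrow> 'b::euclidean_space) \<Rightarrow> real" where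
  "Lp_norm p \<Omega> u = (\<integral>x. norm (u x) powr p \<partial>lebesgue_on \<Omega>) powr (1 / p)"

text \<open>\<open>W1p0 p \<Omega>\<close> is the closure of the test functions in the Sobolev space with norm
  \<open>Lp_norm p \<Omega> u + Lp_norm p \<Omega> G\<close>, \<open>G\<close> the weak gradient of \<open>u\<close>, for finite exponents
  \<open>p \<ge> 1\<close>. Elements are functions rather than equivalence classes; only their restriction
  to \<open>\<Omega>\<close> matters.\<close>
definition W1p0 :: "real \<Rightarrow> (real^'n) set \<Rightarrow> (real^'n \<Rightarrow> real^'N) set" where
  "W1p0 p \<Omega> = {u. u \<in> Lp p \<Omega> \<and> (\<exists>G. weak_grad \<Omega> u G \<and> G \<in> Lp p \<Omega> \<and>
     (\<exists>\<phi> :: nat \<Rightarrow> real^'n \<Rightarrow> real^'N. (\<forall>m. \<phi> m \<in> test_functions \<Omega>) \<and>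
        (\<lambda>m. Lp_norm p \<Omega> (\<lambda>x. \<phi> m x - u x)) \<longlonglongrightarrow> 0 \<and>
        (\<lambda>m. Lp_norm p \<Omega> (\<lambda>x. grad (\<phi> m) x - G x)) \<longlonglongrightarrow> 0))}"


subsection \<open>Quasiconvexity\<close>

text \<open>The integral of an extended-real function, as positive minus negative part
  (\<open>e2ennreal\<close> truncates negative values to zero). It is used only for functions bounded below
  on sets of finite measure, where the negative part is finite.\<close>
definition ext_integral :: "'a measure \<Rightarrow> ('a \<Rightarrow> ereal) \<Rightarrow> ereal" where
  "ext_integral M g =
     enn2ereal (\<integral>\<^sup>+x. e2ennreal (g x) \<partial>M) - enn2ereal (\<integral>\<^sup>+x. e2ennreal (- g x) \<partial>M)"

text \<open>The integrand \<open>f\<close> is meant to be Borel measurable, bounded below and never \<open>-\<infinity>\<close>.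
  The weak gradient \<open>G\<close> of \<open>\<phi>\<close> is unique up to null sets, so quantifying over all of its
  representatives does not change the meaning.\<close>
definition W1p_quasiconvex_at :: "real \<Rightarrow> (real^'n^'N \<Rightarrow> ereal) \<Rightarrow> real^'n^'N \<Rightarrow> bool" where
  "W1p_quasiconvex_at p f \<xi> \<longleftrightarrow>
     (\<exists>\<Omega> :: (real^'n) set. \<Omega> \<noteq> {} \<and> bounded \<Omega> \<and> open \<Omega> \<and> emeasure lebesgue (frontier \<Omega>) = 0 \<and>
        (\<forall>\<phi> G. \<phi> \<in> W1p0 p \<Omega> \<and> weak_grad \<Omega> \<phi> G \<longrightarrow>
           ext_integral (lebesgue_on \<Omega>) (\<lambda>x. f (\<xi> + G x)) \<ge> ereal (measure lebesgue \<Omega>) * f \<xi>))"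

definition W1p_quasiconvex :: "real \<Rightarrow> (real^'n^'N \<Rightarrow> ereal) \<Rightarrow> bool" where
  "W1p_quasiconvex p f \<longleftrightarrow> (\<forall>\<xi>. W1p_quasiconvex_at p f \<xi>)"

end

theory Submission
  imports Defs
begin

text \<open>Fix \<open>\<xi>\<close> and a small ball in the domain that tests quasiconvexity at \<open>\<xi>\<close>. Put on the ball a Whitney-type
  grid, dyadically refined towards the sphere, and let \<open>v\<close> be the map that projects every cell to the
  \<open>(k - 1)\<close>-skeleton of the grid. It maps almost every point into a set where only \<open>k - 1\<close> coordinates are
  free, so \<open>\<nabla>v\<close> has rank at most \<open>k - 1\<close>; it is the identity on the sphere; and \<open>\<bar>\<nabla>v\<bar>\<close> blows up like the
  inverse distance to the dual skeleton, which has codimension \<open>k\<close>. Hence \<open>\<nabla>v\<close> is in \<open>L\<^sup>s\<close> for every \<open>s < k\<close>, and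
  averaging over translations of the grid bounds \<open>\<integral>\<bar>\<nabla>v\<bar>\<^sup>s\<close> by a constant times the volume of the ball.
  With \<open>\<xi> (v - id)\<close> as test function, \<open>f\<close> is only evaluated at the low-rank matrices \<open>\<xi> \<nabla>v\<close> on the ball, and the
  assumed growth there carries over to \<open>\<xi>\<close>. The second claim follows from the growth bound by density of the test
  functions and Fatou's lemma.\<close>

subsection \<open>Smooth bump functions\<close>

text \<open>The rank has to stay below \<open>k\<close> everywhere in the ball, also in the
  transition between cells of one width and cells of half that width, where the two skeletal
  projections disagree. A convex combination of them could raise the rank. Instead the coarse
  projection is released gradually by a parameter \<open>\<beta>\<close> and the fine projection is
  applied last: it always lands in the fine skeleton, and it fixes the coarse skeleton, which is
  part of the fine one. So both ends of the transition match the neighbouring layers. The refinement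
  keeps \<open>v - id\<close> within a multiple of the distance to the sphere. The field
  \<open>v\<close> does not depend on \<open>\<xi>\<close>, which only multiplies it, so one
  estimate with \<open>s = max p q < k\<close> serves all \<open>\<xi>\<close>: \<open>p\<close>
  makes the test function admissible, \<open>q\<close> makes the growth integral finite. Off the
  ball the terms with \<open>f \<xi>\<close> cancel, so the testing domain drops out. The Sobolev
  space is a closure of test functions, while \<open>v\<close> is singular; so \<open>v - id\<close>
  is cut off near its singular set and near the sphere, and then mollified.\<close>

lemma C_k_Suc_imp: "C_k (Suc m) g \<Longrightarrow> C_k m g"
proof (induction m arbitrary: g)
  case 0
  then show ?case
    by (auto simp: continuous_on_eq_continuous_within differentiable_imp_continuous_within)
qed auto

lemma frechet_derivative_eqI: "(f has_derivative f') (at x) \<Longrightarrow> frechet_derivative f (at x) = f'"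
  by (metis frechet_derivative_at)

lemma C_k_const [simp]: "C_k m (\<lambda>x. c)"
proof (induction m arbitrary: c)
  case (Suc m)
  then show ?case by (auto simp: frechet_derivative_eqI[OF has_derivative_const])
qed simp

lemma differentiable_has_frechet:
  "f differentiable (at x) \<Longrightarrow> (f has_derivative frechet_derivative f (at x)) (at x)"
  by (simp add: frechet_derivative_works)

lemma C_k_add: "C_k m f \<Longrightarrow> C_k m g \<Longrightarrow> C_k m (\<lambda>x. f x + g x)"
proof (induction m arbitrary: f g)
  case (Suc m)
  have "frechet_derivative (\<lambda>x. f x + g x) (at x)
      = (\<lambda>b. frechet_derivative f (at x) b + frechet_derivative g (at x) b)" for x
    using Suc.prems by (intro frechet_derivative_eqI has_derivative_add differentiable_has_frechet) auto
  then show ?case using Suc by auto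
qed (auto intro: continuous_intros)

lemma C_k_scaleR:
  fixes f :: "'a::euclidean_space \<Rightarrow> real"
  shows "C_k m f \<Longrightarrow> C_k m g \<Longrightarrow> C_k m (\<lambda>x. f x *\<^sub>R g x)"
proof (induction m arbitrary: f g)
  case (Suc m)
  have *: "((\<lambda>x. f x *\<^sub>R g x) has_derivative
       (\<lambda>b. f x *\<^sub>R frechet_derivative g (at x) b + frechet_derivative f (at x) b *\<^sub>R g x)) (at x)" for x
    using Suc.prems by (intro has_derivative_scaleR differentiable_has_frechet) auto
  have "C_k m f" "C_k m g" using Suc.prems C_k_Suc_imp by auto
  then show ?case using Suc
    using * by (auto simp: frechet_derivative_eqI[OF *] differentiable_def intro!: C_k_add)
qed (auto intro: continuous_intros)

lemma C_k_mult:
  fixes f g :: "'a::euclidean_space \<Rightarrow> real"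
  shows "C_k m f \<Longrightarrow> C_k m g \<Longrightarrow> C_k m (\<lambda>x. f x * g x)"
  using C_k_scaleR[of m f g] by simp

lemma C_k_prod:
  fixes f :: "'i \<Rightarrow> 'a::euclidean_space \<Rightarrow> real"
  assumes "finite I" "\<And>i. i \<in> I \<Longrightarrow> C_k m (f i)"
  shows "C_k m (\<lambda>x. \<Prod>i\<in>I. f i x)"
  using assms by (induction I rule: finite_induct) (auto intro: C_k_mult)

lemma C_k_exp:
  fixes f :: "'a::euclidean_space \<Rightarrow> real"
  shows "C_k m f \<Longrightarrow> C_k m (\<lambda>x. exp (f x))"
proof (induction m)
  case (Suc m)
  have *: "((\<lambda>x. exp (f x)) has_derivative (\<lambda>b. frechet_derivative f (at x) b * exp (f x))) (at x)" for x
    using has_derivative_exp[OF differentiable_has_frechet[of f x]] Suc.prems by auto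
  have "C_k m f" using Suc.prems C_k_Suc_imp by auto
  then show ?case using Suc
    using * by (auto simp: frechet_derivative_eqI[OF *] differentiable_def intro!: C_k_mult)
qed (auto intro: continuous_intros)

text \<open>The polynomial parameter makes the family closed under differentiation: the derivative
  of \<open>P(1/s) exp(-1/s)\<close> is \<open>(1/s)^2 (P - P')(1/s) exp(-1/s)\<close>. Smoothness
  then follows by induction with arbitrary \<open>P\<close>.\<close>

definition flat_exp :: "real poly \<Rightarrow> real \<Rightarrow> real" where
  "flat_exp P s = (if s > 0 then poly P (1/s) * exp (-(1/s)) else 0)"

lemma poly_exp_tendsto_0: "((\<lambda>y::real. poly P y * exp (-y)) \<longlongrightarrow> 0) at_top"
proof -
  have "((\<lambda>y::real. (\<Sum>i\<le>degree P. coeff P i * (y ^ i / exp y))) \<longlongrightarrow> (\<Sum>i\<le>degree P. coeff P i * 0)) at_top"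
    by (intro tendsto_intros tendsto_power_div_exp_0)
  then show ?thesis
    by (simp add: poly_altdef sum_distrib_right exp_minus divide_inverse mult.assoc)
qed

lemma flat_exp_deriv:
  "(flat_exp P has_real_derivative flat_exp (monom 1 2 * (P - pderiv P)) s) (at s)"
proof -
  consider "s > 0" | "s < 0" | "s = 0" by linarith
  then show ?thesis
  proof cases
    case 1
    have inv: "((\<lambda>s. 1/s) has_real_derivative (-((1/s)^2))) (at s)"
      using 1 by (auto simp: power2_eq_square intro!: derivative_eq_intros)
    have "((\<lambda>s. poly P (1/s) * exp (-(1/s))) has_real_derivative
        poly (pderiv P) (1/s) * (-((1/s)^2)) * exp (-(1/s)) + exp (-(1/s)) * (1/s)^2 * poly P (1/s)) (at s)"
      using DERIV_mult[OF DERIV_chain2[OF poly_DERIV inv] DERIV_chain2[OF DERIV_exp DERIV_minus[OF inv]]]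
      by simp
    also have "poly (pderiv P) (1/s) * (-((1/s)^2)) * exp (-(1/s)) + exp (-(1/s)) * (1/s)^2 * poly P (1/s)
        = flat_exp (monom 1 2 * (P - pderiv P)) s"
      using 1 by (simp add: flat_exp_def poly_monom algebra_simps)
    finally have "((\<lambda>s. poly P (1/s) * exp (-(1/s))) has_real_derivative
        (flat_exp (monom 1 2 * (P - pderiv P)) s)) (at s)" .
    moreover have "\<forall>\<^sub>F x in nhds s. flat_exp P x = poly P (1/x) * exp (-(1/x))"
      by (rule eventually_mono[OF eventually_nhds_in_open[of "{0<..}" s]]) (use 1 in \<open>auto simp: flat_exp_def\<close>)
    ultimately show ?thesis
      using DERIV_cong_ev[OF refl _ refl, of "flat_exp P" _ s] by simp
  next
    case 2
    have "\<forall>\<^sub>F x in nhds s. flat_exp P x = 0"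
      by (rule eventually_mono[OF eventually_nhds_in_open[of "{..<0}" s]]) (use 2 in \<open>auto simp: flat_exp_def\<close>)
    then have "(flat_exp P has_real_derivative 0) (at s)"
      using DERIV_cong_ev[of s s "flat_exp P" "\<lambda>_. 0" 0 0] by simp
    then show ?thesis using 2 by (simp add: flat_exp_def)
  next
    case 3
    \<comment> \<open>The factor \<open>1 / y\<close> of the difference quotient is absorbed into
      the polynomial as \<open>monom 1 1\<close>; with \<open>1 / y\<close> as variable the limit at
      0 becomes one at infinity.\<close>
    have lim: "((\<lambda>y. flat_exp P y / y) \<longlongrightarrow> 0) (at_right 0)"
    proof -
      have "((\<lambda>y::real. poly (monom 1 1 * P) (inverse y) * exp (-inverse y)) \<longlongrightarrow> 0) (at_right 0)"
        by (rule filterlim_compose[OF poly_exp_tendsto_0 filterlim_inverse_at_top_right])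
      moreover have "\<forall>\<^sub>F y in at_right 0. poly (monom 1 1 * P) (inverse y) * exp (-inverse y) = flat_exp P y / y"
        by (auto simp: eventually_at_filter flat_exp_def poly_monom divide_inverse)
      ultimately show ?thesis by (simp add: tendsto_cong)
    qed
    have "((\<lambda>y. flat_exp P y / y) \<longlongrightarrow> 0) (at_left 0)"
      by (rule Lim_transform_eventually[of "\<lambda>_. 0"]) (auto simp: eventually_at_filter flat_exp_def)
    with lim have "((\<lambda>y. flat_exp P y / y) \<longlongrightarrow> 0) (at 0)"
      by (simp add: filterlim_at_split)
    then show ?thesis using 3 by (simp add: has_field_derivative_iff flat_exp_def)
  qed
qed

lemma flat_exp_C_k: "C_k m (\<lambda>x::'a::euclidean_space. flat_exp P (c \<bullet> x + a))"
proof (induction m arbitrary: P)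
  case 0
  have "continuous_on UNIV (flat_exp P)"
    by (simp add: continuous_on_eq_continuous_at DERIV_isCont[OF flat_exp_deriv])
  then show ?case
    by (auto intro!: continuous_intros continuous_on_compose2[of UNIV "flat_exp P"])
next
  case (Suc m)
  have *: "((\<lambda>x. flat_exp P (c \<bullet> x + a)) has_derivative
      (\<lambda>b. flat_exp (monom 1 2 * (P - pderiv P)) (c \<bullet> x + a) * (c \<bullet> b))) (at x)" for x
    by (rule has_derivative_eq_rhs, rule has_derivative_compose[OF _ flat_exp_deriv[unfolded has_field_derivative_def]])
      (auto intro!: derivative_eq_intros)
  show ?case
    using * by (auto simp: frechet_derivative_eqI[OF *] differentiable_def intro!: C_k_mult Suc)
qed

definition box_bump :: "'a::euclidean_space \<Rightarrow> 'a \<Rightarrow> 'a \<Rightarrow> real" where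
  "box_bump a b x = (\<Prod>i\<in>Basis. flat_exp 1 (i \<bullet> x + - (a \<bullet> i)) * flat_exp 1 ((-i) \<bullet> x + b \<bullet> i))"

lemma box_bump_C_k: "C_k m (box_bump a b)"
  unfolding box_bump_def by (intro C_k_prod C_k_mult flat_exp_C_k) auto

lemma flat_exp_1: "flat_exp 1 s \<ge> 0" "flat_exp 1 s > 0 \<longleftrightarrow> s > 0"  "flat_exp 1 s = 0 \<longleftrightarrow> s \<le> 0"
  by (auto simp: flat_exp_def)

lemma box_bump_nonneg: "box_bump a b x \<ge> 0"
  unfolding box_bump_def by (intro prod_nonneg mult_nonneg_nonneg flat_exp_1 ballI)

lemma box_bump_pos: "box_bump a b x > 0 \<longleftrightarrow> x \<in> box a b"
proof
  assume "x \<in> box a b"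
  then show "box_bump a b x > 0"
    by (auto simp: box_bump_def box_def flat_exp_1 inner_commute intro!: prod_pos mult_pos_pos)
next
  assume "box_bump a b x > 0"
  then have "box_bump a b x \<noteq> 0" by simp
  then show "x \<in> box a b"
    unfolding box_bump_def
    by (auto simp: box_bump_def box_def flat_exp_1 inner_commute)
qed

lemma box_bump_zero: "x \<notin> box a b \<Longrightarrow> box_bump a b x = 0"
  using box_bump_pos[of a b x] box_bump_nonneg[of a b x] by linarith

lemma test_functionI:
  assumes "\<And>m. C_k m \<psi>" "closed K" "bounded K" "\<And>x. \<psi> x \<noteq> 0 \<Longrightarrow> x \<in> K" "K \<subseteq> \<Omega>"
  shows "\<psi> \<in> test_functions \<Omega>"
proof -
  have "closure {x. \<psi> x \<noteq> 0} \<subseteq> K"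
    using assms by (intro closure_minimal) auto
  moreover have "compact (closure {x. \<psi> x \<noteq> 0})"
    using calculation assms bounded_subset compact_closure by (metis closure_subset order_trans)
  ultimately show ?thesis
    using assms by (auto simp: test_functions_def)
qed

text \<open>As \<open>m\<close> grows these functions increase to the indicator of
  \<open>box a b\<close>, because the bump is positive exactly there. They serve to test against
  boxes in \<open>test_function_integral_zero_on_box\<close>.\<close>

lemma test_function_box:
  assumes "cbox a b \<subseteq> \<Omega>"
  shows "(\<lambda>x. 1 + (-1) * exp ((- real m) * box_bump a b x)) \<in> test_functions \<Omega>"
proof (rule test_functionI)
  show "C_k l (\<lambda>x. 1 + (-1) * exp ((- real m) * box_bump a b x))" for l
    by (intro C_k_add C_k_mult C_k_exp C_k_const box_bump_C_k)
  show "x \<in> cbox a b" if "1 + (-1) * exp ((- real m) * box_bump a b x) \<noteq> 0" for x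
    using that box_bump_zero[of x a b] box_subset_cbox by force
qed (use assms in auto)

lemma test_functionD:
  assumes "\<psi> \<in> test_functions \<Omega>"
  shows "\<psi> differentiable (at x)" "continuous_on UNIV \<psi>"
    "b \<in> Basis \<Longrightarrow> continuous_on UNIV (\<lambda>x. frechet_derivative \<psi> (at x) b)"
    "\<exists>K. compact K \<and> K \<subseteq> \<Omega> \<and> (\<forall>x. \<psi> x \<noteq> 0 \<longrightarrow> x \<in> K) \<and>
        (\<forall>x. frechet_derivative \<psi> (at x) \<noteq> (\<lambda>_. 0) \<longrightarrow> x \<in> K)"
proof -
  have C: "C_k m \<psi>" for m using assms by (auto simp: test_functions_def)
  show "\<psi> differentiable (at x)" using C[of 1] by simp
  show "continuous_on UNIV \<psi>" using C[of 0] by simp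
  show "b \<in> Basis \<Longrightarrow> continuous_on UNIV (\<lambda>x. frechet_derivative \<psi> (at x) b)"
    using C[of 1] by simp
  let ?K = "closure {x. \<psi> x \<noteq> 0}"
  have "x \<in> ?K" if "frechet_derivative \<psi> (at x) \<noteq> (\<lambda>_. 0)" for x
  proof (rule ccontr)
    assume "x \<notin> ?K"
    have "\<forall>\<^sub>F y in nhds x. \<psi> y = 0"
    proof (rule eventually_mono)
      show "\<forall>\<^sub>F y in nhds x. y \<in> - ?K"
        using \<open>x \<notin> ?K\<close> by (intro eventually_nhds_in_open) auto
      show "\<psi> y = 0" if "y \<in> - ?K" for y
        using that closure_subset[of "{x. \<psi> x \<noteq> 0}"] by blast
    qed
    then obtain S where "open S" "x \<in> S" "\<And>y. y \<in> S \<Longrightarrow> \<psi> y = 0"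
      unfolding eventually_nhds by blast
    then have "(\<psi> has_derivative (\<lambda>_. 0)) (at x)"
      by (intro has_derivative_transform_within_open[of "\<lambda>_. 0" "\<lambda>_. 0" x UNIV S \<psi>]) auto
    then show False using that frechet_derivative_eqI by blast
  qed
  then show "\<exists>K. compact K \<and> K \<subseteq> \<Omega> \<and> (\<forall>x. \<psi> x \<noteq> 0 \<longrightarrow> x \<in> K) \<and>
        (\<forall>x. frechet_derivative \<psi> (at x) \<noteq> (\<lambda>_. 0) \<longrightarrow> x \<in> K)"
    using assms closure_subset[of "{x. \<psi> x \<noteq> 0}"] by (auto simp: test_functions_def intro!: exI[of _ ?K])
qed

subsection \<open>Convolution\<close>

lemma integrable_continuous_compact_support:
  fixes f :: "'a::euclidean_space \<Rightarrow> 'b::{banach, second_countable_topology}"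
  assumes "continuous_on UNIV f" "compact K" "\<And>x. f x \<noteq> 0 \<Longrightarrow> x \<in> K"
  shows "integrable lborel f"
proof -
  have "integrable lborel (\<lambda>x. indicator K x *\<^sub>R f x)"
    using assms by (intro borel_integrable_compact continuous_on_subset[OF assms(1)]) auto
  moreover have "indicator K x *\<^sub>R f x = f x" for x
    using assms(3)[of x] by (cases "x \<in> K") auto
  ultimately show ?thesis by simp
qed

lemma has_real_derivative_line:
  fixes g :: "'a::euclidean_space \<Rightarrow> real"
  assumes "g differentiable (at (x + t *\<^sub>R b))"
  shows "((\<lambda>t. g (x + t *\<^sub>R b)) has_real_derivative frechet_derivative g (at (x + t *\<^sub>R b)) b) (at t)"
proof -
  have "((\<lambda>t. g (x + t *\<^sub>R b)) has_derivative (\<lambda>h. frechet_derivative g (at (x + t *\<^sub>R b)) (h *\<^sub>R b))) (at t)"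
    by (rule has_derivative_compose[where f="\<lambda>t. x + t *\<^sub>R b" and g=g, OF _ differentiable_has_frechet[OF assms]])
      (auto intro!: derivative_eq_intros)
  moreover have "frechet_derivative g (at (x + t *\<^sub>R b)) (h *\<^sub>R b)
      = frechet_derivative g (at (x + t *\<^sub>R b)) b * h" for h
    using linear_frechet_derivative[OF assms] by (simp add: linear_cmul)
  ultimately show ?thesis
    by (simp add: has_field_derivative_def)
qed

text \<open>The difference quotients of \<open>g\<close> have integral zero by translation invariance.\<close>
lemma integral_directional_derivative_zero:
  fixes g :: "'a::euclidean_space \<Rightarrow> real"
  assumes d: "\<And>x. g differentiable (at x)"
    and c: "continuous_on UNIV (\<lambda>x. frechet_derivative g (at x) b)"
    and K: "compact K" "\<And>x. g x \<noteq> 0 \<Longrightarrow> x \<in> K"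
  shows "(\<integral>x. frechet_derivative g (at x) b \<partial>lborel) = 0"
proof -
  define D where "D = (\<lambda>x. frechet_derivative g (at x) b)"
  obtain r where r: "K \<subseteq> cball 0 r"
    using compact_imp_bounded[OF K(1)] by (auto simp: bounded_iff subset_iff)
  \<comment> \<open>The steps \<open>h m\<close> used below are at most 1, so all difference
    quotients vanish outside the ball of radius \<open>R\<close>, and a constant on that ball is an
    integrable majorant.\<close>
  define R where "R = \<bar>r\<bar> + norm b"
  have gz: "g x = 0" if "norm x > \<bar>r\<bar>" for x
    using K(2)[of x] r that by force
  have "bounded (D ` cball 0 (R + norm b))"
    unfolding D_def by (intro compact_imp_bounded compact_continuous_image continuous_on_subset[OF c]) auto
  then obtain M where M: "\<And>x. norm x \<le> R + norm b \<Longrightarrow> norm (D x) \<le> M"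
    unfolding bounded_iff by (metis imageI mem_cball_0)
  have cg: "continuous_on UNIV g"
    using d by (auto simp: continuous_on_eq_continuous_within differentiable_imp_continuous_within)
  have gi: "integrable lborel g"
    by (rule integrable_continuous_compact_support[OF cg K])
  define h where "h m = inverse (real (Suc m))" for m
  have h: "h m > 0" "h m \<le> 1" for m by (auto simp: h_def divide_simps)
  define q where "q m x = (g (x + h m *\<^sub>R b) - g x) / h m" for m x
  have gt: "integrable lborel (\<lambda>x. g (x + a))" "(\<integral>x. g (x + a) \<partial>lborel) = (\<integral>x. g x \<partial>lborel)" for a
  proof -
    have [measurable]: "g \<in> borel_measurable borel" using gi by auto
    have "integrable (distr lborel borel ((+) a)) g" using gi by (simp add: lborel_distr_plus)
    then show "integrable lborel (\<lambda>x. g (x + a))"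
      by (subst (asm) integrable_distr_eq) (auto simp: add.commute)
    have "(\<integral>x. g x \<partial>lborel) = (\<integral>x. g x \<partial>distr lborel borel ((+) a))"
      by (simp add: lborel_distr_plus)
    also have "\<dots> = (\<integral>x. g (x + a) \<partial>lborel)"
      by (subst integral_distr) (auto simp: add.commute)
    finally show "(\<integral>x. g (x + a) \<partial>lborel) = (\<integral>x. g x \<partial>lborel)" by simp
  qed
  have q0: "(\<integral>x. q m x \<partial>lborel) = 0" for m
    unfolding q_def using gt gi by simp
  have lim: "(\<lambda>m. q m x) \<longlonglongrightarrow> D x" for x
  proof -
    have "((\<lambda>t. (g (x + t *\<^sub>R b) - g x) / t) \<longlongrightarrow> D x) (at 0)"
      using has_real_derivative_line[of g x 0 b] d by (simp add: has_field_derivative_iff D_def)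
    moreover have "filterlim h (at 0) sequentially"
      unfolding filterlim_at h_def using LIMSEQ_inverse_real_of_nat by auto
    ultimately show ?thesis
      unfolding q_def by (rule filterlim_compose)
  qed
  have bnd: "norm (q m x) \<le> indicator (cball 0 R) x *\<^sub>R M" for m x
  proof (cases "norm x \<le> R")
    case True
    have "\<exists>z>0. z < h m \<and> g (x + h m *\<^sub>R b) - g (x + 0 *\<^sub>R b) = (h m - 0) * D (x + z *\<^sub>R b)"
      unfolding D_def by (intro MVT2 h has_real_derivative_line d)
    then obtain z where z: "0 < z" "z < h m" "g (x + h m *\<^sub>R b) - g (x + 0 *\<^sub>R b) = (h m - 0) * D (x + z *\<^sub>R b)"
      by blast
    have "norm (x + z *\<^sub>R b) \<le> R + norm b"
      using True z h(2)[of m] norm_triangle_ineq[of x "z *\<^sub>R b"] mult_right_mono[of z 1 "norm b"] by auto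
    then show ?thesis using M z True h(1)[of m] by (simp add: q_def)
  next
    case False
    have "norm (h m *\<^sub>R b) \<le> norm b"
      using h[of m] by (simp add: mult_left_le_one_le)
    then have "norm (x + h m *\<^sub>R b) > \<bar>r\<bar>"
      using norm_diff_ineq[of x "h m *\<^sub>R b"] False by (simp add: R_def)
    moreover have "norm x > \<bar>r\<bar>" using False norm_ge_zero[of b] by (simp add: R_def del: norm_ge_zero)
    ultimately show ?thesis using False by (simp add: q_def gz)
  qed
  have [measurable]: "D \<in> borel_measurable borel" "g \<in> borel_measurable borel"
    using c cg by (auto simp: D_def intro: borel_measurable_continuous_onI)
  have "(\<lambda>m. \<integral>x. q m x \<partial>lborel) \<longlonglongrightarrow> (\<integral>x. D x \<partial>lborel)"
  proof (rule integral_dominated_convergence)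
    show "integrable lborel (\<lambda>x. indicator (cball 0 R) x *\<^sub>R M)"
      by (intro borel_integrable_compact) auto
    show "AE x in lborel. norm (q m x) \<le> indicator (cball 0 R) x *\<^sub>R M" for m using bnd by auto
    show "AE x in lborel. (\<lambda>m. q m x) \<longlonglongrightarrow> D x" using lim by auto
  qed (auto simp: q_def)
  then show ?thesis
    using LIMSEQ_unique[of "\<lambda>m. \<integral>x. q m x \<partial>lborel"] q0 by (simp add: D_def)
qed

lemma lborel_integral_reflect_affine:
  fixes F :: "'a::euclidean_space \<Rightarrow> 'b::{banach, second_countable_topology}"
  assumes [measurable]: "F \<in> borel_measurable borel" and "d > 0"
  shows "(\<integral>y. F y \<partial>lborel) = d ^ DIM('a) *\<^sub>R (\<integral>z. F (x - d *\<^sub>R z) \<partial>lborel)"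
proof -
  have "(\<integral>y. F y \<partial>lborel)
      = (\<integral>y. F y \<partial>density (distr lborel borel (\<lambda>z. x + (-d) *\<^sub>R z)) (\<lambda>_. \<bar>-d\<bar> ^ DIM('a)))"
    using lborel_affine[of "-d" x] assms(2) by simp
  also have "\<dots> = d ^ DIM('a) *\<^sub>R (\<integral>y. F y \<partial>distr lborel borel (\<lambda>z. x + (-d) *\<^sub>R z))"
    using assms(2) by (subst integral_density) auto
  also have "(\<integral>y. F y \<partial>distr lborel borel (\<lambda>z. x + (-d) *\<^sub>R z)) = (\<integral>z. F (x - d *\<^sub>R z) \<partial>lborel)"
    by (subst integral_distr) auto
  finally show ?thesis .
qed

definition conv :: "('a::euclidean_space \<Rightarrow> real) \<Rightarrow> ('a \<Rightarrow> 'b::euclidean_space) \<Rightarrow> 'a \<Rightarrow> 'b" where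
  "conv \<kappa> u x = (\<integral>y. \<kappa> (x - y) *\<^sub>R u y \<partial>lborel)"

lemma conv_eq_integral:
  fixes u :: "'a::euclidean_space \<Rightarrow> 'b::euclidean_space"
  assumes "continuous_on UNIV \<kappa>" "continuous_on UNIV u" "\<And>y. u y \<noteq> 0 \<Longrightarrow> y \<in> cbox a b"
  shows "conv \<kappa> u x = integral (cbox a b) (\<lambda>y. \<kappa> (x - y) *\<^sub>R u y)"
proof -
  have c: "continuous_on S (\<lambda>y. \<kappa> (x - y) *\<^sub>R u y)" for S
    using assms by (auto intro!: continuous_intros continuous_on_compose2[OF assms(1)] continuous_on_subset[OF assms(2)])
  have "set_integrable lborel (cbox a b) (\<lambda>y. \<kappa> (x - y) *\<^sub>R u y)"
    unfolding set_integrable_def by (intro borel_integrable_compact c) auto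
  note set_borel_integral_eq_integral(2)[OF this]
  moreover have "indicator (cbox a b) y *\<^sub>R \<kappa> (x - y) *\<^sub>R u y = \<kappa> (x - y) *\<^sub>R u y" for y
    using assms(3)[of y] by (cases "y \<in> cbox a b") auto
  ultimately show ?thesis
    by (simp only: conv_def set_lebesgue_integral_def)
qed

text \<open>All derivatives fall on the kernel, so \<open>u\<close> only has to be continuous with
  bounded support; iterating this gives smoothness in \<open>C_k_conv\<close>.\<close>

lemma conv_has_derivative:
  fixes u :: "'a::euclidean_space \<Rightarrow> 'b::euclidean_space"
  assumes k: "C_k 1 \<kappa>" and u: "continuous_on UNIV u" "\<And>y. u y \<noteq> 0 \<Longrightarrow> y \<in> cbox a b"
  shows "(conv \<kappa> u has_derivative
     (\<lambda>v. \<Sum>i\<in>Basis. (v \<bullet> i) *\<^sub>R conv (\<lambda>x. frechet_derivative \<kappa> (at x) i) u x)) (at x)"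
proof -
  let ?k = "\<lambda>i x. frechet_derivative \<kappa> (at x) i"
  have ck: "continuous_on UNIV \<kappa>" using C_k_Suc_imp[of 0 \<kappa>] k by simp
  have cki: "continuous_on UNIV (?k i)" if "i \<in> Basis" for i using k that by simp
  have ckp: "continuous_on S (\<lambda>z. ?k i (fst z - snd z))" if "i \<in> Basis" for i S
    by (intro continuous_on_compose2[OF cki[OF that]] continuous_intros) auto
  \<comment> \<open>\<open>leibniz_rule\<close> wants the derivative as a bounded linear function.
    The coordinate form makes its joint continuity in \<open>x\<close> and \<open>y\<close>
    visible.\<close>
  define fx where "fx x y = (\<Sum>i\<in>Basis. blinfun_scaleR_left (?k i (x - y) *\<^sub>R u y) o\<^sub>L blinfun_inner_left i)" for x y
  have fxa: "blinfun_apply (fx x y) = (\<lambda>v. \<Sum>i\<in>Basis. (v \<bullet> i) *\<^sub>R ?k i (x - y) *\<^sub>R u y)" for x y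
    by (simp add: fx_def blinfun.sum_left fun_eq_iff)
  have fxc: "continuous_on S (\<lambda>z. fx (fst z) (snd z))" for S
    unfolding fx_def
    by (intro continuous_intros ckp bounded_linear.continuous_on[OF bounded_linear_blinfun_scaleR_left]
        continuous_on_compose2[OF u(1)]) auto
  have der: "((\<lambda>x. \<kappa> (x - y) *\<^sub>R u y) has_derivative blinfun_apply (fx x y)) (at x within UNIV)" for x y
  proof -
    have dk: "\<kappa> differentiable (at (x - y))" using k by simp
    have *: "((\<lambda>x. \<kappa> (x - y)) has_derivative (\<lambda>v. frechet_derivative \<kappa> (at (x - y)) v)) (at x)"
      by (rule has_derivative_compose[where f="\<lambda>x. x - y" and g=\<kappa>, OF _ differentiable_has_frechet[OF dk]])
        (auto intro!: derivative_eq_intros)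
    have "((\<lambda>x. \<kappa> (x - y) *\<^sub>R u y) has_derivative (\<lambda>v. frechet_derivative \<kappa> (at (x - y)) v *\<^sub>R u y)) (at x)"
      using has_derivative_scaleR_left[OF *] .
    moreover have "frechet_derivative \<kappa> (at (x - y)) v *\<^sub>R u y = (\<Sum>i\<in>Basis. (v \<bullet> i) *\<^sub>R ?k i (x - y) *\<^sub>R u y)" for v
    proof -
      have "frechet_derivative \<kappa> (at (x - y)) v = (\<Sum>i\<in>Basis. (v \<bullet> i) * ?k i (x - y))"
        using linear_frechet_derivative[OF dk]
        by (subst euclidean_representation[symmetric, of v]) (simp add: linear_sum linear_cmul del: euclidean_representation_sum_fun euclidean_representation)
      then show ?thesis by (simp add: scaleR_sum_left)
    qed
    ultimately have "((\<lambda>x. \<kappa> (x - y) *\<^sub>R u y) has_derivative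
        (\<lambda>v. \<Sum>i\<in>Basis. (v \<bullet> i) *\<^sub>R ?k i (x - y) *\<^sub>R u y)) (at x)"
      by (rule has_derivative_eq_rhs[OF _ ext])
    then show ?thesis by (simp only: fxa)
  qed
  have "((\<lambda>x. integral (cbox a b) (\<lambda>y. \<kappa> (x - y) *\<^sub>R u y)) has_derivative
      integral (cbox a b) (fx x)) (at x within UNIV)"
  proof (rule leibniz_rule)
    show "(\<lambda>y. \<kappa> (x - y) *\<^sub>R u y) integrable_on cbox a b" for x
      by (intro integrable_continuous continuous_intros continuous_on_compose2[OF ck]
          continuous_on_subset[OF u(1)]) auto
    show "continuous_on (UNIV \<times> cbox a b) (\<lambda>(x, t). fx x t)"
      using fxc by (simp add: case_prod_beta)
  qed (use der in auto)
  moreover have "blinfun_apply (integral (cbox a b) (fx x))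
      = (\<lambda>v. \<Sum>i\<in>Basis. (v \<bullet> i) *\<^sub>R conv (?k i) u x)"
  proof
    fix v
    have ci: "continuous_on S (\<lambda>y. ?k i (x - y) *\<^sub>R u y)" if "i \<in> Basis" for S i
      by (intro continuous_intros continuous_on_compose2[OF cki[OF that]] continuous_on_subset[OF u(1)]) auto
    have fxi: "fx x integrable_on cbox a b"
      by (intro integrable_continuous continuous_on_compose2[OF fxc, of _ "\<lambda>y. (x, y)", simplified])
        (auto intro!: continuous_intros)
    have "blinfun_apply (integral (cbox a b) (fx x)) v = integral (cbox a b) (\<lambda>y. blinfun_apply (fx x y) v)"
      by (rule blinfun_apply_integral[OF fxi])
    also have "\<dots> = (\<Sum>i\<in>Basis. (v \<bullet> i) *\<^sub>R integral (cbox a b) (\<lambda>y. ?k i (x - y) *\<^sub>R u y))"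
      unfolding fxa
      by (subst integral_sum) (auto intro: integrable_cmul[OF integrable_continuous[OF ci]] simp del: scaleR_scaleR)
    finally show "blinfun_apply (integral (cbox a b) (fx x)) v
      = (\<Sum>i\<in>Basis. (v \<bullet> i) *\<^sub>R conv (?k i) u x)"
      using conv_eq_integral[OF cki u, of _ x] by simp
  qed
  moreover have "conv \<kappa> u = (\<lambda>x. integral (cbox a b) (\<lambda>y. \<kappa> (x - y) *\<^sub>R u y))"
    using conv_eq_integral[OF ck u] by auto
  ultimately show ?thesis
    by simp
qed

lemma frechet_derivative_conv:
  fixes u :: "'a::euclidean_space \<Rightarrow> 'b::euclidean_space"
  assumes k: "C_k 1 \<kappa>" and u: "continuous_on UNIV u" "\<And>y. u y \<noteq> 0 \<Longrightarrow> y \<in> cbox a b" and b: "e \<in> Basis"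
  shows "frechet_derivative (conv \<kappa> u) (at x) e = conv (\<lambda>x. frechet_derivative \<kappa> (at x) e) u x"
proof -
  have "(\<Sum>i\<in>Basis. (e \<bullet> i) *\<^sub>R conv (\<lambda>x. frechet_derivative \<kappa> (at x) i) u x)
      = (\<Sum>i\<in>Basis. if i = e then conv (\<lambda>x. frechet_derivative \<kappa> (at x) i) u x else 0)"
    using b by (intro sum.cong) (auto simp: inner_Basis)
  then show ?thesis
    using b by (simp add: frechet_derivative_eqI[OF conv_has_derivative[OF k u]])
qed

lemma C_k_conv:
  fixes u :: "'a::euclidean_space \<Rightarrow> 'b::euclidean_space"
  assumes "\<And>m. C_k m \<kappa>" and u: "continuous_on UNIV u" "\<And>y. u y \<noteq> 0 \<Longrightarrow> y \<in> cbox a b"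
  shows "C_k m (conv \<kappa> u)"
  using assms(1)
proof (induction m arbitrary: \<kappa>)
  case 0
  have "conv \<kappa> u differentiable (at x)" for x
    using conv_has_derivative[OF 0 u] by (auto simp: differentiable_def)
  then show ?case
    by (auto simp: continuous_on_eq_continuous_within differentiable_imp_continuous_within)
next
  case (Suc m)
  have "conv \<kappa> u differentiable (at x)" for x
    using conv_has_derivative[OF Suc.prems u] by (auto simp: differentiable_def)
  moreover have "C_k m (conv (\<lambda>x. frechet_derivative \<kappa> (at x) b) u)" if "b \<in> Basis" for b
    using Suc.prems[of "Suc _"] that by (intro Suc.IH) auto
  ultimately show ?case
    using frechet_derivative_conv[OF Suc.prems u] by simp
qed

subsection \<open>Mollification\<close>

definition std_bump :: "'a::euclidean_space \<Rightarrow> real" where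
  "std_bump x = box_bump (-One) One x / (\<integral>y. box_bump (-One) One (y::'a) \<partial>lborel)"

lemma std_bump_C_k: "C_k m (std_bump :: 'a::euclidean_space \<Rightarrow> real)"
proof -
  have "C_k m (\<lambda>x::'a. (1 / (\<integral>y. box_bump (-One) One (y::'a) \<partial>lborel)) * box_bump (-One) One x)"
    by (intro C_k_mult C_k_const box_bump_C_k)
  moreover have "(\<lambda>x::'a. (1 / (\<integral>y. box_bump (-One) One (y::'a) \<partial>lborel)) * box_bump (-One) One x) = std_bump"
    by (simp add: std_bump_def[abs_def])
  ultimately show ?thesis by simp
qed

lemma std_bump_zero: "x \<notin> cbox (-One) One \<Longrightarrow> std_bump x = 0"
  using box_bump_zero[of x "-One" One] box_subset_cbox by (force simp: std_bump_def)

lemma std_bump_integral: "integrable lborel (std_bump :: 'a::euclidean_space \<Rightarrow> real)" "(\<integral>x. std_bump (x::'a::euclidean_space) \<partial>lborel) = 1"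
proof -
  let ?b = "box_bump (-One) (One::'a)"
  have cb: "continuous_on UNIV ?b" using box_bump_C_k[of 0] by auto
  have i: "integrable lborel ?b"
    using box_bump_zero[of _ "-One" "One::'a"] box_subset_cbox
    by (intro integrable_continuous_compact_support[of _ "cbox (-One) One"] cb) force+
  have "(\<integral>x. ?b x \<partial>lborel) \<noteq> 0"
  proof
    assume "(\<integral>x. ?b x \<partial>lborel) = 0"
    then have "AE x in lborel. ?b x = 0"
      using integral_nonneg_eq_0_iff_AE[OF i] box_bump_nonneg by auto
    then have "AE x in lborel. x \<notin> box (-One) (One::'a)"
      by (rule eventually_mono) (use box_bump_pos in force)
    then have "emeasure lborel (box (-One) (One::'a)) = 0"
      by (subst (asm) AE_iff_measurable[OF _ refl]) auto
    then show False
      using emeasure_lborel_box[of "-One" "One::'a"] by (simp add: algebra_simps)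
  qed
  then show "integrable lborel (std_bump :: 'a::euclidean_space \<Rightarrow> real)" "(\<integral>x. std_bump (x::'a) \<partial>lborel) = 1"
    using i by (auto simp: std_bump_def[abs_def])
qed

lemma std_bump_nonneg: "std_bump x \<ge> 0"
  by (simp add: std_bump_def box_bump_nonneg)

text \<open>The moments of order 0 and 1 of the derivative of the bump come from integrating
  derivatives of compactly supported functions: of the bump itself and of the bump times
  \<open>x \<bullet> e\<close>. They say that mollification differentiates affine maps exactly,
  which identifies the limit of the gradients in \<open>mollify\<close>.\<close>

lemma std_bump_deriv_integrals:
  fixes b e :: "'a::euclidean_space"
  assumes b: "b \<in> Basis"
  defines "D \<equiv> \<lambda>x. frechet_derivative std_bump (at x) b"
  shows "continuous_on UNIV D" "D x \<noteq> 0 \<Longrightarrow> x \<in> cbox (-One) One" "integrable lborel D"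
    "(\<integral>x. D x \<partial>lborel) = 0" "(\<integral>x. D x * (x \<bullet> e) \<partial>lborel) = - (b \<bullet> e)"
proof -
  have dif: "std_bump differentiable (at x)" for x :: 'a using std_bump_C_k[of 1, where 'a='a] by simp
  show c: "continuous_on UNIV D" using std_bump_C_k[of 1, where 'a='a] b by (simp add: D_def)
  show z: "x \<in> cbox (-One) One" if "D x \<noteq> 0" for x
  proof (rule ccontr)
    assume x: "x \<notin> cbox (-One) One"
    have "(std_bump has_derivative (\<lambda>_. 0)) (at x)"
      by (rule has_derivative_transform_within_open[of "\<lambda>_. 0" _ x UNIV "- cbox (-One) One"])
        (use x in \<open>auto simp: std_bump_zero intro: open_Compl closed_cbox\<close>)
    then show False using that frechet_derivative_eqI by (force simp: D_def)
  qed
  show "integrable lborel D"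
    by (rule integrable_continuous_compact_support[OF c compact_cbox z])
  have sz: "x \<in> cbox (-One) One" if "std_bump x \<noteq> 0" for x :: 'a
    using that std_bump_zero by blast
  show "(\<integral>x. D x \<partial>lborel) = 0"
    unfolding D_def
    by (rule integral_directional_derivative_zero[OF dif c[unfolded D_def] compact_cbox sz])
  let ?g = "\<lambda>x. std_bump x * (x \<bullet> e)"
  have dg: "(?g has_derivative (\<lambda>v. std_bump x * (v \<bullet> e) + frechet_derivative std_bump (at x) v * (x \<bullet> e))) (at x)" for x
    by (intro has_derivative_mult differentiable_has_frechet dif bounded_linear_imp_has_derivative
        bounded_linear_inner_left)
  have eq: "frechet_derivative ?g (at x) b = D x * (x \<bullet> e) + (b \<bullet> e) * std_bump x" for x
    using frechet_derivative_eqI[OF dg] by (simp add: D_def)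
  have cs: "continuous_on UNIV (std_bump :: 'a \<Rightarrow> real)" using std_bump_C_k[of 0] by auto
  have "(\<integral>x. frechet_derivative ?g (at x) b \<partial>lborel) = 0"
  proof (rule integral_directional_derivative_zero[OF _ _ compact_cbox[of "-One" One]])
    show "?g differentiable (at x)" for x using dg by (auto simp: differentiable_def)
    show "continuous_on UNIV (\<lambda>x. frechet_derivative ?g (at x) b)"
      unfolding eq by (intro continuous_intros c cs)
  qed (use sz in auto)
  then have "(\<integral>x. D x * (x \<bullet> e) + (b \<bullet> e) * std_bump x \<partial>lborel) = 0"
    by (simp add: eq)
  moreover have "integrable lborel (\<lambda>x. D x * (x \<bullet> e))"
    by (rule integrable_continuous_compact_support[OF _ compact_cbox[of "-One" One]])
      (use z in \<open>auto intro!: continuous_intros c\<close>)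
  moreover have "integrable lborel (\<lambda>x. (b \<bullet> e) * std_bump x)"
    using std_bump_integral(1) by (intro integrable_mult_right)
  ultimately have "(\<integral>x. D x * (x \<bullet> e) \<partial>lborel) + (b \<bullet> e) * (\<integral>x. std_bump (x::'a) \<partial>lborel) = 0"
    by (subst (asm) Bochner_Integration.integral_add) simp_all
  then show "(\<integral>x. D x * (x \<bullet> e) \<partial>lborel) = - (b \<bullet> e)"
    by (simp add: std_bump_integral(2))
qed

lemma norm_One_bound: "x \<in> cbox (-One) (One::'a::euclidean_space) \<Longrightarrow> norm x \<le> real DIM('a)"
proof -
  assume x: "x \<in> cbox (-One) (One::'a)"
  have "norm x \<le> (\<Sum>i\<in>Basis. \<bar>x \<bullet> i\<bar>)" by (rule norm_le_l1)
  also have "\<dots> \<le> (\<Sum>i\<in>(Basis::'a set). 1)"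
    using x by (intro sum_mono) (auto simp: mem_box abs_le_iff)
  finally show ?thesis by simp
qed

text \<open>Convolution with rescaled bumps. Total differentiability of \<open>u\<close> at \<open>x\<close> yields convergence
  of the gradients at \<open>x\<close>, so no Lebesgue point argument is needed.\<close>
lemma mollify_scale:
  fixes u :: "'a::euclidean_space \<Rightarrow> 'b::euclidean_space" and K d :: real
  assumes lip: "\<And>x y. norm (u x - u y) \<le> K * norm (x - y)"
    and S: "compact S" "\<forall>x. u x \<noteq> 0 \<longrightarrow> x \<in> S" and d: "d > 0"
  defines "\<phi> \<equiv> conv (\<lambda>x. (1 / d ^ DIM('a)) * std_bump ((1/d) *\<^sub>R x)) u"
  shows "C_k m \<phi>"
    and "\<phi> x = (\<integral>z. std_bump z *\<^sub>R u (x - d *\<^sub>R z) \<partial>lborel)"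
    and "b \<in> Basis \<Longrightarrow> frechet_derivative \<phi> (at x) b
       = (\<integral>z. frechet_derivative std_bump (at z) b *\<^sub>R ((1/d) *\<^sub>R (u (x - d *\<^sub>R z) - u x)) \<partial>lborel)"
proof -
  let ?k = "\<lambda>x::'a. (1 / d ^ DIM('a)) * std_bump ((1/d) *\<^sub>R x)"
  have cu: "continuous_on UNIV u"
    by (intro lipschitz_on_continuous_on[of "\<bar>K\<bar>"] lipschitz_onI)
      (auto simp: dist_norm intro: order_trans[OF lip mult_right_mono])
  obtain r where "S \<subseteq> cbox (-r) r"
    using bounded_subset_cbox_symmetric[OF compact_imp_bounded[OF S(1)]] by blast
  then have ub: "\<And>y. u y \<noteq> 0 \<Longrightarrow> y \<in> cbox (-r) r" using S(2) by blast
  have scale: "C_k m g \<Longrightarrow> C_k m (\<lambda>x. g ((1/d) *\<^sub>R x))" for m and g :: "'a \<Rightarrow> real"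
  proof (induction m arbitrary: g)
    case 0 then show ?case
      by (auto intro!: continuous_intros continuous_on_compose2[of UNIV g])
  next
    case (Suc m)
    have *: "((\<lambda>x. g ((1/d) *\<^sub>R x)) has_derivative (\<lambda>v. (1/d) * frechet_derivative g (at ((1/d) *\<^sub>R x)) v)) (at x)" for x
    proof -
      have dg: "g differentiable (at ((1/d) *\<^sub>R x))" using Suc.prems by simp
      have "((\<lambda>x. g ((1/d) *\<^sub>R x)) has_derivative (\<lambda>v. frechet_derivative g (at ((1/d) *\<^sub>R x)) ((1/d) *\<^sub>R v))) (at x)"
        by (rule has_derivative_compose[where f="\<lambda>x. (1/d) *\<^sub>R x" and g=g, OF _ differentiable_has_frechet[OF dg]])
          (auto intro!: derivative_eq_intros)
      then show ?thesis
        using linear_frechet_derivative[OF dg] by (simp add: linear_cmul)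
    qed
    have "C_k m (\<lambda>x. (1/d) * frechet_derivative g (at ((1/d) *\<^sub>R x)) b)" if "b \<in> Basis" for b
      using Suc.prems that by (intro C_k_mult C_k_const Suc.IH) auto
    with * show ?case
      by (auto simp: frechet_derivative_eqI[OF *] differentiable_def)
  qed
  have Ck: "C_k m ?k" for m by (intro C_k_mult C_k_const scale std_bump_C_k)
  show "C_k m \<phi>" unfolding \<phi>_def by (rule C_k_conv[OF Ck cu ub])
  have cs: "continuous_on UNIV (std_bump :: 'a \<Rightarrow> real)" using std_bump_C_k[of 0] by auto
  have [measurable]: "u \<in> borel_measurable borel" "(std_bump :: 'a \<Rightarrow> real) \<in> borel_measurable borel"
    using cu cs by (auto intro: borel_measurable_continuous_onI)
  have "\<phi> x = d ^ DIM('a) *\<^sub>R (\<integral>z. ?k (x - (x - d *\<^sub>R z)) *\<^sub>R u (x - d *\<^sub>R z) \<partial>lborel)"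
    unfolding \<phi>_def conv_def using d by (subst lborel_integral_reflect_affine[of _ d x]) auto
  also have "(\<lambda>z. ?k (x - (x - d *\<^sub>R z)) *\<^sub>R u (x - d *\<^sub>R z)) =
      (\<lambda>z. (1 / d ^ DIM('a)) *\<^sub>R (std_bump z *\<^sub>R u (x - d *\<^sub>R z)))"
    using d by (auto simp: fun_eq_iff)
  also have "d ^ DIM('a) *\<^sub>R (\<integral>z. (1 / d ^ DIM('a)) *\<^sub>R (std_bump z *\<^sub>R u (x - d *\<^sub>R z)) \<partial>lborel)
      = (\<integral>z. std_bump z *\<^sub>R u (x - d *\<^sub>R z) \<partial>lborel)"
    using d by (simp add: integral_scaleR_right del: scaleR_scaleR) simp
  finally show "\<phi> x = (\<integral>z. std_bump z *\<^sub>R u (x - d *\<^sub>R z) \<partial>lborel)" .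
  assume b: "b \<in> Basis"
  let ?D = "\<lambda>x. frechet_derivative std_bump (at x) b"
  note D = std_bump_deriv_integrals[OF b]
  have [measurable]: "?D \<in> borel_measurable borel"
    using D(1) by (auto intro: borel_measurable_continuous_onI)
  have dk: "frechet_derivative ?k (at x) b = (1 / d ^ DIM('a)) * ((1/d) * ?D ((1/d) *\<^sub>R x))" for x
  proof -
    have dg: "std_bump differentiable (at ((1/d) *\<^sub>R x))" using std_bump_C_k[of 1, where 'a='a] by simp
    have "((\<lambda>x. std_bump ((1/d) *\<^sub>R x)) has_derivative (\<lambda>v. frechet_derivative std_bump (at ((1/d) *\<^sub>R x)) ((1/d) *\<^sub>R v))) (at x)"
      by (rule has_derivative_compose[where f="\<lambda>x. (1/d) *\<^sub>R x" and g=std_bump, OF _ differentiable_has_frechet[OF dg]])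
        (auto intro!: derivative_eq_intros)
    from frechet_derivative_eqI[OF has_derivative_mult_right[OF this, of "1 / d ^ DIM('a)"]]
    show ?thesis
      using linear_frechet_derivative[OF dg] by (simp add: linear_cmul)
  qed
  have "frechet_derivative \<phi> (at x) b = conv (\<lambda>x. frechet_derivative ?k (at x) b) u x"
    unfolding \<phi>_def by (rule frechet_derivative_conv[OF Ck cu ub b])
  also have "\<dots> = (\<integral>y. ((1 / d ^ DIM('a)) * ((1/d) * ?D ((1/d) *\<^sub>R (x - y)))) *\<^sub>R u y \<partial>lborel)"
    by (simp only: conv_def dk)
  also have "\<dots> = d ^ DIM('a) *\<^sub>R (\<integral>z. ((1 / d ^ DIM('a)) * ((1/d) * ?D ((1/d) *\<^sub>R (x - (x - d *\<^sub>R z))))) *\<^sub>R u (x - d *\<^sub>R z) \<partial>lborel)"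
    using d by (subst lborel_integral_reflect_affine[of _ d x]) auto
  also have "(\<lambda>z. ((1 / d ^ DIM('a)) * ((1/d) * ?D ((1/d) *\<^sub>R (x - (x - d *\<^sub>R z))))) *\<^sub>R u (x - d *\<^sub>R z))
      = (\<lambda>z. (1 / d ^ DIM('a)) *\<^sub>R (?D z *\<^sub>R ((1/d) *\<^sub>R u (x - d *\<^sub>R z))))"
    using d by (auto simp: fun_eq_iff)
  also have "d ^ DIM('a) *\<^sub>R (\<integral>z. (1 / d ^ DIM('a)) *\<^sub>R (?D z *\<^sub>R ((1/d) *\<^sub>R u (x - d *\<^sub>R z))) \<partial>lborel)
      = (\<integral>z. ?D z *\<^sub>R ((1/d) *\<^sub>R u (x - d *\<^sub>R z)) \<partial>lborel)"
    using d by (simp add: integral_scaleR_right del: scaleR_scaleR) simp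
  \<comment> \<open>Subtracting the constant \<open>u x\<close> is free because \<open>?D\<close>
    has integral zero. It turns the dangerous factor \<open>1 / d\<close> into a difference
    quotient, which the Lipschitz constant bounds.\<close>
  also have "\<dots> = (\<integral>z. ?D z *\<^sub>R ((1/d) *\<^sub>R u (x - d *\<^sub>R z)) \<partial>lborel) - (\<integral>z. ?D z *\<^sub>R ((1/d) *\<^sub>R u x) \<partial>lborel)"
    using D(3,4) by simp
  also have "\<dots> = (\<integral>z. ?D z *\<^sub>R ((1/d) *\<^sub>R u (x - d *\<^sub>R z)) - ?D z *\<^sub>R ((1/d) *\<^sub>R u x) \<partial>lborel)"
  proof (rule Bochner_Integration.integral_diff[symmetric])
    show "integrable lborel (\<lambda>z. ?D z *\<^sub>R ((1/d) *\<^sub>R u (x - d *\<^sub>R z)))"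
      by (rule integrable_continuous_compact_support[OF _ compact_cbox[of "-One" One]])
        (use D(2) d in \<open>auto intro!: continuous_intros D(1) continuous_on_compose2[OF cu]\<close>)
  qed (use D(3) in auto)
  finally show "frechet_derivative \<phi> (at x) b
       = (\<integral>z. ?D z *\<^sub>R ((1/d) *\<^sub>R (u (x - d *\<^sub>R z) - u x)) \<partial>lborel)"
    by (simp add: scaleR_diff_right)
qed

text \<open>Gradients that are bounded uniformly in \<open>m\<close> and converge wherever
  \<open>u\<close> is differentiable are what dominated convergence asks for; the approximation is
  then good in every finite \<open>L^p\<close> at once.\<close>

lemma mollify:
  fixes u :: "'a::euclidean_space \<Rightarrow> 'b::euclidean_space" and K :: real
  assumes lip: "\<And>x y. norm (u x - u y) \<le> K * norm (x - y)"
    and S: "compact S" "\<And>x. u x \<noteq> 0 \<Longrightarrow> x \<in> S" and O: "open \<Omega>" "S \<subseteq> \<Omega>"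
  obtains \<phi> :: "nat \<Rightarrow> 'a \<Rightarrow> 'b" and M :: real
  where "\<And>m. \<phi> m \<in> test_functions \<Omega>" "\<And>m x. norm (\<phi> m x - u x) \<le> M * inverse (real (Suc m))"
    "\<And>m x b. b \<in> Basis \<Longrightarrow> norm (frechet_derivative (\<phi> m) (at x) b) \<le> M"
    "\<And>x b. u differentiable (at x) \<Longrightarrow> b \<in> Basis \<Longrightarrow>
       (\<lambda>m. frechet_derivative (\<phi> m) (at x) b) \<longlonglongrightarrow> frechet_derivative u (at x) b"
proof -
  let ?n = "real DIM('a)"
  have n: "?n > 0" by simp
  obtain r where r: "r > 0" "(\<Union>x\<in>S. cball x r) \<subseteq> \<Omega>"
    using compact_subset_open_imp_cball_epsilon_subset[OF S(1) O] by blast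
  \<comment> \<open>The bump lives on the cube \<open>cbox (-One) One\<close>, whose points have
    norm at most \<open>?n\<close>. Dividing by \<open>?n\<close> keeps the mollified support within
    distance \<open>r\<close> of \<open>S\<close>.\<close>
  define d where "d m = (r / ?n) * inverse (real (Suc m))" for m
  have d: "d m > 0" "d m * ?n \<le> r" for m
  proof -
    show "d m > 0" unfolding d_def using r n by (intro mult_pos_pos divide_pos_pos) auto
    have "d m * ?n = r * inverse (real (Suc m))" using n by (simp add: d_def)
    also have "\<dots> \<le> r * 1" using r by (intro mult_left_mono) (auto simp: inverse_le_1_iff)
    finally show "d m * ?n \<le> r" by simp
  qed
  define C where "C = (\<lambda>(x, y). x + y) ` (S \<times> cball (0::'a) r)"
  have C: "compact C" unfolding C_def
    by (intro compact_continuous_image compact_Times S(1)) (auto simp: case_prod_beta intro!: continuous_intros)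
  have CO: "C \<subseteq> \<Omega>"
    using r(2) by (force simp: C_def dist_norm)
  define \<phi> where "\<phi> m = conv (\<lambda>x. (1 / d m ^ DIM('a)) * std_bump ((1/d m) *\<^sub>R x)) u" for m
  have "\<forall>x. u x \<noteq> 0 \<longrightarrow> x \<in> S" using S(2) by blast
  note ms = mollify_scale[OF lip S(1) this d(1), folded \<phi>_def]
  have K: "K \<ge> 0" 
  proof -
    obtain b :: 'a where "b \<in> Basis" using nonempty_Basis by blast
    then show ?thesis using lip[of b 0] norm_ge_zero[of "u b - u 0"] by (simp del: norm_ge_zero)
  qed
  have cu: "continuous_on UNIV u"
    by (intro lipschitz_on_continuous_on[of K] lipschitz_onI)
      (auto simp: dist_norm K intro: lip)
  have cs: "continuous_on UNIV (std_bump :: 'a \<Rightarrow> real)" using std_bump_C_k[of 0] by auto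
  have ub: "norm (u (x - d m *\<^sub>R z) - u x) \<le> d m * (K * ?n)" if "z \<in> cbox (-One) One" for x z m
  proof -
    have "norm (u (x - d m *\<^sub>R z) - u x) \<le> K * (d m * norm z)"
      using lip[of "x - d m *\<^sub>R z" x] d(1)[of m] by simp
    also have "\<dots> \<le> K * (d m * ?n)"
      using norm_One_bound[OF that] K d(1)[of m] by (intro mult_left_mono) auto
    finally show ?thesis by (simp add: ac_simps)
  qed
  have int1: "integrable lborel (\<lambda>z. std_bump z *\<^sub>R (u (x - d m *\<^sub>R z)))" for x m
    using std_bump_zero
    by (intro integrable_continuous_compact_support[of _ "cbox (-One) (One::'a)"])
      (auto intro!: continuous_intros cs continuous_on_compose2[OF cu])
  define D where "D b z = frechet_derivative std_bump (at z) b" for b z :: 'a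
  have Db: "D b = (\<lambda>z. frechet_derivative std_bump (at z) b)" for b by (auto simp: D_def)
  have Dp: "continuous_on UNIV (D b)" "\<And>z. D b z \<noteq> 0 \<Longrightarrow> z \<in> cbox (-One) One" "integrable lborel (D b)"
    "(\<integral>z. D b z * (z \<bullet> e) \<partial>lborel) = - (b \<bullet> e)" if "b \<in> Basis" for b e
    unfolding Db using std_bump_deriv_integrals[OF that] by blast+
  define M where "M = K * r + (\<Sum>b\<in>Basis. (\<integral>z. \<bar>D b z\<bar> \<partial>lborel) * (K * ?n))"
  have Mpos: "(\<integral>z. \<bar>D b z\<bar> \<partial>lborel) * (K * ?n) \<ge> 0" for b using K by simp
  show thesis
  proof (rule that)
    show "\<phi> m \<in> test_functions \<Omega>" for m
    proof (rule test_functionI)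
      show "C_k l (\<phi> m)" for l using ms(1) .
      show "x \<in> C" if "\<phi> m x \<noteq> 0" for x
      proof -
        have "\<exists>z. std_bump z *\<^sub>R u (x - d m *\<^sub>R z) \<noteq> 0"
        proof (rule ccontr)
          assume "\<not> ?thesis"
          then have e: "(\<lambda>z. std_bump z *\<^sub>R u (x - d m *\<^sub>R z)) = (\<lambda>_. 0)" by (simp add: fun_eq_iff)
          have "\<phi> m x = 0" unfolding ms(2) e by simp
          with that show False by simp
        qed
        then obtain z where z: "z \<in> cbox (-One) One" "x - d m *\<^sub>R z \<in> S"
          using std_bump_zero S(2) by force
        have "norm (d m *\<^sub>R z) \<le> d m * ?n"
          using norm_One_bound[OF z(1)] d(1)[of m] by (simp add: mult_left_mono)
        then have "d m *\<^sub>R z \<in> cball 0 r" using d(2)[of m] by simp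
        then have "(x - d m *\<^sub>R z, d m *\<^sub>R z) \<in> S \<times> cball 0 r" using z by blast
        then show ?thesis unfolding C_def by force
      qed
    qed (use C CO in \<open>auto simp: compact_imp_closed compact_imp_bounded\<close>)
    show "norm (\<phi> m x - u x) \<le> M * inverse (real (Suc m))" for m x
    proof -
      have "\<phi> m x - u x = (\<integral>z. std_bump z *\<^sub>R u (x - d m *\<^sub>R z) \<partial>lborel) - (\<integral>z. std_bump (z::'a) *\<^sub>R u x \<partial>lborel)"
        using ms(2)[of m x] std_bump_integral[where 'a='a]
          Bochner_Integration.integral_scaleR_left[of "u x" lborel "std_bump :: 'a \<Rightarrow> real"] by simp
      also have "\<dots> = (\<integral>z. std_bump z *\<^sub>R u (x - d m *\<^sub>R z) - std_bump z *\<^sub>R u x \<partial>lborel)"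
        using int1 std_bump_integral[where 'a='a] by (intro Bochner_Integration.integral_diff[symmetric]) auto
      finally have eq: "\<phi> m x - u x = (\<integral>z. std_bump z *\<^sub>R (u (x - d m *\<^sub>R z) - u x) \<partial>lborel)"
        by (simp add: scaleR_diff_right)
      have "norm (\<phi> m x - u x) \<le> (\<integral>z. std_bump (z::'a) * (d m * (K * ?n)) \<partial>lborel)"
        unfolding eq
      proof (rule Bochner_Integration.integral_norm_bound_integral)
        show "integrable lborel (\<lambda>z. std_bump z *\<^sub>R (u (x - d m *\<^sub>R z) - u x))"
          unfolding scaleR_diff_right using int1 std_bump_integral[where 'a='a] by auto
        show "integrable lborel (\<lambda>z::'a. std_bump z * (d m * (K * ?n)))"
          using std_bump_integral[where 'a='a] by auto
        show "norm (std_bump z *\<^sub>R (u (x - d m *\<^sub>R z) - u x)) \<le> std_bump z * (d m * (K * ?n))" for z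
          using ub[of z x m] std_bump_nonneg[of z] std_bump_zero[of z]
          by (cases "z \<in> cbox (-One) One") (auto intro: mult_left_mono simp del: mult.assoc)
      qed
      also have "\<dots> = d m * (K * ?n)" using std_bump_integral[where 'a='a] by simp
      also have "\<dots> = (K * r) * inverse (real (Suc m))" using n by (simp add: d_def)
      also have "\<dots> \<le> M * inverse (real (Suc m))"
        using Mpos by (intro mult_right_mono) (auto simp: M_def intro!: sum_nonneg)
      finally show ?thesis .
    qed
    have cont: "continuous_on UNIV (\<lambda>z. (1 / d m) *\<^sub>R (u (x - d m *\<^sub>R z) - u x))" for x m
      using d(1)[of m] by (auto intro!: continuous_intros continuous_on_compose2[OF cu])
    have cont2: "continuous_on UNIV (\<lambda>z. D b z *\<^sub>R (1 / d m) *\<^sub>R (u (x - d m *\<^sub>R z) - u x))" if "b \<in> Basis" for x m b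
      by (rule continuous_on_scaleR[OF Dp(1)[OF that] cont])
    have bnd: "norm (D b z *\<^sub>R ((1 / d m) *\<^sub>R (u (x - d m *\<^sub>R z) - u x))) \<le> \<bar>D b z\<bar> * (K * ?n)"
      if "b \<in> Basis" for b z x m
    proof (cases "z \<in> cbox (-One) One")
      case True
      have "norm ((1 / d m) *\<^sub>R (u (x - d m *\<^sub>R z) - u x)) \<le> K * ?n"
        using ub[OF True, of x m] d(1)[of m] unfolding norm_scaleR by (simp add: divide_simps ac_simps)
      then show ?thesis unfolding norm_scaleR[of "D b z"] real_norm_def by (rule mult_left_mono) simp
    next
      case False
      then have "D b z = 0" using Dp(2)[OF that] by blast
      then show ?thesis by simp
    qed
    have intD: "integrable lborel (\<lambda>z. \<bar>D b z\<bar> * (K * ?n))" if "b \<in> Basis" for b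
      using Dp(3)[OF that] by (intro integrable_mult_left integrable_abs)
    show "norm (frechet_derivative (\<phi> m) (at x) b) \<le> M" if b: "b \<in> Basis" for m x b
    proof -
      have "norm (frechet_derivative (\<phi> m) (at x) b) \<le> (\<integral>z. \<bar>D b z\<bar> * (K * ?n) \<partial>lborel)"
        unfolding ms(3)[OF b] D_def[symmetric]
      proof (rule Bochner_Integration.integral_norm_bound_integral[OF _ intD[OF b] bnd[OF b]])
        show "integrable lborel (\<lambda>z. D b z *\<^sub>R (1 / d m) *\<^sub>R (u (x - d m *\<^sub>R z) - u x))"
          using Dp(2)[OF b]
          by (intro integrable_continuous_compact_support[OF cont2[OF b] compact_cbox[of "-One" One]]) auto
      qed
      also have "\<dots> = (\<integral>z. \<bar>D b z\<bar> \<partial>lborel) * (K * ?n)" by simp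
      also have "\<dots> \<le> (\<Sum>b\<in>Basis. (\<integral>z. \<bar>D b z\<bar> \<partial>lborel) * (K * ?n))"
        using Mpos by (intro member_le_sum b) auto
      also have "\<dots> \<le> M" using K r by (simp add: M_def)
      finally show ?thesis .
    qed
    show "(\<lambda>m. frechet_derivative (\<phi> m) (at x) b) \<longlonglongrightarrow> frechet_derivative u (at x) b"
      if du: "u differentiable (at x)" and b: "b \<in> Basis" for x b
    proof -
      let ?A = "frechet_derivative u (at x)"
      have lin: "linear ?A" by (rule linear_frechet_derivative[OF du])
      have [measurable]: "D b \<in> borel_measurable borel"
        using Dp(1)[OF b] by (auto intro: borel_measurable_continuous_onI)
      have lim: "(\<lambda>m. (1 / d m) *\<^sub>R (u (x - d m *\<^sub>R z) - u x)) \<longlonglongrightarrow> - ?A z" for z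
      proof -
        have "((\<lambda>t. u (x - t *\<^sub>R z)) has_derivative (\<lambda>t. ?A (- (t *\<^sub>R z)))) (at 0)"
          by (rule has_derivative_compose[where f="\<lambda>t. x - t *\<^sub>R z" and g=u])
            (use differentiable_has_frechet[OF du] in \<open>auto intro!: derivative_eq_intros\<close>)
        then have "((\<lambda>t. norm ((u (x - t *\<^sub>R z) - u (x - 0 *\<^sub>R z) - ?A (- ((t - 0) *\<^sub>R z))) /\<^sub>R norm (t - 0))) \<longlongrightarrow> 0) (at 0)"
          unfolding has_derivative_at_within by (intro tendsto_norm_zero) blast
        then have "((\<lambda>t. norm ((1 / t) *\<^sub>R (u (x - t *\<^sub>R z) - u x) - (- ?A z))) \<longlongrightarrow> 0) (at 0)"
        proof (rule Lim_transform_eventually)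
          have "norm ((u (x - t *\<^sub>R z) - u (x - 0 *\<^sub>R z) - ?A (- ((t - 0) *\<^sub>R z))) /\<^sub>R norm (t - 0))
            = norm ((1 / t) *\<^sub>R (u (x - t *\<^sub>R z) - u x) - (- ?A z))" if "t \<noteq> 0" for t
          proof -
            have "(1 / t) *\<^sub>R (u (x - t *\<^sub>R z) - u x) - (- ?A z)
                = (1 / t) *\<^sub>R (u (x - t *\<^sub>R z) - u x - ?A (- (t *\<^sub>R z)))"
              using that by (simp add: linear_cmul[OF lin] linear_neg[OF lin] scaleR_diff_right scaleR_add_right)
            then show ?thesis by (simp add: divide_inverse)
          qed
          then show "\<forall>\<^sub>F t in at 0. norm ((u (x - t *\<^sub>R z) - u (x - 0 *\<^sub>R z) - ?A (- ((t - 0) *\<^sub>R z))) /\<^sub>R norm (t - 0))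
            = norm ((1 / t) *\<^sub>R (u (x - t *\<^sub>R z) - u x) - (- ?A z))"
            unfolding eventually_at_filter by (auto intro: always_eventually)
        qed
        then have "((\<lambda>t. (1 / t) *\<^sub>R (u (x - t *\<^sub>R z) - u x)) \<longlongrightarrow> - ?A z) (at 0)"
          by (rule LIM_zero_cancel[OF tendsto_norm_zero_cancel])
        moreover have "filterlim d (at 0) sequentially"
          unfolding filterlim_at
        proof
          show "d \<longlonglongrightarrow> 0" unfolding d_def
            using tendsto_mult_right[OF LIMSEQ_inverse_real_of_nat, of "r / ?n"] by (simp add: mult.commute)
          show "\<forall>\<^sub>F m in sequentially. d m \<in> UNIV \<and> d m \<noteq> 0"
            using d(1) by (auto simp: less_imp_neq[THEN not_sym])
        qed
        ultimately show ?thesis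
          by (rule filterlim_compose)
      qed
      have "(\<lambda>m. frechet_derivative (\<phi> m) (at x) b) \<longlonglongrightarrow> (\<integral>z. D b z *\<^sub>R - ?A z \<partial>lborel)"
        unfolding ms(3)[OF b] D_def[symmetric]
      proof (rule integral_dominated_convergence[OF _ _ intD[OF b]])
        have "continuous_on UNIV ?A" using lin by (simp add: linear_continuous_on linear_conv_bounded_linear)
        then have [measurable]: "?A \<in> borel_measurable borel" by (rule borel_measurable_continuous_onI)
        show "(\<lambda>z. D b z *\<^sub>R - ?A z) \<in> borel_measurable lborel" by measurable
        show "(\<lambda>z. D b z *\<^sub>R (1 / d m) *\<^sub>R (u (x - d m *\<^sub>R z) - u x)) \<in> borel_measurable lborel" for m
          using cont2[OF b] by (simp add: borel_measurable_continuous_onI)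
        show "AE z in lborel. (\<lambda>m. D b z *\<^sub>R (1 / d m) *\<^sub>R (u (x - d m *\<^sub>R z) - u x)) \<longlonglongrightarrow> D b z *\<^sub>R - ?A z"
          by (intro AE_I2 tendsto_scaleR tendsto_const lim)
      qed (use bnd[OF b] in auto)
      \<comment> \<open>The linear map is expanded in coordinates so that only first moments of
        \<open>D b\<close> remain. Their value \<open>- (b \<bullet> i)\<close> cancels the sign
        that comes from stepping to \<open>x - d m *\<^sub>R z\<close>.\<close>
      also have "(\<integral>z. D b z *\<^sub>R - ?A z \<partial>lborel) = (\<integral>z. (\<Sum>i\<in>Basis. (D b z * (z \<bullet> i)) *\<^sub>R - ?A i) \<partial>lborel)"
      proof (rule Bochner_Integration.integral_cong)
        fix z
        have "?A z = (\<Sum>i\<in>Basis. (z \<bullet> i) *\<^sub>R ?A i)"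
          by (subst euclidean_representation[symmetric, of z])
            (simp add: linear_sum[OF lin] linear_cmul[OF lin] del: euclidean_representation_sum_fun euclidean_representation)
        then show "D b z *\<^sub>R - ?A z = (\<Sum>i\<in>Basis. (D b z * (z \<bullet> i)) *\<^sub>R - ?A i)"
          by (simp add: scaleR_sum_right sum_negf)
      qed simp
      also have "\<dots> = (\<Sum>i\<in>Basis. (\<integral>z. D b z * (z \<bullet> i) \<partial>lborel) *\<^sub>R - ?A i)"
      proof -
        have "integrable lborel (\<lambda>z. D b z * (z \<bullet> i))" for i
          using Dp(2)[OF b]
          by (intro integrable_continuous_compact_support[of _ "cbox (-One) (One::'a)"])
            (auto intro!: continuous_intros Dp(1)[OF b])
        then show ?thesis by (subst Bochner_Integration.integral_sum) auto
      qed
      also have "\<dots> = (\<Sum>i\<in>Basis. (b \<bullet> i) *\<^sub>R ?A i)" by (simp add: Dp(4)[OF b])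
      also have "\<dots> = (\<Sum>i\<in>Basis. if i = b then ?A b else 0)"
        using b by (intro sum.cong) (auto simp: inner_Basis)
      also have "\<dots> = ?A b" using b by simp
      finally show ?thesis .
    qed
  qed
qed

subsection \<open>Differentiability almost everywhere\<close>

lemma negligible_countable_cover:
  assumes "countable \<C>" "S \<subseteq> \<Union>\<C>" "\<And>C. C \<in> \<C> \<Longrightarrow> negligible (S \<inter> C)"
  shows "negligible S"
proof -
  have "negligible (\<Union>((\<lambda>C. S \<inter> C) ` \<C>))"
    using assms by (intro negligible_countable_Union) auto
  then show ?thesis by (rule negligible_subset) (use assms in auto)
qed

text \<open>The set is a countable union of pieces that are Lipschitz graphs over coordinate hyperplanes.\<close>
lemma negligible_zero_set_nonzero_derivative:
  fixes \<phi> :: "'a::euclidean_space \<Rightarrow> real"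
  shows "negligible {x. \<phi> x = p \<and> \<phi> differentiable (at x) \<and> frechet_derivative \<phi> (at x) \<noteq> (\<lambda>_. 0)}"
    (is "negligible ?S")
proof -
  define P where "P b z = z - (z \<bullet> b) *\<^sub>R b" for b z :: 'a
  define C where "C b l = {x \<in> ?S. \<forall>y\<in>?S. norm (y - x) < 1 / real (Suc l) \<longrightarrow>
     \<bar>(y - x) \<bullet> b\<bar> \<le> real l * norm (P b (y - x))}" for b :: 'a and l :: nat
  have P: "linear (P b)" for b
    by (auto simp: P_def algebra_simps inner_add_left intro!: linearI)
  have cover: "\<exists>b\<in>Basis. \<exists>l. x \<in> C b l" if "x \<in> ?S" for x
  proof -
    let ?A = "frechet_derivative \<phi> (at x)"
    have hd: "(\<phi> has_derivative ?A) (at x)" using that differentiable_has_frechet by blast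
    have lin: "linear ?A" using hd has_derivative_linear by blast
    have "\<exists>b\<in>Basis. ?A b \<noteq> 0"
    proof (rule ccontr)
      assume "\<not> ?thesis"
      then have "?A = (\<lambda>_. 0)"
        using linear_eq_stdbasis[OF lin, of "\<lambda>_. 0"] by (auto simp: linear_zero)
      then show False using that by blast
    qed
    then obtain b where b: "b \<in> Basis" "?A b \<noteq> 0" by blast
    obtain B where B: "B > 0" "\<And>z. \<bar>?A z\<bar> \<le> B * norm z"
      using linear_bounded_pos[OF lin] by auto
    \<comment> \<open>Half of the slope in direction \<open>b\<close>: the error of the
      linearisation is then absorbed, which leaves
      \<open>e * |(y - x) \<bullet> b| \<le> (B + e) * norm (P b (y - x))\<close>, a cone condition
      around the hyperplane orthogonal to \<open>b\<close>.\<close>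
    define e where "e = \<bar>?A b\<bar> / 2"
    have e: "e > 0" using b by (simp add: e_def)
    obtain d where d: "d > 0" "\<And>y. norm (y - x) < d \<Longrightarrow> \<bar>\<phi> y - \<phi> x - ?A (y - x)\<bar> \<le> e * norm (y - x)"
      using hd e unfolding has_derivative_at_alt by (auto simp: real_norm_def)
    obtain l :: nat where l: "real l > max (1/d) ((B + e) / e)" using reals_Archimedean2 by blast
    have "\<bar>(y - x) \<bullet> b\<bar> \<le> real l * norm (P b (y - x))"
      if y: "y \<in> ?S" "norm (y - x) < 1 / real (Suc l)" for y
    proof -
      have "1 / real (Suc l) < d" using l d by (auto simp: field_simps)
      then have "\<bar>?A (y - x)\<bar> \<le> e * norm (y - x)"
        using d(2)[of y] y \<open>x \<in> ?S\<close> by (auto)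
      moreover have yx: "y - x = ((y - x) \<bullet> b) *\<^sub>R b + P b (y - x)" by (simp add: P_def)
      moreover have "?A (y - x) = ((y - x) \<bullet> b) * ?A b + ?A (P b (y - x))"
        by (subst yx) (simp add: linear_add[OF lin] linear_cmul[OF lin])
      moreover have "norm (y - x) \<le> \<bar>(y - x) \<bullet> b\<bar> + norm (P b (y - x))"
        by (subst yx) (rule order_trans[OF norm_triangle_ineq], use b in simp)
      ultimately have "\<bar>(y - x) \<bullet> b\<bar> * (2 * e) \<le> e * (\<bar>(y - x) \<bullet> b\<bar> + norm (P b (y - x))) + B * norm (P b (y - x))"
        using B(2)[of "P b (y - x)"] mult_left_mono[of "norm (y - x)" "\<bar>(y - x) \<bullet> b\<bar> + norm (P b (y - x))" e] e
          abs_mult[of "(y - x) \<bullet> b" "?A b"] unfolding e_def by linarith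
      then have "e * \<bar>(y - x) \<bullet> b\<bar> \<le> (B + e) * norm (P b (y - x))" by (simp add: algebra_simps)
      then have "\<bar>(y - x) \<bullet> b\<bar> \<le> ((B + e) / e) * norm (P b (y - x))" using e by (simp add: field_simps)
      also have "\<dots> \<le> real l * norm (P b (y - x))" using l by (intro mult_right_mono) auto
      finally show ?thesis .
    qed
    then show ?thesis using b that unfolding C_def by blast
  qed
  have neg: "negligible (C b l \<inter> ball q (1 / (2 * real (Suc l))))" if b: "b \<in> Basis" for b l q
  proof -
    let ?E = "C b l \<inter> ball q (1 / (2 * real (Suc l)))"
    \<comment> \<open>Points of \<open>?E\<close> are less than \<open>1 / Suc l\<close> apart, so
      the cone condition applies to every pair. Hence \<open>P b\<close> is injective on
      \<open>?E\<close> with Lipschitz inverse, and \<open>?E\<close> is a Lipschitz image of a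
      subset of a hyperplane.\<close>
    have key: "norm (y - x) \<le> (real l + 1) * norm (P b y - P b x)" if "x \<in> ?E" "y \<in> ?E" for x y
    proof -
      have "norm (y - x) < 1 / real (Suc l)"
      proof -
        have "norm (y - x) \<le> dist q y + dist q x"
          using dist_triangle3[of y x q] by (simp add: dist_norm norm_minus_commute)
        also have "\<dots> < 1 / (2 * real (Suc l)) + 1 / (2 * real (Suc l))" using that by (intro add_strict_mono) auto
        finally show ?thesis by (simp add: field_simps)
      qed
      then have "\<bar>(y - x) \<bullet> b\<bar> \<le> real l * norm (P b (y - x))"
        using that by (auto simp: C_def)
      moreover have "norm (y - x) \<le> \<bar>(y - x) \<bullet> b\<bar> + norm (P b (y - x))"
      proof -
        have "y - x = ((y - x) \<bullet> b) *\<^sub>R b + P b (y - x)" by (simp add: P_def)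
        then have "norm (y - x) \<le> norm (((y - x) \<bullet> b) *\<^sub>R b) + norm (P b (y - x))"
          by (metis norm_triangle_ineq)
        then show ?thesis using b by simp
      qed
      ultimately show ?thesis using linear_diff[OF P, of b y x] by (simp add: algebra_simps)
    qed
    have inj: "inj_on (P b) ?E"
      using key by (force intro!: inj_onI)
    define g where "g = the_inv_into ?E (P b)"
    have g: "g (P b x) = x" if "x \<in> ?E" for x using the_inv_into_f_f[OF inj that] by (simp add: g_def)
    have "negligible (P b ` ?E)"
    proof (rule negligible_subset[OF negligible_standard_hyperplane[OF b, of 0]])
      show "P b ` ?E \<subseteq> {x. x \<bullet> b = 0}" using b by (auto simp: P_def inner_diff_left)
    qed
    then have "negligible (g ` (P b ` ?E))"
    proof (rule negligible_locally_Lipschitz_image[rotated])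
      fix z assume z: "z \<in> P b ` ?E"
      show "\<exists>T B. open T \<and> z \<in> T \<and> (\<forall>y\<in>P b ` ?E \<inter> T. norm (g y - g z) \<le> B * norm (y - z))"
        using z key g by (intro exI[of _ UNIV] exI[of _ "real l + 1"]) auto
    qed simp
    moreover have "g ` (P b ` ?E) = ?E" using g by (force simp: image_iff)
    ultimately show ?thesis by simp
  qed
  obtain Q :: "'a set" where Q: "countable Q" "\<And>X. open X \<Longrightarrow> X \<noteq> {} \<Longrightarrow> \<exists>q\<in>Q. q \<in> X"
    using countable_dense_exists by metis
  have negC: "negligible (C b l)" if "b \<in> Basis" for b l
  proof (rule negligible_countable_cover[of "(\<lambda>q. ball q (1 / (2 * real (Suc l)))) ` Q"])
    show "C b l \<subseteq> \<Union> ((\<lambda>q. ball q (1 / (2 * real (Suc l)))) ` Q)"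
    proof
      fix x
      obtain q where "q \<in> Q" "q \<in> ball x (1 / (2 * real (Suc l)))"
        using Q(2)[of "ball x (1 / (2 * real (Suc l)))"] by auto
      then show "x \<in> \<Union> ((\<lambda>q. ball q (1 / (2 * real (Suc l)))) ` Q)" by (auto simp: dist_commute)
    qed
  qed (use Q neg that in auto)
  have "negligible (\<Union>((\<lambda>(b, l). C b l) ` (Basis \<times> UNIV)))"
    by (intro negligible_countable_Union countable_image countable_SIGMA countable_finite[OF finite_Basis]) (auto simp: negC intro!: countable_image countable_SIGMA intro: countable_finite[OF finite_Basis])
  then show ?thesis
    by (rule negligible_subset) (use cover in force)
qed

text \<open>The maps constructed later are built from the coordinates and the distance to a point by
  arithmetic, \<open>max\<close> and \<open>min\<close>. This class is closed under these operations
  as long as denominators do not vanish, so differentiability almost everywhere can be read off from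
  the formulas.\<close>

definition ae_diff :: "'a::euclidean_space set \<Rightarrow> ('a \<Rightarrow> 'b::real_normed_vector) \<Rightarrow> bool" where
  "ae_diff U f \<longleftrightarrow> negligible {x \<in> U. \<not> f differentiable (at x)}"

lemma ae_diff_mono: "ae_diff U f \<Longrightarrow> V \<subseteq> U \<Longrightarrow> ae_diff V f"
  unfolding ae_diff_def by (erule negligible_subset) auto

lemma ae_diffI: "(\<And>x. x \<in> U \<Longrightarrow> f differentiable (at x)) \<Longrightarrow> ae_diff U f"
  unfolding ae_diff_def by (metis (mono_tags, lifting) Collect_empty_eq negligible_empty)

lemma ae_diff_lift:
  assumes "ae_diff U f" "\<And>x. x \<in> U \<Longrightarrow> f differentiable (at x) \<Longrightarrow> h differentiable (at x)"
  shows "ae_diff U h"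
  using assms(1) unfolding ae_diff_def by (rule negligible_subset) (use assms(2) in auto)

lemma ae_diff_lift2:
  assumes "ae_diff U f" "ae_diff U g"
    "\<And>x. x \<in> U \<Longrightarrow> f differentiable (at x) \<Longrightarrow> g differentiable (at x) \<Longrightarrow> h differentiable (at x)"
  shows "ae_diff U h"
  using negligible_Un[OF assms(1,2)[unfolded ae_diff_def]] unfolding ae_diff_def
  by (rule negligible_subset) (use assms(3) in auto)

lemma ae_diff_const [simp]: "ae_diff U (\<lambda>x. c)" by (rule ae_diffI) simp

lemma ae_diff_add: "ae_diff U f \<Longrightarrow> ae_diff U g \<Longrightarrow> ae_diff U (\<lambda>x. f x + g x)"
  by (erule (1) ae_diff_lift2) auto

lemma ae_diff_diff: "ae_diff U f \<Longrightarrow> ae_diff U g \<Longrightarrow> ae_diff U (\<lambda>x. f x - g x)"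
  by (erule (1) ae_diff_lift2) auto

lemma ae_diff_mult:
  fixes f g :: "'a::euclidean_space \<Rightarrow> real"
  shows "ae_diff U f \<Longrightarrow> ae_diff U g \<Longrightarrow> ae_diff U (\<lambda>x. f x * g x)"
  by (erule (1) ae_diff_lift2) auto

lemma ae_diff_scaleR:
  fixes f :: "'a::euclidean_space \<Rightarrow> real"
  shows "ae_diff U f \<Longrightarrow> ae_diff U g \<Longrightarrow> ae_diff U (\<lambda>x. f x *\<^sub>R g x)"
  by (erule (1) ae_diff_lift2) auto

lemma ae_diff_divide:
  fixes f g :: "'a::euclidean_space \<Rightarrow> real"
  shows "ae_diff U f \<Longrightarrow> ae_diff U g \<Longrightarrow> (\<And>x. x \<in> U \<Longrightarrow> g x \<noteq> 0) \<Longrightarrow> ae_diff U (\<lambda>x. f x / g x)"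
  by (erule (1) ae_diff_lift2) (auto intro: differentiable_divide)

lemma differentiable_transform_eventually:
  assumes "f differentiable (at x)" "\<forall>\<^sub>F y in nhds x. f y = g y"
  shows "g differentiable (at x)"
proof -
  obtain S where S: "open S" "x \<in> S" "\<And>y. y \<in> S \<Longrightarrow> f y = g y"
    using assms(2) unfolding eventually_nhds by blast
  obtain f' where "(f has_derivative f') (at x)" using assms(1) by (auto simp: differentiable_def)
  then have "(g has_derivative f') (at x)"
    by (rule has_derivative_transform_within_open[OF _ S(1,2)]) (use S(3) in auto)
  then show ?thesis by (auto simp: differentiable_def)
qed

text \<open>Where \<open>f\<close> and \<open>g\<close> differ, the maximum agrees locally with one
  of them. Where they coincide, either the derivative of \<open>f - g\<close> vanishes, and then its
  positive part is differentiable too, or the point lies in the null set of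
  \<open>negligible_zero_set_nonzero_derivative\<close>.\<close>

lemma ae_diff_max:
  fixes f g :: "'a::euclidean_space \<Rightarrow> real"
  assumes "ae_diff U f" "ae_diff U g"
  shows "ae_diff U (\<lambda>x. max (f x) (g x))"
proof -
  let ?h = "\<lambda>x. f x - g x"
  let ?Z = "{x. ?h x = 0 \<and> ?h differentiable (at x) \<and> frechet_derivative ?h (at x) \<noteq> (\<lambda>_. 0)}"
  have "(\<lambda>x. max (f x) (g x)) differentiable (at x)"
    if df: "f differentiable (at x)" and dg: "g differentiable (at x)" and "x \<notin> ?Z" for x
  proof -
    have dh: "?h differentiable (at x)" using df dg by auto
    have cont': "(?h \<longlongrightarrow> ?h x) (nhds x)"
      using differentiable_imp_continuous_within[OF dh] by (simp add: continuous_at tendsto_nhds_iff)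
    consider "?h x > 0" | "?h x < 0" | "?h x = 0" by linarith
    then show ?thesis
    proof cases
      case 1
      have "\<forall>\<^sub>F y in nhds x. ?h y > 0"
        by (rule order_tendstoD(1)[OF cont' 1])
      then have "\<forall>\<^sub>F y in nhds x. f y = max (f y) (g y)" by (rule eventually_mono) auto
      with df show ?thesis by (rule differentiable_transform_eventually)
    next
      case 2
      have "\<forall>\<^sub>F y in nhds x. ?h y < 0"
        by (rule order_tendstoD(2)[OF cont' 2])
      then have "\<forall>\<^sub>F y in nhds x. g y = max (f y) (g y)" by (rule eventually_mono) auto
      with dg show ?thesis by (rule differentiable_transform_eventually)
    next
      case 3
      with dh \<open>x \<notin> ?Z\<close> have "frechet_derivative ?h (at x) = (\<lambda>_. 0)" by blast
      then have hd: "(?h has_derivative (\<lambda>_. 0)) (at x)" using differentiable_has_frechet[OF dh] by simp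
      have "((\<lambda>y. max (?h y) 0) has_derivative (\<lambda>_. 0)) (at x)"
        unfolding has_derivative_at_alt
      proof (intro conjI allI impI)
        fix e :: real assume "e > 0"
        then obtain d where d: "d > 0" "\<And>y. norm (y - x) < d \<Longrightarrow> norm (?h y - ?h x - 0) \<le> e * norm (y - x)"
          using hd unfolding has_derivative_at_alt by blast
        have "norm (max (?h y) 0 - max (?h x) 0 - 0) \<le> e * norm (y - x)" if "norm (y - x) < d" for y
          using d(2)[OF that] 3 by (auto simp: max_def split: if_splits)
        then show "\<exists>d>0. \<forall>y. norm (y - x) < d \<longrightarrow> norm (max (?h y) 0 - max (?h x) 0 - 0) \<le> e * norm (y - x)"
          using d(1) by blast
      qed (rule bounded_linear_zero)
      then have "(\<lambda>y. max (?h y) 0) differentiable (at x)" by (auto simp: differentiable_def)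
      then have "(\<lambda>y. max (?h y) 0 + g y) differentiable (at x)" using dg by auto
      moreover have "(\<lambda>y. max (?h y) 0 + g y) = (\<lambda>x. max (f x) (g x))" by (auto simp: max_def)
      ultimately show ?thesis by simp
    qed
  qed
  then have "{x \<in> U. \<not> (\<lambda>x. max (f x) (g x)) differentiable (at x)}
     \<subseteq> {x \<in> U. \<not> f differentiable (at x)} \<union> {x \<in> U. \<not> g differentiable (at x)} \<union> ?Z" by blast
  moreover have "negligible ({x \<in> U. \<not> f differentiable (at x)} \<union> {x \<in> U. \<not> g differentiable (at x)} \<union> ?Z)"
    using assms negligible_zero_set_nonzero_derivative[of ?h 0] unfolding ae_diff_def by (intro negligible_Un) auto
  ultimately show ?thesis unfolding ae_diff_def by (rule negligible_subset[rotated])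
qed

lemma ae_diff_uminus: "ae_diff U f \<Longrightarrow> ae_diff U (\<lambda>x. - f x)"
  by (erule ae_diff_lift) auto

lemma ae_diff_min:
  fixes f g :: "'a::euclidean_space \<Rightarrow> real"
  assumes "ae_diff U f" "ae_diff U g"
  shows "ae_diff U (\<lambda>x. min (f x) (g x))"
proof -
  have "ae_diff U (\<lambda>x. - max (- f x) (- g x))"
    by (intro ae_diff_uminus ae_diff_max assms)
  moreover have "(\<lambda>x. - max (- f x) (- g x)) = (\<lambda>x. min (f x) (g x))" by (auto simp: max_def min_def)
  ultimately show ?thesis by simp
qed

lemma ae_diff_Max:
  fixes f :: "'i \<Rightarrow> 'a::euclidean_space \<Rightarrow> real"
  assumes "finite I" "I \<noteq> {}" "\<And>i. i \<in> I \<Longrightarrow> ae_diff U (f i)"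
  shows "ae_diff U (\<lambda>x. Max ((\<lambda>i. f i x) ` I))"
  using assms
proof (induction I rule: finite_ne_induct)
  case (insert i F)
  have "(\<lambda>x. Max ((\<lambda>i. f i x) ` insert i F)) = (\<lambda>x. max (f i x) (Max ((\<lambda>i. f i x) ` F)))"
    using insert.hyps by auto
  then show ?case using insert by (auto intro: ae_diff_max)
qed auto

lemma ae_diff_Min:
  fixes f :: "'i \<Rightarrow> 'a::euclidean_space \<Rightarrow> real"
  assumes "finite I" "I \<noteq> {}" "\<And>i. i \<in> I \<Longrightarrow> ae_diff U (f i)"
  shows "ae_diff U (\<lambda>x. Min ((\<lambda>i. f i x) ` I))"
  using assms
proof (induction I rule: finite_ne_induct)
  case (insert i F)
  have "(\<lambda>x. Min ((\<lambda>i. f i x) ` insert i F)) = (\<lambda>x. min (f i x) (Min ((\<lambda>i. f i x) ` F)))"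
    using insert.hyps by auto
  then show ?case using insert by (auto intro: ae_diff_min)
qed auto

subsection \<open>Membership in the Sobolev space\<close>

lemma borel_measurable_matrixI:
  fixes A :: "'a \<Rightarrow> real^'n^'m"
  assumes "\<And>i j. (\<lambda>x. A x $ i $ j) \<in> borel_measurable M"
  shows "A \<in> borel_measurable M"
proof -
  have "(\<lambda>x. A x \<bullet> b) \<in> borel_measurable M" if b: "b \<in> Basis" for b
  proof -
    obtain i j where "b = axis i (axis j 1)" using b by (auto simp: Basis_vec_def)
    then show ?thesis using assms[of i j] by (simp add: inner_axis)
  qed
  then show ?thesis using borel_measurable_euclidean_space by blast
qed

lemma borel_measurable_lebesgue_cong_negligible:
  fixes f g :: "'a::euclidean_space \<Rightarrow> 'b::topological_space"
  assumes f: "f \<in> borel_measurable lebesgue" and N: "negligible {x. f x \<noteq> g x}"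
  shows "g \<in> borel_measurable lebesgue"
proof (rule measurableI)
  fix A :: "'b set" assume A: "A \<in> sets borel"
  let ?N = "{x. f x \<noteq> g x}"
  have "f -` A \<inter> space lebesgue \<in> sets lebesgue" using f A by (rule measurable_sets)
  moreover have "?N \<in> sets lebesgue" "g -` A \<inter> ?N \<in> sets lebesgue"
    using N negligible_subset[OF N, of "g -` A \<inter> ?N"] by (auto simp: negligible_iff_null_sets)
  ultimately have *: "(f -` A \<inter> space lebesgue - ?N) \<union> (g -` A \<inter> ?N) \<in> sets lebesgue" by blast
  have "g -` A \<inter> space lebesgue = (f -` A \<inter> space lebesgue - ?N) \<union> (g -` A \<inter> ?N)" by auto
  then show "g -` A \<inter> space lebesgue \<in> sets lebesgue" using * by (simp only:)
qed auto

lemma grad_component: "grad g x $ i $ j = frechet_derivative g (at x) (axis j 1) $ i"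
  by (simp add: grad_def partial_def)

lemma axis_1_in_Basis: "axis j (1::real) \<in> Basis"
  by (auto simp: axis_in_Basis_iff)

lemma has_derivative_imp_LIMSEQ:
  fixes u :: "'a::real_normed_vector \<Rightarrow> 'b::real_normed_vector"
  assumes "u differentiable (at x)"
  shows "(\<lambda>m. real (Suc m) *\<^sub>R (u (x + (1 / real (Suc m)) *\<^sub>R z) - u x)) \<longlonglongrightarrow> frechet_derivative u (at x) z"
proof -
  let ?A = "frechet_derivative u (at x)"
  have hd: "(u has_derivative ?A) (at x)" using assms frechet_derivative_works by blast
  have lin: "linear ?A" using linear_frechet_derivative[OF assms] .
  have "((\<lambda>t. u (x + t *\<^sub>R z)) has_derivative (\<lambda>t. ?A (t *\<^sub>R z))) (at 0)"
    by (rule has_derivative_compose[where f="\<lambda>t. x + t *\<^sub>R z" and g=u])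
      (use hd in \<open>auto intro!: derivative_eq_intros\<close>)
  then have "((\<lambda>t. (u (x + t *\<^sub>R z) - u (x + 0 *\<^sub>R z) - ?A ((t - 0) *\<^sub>R z)) /\<^sub>R norm (t - 0)) \<longlongrightarrow> 0) (at 0)"
    unfolding has_derivative_at_within by blast
  moreover have "filterlim (\<lambda>m. 1 / real (Suc m)) (at 0) sequentially"
    unfolding filterlim_at using LIMSEQ_inverse_real_of_nat by (auto simp: inverse_eq_divide)
  ultimately have "(\<lambda>m. (u (x + (1 / real (Suc m)) *\<^sub>R z) - u (x + 0 *\<^sub>R z) - ?A ((1 / real (Suc m) - 0) *\<^sub>R z)) /\<^sub>R norm (1 / real (Suc m) - 0)) \<longlonglongrightarrow> 0"
    by (rule filterlim_compose)
  also have "(\<lambda>m. (u (x + (1 / real (Suc m)) *\<^sub>R z) - u (x + 0 *\<^sub>R z) - ?A ((1 / real (Suc m) - 0) *\<^sub>R z)) /\<^sub>R norm (1 / real (Suc m) - 0))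
      = (\<lambda>m. real (Suc m) *\<^sub>R (u (x + (1 / real (Suc m)) *\<^sub>R z) - u x) - ?A z)"
    by (auto simp: fun_eq_iff linear_cmul[OF lin] scaleR_diff_right simp del: of_nat_Suc)
  finally show ?thesis by (rule LIM_zero_cancel)
qed

text \<open>At points of differentiability the gradient is the limit of the difference quotients
  with step \<open>1 / Suc m\<close>, and \<open>lim\<close> of Borel functions is Borel. The
  remaining points of \<open>U\<close> are null, and Lebesgue measure is complete.\<close>

lemma grad_measurable:
  fixes u :: "real^'n \<Rightarrow> real^'N"
  assumes [measurable]: "u \<in> borel_measurable borel" and d: "ae_diff U u" and U: "U \<in> sets lebesgue"
  shows "grad u \<in> borel_measurable (lebesgue_on U)"
proof -
  define g where "g x = (\<chi> i j. lim (\<lambda>m. real (Suc m) * (u (x + (1 / real (Suc m)) *\<^sub>R axis j 1) $ i - u x $ i)))"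
    for x :: "real^'n"
  have [measurable]: "(\<lambda>x. u x $ i) \<in> borel_measurable borel" for i
  proof -
    have "(\<lambda>x. u x \<bullet> axis i 1) \<in> borel_measurable borel" by measurable
    then show ?thesis by (simp add: inner_axis)
  qed
  have "g \<in> borel_measurable borel"
    by (rule borel_measurable_matrixI) (auto simp: g_def)
  then have gm: "g \<in> borel_measurable lebesgue"
    by (simp add: measurable_completion)
  define h where "h x = (if x \<in> U then grad u x else g x)" for x
  have "g x = grad u x" if "u differentiable (at x)" for x
  proof -
    have "lim (\<lambda>m. real (Suc m) * (u (x + (1 / real (Suc m)) *\<^sub>R axis j 1) $ i - u x $ i)) = grad u x $ i $ j" for i j
      using tendsto_vec_nth[OF has_derivative_imp_LIMSEQ[OF that, of "axis j 1"], of i]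
      unfolding grad_component by (intro limI) simp
    then show ?thesis by (simp add: g_def vec_eq_iff)
  qed
  then have "{x. g x \<noteq> h x} \<subseteq> {x \<in> U. \<not> u differentiable (at x)}" by (auto simp: h_def)
  then have "negligible {x. g x \<noteq> h x}" using d unfolding ae_diff_def by (rule negligible_subset[rotated])
  then have "h \<in> borel_measurable lebesgue" by (rule borel_measurable_lebesgue_cong_negligible[OF gm])
  then have "h \<in> borel_measurable (lebesgue_on U)" by (rule measurable_restrict_space1)
  then show ?thesis
    by (rule subst[OF measurable_cong, rotated]) (auto simp: h_def)
qed

lemma continuous_on_grad:
  fixes \<phi> :: "real^'n \<Rightarrow> real^'N"
  assumes "\<phi> \<in> test_functions \<Omega>"
  shows "continuous_on UNIV (grad \<phi>)"
  unfolding grad_def partial_def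
  by (intro continuous_on_vec_lambda continuous_on_component test_functionD(3)[OF assms] axis_1_in_Basis)

lemma bounded_range_compact_support:
  fixes f :: "'a::euclidean_space \<Rightarrow> 'b::real_normed_vector"
  assumes "continuous_on UNIV f" "compact K" "\<And>x. f x \<noteq> 0 \<Longrightarrow> x \<in> K"
  obtains M where "M \<ge> 0" "\<And>x. norm (f x) \<le> M"
proof -
  have "bounded (f ` K)"
    by (intro compact_imp_bounded compact_continuous_image continuous_on_subset[OF assms(1)] assms) auto
  then obtain M where M: "\<And>x. x \<in> K \<Longrightarrow> norm (f x) \<le> M" by (auto simp: bounded_iff)
  have "norm (f x) \<le> max M 0" for x
    using M[of x] assms(3)[of x] by (cases "f x = 0") auto
  then show thesis using that[of "max M 0"] by auto
qed

lemma test_function_bounds: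
  fixes \<phi> :: "real^'n \<Rightarrow> real^'N"
  assumes \<phi>: "\<phi> \<in> test_functions \<Omega>"
  obtains M where "\<And>x. norm (\<phi> x) \<le> M" "\<And>x. norm (grad \<phi> x) \<le> M"
proof -
  obtain K where K: "compact K" "\<forall>x. \<phi> x \<noteq> 0 \<longrightarrow> x \<in> K"
    "\<forall>x. frechet_derivative \<phi> (at x) \<noteq> (\<lambda>_. 0) \<longrightarrow> x \<in> K"
    using test_functionD(4)[OF \<phi>] by blast
  obtain M1 where M1: "\<And>x. norm (\<phi> x) \<le> M1"
    using bounded_range_compact_support[OF test_functionD(2)[OF \<phi>] K(1)] K(2) by metis
  have "x \<in> K" if "grad \<phi> x \<noteq> 0" for x
  proof (rule ccontr)
    assume "x \<notin> K"
    then have "frechet_derivative \<phi> (at x) = (\<lambda>_. 0)" using K(3) by blast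
    with that show False by (simp add: grad_def partial_def vec_eq_iff)
  qed
  then obtain M2 where M2: "\<And>x. norm (grad \<phi> x) \<le> M2"
    using bounded_range_compact_support[OF continuous_on_grad[OF \<phi>] K(1)] by metis
  show thesis using that[of "max M1 M2"] M1 M2 by (simp add: le_max_iff_disj)
qed

lemma partial_test_function_bound:
  fixes \<psi> :: "real^'n \<Rightarrow> real"
  assumes \<psi>: "\<psi> \<in> test_functions \<Omega>"
  obtains M where "M \<ge> 0" "\<And>x. \<bar>\<psi> x\<bar> \<le> M" "\<And>x. \<bar>partial j \<psi> x\<bar> \<le> M"
proof -
  obtain K where K: "compact K" "\<forall>x. \<psi> x \<noteq> 0 \<longrightarrow> x \<in> K"
    "\<forall>x. frechet_derivative \<psi> (at x) \<noteq> (\<lambda>_. 0) \<longrightarrow> x \<in> K"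
    using test_functionD(4)[OF \<psi>] by blast
  obtain M1 where M1: "\<And>x. norm (\<psi> x) \<le> M1"
    using bounded_range_compact_support[OF test_functionD(2)[OF \<psi>] K(1)] K(2) by metis
  have "x \<in> K" if "partial j \<psi> x \<noteq> 0" for x
    using that K(3) unfolding partial_def by metis
  moreover have "continuous_on UNIV (partial j \<psi>)"
    using test_functionD(3)[OF \<psi> axis_1_in_Basis[of j]] by (simp add: partial_def[abs_def])
  ultimately obtain M2 where M2: "\<And>x. norm (partial j \<psi> x) \<le> M2"
    using bounded_range_compact_support[OF _ K(1)] by metis
  have "M1 \<ge> 0" using M1[of 0] norm_ge_zero order_trans by blast
  then show thesis using that[of "max M1 M2"] M1 M2 by (simp add: le_max_iff_disj)
qed

lemma integral_lebesgue_on_eq_lborel: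
  fixes f :: "'a::euclidean_space \<Rightarrow> real"
  assumes "f \<in> borel_measurable borel" "U \<in> sets lebesgue" "\<And>x. f x \<noteq> 0 \<Longrightarrow> x \<in> U"
  shows "(\<integral>x. f x \<partial>lebesgue_on U) = (\<integral>x. f x \<partial>lborel)"
proof -
  have "(\<integral>x. f x \<partial>lebesgue_on U) = (\<integral>x. indicator U x *\<^sub>R f x \<partial>lebesgue)"
    using assms by (simp add: integral_restrict_space)
  also have "(\<lambda>x. indicator U x *\<^sub>R f x) = f" using assms(3) by (auto simp: fun_eq_iff indicator_def)
  finally show ?thesis using assms(1) by (simp add: integral_completion)
qed

lemma test_function_integration_by_parts:
  fixes \<phi> :: "real^'n \<Rightarrow> real^'N" and \<psi> :: "real^'n \<Rightarrow> real"
  assumes \<phi>: "\<phi> \<in> test_functions \<Omega>" and \<psi>: "\<psi> \<in> test_functions \<Omega>" and \<Omega>: "\<Omega> \<in> sets lebesgue"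
  shows "(\<integral>x. \<phi> x $ i * partial j \<psi> x \<partial>lebesgue_on \<Omega>) = - (\<integral>x. grad \<phi> x $ i $ j * \<psi> x \<partial>lebesgue_on \<Omega>)"
proof -
  obtain K where K: "compact K" "K \<subseteq> \<Omega>" "\<forall>x. \<psi> x \<noteq> 0 \<longrightarrow> x \<in> K"
    "\<forall>x. frechet_derivative \<psi> (at x) \<noteq> (\<lambda>_. 0) \<longrightarrow> x \<in> K"
    using test_functionD(4)[OF \<psi>] by blast
  have d: "((\<lambda>x. \<phi> x $ i * \<psi> x) has_derivative
     (\<lambda>v. \<phi> x $ i * frechet_derivative \<psi> (at x) v + frechet_derivative \<phi> (at x) v $ i * \<psi> x)) (at x)" for x
    by (intro has_derivative_mult bounded_linear.has_derivative[OF bounded_linear_vec_nth] differentiable_has_frechet test_functionD(1)[OF \<phi>] test_functionD(1)[OF \<psi>])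
  let ?f = "\<lambda>x. \<phi> x $ i * partial j \<psi> x" and ?g = "\<lambda>x. grad \<phi> x $ i $ j * \<psi> x"
  have eq: "frechet_derivative (\<lambda>x. \<phi> x $ i * \<psi> x) (at x) (axis j 1) = ?f x + ?g x" for x
    using frechet_derivative_eqI[OF d] by (simp add: partial_def grad_component)
  have cf: "continuous_on UNIV ?f"
    using test_functionD(3)[OF \<psi> axis_1_in_Basis[of j]] unfolding partial_def
    by (intro continuous_intros test_functionD(2)[OF \<phi>])
  have cg: "continuous_on UNIV ?g"
    by (intro continuous_intros continuous_on_grad[OF \<phi>] test_functionD(2)[OF \<psi>])
  have f0: "x \<in> K" if "?f x \<noteq> 0" for x
    using that K(4) unfolding partial_def by (metis mult_zero_right)
  have g0: "x \<in> K" if "?g x \<noteq> 0" for x using that K(3) by auto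
  have "(\<integral>x. ?f x + ?g x \<partial>lborel) = 0"
    unfolding eq[symmetric]
  proof (rule integral_directional_derivative_zero)
    show "(\<lambda>x. \<phi> x $ i * \<psi> x) differentiable (at x)" for x using d by (auto simp: differentiable_def)
    show "continuous_on UNIV (\<lambda>x. frechet_derivative (\<lambda>x. \<phi> x $ i * \<psi> x) (at x) (axis j 1))"
      unfolding eq by (intro continuous_on_add cf cg)
    show "x \<in> K" if "\<phi> x $ i * \<psi> x \<noteq> 0" for x using that K(3) by auto
  qed (rule K)
  moreover have "integrable lborel ?f" "integrable lborel ?g"
    using integrable_continuous_compact_support[OF cf K(1)] integrable_continuous_compact_support[OF cg K(1)] f0 g0 by blast+
  ultimately have "(\<integral>x. ?f x \<partial>lborel) = - (\<integral>x. ?g x \<partial>lborel)" by simp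
  moreover have "(\<integral>x. ?f x \<partial>lebesgue_on \<Omega>) = (\<integral>x. ?f x \<partial>lborel)"
    using cf f0 K(2) by (intro integral_lebesgue_on_eq_lborel \<Omega> borel_measurable_continuous_onI) auto
  moreover have "(\<integral>x. ?g x \<partial>lebesgue_on \<Omega>) = (\<integral>x. ?g x \<partial>lborel)"
    using cg g0 K(2) by (intro integral_lebesgue_on_eq_lborel \<Omega> borel_measurable_continuous_onI) auto
  ultimately show ?thesis by simp
qed

text \<open>One step of the closure in \<open>W1p0\<close>. Stated with \<open>nn_integral\<close>,
  it presupposes no integrability; instead the bound itself shows in \<open>W1p0I\<close> that
  \<open>u\<close> and \<open>G\<close> belong to \<open>Lp\<close>.\<close>

definition approx_W1p ::
  "real \<Rightarrow> (real^'n) set \<Rightarrow> (real^'n \<Rightarrow> real^'N) \<Rightarrow> (real^'n \<Rightarrow> real^'n^'N) \<Rightarrow> real \<Rightarrow> bool" where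
  "approx_W1p p \<Omega> u G e \<longleftrightarrow> (\<exists>\<phi>\<in>test_functions \<Omega>.
     (\<integral>\<^sup>+x. ennreal (norm (\<phi> x - u x) powr p) \<partial>lebesgue_on \<Omega>) \<le> ennreal (e powr p) \<and>
     (\<integral>\<^sup>+x. ennreal (norm (grad \<phi> x - G x) powr p) \<partial>lebesgue_on \<Omega>) \<le> ennreal (e powr p))"

lemma powr_add_le:
  fixes a b p :: real
  assumes "a \<ge> 0" "b \<ge> 0" "p \<ge> 0"
  shows "(a + b) powr p \<le> 2 powr p * (a powr p + b powr p)"
proof -
  have "(a + b) powr p \<le> (2 * max a b) powr p" using assms by (intro powr_mono2) auto
  also have "\<dots> = 2 powr p * max a b powr p" using assms by (simp add: powr_mult)
  also have "\<dots> \<le> 2 powr p * (a powr p + b powr p)" by (intro mult_left_mono) (auto simp: max_def)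
  finally show ?thesis .
qed

text \<open>Above \<open>e\<close> the factor \<open>z powr (1 - p)\<close> is at most
  \<open>e powr (1 - p)\<close>. Integrated over a set of finite measure, this turns smallness in
  \<open>L^p\<close> into smallness in \<open>L^1\<close> of the same order
  \<open>e\<close>.\<close>

lemma le_powr_interpolate:
  fixes z e p :: real
  assumes "z \<ge> 0" "e > 0" "p \<ge> 1"
  shows "z \<le> e + e powr (1 - p) * z powr p"
proof (cases "z \<le> e")
  case False
  have "z powr 1 = z powr (1 - p) * z powr p" by (simp flip: powr_add)
  also have "\<dots> \<le> e powr (1 - p) * z powr p"
    using False assms by (intro mult_right_mono powr_mono2') auto
  finally show ?thesis using False assms by simp
qed (use assms in \<open>simp add: add_increasing2\<close>)

lemma integrable_norm_powr_diff:
  fixes f g :: "'a \<Rightarrow> 'b::euclidean_space"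
  assumes "f \<in> borel_measurable M" "g \<in> borel_measurable M" "p \<ge> 0"
    "integrable M (\<lambda>x. norm (f x) powr p)" "(\<integral>\<^sup>+x. ennreal (norm (f x - g x) powr p) \<partial>M) < \<infinity>"
  shows "integrable M (\<lambda>x. norm (g x) powr p)"
proof -
  have [measurable]: "f \<in> borel_measurable M" "g \<in> borel_measurable M" using assms by auto
  have i: "integrable M (\<lambda>x. norm (f x - g x) powr p)"
    using assms(5) by (intro integrableI_nonneg) auto
  show ?thesis
  proof (rule Bochner_Integration.integrable_bound)
    show "integrable M (\<lambda>x. 2 powr p * (norm (f x - g x) powr p + norm (f x) powr p))"
      using i assms(4) by auto
    show "AE x in M. norm (norm (g x) powr p) \<le> norm (2 powr p * (norm (f x - g x) powr p + norm (f x) powr p))"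
    proof (rule AE_I2)
      fix x
      have "norm (g x) \<le> norm (f x - g x) + norm (f x)"
        using norm_triangle_ineq4[of "f x" "f x - g x"] by simp
      then have "norm (g x) powr p \<le> (norm (f x - g x) + norm (f x)) powr p"
        using assms(3) by (intro powr_mono2) auto
      also have "\<dots> \<le> 2 powr p * (norm (f x - g x) powr p + norm (f x) powr p)"
        using assms(3) by (intro powr_add_le) auto
      finally show "norm (norm (g x) powr p) \<le> norm (2 powr p * (norm (f x - g x) powr p + norm (f x) powr p))"
        by simp
    qed
  qed simp
qed

lemma Lp_norm_le:
  assumes "(\<integral>\<^sup>+x. ennreal (norm (f x) powr p) \<partial>lebesgue_on \<Omega>) \<le> ennreal (e powr p)"
    "f \<in> borel_measurable (lebesgue_on \<Omega>)" "e > 0" "p > 0"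
  shows "Lp_norm p \<Omega> f \<le> e"
proof -
  have [measurable]: "f \<in> borel_measurable (lebesgue_on \<Omega>)" by fact
  have "(\<integral>x. norm (f x) powr p \<partial>lebesgue_on \<Omega>) \<le> e powr p"
    using assms(1,3) by (subst integral_eq_nn_integral) (auto intro!: enn2real_leI)
  then have "Lp_norm p \<Omega> f \<le> (e powr p) powr (1 / p)"
    unfolding Lp_norm_def using assms by (intro powr_mono2) (auto intro!: integral_nonneg_AE)
  also have "\<dots> = e" using assms by (simp add: powr_powr)
  finally show ?thesis .
qed

lemma lmeasurable_bounded_open: "open \<Omega> \<Longrightarrow> bounded \<Omega> \<Longrightarrow> \<Omega> \<in> lmeasurable" for \<Omega> :: "'a::euclidean_space set"
  by (simp add: lmeasurable_open)

lemma integral_norm_le_of_powr: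
  fixes f :: "'a::euclidean_space \<Rightarrow> 'b::euclidean_space"
  assumes [measurable]: "f \<in> borel_measurable (lebesgue_on \<Omega>)" and O: "\<Omega> \<in> lmeasurable"
    and le: "(\<integral>\<^sup>+x. ennreal (norm (f x) powr p) \<partial>lebesgue_on \<Omega>) \<le> ennreal (e powr p)" and e: "e > 0" and p: "p \<ge> 1"
  shows "integrable (lebesgue_on \<Omega>) f" "(\<integral>x. norm (f x) \<partial>lebesgue_on \<Omega>) \<le> e * (measure lebesgue \<Omega> + 1)"
proof -
  interpret finite_measure "lebesgue_on \<Omega>" by (rule finite_measure_lebesgue_on[OF O])
  have i: "integrable (lebesgue_on \<Omega>) (\<lambda>x. norm (f x) powr p)"
    using le by (intro integrableI_nonneg) (auto intro: le_less_trans)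
  have ip: "(\<integral>x. norm (f x) powr p \<partial>lebesgue_on \<Omega>) \<le> e powr p"
    using le e by (subst integral_eq_nn_integral) (auto intro!: enn2real_leI)
  have b: "norm (f x) \<le> e + e powr (1 - p) * norm (f x) powr p" for x
    using le_powr_interpolate[OF _ e p] by simp
  have i2: "integrable (lebesgue_on \<Omega>) (\<lambda>x. e + e powr (1 - p) * norm (f x) powr p)"
    using i by auto
  show "integrable (lebesgue_on \<Omega>) f"
    by (rule Bochner_Integration.integrable_bound[OF i2]) (auto intro!: AE_I2 order_trans[OF b])
  then have "(\<integral>x. norm (f x) \<partial>lebesgue_on \<Omega>) \<le> (\<integral>x. e + e powr (1 - p) * norm (f x) powr p \<partial>lebesgue_on \<Omega>)"
    using b by (intro integral_mono i2) auto
  also have "\<dots> = e * measure lebesgue \<Omega> + e powr (1 - p) * (\<integral>x. norm (f x) powr p \<partial>lebesgue_on \<Omega>)"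
    using i O by (simp add: measure_restrict_space fmeasurableD)
  also have "\<dots> \<le> e * measure lebesgue \<Omega> + e powr (1 - p) * e powr p"
    using ip e by (intro add_mono mult_left_mono) auto
  also have "\<dots> = e * (measure lebesgue \<Omega> + 1)"
    using e by (simp add: algebra_simps flip: powr_add)
  finally show "(\<integral>x. norm (f x) \<partial>lebesgue_on \<Omega>) \<le> e * (measure lebesgue \<Omega> + 1)" .
qed

text \<open>Integration by parts passes from the test functions to the limit: on a bounded domain
  convergence in \<open>L^p\<close> implies convergence in \<open>L^1\<close>, and
  \<open>\<psi>\<close> and its partial derivatives are bounded.\<close>

lemma W1p0I:
  fixes u :: "real^'n \<Rightarrow> real^'N"
  assumes \<Omega>: "open \<Omega>" "bounded \<Omega>" and p: "p \<ge> 1"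
    and u[measurable]: "u \<in> borel_measurable (lebesgue_on \<Omega>)" and G[measurable]: "G \<in> borel_measurable (lebesgue_on \<Omega>)"
    and app: "\<And>e. e > 0 \<Longrightarrow> approx_W1p p \<Omega> u G e"
  shows "u \<in> W1p0 p \<Omega>" "weak_grad \<Omega> u G" "G \<in> Lp p \<Omega>"
proof -
  have O: "\<Omega> \<in> lmeasurable" "\<Omega> \<in> sets lebesgue"
    using lmeasurable_bounded_open[OF \<Omega>] by (auto simp: fmeasurableD)
  interpret finite_measure "lebesgue_on \<Omega>" by (rule finite_measure_lebesgue_on[OF O(1)])
  define e where "e m = inverse (real (Suc m))" for m
  have e: "e m > 0" for m by (simp add: e_def)
  have "\<forall>m. \<exists>\<phi>. \<phi> \<in> test_functions \<Omega> \<and>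
     (\<integral>\<^sup>+x. ennreal (norm (\<phi> x - u x) powr p) \<partial>lebesgue_on \<Omega>) \<le> ennreal (e m powr p) \<and>
     (\<integral>\<^sup>+x. ennreal (norm (grad \<phi> x - G x) powr p) \<partial>lebesgue_on \<Omega>) \<le> ennreal (e m powr p)"
    using app[OF e] unfolding approx_W1p_def by blast
  from choice[OF this] obtain \<phi> where \<phi>: "\<And>m. \<phi> m \<in> test_functions \<Omega>"
    "\<And>m. (\<integral>\<^sup>+x. ennreal (norm (\<phi> m x - u x) powr p) \<partial>lebesgue_on \<Omega>) \<le> ennreal (e m powr p)"
    "\<And>m. (\<integral>\<^sup>+x. ennreal (norm (grad (\<phi> m) x - G x) powr p) \<partial>lebesgue_on \<Omega>) \<le> ennreal (e m powr p)"
    by blast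
  have \<phi>m[measurable]: "\<phi> m \<in> borel_measurable (lebesgue_on \<Omega>)" "grad (\<phi> m) \<in> borel_measurable (lebesgue_on \<Omega>)" for m
    using test_functionD(2)[OF \<phi>(1)] continuous_on_grad[OF \<phi>(1)]
    by (auto intro!: measurable_restrict_space1 measurable_completion borel_measurable_continuous_onI)
  have \<phi>i: "integrable (lebesgue_on \<Omega>) (\<lambda>x. norm (\<phi> m x) powr p)"
     "integrable (lebesgue_on \<Omega>) (\<lambda>x. norm (grad (\<phi> m) x) powr p)"
     "integrable (lebesgue_on \<Omega>) (\<phi> m)" "integrable (lebesgue_on \<Omega>) (grad (\<phi> m))" for m
  proof -
    obtain M where M: "\<And>x. norm (\<phi> m x) \<le> M" "\<And>x. norm (grad (\<phi> m) x) \<le> M"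
      using test_function_bounds[OF \<phi>(1)] by metis
    show "integrable (lebesgue_on \<Omega>) (\<lambda>x. norm (\<phi> m x) powr p)" "integrable (lebesgue_on \<Omega>) (\<lambda>x. norm (grad (\<phi> m) x) powr p)"
      using p M by (auto intro!: integrable_const_bound[of _ "M powr p"] AE_I2 powr_mono2)
    show "integrable (lebesgue_on \<Omega>) (\<phi> m)" "integrable (lebesgue_on \<Omega>) (grad (\<phi> m))"
      using M by (auto intro!: integrable_const_bound[of _ "M"] AE_I2)
  qed
  have fin: "ennreal a < \<infinity>" for a by simp
  have up: "integrable (lebesgue_on \<Omega>) (\<lambda>x. norm (u x) powr p)"
    using p by (intro integrable_norm_powr_diff[OF \<phi>m(1) u _ \<phi>i(1) le_less_trans[OF \<phi>(2) fin]]) simp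
  have Gp: "integrable (lebesgue_on \<Omega>) (\<lambda>x. norm (G x) powr p)"
    using p by (intro integrable_norm_powr_diff[OF \<phi>m(2) G _ \<phi>i(2) le_less_trans[OF \<phi>(3) fin]]) simp
  show GL: "G \<in> Lp p \<Omega>" using Gp by (simp add: Lp_def)
  have uL: "u \<in> Lp p \<Omega>" using up by (simp add: Lp_def)
  have du: "integrable (lebesgue_on \<Omega>) (\<lambda>x. \<phi> m x - u x)"
    "(\<integral>x. norm (\<phi> m x - u x) \<partial>lebesgue_on \<Omega>) \<le> e m * (measure lebesgue \<Omega> + 1)" for m
    by (rule integral_norm_le_of_powr[OF _ O(1) \<phi>(2) e p]; measurable)+
  have dG: "integrable (lebesgue_on \<Omega>) (\<lambda>x. grad (\<phi> m) x - G x)"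
    "(\<integral>x. norm (grad (\<phi> m) x - G x) \<partial>lebesgue_on \<Omega>) \<le> e m * (measure lebesgue \<Omega> + 1)" for m
    by (rule integral_norm_le_of_powr[OF _ O(1) \<phi>(3) e p]; measurable)+
  have ui: "integrable (lebesgue_on \<Omega>) u"
    using Bochner_Integration.integrable_diff[OF \<phi>i(3)[of 0] du(1)[of 0]] by simp
  have Gi: "integrable (lebesgue_on \<Omega>) G"
    using Bochner_Integration.integrable_diff[OF \<phi>i(4)[of 0] dG(1)[of 0]] by simp
  have loc: "locally_integrable \<Omega> f" if "integrable (lebesgue_on \<Omega>) f" for f :: "real^'n \<Rightarrow> 'c::euclidean_space"
    unfolding locally_integrable_def
  proof (intro allI impI)
    fix K assume K: "compact K \<and> K \<subseteq> \<Omega>"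
    have "set_integrable lebesgue \<Omega> f"
      using that O(2) by (simp add: set_integrable_def integrable_restrict_space)
    then show "f absolutely_integrable_on K"
      using K by (intro set_integrable_subset[of lebesgue \<Omega> f K]) (auto simp: compact_imp_closed)
  qed
  show wg: "weak_grad \<Omega> u G"
    unfolding weak_grad_def
  proof (intro conjI allI impI loc ui Gi)
    fix \<psi> :: "real^'n \<Rightarrow> real" and i j
    assume \<psi>: "\<psi> \<in> test_functions \<Omega>"
    obtain M where M: "M \<ge> 0" "\<And>x. \<bar>\<psi> x\<bar> \<le> M" "\<And>x. \<bar>partial j \<psi> x\<bar> \<le> M"
      using partial_test_function_bound[OF \<psi>] by metis
    have [measurable]: "\<psi> \<in> borel_measurable (lebesgue_on \<Omega>)" "partial j \<psi> \<in> borel_measurable (lebesgue_on \<Omega>)"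
      using test_functionD(2)[OF \<psi>] test_functionD(3)[OF \<psi> axis_1_in_Basis[of j]]
      by (auto intro!: measurable_restrict_space1 measurable_completion borel_measurable_continuous_onI simp: partial_def[abs_def])
    have close: "integrable (lebesgue_on \<Omega>) (\<lambda>x. f x * w x)"
        "\<bar>(\<integral>x. (h x - f x) * w x \<partial>lebesgue_on \<Omega>)\<bar> \<le> M * d"
      if f: "integrable (lebesgue_on \<Omega>) f" and h: "integrable (lebesgue_on \<Omega>) (\<lambda>x. h x - f x)"
        and w[measurable]: "w \<in> borel_measurable (lebesgue_on \<Omega>)" and wM: "\<And>x. \<bar>w x\<bar> \<le> M"
        and d: "(\<integral>x. \<bar>h x - f x\<bar> \<partial>lebesgue_on \<Omega>) \<le> d" for f h w :: "real^'n \<Rightarrow> real" and d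
    proof -
      have *: "integrable (lebesgue_on \<Omega>) (\<lambda>x. g x * w x)" if g: "integrable (lebesgue_on \<Omega>) g" for g
        by (rule Bochner_Integration.integrable_bound[OF integrable_mult_left[OF g, of M]])
          (use g M wM in \<open>auto simp: abs_mult intro!: AE_I2 mult_left_mono\<close>)
      show "integrable (lebesgue_on \<Omega>) (\<lambda>x. f x * w x)" by (rule *[OF f])
      have "\<bar>(\<integral>x. (h x - f x) * w x \<partial>lebesgue_on \<Omega>)\<bar> \<le> (\<integral>x. \<bar>(h x - f x) * w x\<bar> \<partial>lebesgue_on \<Omega>)"
        by (rule integral_abs_bound)
      also have "\<dots> \<le> (\<integral>x. \<bar>h x - f x\<bar> * M \<partial>lebesgue_on \<Omega>)"
        using integrable_abs[OF *[OF h]] h wM by (intro integral_mono) (auto simp: abs_mult intro!: mult_left_mono)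
      also have "\<dots> \<le> M * d" using d M by (simp add: mult.commute mult_left_mono)
      finally show "\<bar>(\<integral>x. (h x - f x) * w x \<partial>lebesgue_on \<Omega>)\<bar> \<le> M * d" .
    qed
    have ci: "integrable (lebesgue_on \<Omega>) (\<lambda>x. f x $ i)" if "integrable (lebesgue_on \<Omega>) f" for f :: "real^'n \<Rightarrow> ('c::euclidean_space)^'N" and i
      by (rule integrable_bounded_linear[OF bounded_linear_vec_nth that])
    have cj: "integrable (lebesgue_on \<Omega>) (\<lambda>x. f x $ j)" if "integrable (lebesgue_on \<Omega>) f" for f :: "real^'n \<Rightarrow> real^'n" and j
      by (rule integrable_bounded_linear[OF bounded_linear_vec_nth that])
    let ?c = "measure lebesgue \<Omega> + 1"
    have 1: "\<bar>(\<integral>x. (\<phi> m x $ i - u x $ i) * partial j \<psi> x \<partial>lebesgue_on \<Omega>)\<bar> \<le> M * (e m * ?c)" for m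
    proof (rule close(2))
      show "integrable (lebesgue_on \<Omega>) (\<lambda>x. \<phi> m x $ i - u x $ i)" using ci[OF du(1)[of m], of i] by simp
      have "(\<integral>x. \<bar>\<phi> m x $ i - u x $ i\<bar> \<partial>lebesgue_on \<Omega>) \<le> (\<integral>x. norm (\<phi> m x - u x) \<partial>lebesgue_on \<Omega>)"
        using ci[OF du(1)[of m], of i] du(1)[of m]
        by (intro integral_mono) (auto intro: order_trans[OF _ component_le_norm_cart])
      also note du(2)[of m]
      finally show "(\<integral>x. \<bar>\<phi> m x $ i - u x $ i\<bar> \<partial>lebesgue_on \<Omega>) \<le> e m * ?c" .
    qed (use ci[OF ui] M in auto)
    have 2: "\<bar>(\<integral>x. (grad (\<phi> m) x $ i $ j - G x $ i $ j) * \<psi> x \<partial>lebesgue_on \<Omega>)\<bar> \<le> M * (e m * ?c)" for m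
    proof (rule close(2))
      show i: "integrable (lebesgue_on \<Omega>) (\<lambda>x. grad (\<phi> m) x $ i $ j - G x $ i $ j)"
        using cj[OF ci[OF dG(1)[of m], of i], of j] by simp
      have "(\<integral>x. \<bar>grad (\<phi> m) x $ i $ j - G x $ i $ j\<bar> \<partial>lebesgue_on \<Omega>) \<le> (\<integral>x. norm (grad (\<phi> m) x - G x) \<partial>lebesgue_on \<Omega>)"
      proof (intro integral_mono)
        fix x
        have "\<bar>(grad (\<phi> m) x - G x) $ i $ j\<bar> \<le> norm ((grad (\<phi> m) x - G x) $ i)" by (rule component_le_norm_cart)
        also have "\<dots> \<le> norm (grad (\<phi> m) x - G x)" by (rule Finite_Cartesian_Product.norm_nth_le)
        finally show "\<bar>grad (\<phi> m) x $ i $ j - G x $ i $ j\<bar> \<le> norm (grad (\<phi> m) x - G x)" by simp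
      qed (use i dG(1) in auto)
      also note dG(2)[of m]
      finally show "(\<integral>x. \<bar>grad (\<phi> m) x $ i $ j - G x $ i $ j\<bar> \<partial>lebesgue_on \<Omega>) \<le> e m * ?c" .
    qed (use cj[OF ci[OF Gi]] M in auto)
    have I: "integrable (lebesgue_on \<Omega>) (\<lambda>x. f x * w x)" if "integrable (lebesgue_on \<Omega>) f" "w \<in> borel_measurable (lebesgue_on \<Omega>)" "\<And>x. \<bar>w x\<bar> \<le> M" for f w :: "real^'n \<Rightarrow> real"
      using close(1)[OF that(1) _ that(2,3), of f 0] by simp
    have 3: "\<bar>(\<integral>x. u x $ i * partial j \<psi> x \<partial>lebesgue_on \<Omega>) + (\<integral>x. G x $ i $ j * \<psi> x \<partial>lebesgue_on \<Omega>)\<bar> \<le> 2 * (M * (e m * ?c))" for m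
    proof -
      have "(\<integral>x. (\<phi> m x $ i - u x $ i) * partial j \<psi> x \<partial>lebesgue_on \<Omega>)
          = (\<integral>x. \<phi> m x $ i * partial j \<psi> x \<partial>lebesgue_on \<Omega>) - (\<integral>x. u x $ i * partial j \<psi> x \<partial>lebesgue_on \<Omega>)"
        unfolding left_diff_distrib
        by (intro Bochner_Integration.integral_diff I ci ui \<phi>i M) measurable
      moreover have "(\<integral>x. (grad (\<phi> m) x $ i $ j - G x $ i $ j) * \<psi> x \<partial>lebesgue_on \<Omega>)
          = (\<integral>x. grad (\<phi> m) x $ i $ j * \<psi> x \<partial>lebesgue_on \<Omega>) - (\<integral>x. G x $ i $ j * \<psi> x \<partial>lebesgue_on \<Omega>)"
        unfolding left_diff_distrib
        by (intro Bochner_Integration.integral_diff I ci cj Gi \<phi>i M) measurable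
      ultimately show ?thesis
        using 1[of m] 2[of m] test_function_integration_by_parts[OF \<phi>(1)[of m] \<psi> O(2), of i j] by linarith
    qed
    have "(\<lambda>m. 2 * (M * (e m * ?c))) \<longlonglongrightarrow> 2 * (M * (0 * ?c))"
      unfolding e_def by (intro tendsto_intros LIMSEQ_inverse_real_of_nat)
    then have "\<bar>(\<integral>x. u x $ i * partial j \<psi> x \<partial>lebesgue_on \<Omega>) + (\<integral>x. G x $ i $ j * \<psi> x \<partial>lebesgue_on \<Omega>)\<bar> \<le> 2 * (M * (0 * ?c))"
      by (rule LIMSEQ_le_const) (use 3 in blast)
    then show "(\<integral>x. u x $ i * partial j \<psi> x \<partial>lebesgue_on \<Omega>) = - (\<integral>x. G x $ i $ j * \<psi> x \<partial>lebesgue_on \<Omega>)"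
      by linarith
  qed
  have lim: "X \<longlonglongrightarrow> 0" if "\<And>m. X m \<le> e m" "\<And>m. X m \<ge> 0" for X :: "nat \<Rightarrow> real"
    using LIMSEQ_inverse_real_of_nat that unfolding e_def[symmetric]
    by (intro tendsto_sandwich[of "\<lambda>_. 0" X sequentially e 0]) auto
  have nn: "Lp_norm p \<Omega> f \<ge> 0" for f :: "real^'n \<Rightarrow> 'c::euclidean_space" by (simp add: Lp_norm_def)
  have "(\<lambda>m. Lp_norm p \<Omega> (\<lambda>x. \<phi> m x - u x)) \<longlonglongrightarrow> 0" "(\<lambda>m. Lp_norm p \<Omega> (\<lambda>x. grad (\<phi> m) x - G x)) \<longlonglongrightarrow> 0"
    using p by (intro lim nn Lp_norm_le \<phi> e; simp)+
  then show "u \<in> W1p0 p \<Omega>"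
    unfolding W1p0_def using uL wg GL \<phi>(1) by blast
qed

subsection \<open>Approximation at a regularity scale\<close>

text \<open>Bisection (\<open>Bolzano\<close>) along the segment from \<open>x\<close> to
  \<open>y\<close>. Each local estimate only compares with its own centre, so it is applied to
  parameter intervals that contain the centre and are split there.\<close>

lemma lipschitz_from_pointwise:
  fixes f :: "'a::real_normed_vector \<Rightarrow> 'b::real_normed_vector"
  assumes "\<And>x. \<forall>\<^sub>F y in nhds x. norm (f y - f x) \<le> K * norm (y - x)"
  shows "norm (f y - f x) \<le> K * norm (y - x)"
proof -
  define c where "c t = x + t *\<^sub>R (y - x)" for t :: real
  have cd: "c s - c t = (s - t) *\<^sub>R (y - x)" for s t by (simp add: c_def algebra_simps)
  have "norm (f (c 1) - f (c 0)) \<le> K * norm (y - x) * (1 - 0)"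
  proof (rule Bolzano[of 0 1 "\<lambda>a b. norm (f (c b) - f (c a)) \<le> K * norm (y - x) * (b - a)"])
    fix a b d assume "norm (f (c b) - f (c a)) \<le> K * norm (y - x) * (b - a)"
      "norm (f (c d) - f (c b)) \<le> K * norm (y - x) * (d - b)"
    moreover have "norm (f (c d) - f (c a)) \<le> norm (f (c d) - f (c b)) + norm (f (c b) - f (c a))"
      using norm_triangle_ineq[of "f (c d) - f (c b)" "f (c b) - f (c a)"] by simp
    ultimately show "norm (f (c d) - f (c a)) \<le> K * norm (y - x) * (d - a)" by (simp add: algebra_simps)
  next
    fix t :: real
    have "isCont c t" unfolding c_def by (intro continuous_intros)
    then have "filterlim c (nhds (c t)) (nhds t)" by (simp add: isCont_def tendsto_nhds_iff)
    from filterlim_iff[THEN iffD1, OF this, rule_format, OF assms]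
    have "\<forall>\<^sub>F s in nhds t. norm (f (c s) - f (c t)) \<le> K * norm (c s - c t)" .
    then obtain d where d: "d > 0" "\<And>s. dist s t < d \<Longrightarrow> norm (f (c s) - f (c t)) \<le> K * norm (c s - c t)"
      unfolding eventually_nhds_metric by blast
    have "norm (f (c b) - f (c a)) \<le> K * norm (y - x) * (b - a)" if "a \<le> t" "t \<le> b" "b - a < d" for a b
    proof -
      have "norm (f (c b) - f (c t)) \<le> K * norm (c b - c t)" "norm (f (c a) - f (c t)) \<le> K * norm (c a - c t)"
        using that by (auto intro!: d(2) simp: dist_real_def)
      moreover have "norm (f (c b) - f (c a)) \<le> norm (f (c b) - f (c t)) + norm (f (c a) - f (c t))"
        using norm_triangle_ineq4[of "f (c b) - f (c t)" "f (c a) - f (c t)"] by simp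
      moreover have "norm (c b - c t) = (b - t) * norm (y - x)" "norm (c a - c t) = (t - a) * norm (y - x)"
        using that unfolding cd by auto
      ultimately have "norm (f (c b) - f (c a)) \<le> K * ((b - t) * norm (y - x)) + K * ((t - a) * norm (y - x))"
        by simp
      then show ?thesis by (simp add: algebra_simps)
    qed
    then show "\<exists>d>0. \<forall>a b. a \<le> t \<and> t \<le> b \<and> b - a < d \<longrightarrow> norm (f (c b) - f (c a)) \<le> K * norm (y - x) * (b - a)"
      using d(1) by blast
  qed simp
  then show ?thesis by (simp add: c_def)
qed

lemma norm_frechet_le_pointwise_lipschitz:
  fixes u :: "'a::euclidean_space \<Rightarrow> 'b::real_normed_vector"
  assumes d: "u differentiable (at x)" and l: "\<forall>\<^sub>F y in nhds x. norm (u y - u x) \<le> K * norm (y - x)"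
  shows "norm (frechet_derivative u (at x) v) \<le> K * norm v"
proof -
  have lim: "(\<lambda>m. real (Suc m) *\<^sub>R (u (x + (1 / real (Suc m)) *\<^sub>R v) - u x)) \<longlonglongrightarrow> frechet_derivative u (at x) v"
    by (rule has_derivative_imp_LIMSEQ[OF d])
  have "(\<lambda>m. x + (inverse (real (Suc m))) *\<^sub>R v) \<longlonglongrightarrow> x + 0 *\<^sub>R v"
    by (intro tendsto_intros LIMSEQ_inverse_real_of_nat)
  then have "filterlim (\<lambda>m. x + (1 / real (Suc m)) *\<^sub>R v) (nhds x) sequentially"
    by (simp add: inverse_eq_divide)
  from filterlim_iff[THEN iffD1, OF this, rule_format, OF l]
  have "\<forall>\<^sub>F m in sequentially. norm (real (Suc m) *\<^sub>R (u (x + (1 / real (Suc m)) *\<^sub>R v) - u x)) \<le> K * norm v"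
  proof eventually_elim
    case (elim m)
    then have "real (Suc m) * norm (u (x + (1 / real (Suc m)) *\<^sub>R v) - u x) \<le> real (Suc m) * (K * (norm v / real (Suc m)))"
      by (intro mult_left_mono) auto
    then show ?case by simp
  qed
  then show ?thesis
    by (intro tendsto_upperbound[OF tendsto_norm[OF lim]]) auto
qed

lemma norm_matrix_le:
  fixes A :: "real^'n^'m"
  assumes "\<And>i j. \<bar>A $ i $ j\<bar> \<le> K"
  shows "norm A \<le> real CARD('m) * (real CARD('n) * K)"
proof -
  have "norm A \<le> (\<Sum>i\<in>UNIV. norm (A $ i))" by (simp add: norm_vec_def L2_set_le_sum)
  also have "\<dots> \<le> (\<Sum>i\<in>(UNIV::'m set). real CARD('n) * K)"
  proof (rule sum_mono)
    fix i
    have "norm (A $ i) \<le> (\<Sum>j\<in>UNIV. \<bar>A $ i $ j\<bar>)" by (rule norm_le_l1_cart)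
    also have "\<dots> \<le> (\<Sum>j\<in>(UNIV::'n set). K)" by (intro sum_mono assms)
    finally show "norm (A $ i) \<le> real CARD('n) * K" by simp
  qed
  finally show ?thesis by simp
qed

lemma norm_grad_le:
  fixes u :: "real^'n \<Rightarrow> real^'N"
  assumes "\<And>j. norm (frechet_derivative u (at x) (axis j 1)) \<le> K"
  shows "norm (grad u x) \<le> real CARD('N) * (real CARD('n) * K)"
  by (rule norm_matrix_le) (auto simp: grad_component intro: order_trans[OF component_le_norm_cart assms])

lemma nn_integral_powr_tendsto_0:
  fixes f :: "nat \<Rightarrow> 'a \<Rightarrow> 'b::euclidean_space" and W :: "'a \<Rightarrow> real"
  assumes [measurable]: "\<And>m. f m \<in> borel_measurable M" "W \<in> borel_measurable M"
    and W: "(\<integral>\<^sup>+x. ennreal (W x powr p) \<partial>M) < \<infinity>" and p: "p > 0"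
    and bound: "\<And>m. AE x in M. norm (f m x) \<le> W x" and lim: "AE x in M. (\<lambda>m. f m x) \<longlonglongrightarrow> 0"
  shows "(\<lambda>m. \<integral>\<^sup>+x. ennreal (norm (f m x) powr p) \<partial>M) \<longlonglongrightarrow> 0"
proof -
  have "(\<lambda>m. \<integral>\<^sup>+x. ennreal (norm (f m x) powr p) \<partial>M) \<longlonglongrightarrow> (\<integral>\<^sup>+x. 0 \<partial>M)"
  proof (rule nn_integral_dominated_convergence[OF _ _ _ _ W])
    show "AE x in M. ennreal (norm (f m x) powr p) \<le> ennreal (W x powr p)" for m
      using bound[of m] by eventually_elim (use p in \<open>auto intro!: ennreal_leI powr_mono2\<close>)
    show "AE x in M. (\<lambda>m. ennreal (norm (f m x) powr p)) \<longlonglongrightarrow> 0"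
      using lim
    proof eventually_elim
      case (elim x)
      have "(\<lambda>m. norm (f m x) powr p) \<longlonglongrightarrow> 0"
        by (rule tendsto_zero_powrI[OF tendsto_norm_zero[OF elim] tendsto_const _ p]) simp
      then have "(\<lambda>m. ennreal (norm (f m x) powr p)) \<longlonglongrightarrow> ennreal 0" by (rule tendsto_ennrealI)
      then show ?case by simp
    qed
  qed measurable
  then show ?thesis by simp
qed

lemma approx_W1p_lipschitz:
  fixes u :: "real^'n \<Rightarrow> real^'N"
  assumes \<Omega>: "open \<Omega>" "bounded \<Omega>" and p: "p \<ge> 1"
    and lip: "\<And>x y. norm (u x - u y) \<le> K * norm (x - y)"
    and S: "compact S" "\<And>x. u x \<noteq> 0 \<Longrightarrow> x \<in> S" "S \<subseteq> \<Omega>" and d: "ae_diff UNIV u" and e: "e > 0"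
  shows "approx_W1p p \<Omega> u (grad u) e"
proof -
  obtain \<phi> M where \<phi>: "\<And>m. \<phi> m \<in> test_functions \<Omega>" "\<And>m x. norm (\<phi> m x - u x) \<le> M * inverse (real (Suc m))"
    "\<And>m x b. b \<in> Basis \<Longrightarrow> norm (frechet_derivative (\<phi> m) (at x) b) \<le> M"
    "\<And>x b. u differentiable (at x) \<Longrightarrow> b \<in> Basis \<Longrightarrow>
       (\<lambda>m. frechet_derivative (\<phi> m) (at x) b) \<longlonglongrightarrow> frechet_derivative u (at x) b"
    using mollify[OF lip S(1) _ \<Omega>(1) S(3)] S(2) by blast
  have O: "\<Omega> \<in> lmeasurable" "\<Omega> \<in> sets lebesgue"
    using lmeasurable_bounded_open[OF \<Omega>] by (auto simp: fmeasurableD)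
  interpret finite_measure "lebesgue_on \<Omega>" by (rule finite_measure_lebesgue_on[OF O(1)])
  have \<phi>m[measurable]: "\<phi> m \<in> borel_measurable (lebesgue_on \<Omega>)" "grad (\<phi> m) \<in> borel_measurable (lebesgue_on \<Omega>)" for m
    using test_functionD(2)[OF \<phi>(1)] continuous_on_grad[OF \<phi>(1)]
    by (auto intro!: measurable_restrict_space1 measurable_completion borel_measurable_continuous_onI)
  have "continuous_on UNIV u"
    by (intro lipschitz_on_continuous_on[of "\<bar>K\<bar>"] lipschitz_onI)
      (auto simp: dist_norm intro: order_trans[OF lip mult_right_mono])
  then have ub: "u \<in> borel_measurable borel" by (rule borel_measurable_continuous_onI)
  then have [measurable]: "u \<in> borel_measurable (lebesgue_on \<Omega>)"
    by (auto intro!: measurable_restrict_space1 measurable_completion)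
  have [measurable]: "grad u \<in> borel_measurable (lebesgue_on \<Omega>)"
    using d by (intro grad_measurable[OF ub _ O(2)] ae_diff_mono[OF d]) auto
  have fin: "(\<integral>\<^sup>+x. ennreal (c powr p) \<partial>lebesgue_on \<Omega>) < \<infinity>" for c :: real
  proof -
    have "emeasure (lebesgue_on \<Omega>) \<Omega> < top" using emeasure_finite[of \<Omega>] unfolding infinity_ennreal_def less_top .
    then show ?thesis by (simp add: ennreal_mult_less_top)
  qed
  have M: "M \<ge> 0" using order_trans[OF norm_ge_zero \<phi>(3)[OF axis_1_in_Basis]] .
  have AEd: "AE x in lebesgue_on \<Omega>. u differentiable (at x)"
  proof -
    have "{x \<in> UNIV. \<not> u differentiable (at x)} \<in> null_sets lebesgue"
      using d unfolding ae_diff_def negligible_iff_null_sets .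
    then have "AE x in lebesgue. x \<in> \<Omega> \<longrightarrow> u differentiable (at x)"
      by (rule AE_not_in[THEN eventually_mono]) simp
    then show ?thesis using O(2) by (subst AE_restrict_space_iff) auto
  qed
  let ?c = "real CARD('N) * (real CARD('n) * M)"
  have "(\<lambda>m. \<integral>\<^sup>+x. ennreal (norm (\<phi> m x - u x) powr p) \<partial>lebesgue_on \<Omega>) \<longlonglongrightarrow> 0"
  proof (rule nn_integral_powr_tendsto_0[OF _ _ fin[of M]])
    show "AE x in lebesgue_on \<Omega>. norm (\<phi> m x - u x) \<le> M" for m
    proof (rule AE_I2)
      fix x
      have "M * inverse (real (Suc m)) \<le> M * 1" using M by (intro mult_left_mono) (auto simp: inverse_le_1_iff)
      then show "norm (\<phi> m x - u x) \<le> M" using \<phi>(2)[of m x] by simp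
    qed
    show "AE x in lebesgue_on \<Omega>. (\<lambda>m. \<phi> m x - u x) \<longlonglongrightarrow> 0"
    proof (rule AE_I2)
      fix x
      have "(\<lambda>m. M * inverse (real (Suc m))) \<longlonglongrightarrow> M * 0" by (intro tendsto_intros LIMSEQ_inverse_real_of_nat)
      then have "(\<lambda>m. M * inverse (real (Suc m))) \<longlonglongrightarrow> 0" by simp
      then show "(\<lambda>m. \<phi> m x - u x) \<longlonglongrightarrow> 0" by (rule Lim_null_comparison[rotated]) (use \<phi>(2) in auto)
    qed
  qed (use p in auto)
  moreover have "(\<lambda>m. \<integral>\<^sup>+x. ennreal (norm (grad (\<phi> m) x - grad u x) powr p) \<partial>lebesgue_on \<Omega>) \<longlonglongrightarrow> 0"
  proof (rule nn_integral_powr_tendsto_0[OF _ _ fin[of "?c + ?c"]])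
    have conv: "(\<lambda>m. grad (\<phi> m) x) \<longlonglongrightarrow> grad u x" if "u differentiable (at x)" for x
    proof (intro vec_tendstoI)
      fix i j
      show "(\<lambda>m. grad (\<phi> m) x $ i $ j) \<longlonglongrightarrow> grad u x $ i $ j"
        unfolding grad_component by (intro tendsto_vec_nth \<phi>(4) that axis_1_in_Basis)
    qed
    have b: "norm (grad (\<phi> m) x) \<le> ?c" for m x
      by (intro norm_grad_le \<phi>(3) axis_1_in_Basis)
    show "AE x in lebesgue_on \<Omega>. norm (grad (\<phi> m) x - grad u x) \<le> ?c + ?c" for m
      using AEd
    proof eventually_elim
      case (elim x)
      have "norm (grad u x) \<le> ?c"
        by (rule tendsto_upperbound[OF tendsto_norm[OF conv[OF elim]]]) (use b in auto)
      with b[of m x] show ?case using norm_triangle_ineq4[of "grad (\<phi> m) x" "grad u x"] by linarith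
    qed
    show "AE x in lebesgue_on \<Omega>. (\<lambda>m. grad (\<phi> m) x - grad u x) \<longlonglongrightarrow> 0"
      using AEd by eventually_elim (rule LIM_zero[OF conv])
  qed (use p in auto)
  moreover have "ennreal (e powr p) > 0" using e by simp
  ultimately have "\<forall>\<^sub>F m in sequentially. (\<integral>\<^sup>+x. ennreal (norm (\<phi> m x - u x) powr p) \<partial>lebesgue_on \<Omega>) < ennreal (e powr p) \<and>
     (\<integral>\<^sup>+x. ennreal (norm (grad (\<phi> m) x - grad u x) powr p) \<partial>lebesgue_on \<Omega>) < ennreal (e powr p)"
    by (intro eventually_conj order_tendstoD(2))
  then obtain m where "(\<integral>\<^sup>+x. ennreal (norm (\<phi> m x - u x) powr p) \<partial>lebesgue_on \<Omega>) < ennreal (e powr p)"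
     "(\<integral>\<^sup>+x. ennreal (norm (grad (\<phi> m) x - grad u x) powr p) \<partial>lebesgue_on \<Omega>) < ennreal (e powr p)"
    using eventually_happens[of _ sequentially] by fastforce
  then show ?thesis unfolding approx_W1p_def using \<phi>(1)[of m] by (intro bexI[of _ "\<phi> m"]) auto
qed

text \<open>The quarter pays for the factor of \<open>powr_add_le\<close> and for the two summands:
  \<open>2 powr p * (2 * (e/4) powr p) = 2 * (e/2) powr p\<close>, which is at most
  \<open>e powr p\<close> since \<open>p \<ge> 1\<close>.\<close>

lemma nn_integral_powr_triangle:
  fixes f g k :: "'a \<Rightarrow> 'b::euclidean_space" and h :: "'a \<Rightarrow> real"
  assumes [measurable]: "f \<in> borel_measurable M" "g \<in> borel_measurable M" "h \<in> borel_measurable M"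
    and h: "AE x in M. norm (g x - k x) \<le> h x" and p: "p \<ge> 1" and e: "e > 0"
    and 1: "(\<integral>\<^sup>+x. ennreal (norm (f x - g x) powr p) \<partial>M) \<le> ennreal ((e/4) powr p)"
    and 2: "(\<integral>\<^sup>+x. ennreal (norm (h x) powr p) \<partial>M) \<le> ennreal ((e/4) powr p)"
  shows "(\<integral>\<^sup>+x. ennreal (norm (f x - k x) powr p) \<partial>M) \<le> ennreal (e powr p)"
proof -
  have "(\<integral>\<^sup>+x. ennreal (norm (f x - k x) powr p) \<partial>M)
     \<le> (\<integral>\<^sup>+x. ennreal (2 powr p) * (ennreal (norm (f x - g x) powr p) + ennreal (norm (h x) powr p)) \<partial>M)"
  proof (rule nn_integral_mono_AE)
    show "AE x in M. ennreal (norm (f x - k x) powr p)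
       \<le> ennreal (2 powr p) * (ennreal (norm (f x - g x) powr p) + ennreal (norm (h x) powr p))"
      using h
    proof eventually_elim
      case (elim x)
      have "norm (f x - k x) \<le> norm (f x - g x) + norm (h x)"
        using norm_triangle_ineq[of "f x - g x" "g x - k x"] elim by simp
      then have "norm (f x - k x) powr p \<le> (norm (f x - g x) + norm (h x)) powr p"
        using p by (intro powr_mono2) auto
      also have "\<dots> \<le> 2 powr p * (norm (f x - g x) powr p + norm (h x) powr p)"
        using p by (intro powr_add_le) auto
      finally have "ennreal (norm (f x - k x) powr p) \<le> ennreal (2 powr p * (norm (f x - g x) powr p + norm (h x) powr p))"
        by (rule ennreal_leI)
      then show ?case by (simp add: ennreal_mult)
    qed
  qed
  also have "\<dots> = ennreal (2 powr p) * ((\<integral>\<^sup>+x. ennreal (norm (f x - g x) powr p) \<partial>M) + (\<integral>\<^sup>+x. ennreal (norm (h x) powr p) \<partial>M))"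
    by (subst nn_integral_cmult) (auto simp: nn_integral_add)
  also have "\<dots> \<le> ennreal (2 powr p) * (ennreal ((e/4) powr p) + ennreal ((e/4) powr p))"
    by (intro mult_left_mono add_mono 1 2) auto
  also have "\<dots> = ennreal (2 powr p * ((e/4) powr p + (e/4) powr p))"
    by (subst ennreal_plus[symmetric]) (auto simp: ennreal_mult simp del: ennreal_plus)
  also have "\<dots> \<le> ennreal (e powr p)"
  proof (rule ennreal_leI)
    have "2 powr p * ((e/4) powr p + (e/4) powr p) = 2 * (2 * (e / 4)) powr p"
      using e by (subst powr_mult) auto
    also have "\<dots> = 2 * (e powr p / 2 powr p)" using e by (simp add: powr_divide)
    also have "\<dots> \<le> 2 * (e powr p / 2 powr 1)" using p by (intro mult_left_mono divide_left_mono powr_mono) auto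
    finally show "2 powr p * ((e/4) powr p + (e/4) powr p) \<le> e powr p" by simp
  qed
  finally show ?thesis .
qed

lemma pointwise_lipschitz_imp_continuous:
  fixes f :: "'a::real_normed_vector \<Rightarrow> 'b::real_normed_vector"
  assumes "\<And>x. \<forall>\<^sub>F y in nhds x. norm (f y - f x) \<le> K * norm (y - x)"
  shows "continuous_on UNIV f"
  by (intro lipschitz_on_continuous_on[of "\<bar>K\<bar>"] lipschitz_onI)
    (auto simp: dist_norm intro: order_trans[OF lipschitz_from_pointwise[OF assms] mult_right_mono])

text \<open>\<open>\<sigma>\<close> measures the distance to the singular set and to the boundary; multiplying \<open>u\<close> with a
  cutoff function of \<open>\<sigma> / \<epsilon>\<close> costs a gradient of order \<open>\<bar>u\<bar> / \<epsilon> \<le> R\<close> on \<open>{\<sigma> \<le> \<epsilon>}\<close>.\<close>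
lemma approx_W1p_regularity_scale:
  fixes u :: "real^'n \<Rightarrow> real^'N" and \<sigma> R :: "real^'n \<Rightarrow> real"
  assumes \<Omega>: "open \<Omega>" "bounded \<Omega>" and p: "p \<ge> 1" and e: "e > 0"
    and \<sigma>0: "\<And>x. \<sigma> x \<ge> 0" "{x. \<sigma> x > 0} \<subseteq> \<Omega>"
    and \<sigma>lip: "\<And>x. \<forall>\<^sub>F y in nhds x. \<bar>\<sigma> y - \<sigma> x\<bar> \<le> C * norm (y - x)"
    and R0: "\<And>x. \<sigma> x > 0 \<Longrightarrow> R x \<ge> 0" and RB: "\<And>x. \<sigma> x > 0 \<Longrightarrow> R x * \<sigma> x \<le> B"
    and uR: "\<And>x. \<sigma> x > 0 \<Longrightarrow> norm (u x) \<le> R x * \<sigma> x"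
    and ulip: "\<And>x. \<sigma> x > 0 \<Longrightarrow> \<forall>\<^sub>F y in nhds x. norm (u y - u x) \<le> R x * norm (y - x)"
    and dif: "ae_diff {x. \<sigma> x > 0} u" "ae_diff {x. \<sigma> x > 0} \<sigma>"
    and triv: "negligible {x \<in> \<Omega>. \<sigma> x = 0 \<and> \<not> (\<forall>\<^sub>F y in nhds x. u y = 0)}"
    and Rm: "R \<in> borel_measurable (lebesgue_on \<Omega>)"
    and Rint: "(\<integral>\<^sup>+x. ennreal ((indicator {x. \<sigma> x > 0} x * R x) powr p) \<partial>lebesgue_on \<Omega>) < \<infinity>"
  shows "approx_W1p p \<Omega> u (grad u) e"
proof -
  have O: "\<Omega> \<in> lmeasurable" "\<Omega> \<in> sets lebesgue"
    using lmeasurable_bounded_open[OF \<Omega>] by (auto simp: fmeasurableD)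
  have \<sigma>c: "continuous_on UNIV \<sigma>"
    using \<sigma>lip by (intro pointwise_lipschitz_imp_continuous[of \<sigma> C]) simp
  have \<sigma>lt: "\<forall>\<^sub>F y in nhds x. \<sigma> y < a" if "\<sigma> x < a" for x a
    using eventually_nhds_in_open[of "{y. \<sigma> y < a}" x] that \<sigma>c by (auto simp: open_Collect_less)
  have \<sigma>gt: "\<forall>\<^sub>F y in nhds x. \<sigma> y > a" if "\<sigma> x > a" for x a
    using eventually_nhds_in_open[of "{y. \<sigma> y > a}" x] that \<sigma>c by (auto simp: open_Collect_less)
  have C: "C \<ge> 0"
  proof -
    have "\<bar>\<sigma> (axis undefined 1) - \<sigma> 0\<bar> \<le> C * norm (axis undefined (1::real) - 0 :: real^'n)"
      using lipschitz_from_pointwise[of \<sigma> C "axis undefined 1" 0] \<sigma>lip by simp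
    then show ?thesis using abs_ge_zero order_trans by fastforce
  qed
  have [measurable]: "R \<in> borel_measurable (lebesgue_on \<Omega>)" "\<sigma> \<in> borel_measurable (lebesgue_on \<Omega>)"
    using Rm \<sigma>c by (auto intro!: measurable_restrict_space1 measurable_completion borel_measurable_continuous_onI)
  \<comment> \<open>The difference between \<open>u\<close> and its cut-off version will have
    pointwise Lipschitz constant \<open>(1 + 2 * C) * R x\<close>; the cardinalities convert this
    into a bound for the matrix norm as in \<open>norm_grad_le\<close>. The extra 1 gives
    \<open>c0 \<ge> 1\<close>, so that \<open>c0 * R x\<close> also bounds the difference of the
    values.\<close>
  define c0 where "c0 = real CARD('N) * (real CARD('n) * (1 + 2 * C)) + 1"
  have c0: "c0 \<ge> 1" using C by (simp add: c0_def)
  define \<epsilon> where "\<epsilon> m = inverse (real (Suc m))" for m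
  have \<epsilon>: "\<epsilon> m > 0" "\<epsilon> m \<le> 1" for m by (auto simp: \<epsilon>_def inverse_le_1_iff)
  define h where "h m x = (if 0 < \<sigma> x \<and> \<sigma> x \<le> \<epsilon> m then c0 * R x else 0)" for m x
  have [measurable]: "h m \<in> borel_measurable (lebesgue_on \<Omega>)" for m unfolding h_def by measurable
  have "(\<lambda>m. \<integral>\<^sup>+x. ennreal (norm (h m x) powr p) \<partial>lebesgue_on \<Omega>) \<longlonglongrightarrow> 0"
  proof (rule nn_integral_powr_tendsto_0[where W="\<lambda>x. c0 * (indicator {x. \<sigma> x > 0} x * R x)"])
    have "(\<integral>\<^sup>+x. ennreal ((c0 * (indicator {x. \<sigma> x > 0} x * R x)) powr p) \<partial>lebesgue_on \<Omega>)
        = (\<integral>\<^sup>+x. ennreal (c0 powr p) * ennreal ((indicator {x. \<sigma> x > 0} x * R x) powr p) \<partial>lebesgue_on \<Omega>)"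
    proof (rule nn_integral_cong)
      fix x
      have "indicator {x. \<sigma> x > 0} x * R x \<ge> 0" using R0[of x] by (auto simp: indicator_def)
      then show "ennreal ((c0 * (indicator {x. \<sigma> x > 0} x * R x)) powr p)
        = ennreal (c0 powr p) * ennreal ((indicator {x. \<sigma> x > 0} x * R x) powr p)"
        using c0 by (simp add: powr_mult ennreal_mult)
    qed
    also have "\<dots> = ennreal (c0 powr p) * (\<integral>\<^sup>+x. ennreal ((indicator {x. \<sigma> x > 0} x * R x) powr p) \<partial>lebesgue_on \<Omega>)"
      by (rule nn_integral_cmult) measurable
    also have "\<dots> < \<infinity>" using Rint by (simp add: ennreal_mult_less_top)
    finally show "(\<integral>\<^sup>+x. ennreal ((c0 * (indicator {x. \<sigma> x > 0} x * R x)) powr p) \<partial>lebesgue_on \<Omega>) < \<infinity>" .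
    show "AE x in lebesgue_on \<Omega>. norm (h m x) \<le> c0 * (indicator {x. \<sigma> x > 0} x * R x)" for m
      using R0 c0 by (intro AE_I2) (auto simp: h_def indicator_def)
    show "AE x in lebesgue_on \<Omega>. (\<lambda>m. h m x) \<longlonglongrightarrow> 0"
    proof (rule AE_I2)
      fix x
      have "\<forall>\<^sub>F m in sequentially. h m x = 0"
      proof (cases "\<sigma> x > 0")
        case True
        have "\<forall>\<^sub>F m in sequentially. \<epsilon> m < \<sigma> x"
          using order_tendstoD(2)[OF LIMSEQ_inverse_real_of_nat True] by (simp add: \<epsilon>_def)
        then show ?thesis by (rule eventually_mono) (auto simp: h_def)
      qed (simp add: h_def)
      then show "(\<lambda>m. h m x) \<longlonglongrightarrow> 0" by (rule tendsto_eventually)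
    qed
  qed (use p in auto)
  moreover have "ennreal ((e/4) powr p) > 0" using e by simp
  ultimately have "\<forall>\<^sub>F m in sequentially. (\<integral>\<^sup>+x. ennreal (norm (h m x) powr p) \<partial>lebesgue_on \<Omega>) < ennreal ((e/4) powr p)"
    by (rule order_tendstoD(2))
  \<comment> \<open>This fixes the cutoff height: up to a null set, cutting off changes
    \<open>u\<close> only where \<open>0 < \<sigma> x \<le> \<epsilon> m\<close>, and there the
    integral of the majorant is small.\<close>
  then obtain m where m: "(\<integral>\<^sup>+x. ennreal (norm (h m x) powr p) \<partial>lebesgue_on \<Omega>) < ennreal ((e/4) powr p)"
    using eventually_happens[of _ sequentially] by fastforce
  let ?e = "\<epsilon> m"
  define \<eta> where "\<eta> x = max 0 (min 1 (2 * \<sigma> x / ?e - 1))" for x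
  have \<eta>01: "0 \<le> \<eta> x" "\<eta> x \<le> 1" for x by (auto simp: \<eta>_def)
  have \<eta>0: "\<eta> x = 0" if "\<sigma> x \<le> ?e / 2" for x using that \<epsilon>(1)[of m] by (simp add: \<eta>_def field_simps)
  have \<eta>1: "\<eta> x = 1" if "\<sigma> x \<ge> ?e" for x using that \<epsilon>(1)[of m] by (simp add: \<eta>_def field_simps)
  have \<eta>d: "\<bar>\<eta> y - \<eta> x\<bar> \<le> 2 / ?e * \<bar>\<sigma> y - \<sigma> x\<bar>" for x y
  proof -
    have "\<bar>\<eta> y - \<eta> x\<bar> \<le> \<bar>2 * \<sigma> y / ?e - 2 * \<sigma> x / ?e\<bar>" unfolding \<eta>_def by (auto simp: max_def min_def)
    also have "2 * \<sigma> y / ?e - 2 * \<sigma> x / ?e = 2 / ?e * (\<sigma> y - \<sigma> x)" by (simp add: right_diff_distrib)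
    also have "\<bar>2 / ?e * (\<sigma> y - \<sigma> x)\<bar> = 2 / ?e * \<bar>\<sigma> y - \<sigma> x\<bar>" using \<epsilon>(1)[of m] by (simp only: abs_mult) simp
    finally show ?thesis .
  qed
  have \<eta>lip: "\<forall>\<^sub>F y in nhds x. \<bar>\<eta> y - \<eta> x\<bar> \<le> 2 / ?e * (C * norm (y - x))" for x
    using \<sigma>lip[of x]
    by eventually_elim (rule order_trans[OF \<eta>d mult_left_mono], use \<epsilon>(1)[of m] in auto)
  define v where "v x = \<eta> x *\<^sub>R u x" for x
  \<comment> \<open>On \<open>\<sigma> x \<ge> ?e / 2\<close> the bound
    \<open>R x * \<sigma> x \<le> B\<close> controls \<open>R x\<close> by a multiple of
    \<open>B / ?e\<close>; the other summand is the slope of \<open>\<eta>\<close> times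
    \<open>norm (u x) \<le> B\<close>. The maximum with 0 serves the region where \<open>v\<close>
    vanishes.\<close>
  define K where "K = max (4 * B / ?e + 2 / ?e * C * B) 0"
  have vlip: "\<forall>\<^sub>F y in nhds x. norm (v y - v x) \<le> K * norm (y - x)" for x
  proof (cases "\<sigma> x < ?e / 2")
    case True
    show ?thesis
      using \<sigma>lt[OF True]
    proof eventually_elim
      case (elim y)
      then have "v y = 0" "v x = 0" using True by (auto simp: v_def \<eta>0)
      then show ?case by (simp add: K_def)
    qed
  next
    case False
    then have pos: "\<sigma> x > 0" using \<epsilon>(1)[of m] by linarith
    have Rle: "R x \<le> 4 * B / ?e"
    proof -
      have "R x * (?e / 2) \<le> B" using mult_left_mono[OF _ R0[OF pos], of "?e/2" "\<sigma> x"] False RB[OF pos] by linarith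
      moreover have "B \<ge> 0" using RB[OF pos] R0[OF pos] pos mult_nonneg_nonneg[of "R x" "\<sigma> x"] by linarith
      ultimately have "R x \<le> 2 * B / ?e" using \<epsilon>(1)[of m] by (simp add: field_simps)
      also have "\<dots> \<le> 4 * B / ?e" using \<epsilon>(1)[of m] \<open>B \<ge> 0\<close> by (intro divide_right_mono) auto
      finally show ?thesis .
    qed
    show ?thesis
      using ulip[OF pos] \<eta>lip[of x]
    proof eventually_elim
      case (elim y)
      have "v y - v x = \<eta> y *\<^sub>R (u y - u x) + (\<eta> y - \<eta> x) *\<^sub>R u x" by (simp add: v_def algebra_simps)
      then have "norm (v y - v x) \<le> \<eta> y * norm (u y - u x) + \<bar>\<eta> y - \<eta> x\<bar> * norm (u x)"
        using norm_triangle_ineq[of "\<eta> y *\<^sub>R (u y - u x)" "(\<eta> y - \<eta> x) *\<^sub>R u x"] \<eta>01[of y] by simp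
      also have "\<dots> \<le> 1 * (R x * norm (y - x)) + (2 / ?e * (C * norm (y - x))) * B"
        using elim \<eta>01[of y] uR[OF pos] RB[OF pos] \<epsilon>(1)[of m] C by (intro add_mono mult_mono) auto
      also have "\<dots> = (R x + 2 / ?e * C * B) * norm (y - x)" by (simp add: algebra_simps)
      also have "\<dots> \<le> K * norm (y - x)" using Rle by (intro mult_right_mono) (auto simp: K_def)
      finally show ?case .
    qed
  qed
  let ?S = "{x. \<sigma> x \<ge> ?e / 2}"
  have SO: "?S \<subseteq> \<Omega>" using \<sigma>0(2) \<epsilon>(1)[of m] by force
  have S: "compact ?S"
  proof -
    have "closed ?S" by (intro closed_Collect_le continuous_on_const \<sigma>c)
    then show ?thesis using bounded_subset[OF \<Omega>(2) SO] by (simp only: compact_eq_bounded_closed)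
  qed
  have dv0: "v differentiable (at x)" if "\<sigma> x < ?e / 2" for x
  proof (rule differentiable_transform_eventually[of "\<lambda>_. 0"])
    show "\<forall>\<^sub>F y in nhds x. 0 = v y" using \<sigma>lt[OF that] by eventually_elim (simp add: v_def \<eta>0)
  qed simp
  have dv: "ae_diff UNIV v"
  proof -
    have "ae_diff {x. \<sigma> x > 0} v"
      unfolding v_def \<eta>_def
      by (intro ae_diff_scaleR ae_diff_max ae_diff_min ae_diff_diff ae_diff_divide ae_diff_mult ae_diff_const dif)
        (use \<epsilon>(1)[of m] in auto)
    moreover have "{x \<in> UNIV. \<not> v differentiable (at x)} \<subseteq> {x \<in> {x. \<sigma> x > 0}. \<not> v differentiable (at x)}"
      using dv0 \<epsilon>(1)[of m] by force
    ultimately show ?thesis unfolding ae_diff_def by (rule negligible_subset)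
  qed
  have vu: "norm (v x - u x) \<le> h m x \<and> norm (grad v x - grad u x) \<le> h m x"
    if good: "\<sigma> x > 0 \<or> (\<forall>\<^sub>F y in nhds x. u y = 0)" and du: "\<sigma> x > 0 \<Longrightarrow> u differentiable (at x)"
      and dvx: "\<sigma> x > 0 \<Longrightarrow> v differentiable (at x)" for x
  proof -
    have h0: "h m x \<ge> 0" using R0[of x] c0 by (simp add: h_def)
    consider "\<not> \<sigma> x > 0" | "\<sigma> x > ?e" | "0 < \<sigma> x" "\<sigma> x \<le> ?e" by linarith
    then show ?thesis
    proof cases
      case 1
      then have z: "\<forall>\<^sub>F y in nhds x. u y = 0" using good by blast
      then have zv: "\<forall>\<^sub>F y in nhds x. v y = 0" by eventually_elim (simp add: v_def)
      have "frechet_derivative w (at x) = (\<lambda>_. 0)" if "\<forall>\<^sub>F y in nhds x. w y = 0" for w :: "real^'n \<Rightarrow> real^'N"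
      proof -
        obtain T where T: "open T" "x \<in> T" "\<And>y. y \<in> T \<Longrightarrow> w y = 0" using \<open>\<forall>\<^sub>F y in nhds x. w y = 0\<close> unfolding eventually_nhds by blast
        have "(w has_derivative (\<lambda>_. 0)) (at x)"
          by (rule has_derivative_transform_within_open[of "\<lambda>_. 0" _ x UNIV T]) (use T in auto)
        then show ?thesis by (rule frechet_derivative_eqI)
      qed
      then have "grad u x = 0" "grad v x = 0" using z zv by (auto simp: vec_eq_iff grad_component)
      moreover have "u x = 0" "v x = 0" using eventually_nhds_x_imp_x[OF z] eventually_nhds_x_imp_x[OF zv] by auto
      ultimately show ?thesis using h0 by simp
    next
      case 2
      have eq: "\<forall>\<^sub>F y in nhds x. v y = u y" using \<sigma>gt[OF 2] by eventually_elim (simp add: v_def \<eta>1)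
      have pos: "\<sigma> x > 0" using 2 \<epsilon>(1)[of m] by linarith
      obtain T where T: "open T" "x \<in> T" "\<And>y. y \<in> T \<Longrightarrow> v y = u y" using eq unfolding eventually_nhds by blast
      have "(v has_derivative frechet_derivative u (at x)) (at x)"
        by (rule has_derivative_transform_within_open[OF differentiable_has_frechet[OF du[OF pos]] T(1,2)]) (use T(3) in auto)
      then have "frechet_derivative v (at x) = frechet_derivative u (at x)" by (rule frechet_derivative_eqI)
      then have "grad v x = grad u x" by (simp add: vec_eq_iff grad_component)
      moreover have "v x = u x" using eventually_nhds_x_imp_x[OF eq] .
      ultimately show ?thesis using h0 by simp
    next
      case 3
      have R: "R x \<ge> 0" by (rule R0[OF 3(1)])
      have hx: "h m x = c0 * R x" using 3 by (simp add: h_def)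
      let ?w = "\<lambda>y. v y - u y"
      have dw: "?w differentiable (at x)" using du dvx 3 by auto
      \<comment> \<open>The slope \<open>2 / ?e\<close> of the cutoff is compensated by the
        smallness of \<open>u\<close>: \<open>norm (u x) \<le> R x * \<sigma> x\<close> and
        \<open>\<sigma> x \<le> ?e\<close> on this layer.\<close>
      have RS: "2 / ?e * (C * (R x * \<sigma> x)) \<le> 2 * C * R x"
      proof -
        have "R x * \<sigma> x \<le> R x * ?e" using 3 R by (intro mult_left_mono) auto
        then have "2 / ?e * (C * (R x * \<sigma> x)) \<le> 2 / ?e * (C * (R x * ?e))"
          by (rule mult_left_mono[OF mult_left_mono[OF _ C]]) (use \<epsilon>(1)[of m] in auto)
        also have "\<dots> = 2 * C * R x" using \<epsilon>(1)[of m] by simp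
        finally show ?thesis .
      qed
      have "\<forall>\<^sub>F y in nhds x. norm (?w y - ?w x) \<le> ((1 + 2 * C) * R x) * norm (y - x)"
        using ulip[OF 3(1)] \<eta>lip[of x]
      proof eventually_elim
        case (elim y)
        have "?w y - ?w x = (\<eta> y - 1) *\<^sub>R (u y - u x) + (\<eta> y - \<eta> x) *\<^sub>R u x" by (simp add: v_def algebra_simps)
        then have "norm (?w y - ?w x) \<le> \<bar>\<eta> y - 1\<bar> * norm (u y - u x) + \<bar>\<eta> y - \<eta> x\<bar> * norm (u x)"
          using norm_triangle_ineq[of "(\<eta> y - 1) *\<^sub>R (u y - u x)" "(\<eta> y - \<eta> x) *\<^sub>R u x"] by simp
        also have "\<dots> \<le> 1 * (R x * norm (y - x)) + (2 / ?e * (C * norm (y - x))) * (R x * \<sigma> x)"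
          using elim \<eta>01[of y] uR[OF 3(1)] \<epsilon>(1)[of m] C by (intro add_mono mult_mono) auto
        also have "\<dots> = R x * norm (y - x) + (2 / ?e * (C * (R x * \<sigma> x))) * norm (y - x)" by (simp add: algebra_simps)
        also have "\<dots> \<le> R x * norm (y - x) + (2 * C * R x) * norm (y - x)"
          using RS by (intro add_left_mono mult_right_mono) auto
        finally show ?case by (simp add: algebra_simps)
      qed
      then have wb: "norm (frechet_derivative ?w (at x) b) \<le> ((1 + 2 * C) * R x) * norm b" for b
        by (rule norm_frechet_le_pointwise_lipschitz[OF dw])
      have "(?w has_derivative (\<lambda>b. frechet_derivative v (at x) b - frechet_derivative u (at x) b)) (at x)"
        using du dvx 3 by (intro has_derivative_diff differentiable_has_frechet) auto
      then have "grad ?w x = grad v x - grad u x"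
        by (simp add: vec_eq_iff grad_component frechet_derivative_eqI)
      moreover have "norm (grad ?w x) \<le> real CARD('N) * (real CARD('n) * ((1 + 2 * C) * R x))"
        by (rule norm_grad_le) (use wb[of "axis _ 1"] in simp)
      moreover have "real CARD('N) * (real CARD('n) * ((1 + 2 * C) * R x)) \<le> h m x"
        using R by (simp add: hx c0_def algebra_simps)
      moreover have "norm (v x - u x) \<le> h m x"
      proof -
        have "v x - u x = (\<eta> x - 1) *\<^sub>R u x" by (simp add: v_def algebra_simps)
        then have "norm (v x - u x) \<le> 1 * norm (u x)" using \<eta>01[of x] by (simp add: mult_left_le_one_le)
        also have "\<dots> \<le> R x * \<sigma> x" using uR[OF 3(1)] by simp
        also have "\<dots> \<le> R x * 1" using 3 R \<epsilon>(2)[of m] by (intro mult_left_mono) auto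
        also have "\<dots> \<le> c0 * R x" using mult_right_mono[OF c0 R] by simp
        finally show ?thesis by (simp add: hx)
      qed
      ultimately show ?thesis by simp
    qed
  qed
  have AEh: "AE x in lebesgue_on \<Omega>. norm (v x - u x) \<le> h m x \<and> norm (grad v x - grad u x) \<le> h m x"
  proof -
    let ?N = "{x \<in> \<Omega>. \<sigma> x = 0 \<and> \<not> (\<forall>\<^sub>F y in nhds x. u y = 0)} \<union> {x \<in> {x. \<sigma> x > 0}. \<not> u differentiable (at x)}
       \<union> {x \<in> UNIV. \<not> v differentiable (at x)}"
    have "?N \<in> null_sets lebesgue"
      using triv dif(1) dv unfolding ae_diff_def negligible_iff_null_sets[symmetric] by (intro negligible_Un)
    then have "AE x in lebesgue. x \<notin> ?N" by (rule AE_not_in)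
    then have "AE x in lebesgue. x \<in> \<Omega> \<longrightarrow> norm (v x - u x) \<le> h m x \<and> norm (grad v x - grad u x) \<le> h m x"
    proof eventually_elim
      case (elim x)
      show ?case
      proof
        assume "x \<in> \<Omega>"
        with elim \<sigma>0(1)[of x] show "norm (v x - u x) \<le> h m x \<and> norm (grad v x - grad u x) \<le> h m x"
          by (intro vu) auto
      qed
    qed
    then show ?thesis using O(2) by (subst AE_restrict_space_iff) auto
  qed
  have "approx_W1p p \<Omega> v (grad v) (e/4)"
  proof (rule approx_W1p_lipschitz[OF \<Omega> p _ S _ SO dv])
    show "norm (v x - v y) \<le> K * norm (x - y)" for x y by (rule lipschitz_from_pointwise[OF vlip])
    show "x \<in> ?S" if "v x \<noteq> 0" for x using that \<eta>0[of x] by (force simp: v_def)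
  qed (use e in auto)
  then obtain \<phi> where \<phi>: "\<phi> \<in> test_functions \<Omega>"
     "(\<integral>\<^sup>+x. ennreal (norm (\<phi> x - v x) powr p) \<partial>lebesgue_on \<Omega>) \<le> ennreal ((e/4) powr p)"
     "(\<integral>\<^sup>+x. ennreal (norm (grad \<phi> x - grad v x) powr p) \<partial>lebesgue_on \<Omega>) \<le> ennreal ((e/4) powr p)"
    unfolding approx_W1p_def by blast
  have vb: "v \<in> borel_measurable borel"
    using pointwise_lipschitz_imp_continuous[OF vlip] by (rule borel_measurable_continuous_onI)
  have meas: "\<phi> \<in> borel_measurable (lebesgue_on \<Omega>)" "grad \<phi> \<in> borel_measurable (lebesgue_on \<Omega>)"
     "v \<in> borel_measurable (lebesgue_on \<Omega>)" "grad v \<in> borel_measurable (lebesgue_on \<Omega>)"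
    using test_functionD(2)[OF \<phi>(1)] continuous_on_grad[OF \<phi>(1)] vb
      grad_measurable[OF vb ae_diff_mono[OF dv subset_UNIV] O(2)]
    by (auto intro!: measurable_restrict_space1 measurable_completion borel_measurable_continuous_onI)
  have "(\<integral>\<^sup>+x. ennreal (norm (\<phi> x - u x) powr p) \<partial>lebesgue_on \<Omega>) \<le> ennreal (e powr p)"
    by (rule nn_integral_powr_triangle[OF meas(1,3) _ _ p e \<phi>(2) less_imp_le[OF m]]) (use AEh in auto)
  moreover have "(\<integral>\<^sup>+x. ennreal (norm (grad \<phi> x - grad u x) powr p) \<partial>lebesgue_on \<Omega>) \<le> ennreal (e powr p)"
    by (rule nn_integral_powr_triangle[OF meas(2,4) _ _ p e \<phi>(3) less_imp_le[OF m]]) (use AEh in auto)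
  ultimately show ?thesis unfolding approx_W1p_def using \<phi>(1) by blast
qed

subsection \<open>Quasiconvexity under a growth condition\<close>

lemma test_function_integral_zero_on_box:
  fixes g :: "'a::euclidean_space \<Rightarrow> real"
  assumes i: "set_integrable lebesgue (cbox a b) g" and ab: "cbox a b \<subseteq> \<Omega>" and \<Omega>: "\<Omega> \<in> sets lebesgue"
    and z: "\<And>\<psi>::'a \<Rightarrow> real. \<psi> \<in> test_functions \<Omega> \<Longrightarrow> (\<integral>x. g x * \<psi> x \<partial>lebesgue_on \<Omega>) = 0"
  shows "(\<integral>x. indicator (box a b) x * g x \<partial>lebesgue) = 0"
proof -
  define \<psi> where "\<psi> m x = 1 + (-1) * exp ((- real m) * box_bump a b x)" for m and x :: 'a
  have \<psi>t: "\<psi> m \<in> test_functions \<Omega>" for m unfolding \<psi>_def by (rule test_function_box[OF ab])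
  have \<psi>0: "\<psi> m x = 0" if "x \<notin> box a b" for m x using box_bump_zero[OF that] by (simp add: \<psi>_def)
  have \<psi>1: "0 \<le> \<psi> m x" "\<psi> m x \<le> 1" for m x using box_bump_nonneg[of a b x] by (auto simp: \<psi>_def)
  define k where "k x = indicator (cbox a b) x * g x" for x
  have ki: "integrable lebesgue k" using i by (simp add: set_integrable_def k_def[abs_def])
  have [measurable]: "k \<in> borel_measurable lebesgue" using ki by auto
  have [measurable]: "\<psi> m \<in> borel_measurable lebesgue" for m
    using test_functionD(2)[OF \<psi>t] by (intro measurable_completion) (simp add: borel_measurable_continuous_onI)
  have eq: "(\<integral>x. g x * \<psi> m x \<partial>lebesgue_on \<Omega>) = (\<integral>x. k x * \<psi> m x \<partial>lebesgue)" for m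
  proof -
    have "(\<integral>x. g x * \<psi> m x \<partial>lebesgue_on \<Omega>) = (\<integral>x. indicator \<Omega> x *\<^sub>R (g x * \<psi> m x) \<partial>lebesgue)"
      using \<Omega> by (simp add: integral_restrict_space)
    also have "(\<lambda>x. indicator \<Omega> x *\<^sub>R (g x * \<psi> m x)) = (\<lambda>x. k x * \<psi> m x)"
      using ab \<psi>0 box_subset_cbox[of a b] by (auto simp: fun_eq_iff k_def indicator_def)
    finally show ?thesis .
  qed
  have "(\<lambda>m. \<integral>x. k x * \<psi> m x \<partial>lebesgue) \<longlonglongrightarrow> (\<integral>x. k x * indicator (box a b) x \<partial>lebesgue)"
  proof (rule integral_dominated_convergence)
    show "integrable lebesgue (\<lambda>x. norm (k x))" using ki by auto
    show "AE x in lebesgue. norm (k x * \<psi> m x) \<le> norm (k x)" for m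
      using \<psi>1 by (intro AE_I2) (simp add: abs_mult mult_left_le)
    show "AE x in lebesgue. (\<lambda>m. k x * \<psi> m x) \<longlonglongrightarrow> k x * indicator (box a b) x"
    proof (intro AE_I2 tendsto_mult tendsto_const)
      fix x
      show "(\<lambda>m. \<psi> m x) \<longlonglongrightarrow> indicator (box a b) x"
      proof (cases "x \<in> box a b")
        case True
        then have pos: "box_bump a b x > 0" by (simp add: box_bump_pos)
        have "(\<lambda>m. exp (- box_bump a b x) ^ m) \<longlonglongrightarrow> 0" using pos by (intro LIMSEQ_realpow_zero) auto
        then have "(\<lambda>m. 1 - exp (- box_bump a b x) ^ m) \<longlonglongrightarrow> 1 - 0" by (rule tendsto_diff[OF tendsto_const])
        moreover have "\<psi> m x = 1 - exp (- box_bump a b x) ^ m" for m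
          by (simp add: \<psi>_def exp_of_nat_mult[symmetric])
        ultimately show ?thesis using True by simp
      qed (simp add: \<psi>0)
    qed
  qed (auto intro!: borel_measurable_times borel_measurable_indicator)
  moreover have "(\<integral>x. k x * \<psi> m x \<partial>lebesgue) = 0" for m using z[OF \<psi>t[of m]] eq by simp
  ultimately have "(\<integral>x. k x * indicator (box a b) x \<partial>lebesgue) = 0"
    using LIMSEQ_unique[OF _ tendsto_const[of 0]] by simp
  also have "(\<lambda>x. k x * indicator (box a b) x) = (\<lambda>x. indicator (box a b) x * g x)"
    using box_subset_cbox[of a b] by (auto simp: k_def fun_eq_iff indicator_def)
  finally show ?thesis .
qed

text \<open>Boxes form an intersection-stable generator of the Borel sets, so integrals that vanish
  over all boxes vanish over all Borel sets, and a function with this property is zero almost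
  everywhere.\<close>

lemma fundamental_lemma_variations:
  fixes g :: "'a::euclidean_space \<Rightarrow> real"
  assumes \<Omega>: "open \<Omega>" and loc: "locally_integrable \<Omega> g"
    and z: "\<And>\<psi>::'a \<Rightarrow> real. \<psi> \<in> test_functions \<Omega> \<Longrightarrow> (\<integral>x. g x * \<psi> x \<partial>lebesgue_on \<Omega>) = 0"
  shows "negligible {x \<in> \<Omega>. g x \<noteq> 0}"
proof -
  have O: "\<Omega> \<in> sets lebesgue" using \<Omega> by simp
  have boxneg: "negligible {x \<in> box c d. g x \<noteq> 0}" if cd: "cbox c d \<subseteq> \<Omega>" for c d
  proof -
    \<comment> \<open>Truncation to one box makes the function integrable on the whole space. Since
      intersections of boxes are boxes, integrating \<open>k\<close> over any box amounts to
      integrating \<open>g\<close> over a box inside the domain.\<close>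
    define k where "k x = indicator (box c d) x * g x" for x
    have "set_integrable lebesgue (cbox c d) g"
      using loc cd by (simp add: locally_integrable_def)
    then have "set_integrable lebesgue (box c d) g"
      by (rule set_integrable_subset) (use box_subset_cbox in auto)
    then have ki: "integrable lebesgue k" by (simp add: set_integrable_def k_def[abs_def])
    obtain k' where k'[measurable]: "k' \<in> borel_measurable lborel" and AEk: "AE x in lborel. k x = k' x"
      using completion_ex_borel_measurable_real[of k lborel] ki by auto
    have AEk2: "AE x in lebesgue. k x = k' x" by (rule AE_completion[OF AEk])
    have k'm: "k' \<in> borel_measurable lebesgue" by (intro measurable_completion k')
    have "integrable lebesgue k'"
      using ki AEk2 k'm by (subst integrable_cong_AE[symmetric, of k]) auto
    then have k'i: "integrable lborel k'" by (simp add: integrable_completion)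
    have box0: "set_lebesgue_integral lborel (box a b) k' = 0" for a b
    proof -
      define a' b' where "a' = (\<Sum>i\<in>Basis. max (a\<bullet>i) (c\<bullet>i) *\<^sub>R i)" and "b' = (\<Sum>i\<in>Basis. min (b\<bullet>i) (d\<bullet>i) *\<^sub>R i)"
      have bx: "box a b \<inter> box c d = box a' b'" by (simp add: box_Int_box a'_def b'_def)
      have "cbox a' b' \<subseteq> cbox c d" by (auto simp: a'_def b'_def mem_box)
      then have sub: "cbox a' b' \<subseteq> \<Omega>" using cd by blast
      have "(\<integral>x. indicator (box a b) x * k' x \<partial>lborel) = (\<integral>x. indicator (box a b) x * k' x \<partial>lebesgue)"
        by (rule integral_completion[symmetric]) measurable
      also have "\<dots> = (\<integral>x. indicator (box a b) x * k x \<partial>lebesgue)"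
      proof (rule integral_cong_AE)
        show "AE x in lebesgue. indicator (box a b) x * k' x = indicator (box a b) x * k x"
          using AEk2 by eventually_elim simp
      qed (intro borel_measurable_times borel_measurable_indicator k'm borel_measurable_integrable[OF ki]; simp)+
      also have "(\<lambda>x. indicator (box a b) x * k x) = (\<lambda>x. indicator (box a' b') x * g x)"
        unfolding bx[symmetric] by (auto simp: k_def indicator_def fun_eq_iff)
      also have "(\<integral>x. indicator (box a' b') x * g x \<partial>lebesgue) = 0"
        using loc sub by (intro test_function_integral_zero_on_box[OF _ sub O z]) (auto simp: locally_integrable_def)
      finally show ?thesis by (simp add: set_lebesgue_integral_def)
    qed
    have total: "(\<integral>x. k' x \<partial>lborel) = 0"
    proof -
      have "(\<integral>x. k' x \<partial>lborel) = (\<integral>x. indicator (box c d) x *\<^sub>R k' x \<partial>lborel)"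
      proof (rule integral_cong_AE)
        show "AE x in lborel. k' x = indicator (box c d) x *\<^sub>R k' x"
          using AEk by eventually_elim (auto simp: k_def indicator_def split: if_splits)
      qed auto
      then show ?thesis using box0[of c d] by (simp add: set_lebesgue_integral_def)
    qed
    have all0: "set_lebesgue_integral lborel A k' = 0" if "A \<in> sets lborel" for A
    proof -
      have si: "set_integrable lborel B k'" if "B \<in> sets lborel" for B
        unfolding set_integrable_def by (rule integrable_mult_indicator[OF that k'i])
      have *: "A \<in> sigma_sets UNIV (range (\<lambda>(a, b). box a b :: 'a set))"
        using that by (simp add: borel_eq_box)
      have stable: "Int_stable (range (\<lambda>(a, b). box a b :: 'a set))"
        unfolding Int_stable_def by (auto simp: box_Int_box)
      have "range (\<lambda>(a, b). box a b :: 'a set) \<subseteq> Pow UNIV" by simp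
      from stable this * show ?thesis
      proof (induction rule: sigma_sets_induct_disjoint)
        case (basic A)
        then show ?case using box0 by auto
      next
        case empty
        then show ?case by (simp add: set_lebesgue_integral_def)
      next
        case (compl A)
        have Am: "A \<in> sets lborel" using compl(1) by (simp add: borel_eq_box)
        have "set_lebesgue_integral lborel (UNIV - A) k' = (\<integral>x. k' x - indicator A x *\<^sub>R k' x \<partial>lborel)"
          unfolding set_lebesgue_integral_def by (intro Bochner_Integration.integral_cong) (auto simp: indicator_def)
        also have "\<dots> = (\<integral>x. k' x \<partial>lborel) - set_lebesgue_integral lborel A k'"
          using si[OF Am] k'i unfolding set_lebesgue_integral_def set_integrable_def by (intro Bochner_Integration.integral_diff)
        finally show ?case using total compl by simp
      next
        case (union A)
        have Am: "A i \<in> sets lborel" for i using union(2) by (auto simp: borel_eq_box)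
        have "(LINT x:(\<Union>i. A i)|lborel. k' x) = (\<Sum>i. (LINT x:(A i)|lborel. k' x))"
          using union(1) Am by (intro lebesgue_integral_countable_add si) (auto simp: disjoint_family_on_def)
        then show ?case using union by simp
      qed
    qed
    have "AE x in lborel. k' x = 0" by (rule sigma_finite_measure.density_zero[OF sigma_finite_lborel k'i all0])
    with AEk have "AE x in lborel. k x = 0" by eventually_elim simp
    then have "AE x in lebesgue. k x = 0" by (rule AE_completion)
    then have "{x. k x \<noteq> 0} \<in> null_sets lebesgue" by (simp add: completion.AE_iff_null_sets)
    then have "negligible {x. k x \<noteq> 0}" by (simp add: negligible_iff_null_sets)
    then show ?thesis by (rule negligible_subset) (auto simp: k_def)
  qed
  obtain \<D> where \<D>: "countable \<D>" "\<D> \<subseteq> Pow \<Omega>" "\<And>X. X \<in> \<D> \<Longrightarrow> \<exists>a b. X = cbox a b" "\<Union>\<D> = \<Omega>"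
    using open_countable_Union_open_cbox[OF \<Omega>] by blast
  show ?thesis
  proof (rule negligible_countable_cover[OF \<D>(1)])
    fix X assume X: "X \<in> \<D>"
    then obtain a b where ab: "X = cbox a b" "cbox a b \<subseteq> \<Omega>" using \<D>(2,3) by blast
    have "negligible ({x \<in> box a b. g x \<noteq> 0} \<union> (cbox a b - box a b))"
      using boxneg[OF ab(2)] negligible_frontier_interval by (intro negligible_Un)
    then show "negligible ({x \<in> \<Omega>. g x \<noteq> 0} \<inter> X)"
      by (rule negligible_subset) (use ab in auto)
  qed (use \<D>(4) in auto)
qed

text \<open>Quasiconvexity is tested with an arbitrary weak gradient, while membership in
  \<open>W1p0\<close> supplies approximations for one particular weak gradient; this lemma connects
  the two.\<close>

lemma weak_grad_unique:
  fixes u :: "real^'n \<Rightarrow> real^'N"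
  assumes \<Omega>: "open \<Omega>" and G: "weak_grad \<Omega> u G" and G': "weak_grad \<Omega> u G'"
  shows "negligible {x \<in> \<Omega>. G x \<noteq> G' x}"
proof -
  have O: "\<Omega> \<in> sets lebesgue" using \<Omega> by simp
  have comp: "locally_integrable \<Omega> (\<lambda>x. F x $ i $ j)" if F: "locally_integrable \<Omega> F" for F :: "real^'n \<Rightarrow> real^'n^'N" and i j
    unfolding locally_integrable_def
  proof (intro allI impI)
    fix K assume "compact K \<and> K \<subseteq> \<Omega>"
    then have "F absolutely_integrable_on K" using F by (auto simp: locally_integrable_def)
    moreover have "bounded_linear (\<lambda>A::real^'n^'N. A $ i $ j)"
      using bounded_linear_compose[OF bounded_linear_vec_nth bounded_linear_vec_nth, of i j] by simp
    ultimately show "(\<lambda>x. F x $ i $ j) absolutely_integrable_on K"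
      by (rule absolutely_integrable_linear[unfolded o_def])
  qed
  have int: "integrable (lebesgue_on \<Omega>) (\<lambda>x. F x $ i $ j * \<psi> x)"
    if F: "locally_integrable \<Omega> F" and \<psi>: "\<psi> \<in> test_functions \<Omega>"
    for F :: "real^'n \<Rightarrow> real^'n^'N" and i j and \<psi> :: "real^'n \<Rightarrow> real"
  proof -
    obtain K where K: "compact K" "K \<subseteq> \<Omega>" "\<forall>x. \<psi> x \<noteq> 0 \<longrightarrow> x \<in> K" using test_functionD(4)[OF \<psi>] by blast
    obtain M where M: "M \<ge> 0" "\<And>x. norm (\<psi> x) \<le> M"
      using bounded_range_compact_support[OF test_functionD(2)[OF \<psi>] K(1)] K(3) by metis
    have "set_integrable lebesgue K (\<lambda>x. F x $ i $ j)"
      using comp[OF F] K by (auto simp: locally_integrable_def)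
    then have ki: "integrable lebesgue (\<lambda>x. indicator K x *\<^sub>R (F x $ i $ j))" by (simp add: set_integrable_def)
    have "integrable lebesgue (\<lambda>x. (indicator K x *\<^sub>R (F x $ i $ j)) * \<psi> x)"
    proof (rule Bochner_Integration.integrable_bound[OF integrable_mult_left[OF ki, of M]])
      show "(\<lambda>x. (indicator K x *\<^sub>R (F x $ i $ j)) * \<psi> x) \<in> borel_measurable lebesgue"
        using test_functionD(2)[OF \<psi>]
        by (intro borel_measurable_times borel_measurable_integrable[OF ki] measurable_completion)
          (simp add: borel_measurable_continuous_onI)
      show "AE x in lebesgue. norm ((indicator K x *\<^sub>R (F x $ i $ j)) * \<psi> x) \<le> norm ((indicator K x *\<^sub>R (F x $ i $ j)) * M)"
        unfolding norm_mult using M by (intro AE_I2 mult_left_mono) auto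
    qed
    also have "(\<lambda>x. (indicator K x *\<^sub>R (F x $ i $ j)) * \<psi> x) = (\<lambda>x. indicator \<Omega> x *\<^sub>R (F x $ i $ j * \<psi> x))"
      using K by (auto simp: fun_eq_iff indicator_def)
    finally show ?thesis using O by (simp add: integrable_restrict_space)
  qed
  have lG: "locally_integrable \<Omega> G" "locally_integrable \<Omega> G'" using G G' by (auto simp: weak_grad_def)
  have ij: "negligible {x \<in> \<Omega>. G x $ i $ j - G' x $ i $ j \<noteq> 0}" for i j
  proof (rule fundamental_lemma_variations[OF \<Omega>])
    show "locally_integrable \<Omega> (\<lambda>x. G x $ i $ j - G' x $ i $ j)"
      using comp[OF lG(1), of i j] comp[OF lG(2), of i j]
      by (auto simp: locally_integrable_def intro!: set_integral_diff(1))
    fix \<psi> :: "real^'n \<Rightarrow> real" assume \<psi>: "\<psi> \<in> test_functions \<Omega>"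
    have "(\<integral>x. (G x $ i $ j - G' x $ i $ j) * \<psi> x \<partial>lebesgue_on \<Omega>)
        = (\<integral>x. G x $ i $ j * \<psi> x \<partial>lebesgue_on \<Omega>) - (\<integral>x. G' x $ i $ j * \<psi> x \<partial>lebesgue_on \<Omega>)"
      unfolding left_diff_distrib by (intro Bochner_Integration.integral_diff int lG \<psi>)
    also have "\<dots> = 0"
      using G G' \<psi> unfolding weak_grad_def by (metis (no_types, lifting) diff_self minus_equation_iff)
    finally show "(\<integral>x. (G x $ i $ j - G' x $ i $ j) * \<psi> x \<partial>lebesgue_on \<Omega>) = 0" .
  qed
  have "negligible (\<Union>(range (\<lambda>(i, j). {x \<in> \<Omega>. G x $ i $ j - G' x $ i $ j \<noteq> 0})))"
  proof (rule negligible_Union)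
    fix T assume "T \<in> range (\<lambda>(i, j). {x \<in> \<Omega>. G x $ i $ j - G' x $ i $ j \<noteq> 0})"
    then obtain i j where "T = {x \<in> \<Omega>. G x $ i $ j - G' x $ i $ j \<noteq> 0}" by auto
    then show "negligible T" using ij by simp
  qed simp
  then show ?thesis by (rule negligible_subset) (auto simp: vec_eq_iff)
qed

section \<open>Transfer of quasiconvexity between exponents\<close>

lemma ext_integral_real:
  assumes g: "integrable M g"
  shows "ext_integral M (\<lambda>x. ereal (g x)) = ereal (\<integral>x. g x \<partial>M)"
proof -
  have "(\<integral>\<^sup>+x. ennreal (g x) \<partial>M) < \<infinity>" "(\<integral>\<^sup>+x. ennreal (- g x) \<partial>M) < \<infinity>"
    using g by (auto simp: real_integrable_def less_top)
  moreover have "\<exists>a\<ge>0. X = ennreal a" if "X < \<infinity>" for X :: ennreal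
    using that by (cases X rule: ennreal_cases) auto
  ultimately obtain a b where a: "a \<ge> 0" "(\<integral>\<^sup>+x. ennreal (g x) \<partial>M) = ennreal a"
    and b: "b \<ge> 0" "(\<integral>\<^sup>+x. ennreal (- g x) \<partial>M) = ennreal b"
    by meson
  have e: "e2ennreal (ereal (g x)) = ennreal (g x)" "e2ennreal (- ereal (g x)) = ennreal (- g x)" for x by simp_all
  show ?thesis
    unfolding ext_integral_def e a(2) b(2) real_lebesgue_integral_def[OF g] using a(1) b(1) by simp
qed

text \<open>Fatou's lemma is applied to \<open>L (1 + 2\<^sup>q (\<bar>\<xi> + G\<bar>\<^sup>q + \<bar>\<nabla>\<phi>\<^sub>m - G\<bar>\<^sup>q)) - f (\<xi> + \<nabla>\<phi>\<^sub>m)\<close>.\<close>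
lemma quasiconvex_of_growth:
  fixes f :: "real^'n^'N \<Rightarrow> real"
  assumes p: "1 \<le> p" and q: "1 \<le> q" and cf: "continuous_on UNIV f" and bd: "bdd_below (range f)"
    and qc: "W1p_quasiconvex p (\<lambda>\<xi>. ereal (f \<xi>))"
    and L: "L \<ge> 0" "\<And>\<xi>. f \<xi> \<le> L * (1 + norm \<xi> powr q)"
  shows "W1p_quasiconvex q (\<lambda>\<xi>. ereal (f \<xi>))"
  unfolding W1p_quasiconvex_def
proof
  fix \<xi> :: "real^'n^'N"
  have "W1p_quasiconvex_at p (\<lambda>\<xi>. ereal (f \<xi>)) \<xi>" using qc unfolding W1p_quasiconvex_def by (rule spec)
  then obtain \<Omega> :: "(real^'n) set" where *: "\<Omega> \<noteq> {} \<and> bounded \<Omega> \<and> open \<Omega> \<and> emeasure lebesgue (frontier \<Omega>) = 0 \<and>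
      (\<forall>\<phi> G. \<phi> \<in> W1p0 p \<Omega> \<and> weak_grad \<Omega> \<phi> G \<longrightarrow>
        ext_integral (lebesgue_on \<Omega>) (\<lambda>x. ereal (f (\<xi> + G x))) \<ge> ereal (measure lebesgue \<Omega>) * ereal (f \<xi>))"
    unfolding W1p_quasiconvex_at_def by (rule exE)
  then have \<Omega>: "\<Omega> \<noteq> {}" "bounded \<Omega>" "open \<Omega>" "emeasure lebesgue (frontier \<Omega>) = 0" by simp_all
  have tst: "ext_integral (lebesgue_on \<Omega>) (\<lambda>x. ereal (f (\<xi> + G x))) \<ge> ereal (measure lebesgue \<Omega>) * ereal (f \<xi>)"
    if "\<phi> \<in> W1p0 p \<Omega>" "weak_grad \<Omega> \<phi> G" for \<phi> G
    using *[THEN conjunct2, THEN conjunct2, THEN conjunct2, THEN conjunct2] that by blast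
  have O: "\<Omega> \<in> lmeasurable" "\<Omega> \<in> sets lebesgue"
    using lmeasurable_bounded_open[OF \<Omega>(3,2)] by (auto simp: fmeasurableD)
  interpret finite_measure "lebesgue_on \<Omega>" by (rule finite_measure_lebesgue_on[OF O(1)])
  obtain c where c: "\<And>\<zeta>. c \<le> f \<zeta>" using bd by (auto simp: bdd_below_def)
  have fm[measurable]: "f \<in> borel_measurable borel" using cf by (rule borel_measurable_continuous_onI)
  have fabs: "\<bar>f \<zeta>\<bar> \<le> \<bar>c\<bar> + L * (1 + norm \<zeta> powr q)" for \<zeta>
  proof -
    have "0 \<le> L * (1 + norm \<zeta> powr q)" using L(1) by simp
    then show ?thesis using c[of \<zeta>] L(2)[of \<zeta>] by linarith
  qed
  have fint: "integrable (lebesgue_on \<Omega>) (\<lambda>x. f (\<xi> + G x))"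
    if G[measurable]: "G \<in> borel_measurable (lebesgue_on \<Omega>)" and i: "integrable (lebesgue_on \<Omega>) (\<lambda>x. norm (\<xi> + G x) powr q)" for G
    by (rule Bochner_Integration.integrable_bound[of _ "\<lambda>x. \<bar>c\<bar> + L * (1 + norm (\<xi> + G x) powr q)"])
      (use i in \<open>auto intro!: AE_I2 order_trans[OF fabs abs_ge_self]\<close>)
  have sh: "integrable (lebesgue_on \<Omega>) (\<lambda>x. norm (\<xi> + G x) powr q)"
    if G[measurable]: "G \<in> borel_measurable (lebesgue_on \<Omega>)" and i: "integrable (lebesgue_on \<Omega>) (\<lambda>x. norm (G x) powr q)" for G
  proof (rule Bochner_Integration.integrable_bound[of _ "\<lambda>x. 2 powr q * (norm \<xi> powr q + norm (G x) powr q)"])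
    show "AE x in lebesgue_on \<Omega>. norm (norm (\<xi> + G x) powr q) \<le> norm (2 powr q * (norm \<xi> powr q + norm (G x) powr q))"
    proof (rule AE_I2)
      fix x
      have "norm (\<xi> + G x) powr q \<le> (norm \<xi> + norm (G x)) powr q"
        using q by (intro powr_mono2 norm_triangle_ineq) auto
      also have "\<dots> \<le> 2 powr q * (norm \<xi> powr q + norm (G x) powr q)" using q by (intro powr_add_le) auto
      finally show "norm (norm (\<xi> + G x) powr q) \<le> norm (2 powr q * (norm \<xi> powr q + norm (G x) powr q))" by simp
    qed
  qed (use i in auto)
  show "W1p_quasiconvex_at q (\<lambda>\<xi>. ereal (f \<xi>)) \<xi>"
    unfolding W1p_quasiconvex_at_def
  \<comment> \<open>The domain that witnesses quasiconvexity for \<open>p\<close> at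
    \<open>\<xi>\<close> also serves for \<open>q\<close>.\<close>
  proof (intro exI[of _ \<Omega>] conjI allI impI \<Omega>)
    fix \<phi> and G :: "real^'n \<Rightarrow> real^'n^'N"
    assume A: "\<phi> \<in> W1p0 q \<Omega> \<and> weak_grad \<Omega> \<phi> G"
    then obtain G' \<psi> where G': "weak_grad \<Omega> \<phi> G'" "G' \<in> Lp q \<Omega>" and \<psi>: "\<And>m. \<psi> m \<in> test_functions \<Omega>"
      and lim: "(\<lambda>m. Lp_norm q \<Omega> (\<lambda>x. grad (\<psi> m) x - G' x)) \<longlonglongrightarrow> 0"
      unfolding W1p0_def by blast
    have N: "negligible {x \<in> \<Omega>. G x \<noteq> G' x}" using A G'(1) by (intro weak_grad_unique[OF \<Omega>(3)]) auto
    have AEG: "AE x in lebesgue_on \<Omega>. G' x = G x"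
    proof -
      have "AE x in lebesgue. x \<in> \<Omega> \<longrightarrow> G' x = G x"
        using N unfolding negligible_iff_null_sets by (rule AE_not_in[THEN eventually_mono]) auto
      then show ?thesis using O(2) by (subst AE_restrict_space_iff) auto
    qed
    have [measurable]: "G' \<in> borel_measurable (lebesgue_on \<Omega>)" and G'i: "integrable (lebesgue_on \<Omega>) (\<lambda>x. norm (G' x) powr q)"
      using G'(2) by (auto simp: Lp_def)
    have \<psi>m[measurable]: "\<psi> m \<in> borel_measurable (lebesgue_on \<Omega>)" "grad (\<psi> m) \<in> borel_measurable (lebesgue_on \<Omega>)" for m
      using test_functionD(2)[OF \<psi>] continuous_on_grad[OF \<psi>]
      by (auto intro!: measurable_restrict_space1 measurable_completion borel_measurable_continuous_onI)
    have \<psi>i: "integrable (lebesgue_on \<Omega>) (\<lambda>x. norm (grad (\<psi> m) x) powr q)" for m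
    proof -
      obtain M where "\<And>x. norm (grad (\<psi> m) x) \<le> M" using test_function_bounds[OF \<psi>[of m]] by metis
      then show ?thesis using q by (auto intro!: integrable_const_bound[of _ "M powr q"] AE_I2 powr_mono2)
    qed
    \<comment> \<open>Test functions belong to \<open>W1p0\<close> for every exponent, with
      themselves as approximants. This is the bridge from \<open>p\<close> to \<open>q\<close>,
      whichever of the two is larger.\<close>
    have qcm: "measure lebesgue \<Omega> * f \<xi> \<le> (\<integral>x. f (\<xi> + grad (\<psi> m) x) \<partial>lebesgue_on \<Omega>)" for m
    proof -
      have "approx_W1p p \<Omega> (\<psi> m) (grad (\<psi> m)) e" for e
        unfolding approx_W1p_def by (intro bexI[OF _ \<psi>[of m]]) simp
      then have "\<psi> m \<in> W1p0 p \<Omega>" "weak_grad \<Omega> (\<psi> m) (grad (\<psi> m))"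
        using W1p0I[OF \<Omega>(3,2) p \<psi>m(1,2)] by blast+
      from tst[OF this] show ?thesis
        by (simp add: ext_integral_real[OF fint[OF \<psi>m(2) sh[OF \<psi>m(2) \<psi>i]]])
    qed
    define d where "d m = (\<integral>x. norm (grad (\<psi> m) x - G' x) powr q \<partial>lebesgue_on \<Omega>)" for m
    have di: "integrable (lebesgue_on \<Omega>) (\<lambda>x. norm (grad (\<psi> m) x - G' x) powr q)" for m
    proof (rule Bochner_Integration.integrable_bound[of _ "\<lambda>x. 2 powr q * (norm (grad (\<psi> m) x) powr q + norm (G' x) powr q)"])
      show "AE x in lebesgue_on \<Omega>. norm (norm (grad (\<psi> m) x - G' x) powr q) \<le> norm (2 powr q * (norm (grad (\<psi> m) x) powr q + norm (G' x) powr q))"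
      proof (rule AE_I2)
        fix x
        have "norm (grad (\<psi> m) x - G' x) powr q \<le> (norm (grad (\<psi> m) x) + norm (G' x)) powr q"
          using q by (intro powr_mono2 norm_triangle_ineq4) auto
        also have "\<dots> \<le> 2 powr q * (norm (grad (\<psi> m) x) powr q + norm (G' x) powr q)" using q by (intro powr_add_le) auto
        finally show "norm (norm (grad (\<psi> m) x - G' x) powr q) \<le> norm (2 powr q * (norm (grad (\<psi> m) x) powr q + norm (G' x) powr q))" by simp
      qed
    qed (use \<psi>i G'i in auto)
    have d0: "d \<longlonglongrightarrow> 0"
    proof -
      have "(\<lambda>m. Lp_norm q \<Omega> (\<lambda>x. grad (\<psi> m) x - G' x) powr q) \<longlonglongrightarrow> 0"
        by (rule tendsto_zero_powrI[OF lim tendsto_const]) (use q in \<open>auto simp: Lp_norm_def\<close>)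
      moreover have "Lp_norm q \<Omega> (\<lambda>x. grad (\<psi> m) x - G' x) powr q = d m" for m
        using q by (auto simp: Lp_norm_def d_def powr_powr intro!: integral_nonneg_AE powr_one)
      ultimately show ?thesis by simp
    qed
    have "(\<lambda>m. \<integral>x. norm (norm (grad (\<psi> m) x - G' x) powr q) \<partial>lebesgue_on \<Omega>) \<longlonglongrightarrow> 0"
      using d0 by (simp add: d_def[abs_def])
    from tendsto_L1_AE_subseq[OF di this] obtain r where r: "strict_mono r"
      and AEr: "AE x in lebesgue_on \<Omega>. (\<lambda>m. norm (grad (\<psi> (r m)) x - G' x) powr q) \<longlonglongrightarrow> 0" by blast
    define A where "A x = L * (1 + 2 powr q * norm (\<xi> + G' x) powr q)" for x
    define h where "h m x = A x + L * 2 powr q * norm (grad (\<psi> (r m)) x - G' x) powr q - f (\<xi> + grad (\<psi> (r m)) x)" for m x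
    define h' where "h' x = A x - f (\<xi> + G' x)" for x
    have [measurable]: "A \<in> borel_measurable (lebesgue_on \<Omega>)" unfolding A_def by measurable
    have [measurable]: "h m \<in> borel_measurable (lebesgue_on \<Omega>)" for m unfolding h_def by measurable
    have Ai: "integrable (lebesgue_on \<Omega>) A" unfolding A_def using sh[OF _ G'i] by auto
    have fG': "integrable (lebesgue_on \<Omega>) (\<lambda>x. f (\<xi> + G' x))" by (rule fint[OF _ sh[OF _ G'i]]) measurable
    have h'i: "integrable (lebesgue_on \<Omega>) h'" unfolding h'_def using Ai fG' by auto
    have fm: "integrable (lebesgue_on \<Omega>) (\<lambda>x. f (\<xi> + grad (\<psi> m) x))" for m by (rule fint[OF \<psi>m(2) sh[OF \<psi>m(2) \<psi>i]])
    have hi: "integrable (lebesgue_on \<Omega>) (h m)" for m unfolding h_def using Ai di[of "r m"] fm[of "r m"] by auto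
    have h0: "h m x \<ge> 0" for m x
    proof -
      have "norm (\<xi> + grad (\<psi> (r m)) x) \<le> norm (\<xi> + G' x) + norm (grad (\<psi> (r m)) x - G' x)"
        using norm_triangle_ineq[of "\<xi> + G' x" "grad (\<psi> (r m)) x - G' x"] by simp
      then have "norm (\<xi> + grad (\<psi> (r m)) x) powr q \<le> (norm (\<xi> + G' x) + norm (grad (\<psi> (r m)) x - G' x)) powr q"
        using q by (intro powr_mono2) auto
      also have "\<dots> \<le> 2 powr q * (norm (\<xi> + G' x) powr q + norm (grad (\<psi> (r m)) x - G' x) powr q)"
        using q by (intro powr_add_le) auto
      finally have "L * (1 + norm (\<xi> + grad (\<psi> (r m)) x) powr q)
         \<le> L * (1 + 2 powr q * (norm (\<xi> + G' x) powr q + norm (grad (\<psi> (r m)) x - G' x) powr q))"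
        using L(1) by (intro mult_left_mono add_left_mono)
      then show ?thesis using L(2)[of "\<xi> + grad (\<psi> (r m)) x"] by (simp add: h_def A_def algebra_simps)
    qed
    have hlim: "AE x in lebesgue_on \<Omega>. (\<lambda>m. h m x) \<longlonglongrightarrow> h' x"
      using AEr
    proof eventually_elim
      case (elim x)
      have "(\<lambda>m. (norm (grad (\<psi> (r m)) x - G' x) powr q) powr (1/q)) \<longlonglongrightarrow> 0"
        by (rule tendsto_zero_powrI[OF elim tendsto_const]) (use q in auto)
      then have "(\<lambda>m. norm (grad (\<psi> (r m)) x - G' x)) \<longlonglongrightarrow> 0" using q by (simp add: powr_powr)
      then have "(\<lambda>m. grad (\<psi> (r m)) x) \<longlonglongrightarrow> G' x" by (rule LIM_zero_cancel[OF tendsto_norm_zero_cancel])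
      then have "(\<lambda>m. \<xi> + grad (\<psi> (r m)) x) \<longlonglongrightarrow> \<xi> + G' x" by (intro tendsto_intros)
      then have "(\<lambda>m. f (\<xi> + grad (\<psi> (r m)) x)) \<longlonglongrightarrow> f (\<xi> + G' x)"
        using cf by (intro continuous_on_tendsto_compose[OF cf]) auto
      then have "(\<lambda>m. h m x) \<longlonglongrightarrow> A x + L * 2 powr q * 0 - f (\<xi> + G' x)"
        unfolding h_def by (intro tendsto_intros elim)
      then show ?case by (simp add: h'_def)
    qed
    have h'0: "AE x in lebesgue_on \<Omega>. h' x \<ge> 0"
      using hlim by eventually_elim (rule LIMSEQ_le_const, use h0 in auto)
    let ?a = "(\<integral>x. A x \<partial>lebesgue_on \<Omega>)" and ?m = "measure lebesgue \<Omega> * f \<xi>"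
    have hb: "(\<integral>x. h m x \<partial>lebesgue_on \<Omega>) \<le> ?a + L * 2 powr q * d (r m) - ?m" for m
    proof -
      have "(\<integral>x. h m x \<partial>lebesgue_on \<Omega>) = ?a + L * 2 powr q * d (r m) - (\<integral>x. f (\<xi> + grad (\<psi> (r m)) x) \<partial>lebesgue_on \<Omega>)"
        unfolding h_def d_def using Ai di[of "r m"] fm[of "r m"] by simp
      then show ?thesis using qcm[of "r m"] by simp
    qed
    have "(\<lambda>m. ?a + L * 2 powr q * d (r m) - ?m) \<longlonglongrightarrow> ?a + L * 2 powr q * 0 - ?m"
      using LIMSEQ_subseq_LIMSEQ[OF d0 r] by (intro tendsto_intros) (simp add: o_def)
    then have lim2: "(\<lambda>m. ennreal (?a + L * 2 powr q * d (r m) - ?m)) \<longlonglongrightarrow> ennreal (?a + L * 2 powr q * 0 - ?m)"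
      by (rule tendsto_ennrealI)
    have pos: "?a - ?m \<ge> 0"
    proof -
      have "0 \<le> ?a + L * 2 powr q * d (r m) - ?m" for m
        using hb[of m] Bochner_Integration.integral_nonneg[of "lebesgue_on \<Omega>" "h m"] h0 by (meson order_trans)
      then have "0 \<le> ?a + L * 2 powr q * 0 - ?m"
        using \<open>(\<lambda>m. ?a + L * 2 powr q * d (r m) - ?m) \<longlonglongrightarrow> ?a + L * 2 powr q * 0 - ?m\<close>
        by (intro LIMSEQ_le_const) auto
      then show ?thesis by simp
    qed
    have "(\<integral>\<^sup>+x. ennreal (h' x) \<partial>lebesgue_on \<Omega>) = (\<integral>\<^sup>+x. liminf (\<lambda>m. ennreal (h m x)) \<partial>lebesgue_on \<Omega>)"
    proof (rule nn_integral_cong_AE)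
      show "AE x in lebesgue_on \<Omega>. ennreal (h' x) = liminf (\<lambda>m. ennreal (h m x))"
        using hlim
      proof eventually_elim
        case (elim x)
        then have "(\<lambda>m. ennreal (h m x)) \<longlonglongrightarrow> ennreal (h' x)" by (rule tendsto_ennrealI)
        then show ?case by (intro lim_imp_Liminf[symmetric]) auto
      qed
    qed
    also have "\<dots> \<le> liminf (\<lambda>m. \<integral>\<^sup>+x. ennreal (h m x) \<partial>lebesgue_on \<Omega>)"
      by (rule nn_integral_liminf) measurable
    also have "\<dots> \<le> liminf (\<lambda>m. ennreal (?a + L * 2 powr q * d (r m) - ?m))"
      using hb by (intro Liminf_mono always_eventually allI) (auto simp: nn_integral_eq_integral[OF hi] h0 intro!: ennreal_leI)
    also have "\<dots> = ennreal (?a + L * 2 powr q * 0 - ?m)"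
      by (rule lim_imp_Liminf[OF _ lim2]) simp
    finally have "ennreal (\<integral>x. h' x \<partial>lebesgue_on \<Omega>) \<le> ennreal (?a - ?m)"
      using nn_integral_eq_integral[OF h'i h'0] by simp
    then have "(\<integral>x. h' x \<partial>lebesgue_on \<Omega>) \<le> ?a - ?m" using pos by (simp add: ennreal_le_iff)
    moreover have "(\<integral>x. h' x \<partial>lebesgue_on \<Omega>) = ?a - (\<integral>x. f (\<xi> + G' x) \<partial>lebesgue_on \<Omega>)"
      unfolding h'_def using Ai fG' by simp
    ultimately have fin: "?m \<le> (\<integral>x. f (\<xi> + G' x) \<partial>lebesgue_on \<Omega>)" by simp
    have "ext_integral (lebesgue_on \<Omega>) (\<lambda>x. ereal (f (\<xi> + G x))) = ext_integral (lebesgue_on \<Omega>) (\<lambda>x. ereal (f (\<xi> + G' x)))"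
    proof -
      have "(\<integral>\<^sup>+x. e2ennreal (ereal (f (\<xi> + G x))) \<partial>lebesgue_on \<Omega>) = (\<integral>\<^sup>+x. e2ennreal (ereal (f (\<xi> + G' x))) \<partial>lebesgue_on \<Omega>)"
        "(\<integral>\<^sup>+x. e2ennreal (- ereal (f (\<xi> + G x))) \<partial>lebesgue_on \<Omega>) = (\<integral>\<^sup>+x. e2ennreal (- ereal (f (\<xi> + G' x))) \<partial>lebesgue_on \<Omega>)"
        using AEG by (auto intro!: nn_integral_cong_AE elim: AE_mp)
      then show ?thesis by (simp add: ext_integral_def)
    qed
    then show "ext_integral (lebesgue_on \<Omega>) (\<lambda>x. ereal (f (\<xi> + G x))) \<ge> ereal (measure lebesgue \<Omega>) * ereal (f \<xi>)"
      using fin by (simp add: ext_integral_real[OF fG'])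
  qed
qed

subsection \<open>Projection to skeleta within a cell\<close>

text \<open>The \<open>k\<close>-th smallest of the numbers \<open>y i\<close>.\<close>
definition ksmall :: "nat \<Rightarrow> ('n::finite \<Rightarrow> real) \<Rightarrow> real" where
  "ksmall k y = Min ((\<lambda>I. Max (y ` I)) ` {I. card I = k})"

lemma finite_card_sets: "finite {I::'n::finite set. card I = k}"
  by (rule finite_subset[OF subset_UNIV]) simp

lemma card_sets_nonempty: "k \<le> CARD('n::finite) \<Longrightarrow> {I::'n set. card I = k} \<noteq> {}"
  using obtain_subset_with_card_n[of k "UNIV::'n set"] by blast

lemma ksmall_obtain:
  fixes y :: "'n::finite \<Rightarrow> real"
  assumes "1 \<le> k" "k \<le> CARD('n)"
  obtains I where "card I = k" "\<And>i. i \<in> I \<Longrightarrow> y i \<le> ksmall k y"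
proof -
  have "ksmall k y \<in> (\<lambda>I. Max (y ` I)) ` {I. card I = k}"
    unfolding ksmall_def using finite_card_sets card_sets_nonempty[OF assms(2)] by (intro Min_in) auto
  then obtain I where I: "card I = k" "ksmall k y = Max (y ` I)" by blast
  have "y i \<le> ksmall k y" if "i \<in> I" for i
    unfolding I(2) using that by (intro Max_ge) auto
  with I(1) show thesis by (rule that)
qed

lemma ksmall_le:
  fixes y :: "'n::finite \<Rightarrow> real"
  assumes "1 \<le> k" "card I = k" "\<And>i. i \<in> I \<Longrightarrow> y i \<le> c"
  shows "ksmall k y \<le> c"
proof -
  have "ksmall k y \<le> Max (y ` I)"
    unfolding ksmall_def using assms(2) finite_card_sets by (intro Min_le) auto
  also have "\<dots> \<le> c" using assms by (subst Max_le_iff) auto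
  finally show ?thesis .
qed

lemma card_less_ksmall:
  fixes y :: "'n::finite \<Rightarrow> real"
  assumes "1 \<le> k"
  shows "card {i. y i < ksmall k y} < k"
proof (rule ccontr)
  assume "\<not> ?thesis"
  then obtain I where I: "I \<subseteq> {i. y i < ksmall k y}" "card I = k"
    using obtain_subset_with_card_n[of k "{i. y i < ksmall k y}"] by auto
  have "I \<noteq> {}" using I(2) assms by auto
  then have "Max (y ` I) < ksmall k y" using I(1) by (subst Max_less_iff) auto
  moreover have "ksmall k y \<le> Max (y ` I)" by (rule ksmall_le[OF assms I(2)]) auto
  ultimately show False by simp
qed

lemma ksmall_ge:
  fixes y :: "'n::finite \<Rightarrow> real"
  assumes "1 \<le> k" "k \<le> CARD('n)" "card {i. y i < c} < k"
  shows "c \<le> ksmall k y"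
proof -
  obtain I where I: "card I = k" "\<And>i. i \<in> I \<Longrightarrow> y i \<le> ksmall k y" using ksmall_obtain[OF assms(1,2)] by metis
  have "\<not> I \<subseteq> {i. y i < c}"
    using card_mono[of "{i. y i < c}" I] I(1) assms(3) by auto
  then obtain i where "i \<in> I" "i \<notin> {i. y i < c}" by blast
  then have "i \<in> I" "c \<le> y i" by auto
  then show ?thesis using I(2) by force
qed

text \<open>The \<open>k\<close>-th smallest value is monotone in the entries and moves by
  \<open>d\<close> when all entries do.\<close>

lemma ksmall_lipschitz:
  fixes y y' :: "'n::finite \<Rightarrow> real"
  assumes k: "1 \<le> k" "k \<le> CARD('n)" and d: "\<And>i. \<bar>y' i - y i\<bar> \<le> d"
  shows "\<bar>ksmall k y' - ksmall k y\<bar> \<le> d"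
proof -
  have *: "ksmall k u \<le> ksmall k v + d" if "\<And>i. u i \<le> v i + d" for u v :: "'n \<Rightarrow> real"
  proof -
    obtain I where I: "card I = k" "\<And>i. i \<in> I \<Longrightarrow> v i \<le> ksmall k v" using ksmall_obtain[OF k] by metis
    show ?thesis using that I(2) by (intro ksmall_le[OF k(1) I(1)]) (meson add_right_mono order_trans)
  qed
  have "y' i \<le> y i + d" "y i \<le> y' i + d" for i using d[of i] by (auto simp: abs_le_iff)
  then show ?thesis using *[of y' y] *[of y y'] by (simp add: abs_le_iff)
qed

lemma ksmall_bounds:
  fixes y :: "'n::finite \<Rightarrow> real"
  assumes k: "1 \<le> k" "k \<le> CARD('n)" and y: "\<And>i. l \<le> y i" "\<And>i. y i \<le> u"
  shows "l \<le> ksmall k y" "ksmall k y \<le> u"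
proof -
  have "{i. y i < l} = {}" using y(1) by (auto simp: not_less)
  then show "l \<le> ksmall k y" using k by (intro ksmall_ge) auto
  obtain I :: "'n set" where "card I = k" using card_sets_nonempty[OF k(2)] by blast
  then show "ksmall k y \<le> u" using y(2) by (intro ksmall_le[OF k(1)]) auto
qed

lemma ae_diff_ksmall:
  fixes y :: "'n::finite \<Rightarrow> 'a::euclidean_space \<Rightarrow> real"
  assumes k: "1 \<le> k" "k \<le> CARD('n)" and d: "\<And>i. ae_diff U (y i)"
  shows "ae_diff U (\<lambda>x. ksmall k (\<lambda>i. y i x))"
  unfolding ksmall_def
proof (rule ae_diff_Min[OF finite_card_sets card_sets_nonempty[OF k(2)]])
  fix I :: "'n set" assume "I \<in> {I. card I = k}"
  then have "finite I" "I \<noteq> {}" using k(1) by auto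
  then show "ae_diff U (\<lambda>x. Max ((\<lambda>i. y i x) ` I))" using d by (intro ae_diff_Max) auto
qed

section \<open>Clipping and the map of a single cell\<close>

text \<open>Dividing the coordinates of a point of the cube by their \<open>k\<close>-th smallest
  modulus and clipping leaves fewer than \<open>k\<close> of them different from -1 and 1. This
  retracts the cube, without the points that have at least \<open>k\<close> zero coordinates, onto
  its \<open>(k - 1)\<close>-skeleton.\<close>

definition clip :: "real \<Rightarrow> real" where "clip s = max (-1) (min 1 s)"

lemma clip_simps: "s \<ge> 1 \<Longrightarrow> clip s = 1" "s \<le> -1 \<Longrightarrow> clip s = -1" "\<bar>s\<bar> \<le> 1 \<Longrightarrow> clip s = s"
  by (auto simp: clip_def max_def min_def)

lemma clip_bound: "\<bar>clip s\<bar> \<le> 1" by (auto simp: clip_def)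

lemma clip_minus: "clip (- s) = - clip s" by (auto simp: clip_def max_def min_def)

lemma clip_lipschitz: "\<bar>clip s - clip s'\<bar> \<le> \<bar>s - s'\<bar>" by (auto simp: clip_def max_def min_def)

lemma clip_abs: "\<bar>clip s\<bar> = min 1 \<bar>s\<bar>" by (auto simp: clip_def max_def min_def)

text \<open>Only the first denominator enters the bound: wherever \<open>1 / b'\<close> would be
  large, clipping takes over. This one-sided form is what allows comparing a regular point with an
  arbitrary nearby one.\<close>

lemma clip_divide_lipschitz:
  assumes b: "b > 0" "b' \<ge> 0"
  shows "\<bar>clip (x' / b') - clip (x / b)\<bar> \<le> (\<bar>x' - x\<bar> + \<bar>b' - b\<bar>) / b"
proof -
  have *: "\<bar>clip (x / b') - clip (x / b)\<bar> \<le> \<bar>b' - b\<bar> / b" if x: "x \<ge> 0" and b': "b' > 0" for x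
  proof -
    consider "x \<ge> b" "x \<ge> b'" | "x \<ge> b" "x < b'" | "x < b" "x \<ge> b'" | "x < b" "x < b'" by linarith
    then show ?thesis
    proof cases
      case 1 then show ?thesis using b b' by (simp add: clip_simps)
    next
      case 2
      then have "clip (x / b) = 1" "clip (x / b') = x / b'" using b b' x by (simp_all add: clip_simps)
      moreover have "1 - x / b' = (b' - x) / b'" using b' by (simp add: field_simps)
      moreover have "(b' - x) / b' \<le> (b' - b) / b" using 2 b b' by (intro frac_le) auto
      ultimately show ?thesis using 2 b' by (simp add: abs_if)
    next
      case 3
      then have "clip (x / b') = 1" "clip (x / b) = x / b" using b b' x by (simp_all add: clip_simps)
      moreover have "1 - x / b = (b - x) / b" using b by (simp add: field_simps)
      moreover have "(b - x) / b \<le> (b - b') / b" using 3 b by (intro divide_right_mono) auto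
      moreover have "(b - x) / b \<ge> 0" using 3 b by simp
      ultimately show ?thesis using 3 by simp
    next
      case 4
      then have "clip (x / b') = x / b'" "clip (x / b) = x / b" using b b' x by (simp_all add: clip_simps)
      moreover have "x / b' - x / b = (x / b') * ((b - b') / b)" using b b' by (simp add: field_simps)
      moreover have "\<bar>(x / b') * ((b - b') / b)\<bar> \<le> 1 * \<bar>(b - b') / b\<bar>"
        unfolding abs_mult using 4 x b' by (intro mult_right_mono) auto
      ultimately show ?thesis using b by (simp add: abs_minus_commute)
    qed
  qed
  show ?thesis
  proof (cases "b' = 0")
    \<comment> \<open>Division by zero gives the value \<open>clip 0 = 0\<close>. The bound still
      holds because \<open>|b' - b| / b\<close> equals 1 here.\<close>
    case True
    have "\<bar>clip (x / b)\<bar> \<le> 1" by (rule clip_bound)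
    also have "1 \<le> (\<bar>x' - x\<bar> + \<bar>b' - b\<bar>) / b" using b True by (simp add: field_simps)
    finally show ?thesis using True by (simp add: clip_def)
  next
    case False
    then have b': "b' > 0" using b by simp
    have "\<bar>clip (x' / b') - clip (x' / b)\<bar> \<le> \<bar>b' - b\<bar> / b"
      using *[OF _ b', of x'] *[OF _ b', of "- x'"] clip_minus[of "x' / b'"] clip_minus[of "x' / b"]
      by (cases "x' \<ge> 0") (auto simp: abs_minus_commute)
    moreover have "\<bar>clip (x' / b) - clip (x / b)\<bar> \<le> \<bar>x' - x\<bar> / b"
      using clip_lipschitz[of "x' / b" "x / b"] b by (simp add: diff_divide_distrib[symmetric])
    ultimately show ?thesis by (simp add: add_divide_distrib)
  qed
qed

text \<open>In normalised coordinates \<open>r\<close> of a grid cell, \<open>cell_s\<close> interpolates between the identity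
  (\<open>\<beta> = 1\<close>) and the projection of the cell to its \<open>(k - 1)\<close>-skeleton (\<open>\<beta> = 0\<close>), and \<open>cell_map\<close>
  follows it by the projection to the \<open>(k - 1)\<close>-skeleton of the dyadic subdivision. At \<open>\<beta> = 1\<close> the
  result is the projection for the finer grid, at \<open>\<beta> = 0\<close> it is the one for the coarser grid.\<close>
definition cell_b :: "nat \<Rightarrow> ('n::finite \<Rightarrow> real) \<Rightarrow> real \<Rightarrow> real" where
  "cell_b k r \<beta> = max (ksmall k (\<lambda>i. \<bar>r i\<bar>)) \<beta>"

definition cell_s :: "nat \<Rightarrow> ('n::finite \<Rightarrow> real) \<Rightarrow> real \<Rightarrow> 'n \<Rightarrow> real" where
  "cell_s k r \<beta> i = clip (r i / cell_b k r \<beta>)"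

text \<open>Up to sign, \<open>2 * |s| - 1\<close> is the position of \<open>s\<close> relative to
  the centre 1/2 or -1/2 of its dyadic subcell, in units of the half-width 1/2. So this is the
  \<open>k\<close>-th smallest modulus with respect to the finer grid.\<close>

definition cell_c :: "nat \<Rightarrow> ('n::finite \<Rightarrow> real) \<Rightarrow> real \<Rightarrow> real" where
  "cell_c k r \<beta> = ksmall k (\<lambda>i. \<bar>2 * \<bar>cell_s k r \<beta> i\<bar> - 1\<bar>)"

text \<open>Since \<open>cell_c\<close> is at most 1, for \<open>s \<ge> 0\<close> and
  \<open>cell_c > 0\<close> the second clip equals 1, and the average carries the projection of the
  subcell \<open>[0, 1]\<close> back from its own coordinates; symmetrically for
  \<open>s < 0\<close>. One expression for both halves keeps the Lipschitz estimate free of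
  cases.\<close>

definition cell_map :: "nat \<Rightarrow> ('n::finite \<Rightarrow> real) \<Rightarrow> real \<Rightarrow> 'n \<Rightarrow> real" where
  "cell_map k r \<beta> i = (clip ((2 * cell_s k r \<beta> i - 1) / cell_c k r \<beta>) + clip ((2 * cell_s k r \<beta> i + 1) / cell_c k r \<beta>)) / 2"

text \<open>Its reciprocal bounds the local Lipschitz constant of \<open>cell_map\<close>, and its
  zeros are the singular points. The product, unlike \<open>cell_c\<close> alone, is itself
  Lipschitz (\<open>cell_scale_lipschitz\<close>).\<close>

definition cell_scale :: "nat \<Rightarrow> ('n::finite \<Rightarrow> real) \<Rightarrow> real \<Rightarrow> real" where
  "cell_scale k r \<beta> = cell_b k r \<beta> * cell_c k r \<beta>"

context
  fixes k :: nat and n_type :: "'n::finite itself"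
  assumes k: "1 \<le> k" "k \<le> CARD('n)"
begin

lemma cell_b_bounds:
  fixes r :: "'n \<Rightarrow> real"
  assumes "\<And>i. \<bar>r i\<bar> \<le> 1" "0 \<le> \<beta>" "\<beta> \<le> 1"
  shows "0 \<le> cell_b k r \<beta>" "cell_b k r \<beta> \<le> 1"
  using ksmall_bounds[OF k, of 0 "\<lambda>i. \<bar>r i\<bar>" 1] assms by (auto simp: cell_b_def)

lemma cell_c_bounds:
  fixes r :: "'n \<Rightarrow> real"
  shows "0 \<le> cell_c k r \<beta>" "cell_c k r \<beta> \<le> 1"
proof -
  have "\<bar>2 * \<bar>cell_s k r \<beta> i\<bar> - 1\<bar> \<le> 1" for i using clip_bound[of "r i / cell_b k r \<beta>"] by (simp add: cell_s_def abs_le_iff)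
  then show "0 \<le> cell_c k r \<beta>" "cell_c k r \<beta> \<le> 1"
    unfolding cell_c_def using ksmall_bounds[OF k, of 0 "\<lambda>i. \<bar>2 * \<bar>cell_s k r \<beta> i\<bar> - 1\<bar>" 1] by auto
qed

lemma cell_scale_bounds:
  fixes r :: "'n \<Rightarrow> real"
  assumes "\<And>i. \<bar>r i\<bar> \<le> 1" "0 \<le> \<beta>" "\<beta> \<le> 1"
  shows "0 \<le> cell_scale k r \<beta>" "cell_scale k r \<beta> \<le> 1"
  unfolding cell_scale_def using cell_b_bounds[OF assms] cell_c_bounds[of r \<beta>] by (auto intro: mult_le_one)

lemma cell_map_bound: "\<bar>cell_map k r \<beta> i\<bar> \<le> 1"
  using clip_bound[of "(2 * cell_s k r \<beta> i - 1) / cell_c k r \<beta>"] clip_bound[of "(2 * cell_s k r \<beta> i + 1) / cell_c k r \<beta>"]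
    abs_triangle_ineq[of "clip ((2 * cell_s k r \<beta> i - 1) / cell_c k r \<beta>)" "clip ((2 * cell_s k r \<beta> i + 1) / cell_c k r \<beta>)"]
  by (simp add: cell_map_def)

lemma cell_b_lipschitz:
  fixes r r' :: "'n \<Rightarrow> real"
  assumes "\<And>i. \<bar>r' i - r i\<bar> \<le> d" "\<bar>\<beta>' - \<beta>\<bar> \<le> e"
  shows "\<bar>cell_b k r' \<beta>' - cell_b k r \<beta>\<bar> \<le> d + e"
proof -
  have "\<bar>ksmall k (\<lambda>i. \<bar>r' i\<bar>) - ksmall k (\<lambda>i. \<bar>r i\<bar>)\<bar> \<le> d"
  proof (rule ksmall_lipschitz[OF k])
    show "\<bar>\<bar>r' i\<bar> - \<bar>r i\<bar>\<bar> \<le> d" for i using assms(1)[of i] by linarith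
  qed
  then show ?thesis
    using assms(1)[of undefined] assms(2) unfolding cell_b_def by (auto simp: max_def abs_le_iff)
qed

lemma cell_s_lipschitz:
  fixes r r' :: "'n \<Rightarrow> real"
  assumes d: "\<And>i. \<bar>r' i - r i\<bar> \<le> d" and e: "\<bar>\<beta>' - \<beta>\<bar> \<le> e"
    and b: "cell_b k r \<beta> > 0" "cell_b k r' \<beta>' \<ge> 0"
  shows "\<bar>cell_s k r' \<beta>' i - cell_s k r \<beta> i\<bar> \<le> (2 * d + e) / cell_b k r \<beta>"
proof -
  have "\<bar>cell_s k r' \<beta>' i - cell_s k r \<beta> i\<bar> \<le> (\<bar>r' i - r i\<bar> + \<bar>cell_b k r' \<beta>' - cell_b k r \<beta>\<bar>) / cell_b k r \<beta>"
    unfolding cell_s_def by (rule clip_divide_lipschitz[OF b])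
  also have "\<dots> \<le> (2 * d + e) / cell_b k r \<beta>"
  proof (rule divide_right_mono)
    have "\<bar>cell_b k r' \<beta>' - cell_b k r \<beta>\<bar> \<le> d + e" by (rule cell_b_lipschitz[OF d e])
    then show "\<bar>r' i - r i\<bar> + \<bar>cell_b k r' \<beta>' - cell_b k r \<beta>\<bar> \<le> 2 * d + e" using d[of i] by simp
  qed (use b in simp)
  finally show ?thesis .
qed

lemma cell_c_lipschitz:
  fixes r r' :: "'n \<Rightarrow> real"
  assumes d: "\<And>i. \<bar>r' i - r i\<bar> \<le> d" and e: "\<bar>\<beta>' - \<beta>\<bar> \<le> e"
    and b: "cell_b k r \<beta> > 0" "cell_b k r' \<beta>' \<ge> 0"
  shows "\<bar>cell_c k r' \<beta>' - cell_c k r \<beta>\<bar> \<le> 2 * ((2 * d + e) / cell_b k r \<beta>)"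
  unfolding cell_c_def
proof (rule ksmall_lipschitz[OF k])
  fix i
  show "\<bar>\<bar>2 * \<bar>cell_s k r' \<beta>' i\<bar> - 1\<bar> - \<bar>2 * \<bar>cell_s k r \<beta> i\<bar> - 1\<bar>\<bar> \<le> 2 * ((2 * d + e) / cell_b k r \<beta>)"
    using cell_s_lipschitz[OF d e b, of i] by linarith
qed

text \<open>Two applications of \<open>clip_divide_lipschitz\<close> in a row, one dividing by
  \<open>cell_b\<close> and one by \<open>cell_c\<close>, which is why their product appears. The
  factor 4 collects \<open>2 * E\<close> from the numerator and \<open>2 * E\<close> from the
  denominator \<open>cell_c\<close>.\<close>

lemma cell_map_lipschitz:
  fixes r r' :: "'n \<Rightarrow> real"
  assumes d: "\<And>i. \<bar>r' i - r i\<bar> \<le> d" and e: "\<bar>\<beta>' - \<beta>\<bar> \<le> e"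
    and b: "cell_b k r \<beta> > 0" "cell_b k r' \<beta>' \<ge> 0" and c: "cell_c k r \<beta> > 0"
  shows "\<bar>cell_map k r' \<beta>' i - cell_map k r \<beta> i\<bar> \<le> 4 * (2 * d + e) / cell_scale k r \<beta>"
proof -
  let ?s = "cell_s k r \<beta> i" and ?s' = "cell_s k r' \<beta>' i" and ?c = "cell_c k r \<beta>" and ?c' = "cell_c k r' \<beta>'"
  define E where "E = (2 * d + e) / cell_b k r \<beta>"
  have s: "\<bar>?s' - ?s\<bar> \<le> E" unfolding E_def by (rule cell_s_lipschitz[OF d e b])
  have cc: "\<bar>?c' - ?c\<bar> \<le> 2 * E" unfolding E_def by (rule cell_c_lipschitz[OF d e b])
  have "\<bar>clip ((2 * ?s' + q) / ?c') - clip ((2 * ?s + q) / ?c)\<bar> \<le> 4 * E / ?c" for q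
  proof -
    have "\<bar>clip ((2 * ?s' + q) / ?c') - clip ((2 * ?s + q) / ?c)\<bar> \<le> (\<bar>(2 * ?s' + q) - (2 * ?s + q)\<bar> + \<bar>?c' - ?c\<bar>) / ?c"
      by (rule clip_divide_lipschitz[OF c cell_c_bounds(1)])
    also have "\<dots> \<le> (4 * E) / ?c" using s cc c by (intro divide_right_mono) auto
    finally show ?thesis .
  qed
  from this[of "-1"] this[of 1]
  have q: "\<bar>clip ((2 * ?s' - 1) / ?c') - clip ((2 * ?s - 1) / ?c)\<bar> \<le> 4 * E / ?c"
    "\<bar>clip ((2 * ?s' + 1) / ?c') - clip ((2 * ?s + 1) / ?c)\<bar> \<le> 4 * E / ?c" by simp_all
  have half: "\<bar>(a' + b') / 2 - (a + b) / 2\<bar> \<le> B" if "\<bar>a' - a\<bar> \<le> B" "\<bar>b' - b\<bar> \<le> B" for a a' b b' B :: real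
    using that by (simp add: abs_le_iff field_simps)
  have "\<bar>cell_map k r' \<beta>' i - cell_map k r \<beta> i\<bar> \<le> 4 * E / ?c"
    unfolding cell_map_def by (rule half[OF q])
  also have "4 * E / ?c = 4 * (2 * d + e) / cell_scale k r \<beta>" by (simp add: cell_scale_def E_def)
  finally show ?thesis .
qed

text \<open>\<open>cell_c\<close> has a Lipschitz constant of order \<open>1 / cell_b\<close>, which
  the factor \<open>cell_b\<close> of the product cancels. The product rule gives
  \<open>(d + e) + 2 * (2 * d + e)\<close>.\<close>

lemma cell_scale_lipschitz:
  fixes r r' :: "'n \<Rightarrow> real"
  assumes d: "\<And>i. \<bar>r' i - r i\<bar> \<le> d" and e: "\<bar>\<beta>' - \<beta>\<bar> \<le> e"
    and b: "cell_b k r \<beta> \<ge> 0" "cell_b k r' \<beta>' \<ge> 0"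
  shows "\<bar>cell_scale k r' \<beta>' - cell_scale k r \<beta>\<bar> \<le> 5 * d + 3 * e"
proof -
  let ?b = "cell_b k r \<beta>" and ?b' = "cell_b k r' \<beta>'" and ?c = "cell_c k r \<beta>" and ?c' = "cell_c k r' \<beta>'"
  have bl: "\<bar>?b' - ?b\<bar> \<le> d + e" by (rule cell_b_lipschitz[OF d e])
  have "cell_scale k r' \<beta>' - cell_scale k r \<beta> = ?c' * (?b' - ?b) + ?b * (?c' - ?c)"
    by (simp add: cell_scale_def algebra_simps)
  then have "\<bar>cell_scale k r' \<beta>' - cell_scale k r \<beta>\<bar> \<le> \<bar>?c' * (?b' - ?b)\<bar> + \<bar>?b * (?c' - ?c)\<bar>"
    by (simp only: abs_triangle_ineq)
  also have "\<bar>?c' * (?b' - ?b)\<bar> \<le> 1 * (d + e)"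
    unfolding abs_mult using bl cell_c_bounds[of r' \<beta>'] by (intro mult_mono) auto
  also have "\<bar>?b * (?c' - ?c)\<bar> \<le> 4 * d + 2 * e"
  proof (cases "?b = 0")
    case True
    then show ?thesis using d[of undefined] e by (simp add: add_nonneg_nonneg)
  next
    case False
    then have bp: "?b > 0" using b by simp
    have "\<bar>?b * (?c' - ?c)\<bar> \<le> ?b * (2 * ((2 * d + e) / ?b))"
      unfolding abs_mult using cell_c_lipschitz[OF d e bp b(2)] bp by (intro mult_mono) auto
    also have "\<dots> = 4 * d + 2 * e" using bp by simp
    finally show ?thesis .
  qed
  finally show ?thesis by simp
qed

text \<open>If \<open>\<beta>\<close> is not active, the first projection has already moved the
  point to the coarse skeleton: fewer than \<open>k\<close> coordinates have \<open>|s| < 1\<close>,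
  and \<open>|s| = 1\<close> gives \<open>|2 * |s| - 1| = 1\<close>. The second projection then has
  nothing left to do.\<close>

lemma cell_c_eq_1:
  fixes r :: "'n \<Rightarrow> real"
  assumes b: "cell_b k r \<beta> > 0" and eq: "cell_b k r \<beta> = ksmall k (\<lambda>i. \<bar>r i\<bar>)"
  shows "cell_c k r \<beta> = 1"
proof -
  have "{i. \<bar>2 * \<bar>cell_s k r \<beta> i\<bar> - 1\<bar> < 1} \<subseteq> {i. \<bar>r i\<bar> < ksmall k (\<lambda>i. \<bar>r i\<bar>)}"
  proof
    fix i assume i: "i \<in> {i. \<bar>2 * \<bar>cell_s k r \<beta> i\<bar> - 1\<bar> < 1}"
    have "\<bar>r i / cell_b k r \<beta>\<bar> < 1"
      using i by (auto simp: cell_s_def clip_abs min_def split: if_splits)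
    then show "i \<in> {i. \<bar>r i\<bar> < ksmall k (\<lambda>i. \<bar>r i\<bar>)}" using b eq by (simp add: abs_divide)
  qed
  then have "card {i. \<bar>2 * \<bar>cell_s k r \<beta> i\<bar> - 1\<bar> < 1} < k"
    using card_less_ksmall[OF k(1), of "\<lambda>i. \<bar>r i\<bar>"] card_mono[of "{i. \<bar>r i\<bar> < ksmall k (\<lambda>i. \<bar>r i\<bar>)}"]
    by (meson finite order_le_less_trans)
  then have "1 \<le> cell_c k r \<beta>" unfolding cell_c_def by (rule ksmall_ge[OF k])
  then show ?thesis using cell_c_bounds(2)[of r \<beta>] by simp
qed

lemma cell_map_beta_0:
  fixes r :: "'n \<Rightarrow> real"
  assumes b: "ksmall k (\<lambda>i. \<bar>r i\<bar>) > 0"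
  shows "cell_map k r 0 i = clip (r i / ksmall k (\<lambda>i. \<bar>r i\<bar>))"
proof -
  have eq: "cell_b k r 0 = ksmall k (\<lambda>i. \<bar>r i\<bar>)" using b by (simp add: cell_b_def)
  then have c: "cell_c k r 0 = 1" using b by (intro cell_c_eq_1) auto
  have "\<bar>cell_s k r 0 i\<bar> \<le> 1" unfolding cell_s_def by (rule clip_bound)
  then have "cell_map k r 0 i = cell_s k r 0 i" unfolding cell_map_def c by (auto simp: clip_def max_def min_def)
  then show ?thesis by (simp add: cell_s_def eq)
qed

lemma cell_scale_beta_0:
  fixes r :: "'n \<Rightarrow> real"
  shows "cell_scale k r 0 = ksmall k (\<lambda>i. \<bar>r i\<bar>)"
proof -
  have b: "ksmall k (\<lambda>i. \<bar>r i\<bar>) \<ge> 0" by (rule ksmall_bounds(1)[OF k, of 0 _ "\<Sum>i\<in>UNIV. \<bar>r i\<bar>"]) (auto intro: member_le_sum)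
  then have eq: "cell_b k r 0 = ksmall k (\<lambda>i. \<bar>r i\<bar>)" by (simp add: cell_b_def)
  show ?thesis
  proof (cases "ksmall k (\<lambda>i. \<bar>r i\<bar>) = 0")
    case False
    then show ?thesis using b cell_c_eq_1[of r 0] eq by (simp add: cell_scale_def)
  qed (simp add: cell_scale_def eq)
qed

lemma cell_beta_1:
  fixes r :: "'n \<Rightarrow> real"
  assumes "\<And>i. \<bar>r i\<bar> \<le> 1"
  shows "cell_b k r 1 = 1" "cell_s k r 1 i = r i" "cell_scale k r 1 = ksmall k (\<lambda>i. \<bar>2 * \<bar>r i\<bar> - 1\<bar>)"
proof -
  have "ksmall k (\<lambda>i. \<bar>r i\<bar>) \<le> 1" using assms by (intro ksmall_bounds(2)[OF k, of 0]) auto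
  then show b: "cell_b k r 1 = 1" by (simp add: cell_b_def)
  show s: "cell_s k r 1 i = r i" for i using assms[of i] by (simp add: cell_s_def b clip_simps)
  show "cell_scale k r 1 = ksmall k (\<lambda>i. \<bar>2 * \<bar>r i\<bar> - 1\<bar>)" by (simp add: cell_scale_def b cell_c_def s)
qed

text \<open>A coordinate whose offset in the subcell is at least the \<open>k\<close>-th smallest
  one is pushed to a face of the subcell, and fewer than \<open>k\<close> offsets lie strictly below
  it. The rank bound rests on this count.\<close>

lemma card_cell_map_off_grid:
  fixes r :: "'n \<Rightarrow> real"
  assumes c: "cell_c k r \<beta> > 0"
  shows "card {i. cell_map k r \<beta> i \<notin> {-1, 0, 1}} < k"
proof -
  have "{i. cell_map k r \<beta> i \<notin> {-1, 0, 1}} \<subseteq> {i. \<bar>2 * \<bar>cell_s k r \<beta> i\<bar> - 1\<bar> < cell_c k r \<beta>}"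
  proof (rule subsetI, rule ccontr)
    fix i assume i: "i \<in> {i. cell_map k r \<beta> i \<notin> {-1, 0, 1}}"
      and "i \<notin> {i. \<bar>2 * \<bar>cell_s k r \<beta> i\<bar> - 1\<bar> < cell_c k r \<beta>}"
    then have z: "\<bar>2 * \<bar>cell_s k r \<beta> i\<bar> - 1\<bar> \<ge> cell_c k r \<beta>" by simp
    let ?s = "cell_s k r \<beta> i" and ?c = "cell_c k r \<beta>"
    have c1: "?c \<le> 1" by (rule cell_c_bounds)
    have dv: "\<And>a. a \<ge> ?c \<Longrightarrow> clip (a / ?c) = 1" "\<And>a. a \<le> - ?c \<Longrightarrow> clip (a / ?c) = -1"
      using c by (auto intro!: clip_simps simp: field_simps)
    have "cell_map k r \<beta> i \<in> {-1, 0, 1}"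
    proof (cases "?s \<ge> 0")
      case True
      have "clip ((2 * ?s + 1) / ?c) = 1" using True c1 by (intro dv) auto
      moreover have "clip ((2 * ?s - 1) / ?c) = 1 \<or> clip ((2 * ?s - 1) / ?c) = -1"
        using z True dv(1)[of "2 * ?s - 1"] dv(2)[of "2 * ?s - 1"] by (auto simp: abs_if split: if_splits)
      ultimately show ?thesis by (auto simp: cell_map_def)
    next
      case False
      have "clip ((2 * ?s - 1) / ?c) = -1" using False c1 by (intro dv) auto
      moreover have "clip ((2 * ?s + 1) / ?c) = 1 \<or> clip ((2 * ?s + 1) / ?c) = -1"
        using z False dv(1)[of "2 * ?s + 1"] dv(2)[of "2 * ?s + 1"] by (auto simp: abs_if split: if_splits)
      ultimately show ?thesis by (auto simp: cell_map_def)
    qed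
    with i show False by simp
  qed
  then show ?thesis
    using card_less_ksmall[OF k(1), of "\<lambda>i. \<bar>2 * \<bar>cell_s k r \<beta> i\<bar> - 1\<bar>"] unfolding cell_c_def[symmetric]
    by (meson card_mono finite order_le_less_trans)
qed

text \<open>Quantifies that the singular set has codimension \<open>k\<close>: a small scale forces
  \<open>k\<close> coordinates to be close to 0 or \<open>\<beta>/2\<close> or
  \<open>-\<beta>/2\<close> simultaneously. If \<open>cell_c < 1\<close>, then
  \<open>\<beta>\<close> is active and the coordinates found by \<open>cell_c\<close> are unclipped;
  otherwise those found by \<open>cell_b\<close> do.\<close>

lemma cell_scale_witness:
  fixes r :: "'n \<Rightarrow> real"
  assumes r: "\<And>i. \<bar>r i\<bar> \<le> 1" and \<beta>: "0 \<le> \<beta>" "\<beta> \<le> 1"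
  obtains I where "card I = k" "\<And>i. i \<in> I \<Longrightarrow> \<exists>e\<in>{0, \<beta>/2, -\<beta>/2}. \<bar>r i - e\<bar> \<le> cell_scale k r \<beta>"
proof -
  let ?y = "cell_scale k r \<beta>"
  obtain I where I: "card I = k" "\<And>i. i \<in> I \<Longrightarrow> \<bar>r i\<bar> \<le> ksmall k (\<lambda>i. \<bar>r i\<bar>)"
    using ksmall_obtain[OF k, of "\<lambda>i. \<bar>r i\<bar>"] by metis
  have b0: "0 \<le> cell_b k r \<beta>" by (rule cell_b_bounds[OF r \<beta>])
  consider "cell_b k r \<beta> = 0" | "cell_b k r \<beta> > 0" "cell_c k r \<beta> = 1" | "cell_b k r \<beta> > 0" "cell_c k r \<beta> < 1"
    using b0 cell_c_bounds(2)[of r \<beta>] by linarith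
  then show thesis
  proof cases
    case 1
    show thesis
    proof (rule that[OF I(1)])
      fix i assume "i \<in> I"
      from I(2)[OF this] 1 show "\<exists>e\<in>{0, \<beta>/2, -\<beta>/2}. \<bar>r i - e\<bar> \<le> ?y"
        by (auto simp: cell_scale_def cell_b_def max_def split: if_splits)
    qed
  next
    case 2
    show thesis
    proof (rule that[OF I(1)])
      fix i assume "i \<in> I"
      from I(2)[OF this] 2 show "\<exists>e\<in>{0, \<beta>/2, -\<beta>/2}. \<bar>r i - e\<bar> \<le> ?y"
        by (intro bexI[of _ 0]) (auto simp: cell_scale_def cell_b_def)
    qed
  next
    case 3
    have bb: "cell_b k r \<beta> = \<beta>"
    proof (rule ccontr)
      assume "cell_b k r \<beta> \<noteq> \<beta>"
      then have "cell_b k r \<beta> = ksmall k (\<lambda>i. \<bar>r i\<bar>)" by (auto simp: cell_b_def max_def)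
      from cell_c_eq_1[OF 3(1) this] 3(2) show False by simp
    qed
    obtain I' where I': "card I' = k" "\<And>i. i \<in> I' \<Longrightarrow> \<bar>2 * \<bar>cell_s k r \<beta> i\<bar> - 1\<bar> \<le> cell_c k r \<beta>"
      using ksmall_obtain[OF k, of "\<lambda>i. \<bar>2 * \<bar>cell_s k r \<beta> i\<bar> - 1\<bar>"] unfolding cell_c_def[symmetric] by metis
    show thesis
    proof (rule that[OF I'(1)])
      fix i assume i: "i \<in> I'"
      have z: "\<bar>2 * \<bar>cell_s k r \<beta> i\<bar> - 1\<bar> \<le> cell_c k r \<beta>" by (rule I'(2)[OF i])
      have "\<bar>r i / \<beta>\<bar> < 1"
        using z 3(2) by (auto simp: cell_s_def bb clip_abs min_def split: if_splits)
      then have s: "\<bar>cell_s k r \<beta> i\<bar> = \<bar>r i\<bar> / \<beta>" using 3(1) by (simp add: cell_s_def bb clip_abs abs_divide)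
      have "\<beta> * \<bar>2 * (\<bar>r i\<bar> / \<beta>) - 1\<bar> \<le> \<beta> * cell_c k r \<beta>"
        using z 3(1) unfolding s bb by (intro mult_left_mono) auto
      moreover have "\<beta> * \<bar>2 * (\<bar>r i\<bar> / \<beta>) - 1\<bar> = \<bar>2 * \<bar>r i\<bar> - \<beta>\<bar>"
      proof -
        have "\<beta> * (2 * (\<bar>r i\<bar> / \<beta>) - 1) = 2 * \<bar>r i\<bar> - \<beta>" using 3(1) unfolding bb by (simp add: field_simps)
        moreover have "\<bar>\<beta> * (2 * (\<bar>r i\<bar> / \<beta>) - 1)\<bar> = \<beta> * \<bar>2 * (\<bar>r i\<bar> / \<beta>) - 1\<bar>"
          using 3(1) unfolding bb by (simp only: abs_mult abs_of_pos)
        ultimately show ?thesis by simp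
      qed
      ultimately have *: "\<bar>2 * \<bar>r i\<bar> - \<beta>\<bar> \<le> ?y" by (simp add: cell_scale_def bb)
      show "\<exists>e\<in>{0, \<beta>/2, -\<beta>/2}. \<bar>r i - e\<bar> \<le> ?y"
      proof (cases "r i \<ge> 0")
        case True then show ?thesis using * by (intro bexI[of _ "\<beta>/2"]) auto
      next
        case False then show ?thesis using * by (intro bexI[of _ "-\<beta>/2"]) auto
      qed
    qed
  qed
qed

end

section \<open>Integrability of the singular weights\<close>

text \<open>In HOL \<open>0 powr - \<alpha>\<close> is 0, so the pole is set to infinity by hand. A
  finite integral then also forces the singular set to be null.\<close>

definition sing_powr :: "real \<Rightarrow> real \<Rightarrow> ennreal" where
  "sing_powr \<alpha> y = (if y = 0 then \<infinity> else ennreal (\<bar>y\<bar> powr - \<alpha>))"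

lemma sing_powr_measurable [measurable]: "sing_powr \<alpha> \<in> borel_measurable borel"
  unfolding sing_powr_def by measurable

lemma sing_powr_antimono: "\<alpha> \<ge> 0 \<Longrightarrow> \<bar>x\<bar> \<le> \<bar>y\<bar> \<Longrightarrow> sing_powr \<alpha> y \<le> sing_powr \<alpha> x"
  by (auto simp: sing_powr_def intro!: ennreal_leI powr_mono2')

lemma sing_powr_ge_1: "\<alpha> \<ge> 0 \<Longrightarrow> \<bar>x\<bar> \<le> 1 \<Longrightarrow> 1 \<le> sing_powr \<alpha> x"
  using sing_powr_antimono[of \<alpha> x 1] by (simp add: sing_powr_def)

text \<open>The three poles are the values near which \<open>cell_scale_witness\<close> places a
  coordinate.\<close>

definition cell_weight :: "real \<Rightarrow> real \<Rightarrow> real \<Rightarrow> ennreal" where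
  "cell_weight \<alpha> \<beta> r = sing_powr \<alpha> r + sing_powr \<alpha> (r - \<beta>/2) + sing_powr \<alpha> (r + \<beta>/2)"

lemma cell_weight_measurable [measurable]:
  "(\<lambda>x. cell_weight \<alpha> (f x) (g x)) \<in> borel_measurable M"
  if [measurable]: "f \<in> borel_measurable M" "g \<in> borel_measurable M"
  unfolding cell_weight_def by measurable

text \<open>The power \<open>- s\<close> is distributed evenly over the \<open>k\<close> witnessing
  coordinates. The weights of the others are at least 1, so the product may run over all coordinates
  and no longer depends on the witnessing set. Each factor has exponent \<open>s / k\<close>, which
  is integrable in one dimension precisely if \<open>s < k\<close>.\<close>

lemma sing_powr_cell_scale_le:
  fixes r :: "'n::finite \<Rightarrow> real"
  assumes k: "1 \<le> k" "k \<le> CARD('n)" and s: "s \<ge> 0"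
    and r: "\<And>i. \<bar>r i\<bar> \<le> 1" and \<beta>: "0 \<le> \<beta>" "\<beta> \<le> 1"
  shows "sing_powr s (cell_scale k r \<beta>) \<le> (\<Prod>i\<in>UNIV. cell_weight (s / k) \<beta> (r i))"
proof -
  let ?y = "cell_scale k r \<beta>" and ?\<alpha> = "s / real k"
  have \<alpha>: "?\<alpha> \<ge> 0" using s by simp
  have y0: "?y \<ge> 0" by (rule cell_scale_bounds[where r=r, OF k r \<beta>])
  obtain I where I: "card I = k" "\<And>i. i \<in> I \<Longrightarrow> \<exists>e\<in>{0, \<beta>/2, -\<beta>/2}. \<bar>r i - e\<bar> \<le> ?y"
    using cell_scale_witness[where r=r, OF k r \<beta>] by blast
  have w1: "1 \<le> cell_weight ?\<alpha> \<beta> (r i)" for i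
    using sing_powr_ge_1[OF \<alpha> r, of i] unfolding cell_weight_def by (intro add_increasing2) auto
  have wy: "sing_powr ?\<alpha> ?y \<le> cell_weight ?\<alpha> \<beta> (r i)" if i: "i \<in> I" for i
  proof -
    obtain e where e: "e \<in> {0, \<beta>/2, -\<beta>/2}" "\<bar>r i - e\<bar> \<le> ?y" using I(2)[OF i] by blast
    have "sing_powr ?\<alpha> ?y \<le> sing_powr ?\<alpha> (r i - e)" using e(2) y0 by (intro sing_powr_antimono \<alpha>) auto
    also have "\<dots> \<le> cell_weight ?\<alpha> \<beta> (r i)"
      using e(1) by (auto simp: cell_weight_def add_increasing add_increasing2)
    finally show ?thesis .
  qed
  have "sing_powr s ?y = (\<Prod>i\<in>I. sing_powr ?\<alpha> ?y)"
  proof (cases "?y = 0")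
    case True
    have "(\<infinity> :: ennreal) ^ k = \<infinity>" using k by (simp add: power_eq_top_ennreal)
    then show ?thesis using True I(1) by (simp add: sing_powr_def)
  next
    case False
    have "(?y powr - ?\<alpha>) ^ k = ?y powr - s"
      using False y0 k by (simp add: powr_realpow[symmetric] powr_powr)
    then show ?thesis using False y0 I(1) by (simp add: sing_powr_def ennreal_power)
  qed
  also have "\<dots> \<le> (\<Prod>i\<in>I. cell_weight ?\<alpha> \<beta> (r i))"
    by (intro prod_mono_ennreal wy)
  also have "\<dots> \<le> (\<Prod>i\<in>I. cell_weight ?\<alpha> \<beta> (r i)) * (\<Prod>i\<in>-I. cell_weight ?\<alpha> \<beta> (r i))"
  proof -
    have "1 \<le> (\<Prod>i\<in>J. cell_weight ?\<alpha> \<beta> (r i))" for J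
      using prod_mono_ennreal[of J "\<lambda>_. 1" "\<lambda>i. cell_weight ?\<alpha> \<beta> (r i)"] w1 by simp
    from mult_left_mono[OF this[of "-I"], of "\<Prod>i\<in>I. cell_weight ?\<alpha> \<beta> (r i)"] show ?thesis by simp
  qed
  also have "\<dots> = (\<Prod>i\<in>UNIV. cell_weight ?\<alpha> \<beta> (r i))"
    using prod.union_disjoint[of I "-I" "\<lambda>i. cell_weight ?\<alpha> \<beta> (r i)"] by simp
  finally show ?thesis .
qed

lemma nn_integral_sing_powr_finite:
  assumes \<alpha>: "0 \<le> \<alpha>" "\<alpha> < 1"
  shows "(\<integral>\<^sup>+x. indicator {-2..2} x * sing_powr \<alpha> x \<partial>lborel) < \<infinity>"
proof -
  have pos: "(\<integral>\<^sup>+x. indicator {0..2} x * sing_powr \<alpha> x \<partial>lborel) < \<infinity>"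
  proof -
    have "((\<lambda>x. x powr - \<alpha>) has_integral (2 powr (- \<alpha> + 1) / (- \<alpha> + 1))) {0..2}"
      using \<alpha> by (intro has_integral_powr_from_0) auto
    then have "(\<integral>\<^sup>+x. ennreal (x powr - \<alpha>) * indicator {0..2} x \<partial>lborel) = ennreal (2 powr (- \<alpha> + 1) / (- \<alpha> + 1))"
      by (intro nn_integral_has_integral_lebesgue') auto
    moreover have "(\<integral>\<^sup>+x. indicator {0..2} x * sing_powr \<alpha> x \<partial>lborel) = (\<integral>\<^sup>+x. ennreal (x powr - \<alpha>) * indicator {0..2} x \<partial>lborel)"
    proof (rule nn_integral_cong_AE)
      show "AE x in lborel. indicator {0..2} x * sing_powr \<alpha> x = ennreal (x powr - \<alpha>) * indicator {0..2} x"
        using AE_lborel_singleton[of "0::real"] by eventually_elim (auto simp: sing_powr_def indicator_def)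
    qed
    ultimately show ?thesis by simp
  qed
  have refl: "(\<integral>\<^sup>+x. indicator {-2..0} x * sing_powr \<alpha> x \<partial>lborel) = (\<integral>\<^sup>+x. indicator {0..2} x * sing_powr \<alpha> x \<partial>lborel)"
  proof -
    have "(\<integral>\<^sup>+x. indicator {-2..0} x * sing_powr \<alpha> x \<partial>lborel) = ennreal \<bar>-1\<bar> * (\<integral>\<^sup>+x. indicator {-2..0} (0 + (-1) * x) * sing_powr \<alpha> (0 + (-1) * x) \<partial>lborel)"
      by (rule nn_integral_real_affine) auto
    also have "(\<lambda>x. indicator {-2..0} (0 + (-1) * x) * sing_powr \<alpha> (0 + (-1) * x)) = (\<lambda>x. indicator {0..2} x * sing_powr \<alpha> x)"
      by (auto simp: fun_eq_iff indicator_def sing_powr_def)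
    finally show ?thesis by simp
  qed
  have "(\<integral>\<^sup>+x. indicator {-2..2} x * sing_powr \<alpha> x \<partial>lborel)
     \<le> (\<integral>\<^sup>+x. indicator {-2..0} x * sing_powr \<alpha> x + indicator {0..2} x * sing_powr \<alpha> x \<partial>lborel)"
    by (intro nn_integral_mono) (auto simp: indicator_def)
  also have "\<dots> = (\<integral>\<^sup>+x. indicator {-2..0} x * sing_powr \<alpha> x \<partial>lborel) + (\<integral>\<^sup>+x. indicator {0..2} x * sing_powr \<alpha> x \<partial>lborel)"
    by (rule nn_integral_add) auto
  also have "\<dots> < \<infinity>" using pos refl by simp
  finally show ?thesis .
qed

text \<open>The position of \<open>x\<close> in its cell of the grid of width \<open>2 h\<close>, scaled to \<open>[-1, 1)\<close>.\<close>
definition cell_pos :: "real \<Rightarrow> real \<Rightarrow> real" where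
  "cell_pos h x = 2 * frac (x / (2 * h)) - 1"

lemma cell_pos_measurable [measurable]:
  "(\<lambda>x. cell_pos h (f x)) \<in> borel_measurable M" if [measurable]: "f \<in> borel_measurable M"
  unfolding cell_pos_def frac_def by measurable

lemma cell_pos_bound: "\<bar>cell_pos h x\<bar> \<le> 1"
  unfolding cell_pos_def using frac_ge_0[of "x / (2 * h)"] frac_lt_1[of "x / (2 * h)"] by linarith

lemma cell_pos_eq: "h > 0 \<Longrightarrow> cell_pos h x = x / h - (2 * of_int \<lfloor>x / (2 * h)\<rfloor> + 1)"
  by (simp add: cell_pos_def frac_def field_simps)

text \<open>The bound is uniform in \<open>h\<close> and \<open>\<beta>\<close>. The constant is
  \<open>9 = 3 * 3\<close>: three poles, each contributing at most the integral over
  \<open>{-2..2}\<close>, a window that contains all shifts of \<open>{-1..1}\<close> by at most 1;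
  and a number of cells which, times \<open>h\<close>, is at most 3.\<close>

lemma nn_integral_cell_weight_shift:
  assumes \<alpha>: "0 \<le> \<alpha>" and \<beta>: "0 \<le> \<beta>" "\<beta> \<le> 1" and h: "0 < h" "h \<le> 1"
  shows "(\<integral>\<^sup>+a. indicator {0..2} a * cell_weight \<alpha> \<beta> (cell_pos h (x - a)) \<partial>lborel)
    \<le> 9 * (\<integral>\<^sup>+y. indicator {-2..2} y * sing_powr \<alpha> y \<partial>lborel)" (is "_ \<le> 9 * ?K")
proof -
  define Z where "Z = {\<lfloor>(x - 2) / (2 * h)\<rfloor>..\<lfloor>x / (2 * h)\<rfloor>}"
  define g where "g y = indicator {-1..1} y * cell_weight \<alpha> \<beta> y" for y :: real
  have [measurable]: "g \<in> borel_measurable borel" unfolding g_def by measurable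
  have gK: "(\<integral>\<^sup>+y. g y \<partial>lborel) \<le> 3 * ?K"
  proof -
    have shift: "(\<integral>\<^sup>+y. indicator {-1..1} y * sing_powr \<alpha> (y + e) \<partial>lborel) \<le> ?K" if "\<bar>e\<bar> \<le> 1" for e
    proof -
      have "(\<integral>\<^sup>+y. indicator {-1..1} y * sing_powr \<alpha> (y + e) \<partial>lborel) \<le> (\<integral>\<^sup>+y. indicator {-2..2} (e + 1 * y) * sing_powr \<alpha> (e + 1 * y) \<partial>lborel)"
        using that by (intro nn_integral_mono) (auto simp: indicator_def add.commute)
      also have "\<dots> = ?K"
        using nn_integral_real_affine[of "\<lambda>y. indicator {-2..2} y * sing_powr \<alpha> y" 1 e] by simp
      finally show ?thesis .
    qed
    have "(\<integral>\<^sup>+y. g y \<partial>lborel) = (\<integral>\<^sup>+y. indicator {-1..1} y * sing_powr \<alpha> (y + 0) + indicator {-1..1} y * sing_powr \<alpha> (y + - \<beta>/2) + indicator {-1..1} y * sing_powr \<alpha> (y + \<beta>/2) \<partial>lborel)"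
      by (intro nn_integral_cong) (simp add: g_def cell_weight_def distrib_left)
    also have "\<dots> = (\<integral>\<^sup>+y. indicator {-1..1} y * sing_powr \<alpha> (y + 0) \<partial>lborel) + (\<integral>\<^sup>+y. indicator {-1..1} y * sing_powr \<alpha> (y + - \<beta>/2) \<partial>lborel)
        + (\<integral>\<^sup>+y. indicator {-1..1} y * sing_powr \<alpha> (y + \<beta>/2) \<partial>lborel)"
      by (subst nn_integral_add; (subst nn_integral_add)?) auto
    also have "\<dots> \<le> ?K + ?K + ?K" using \<beta> by (intro add_mono shift) auto
    also have "\<dots> = (1 + 1 + 1) * ?K" by (simp only: distrib_right mult_1)
    also have "(1 + 1 + 1) = (3 :: ennreal)" by simp
    finally show ?thesis .
  qed
  have ptw: "indicator {0..2} a * cell_weight \<alpha> \<beta> (cell_pos h (x - a)) \<le> (\<Sum>z\<in>Z. g ((x / h - (2 * of_int z + 1)) + (-1/h) * a))" for a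
  proof (cases "a \<in> {0..2}")
    case True
    let ?z = "\<lfloor>(x - a) / (2 * h)\<rfloor>"
    have "?z \<in> Z" using True h by (auto simp: Z_def intro!: floor_mono divide_right_mono)
    have "cell_pos h (x - a) = (x / h - (2 * of_int ?z + 1)) + (-1/h) * a"
      using cell_pos_eq[OF h(1), of "x - a"] by (simp add: diff_divide_distrib)
    moreover have "cell_weight \<alpha> \<beta> (cell_pos h (x - a)) = g (cell_pos h (x - a))"
      using cell_pos_bound[of h "x - a"] by (simp add: g_def indicator_def abs_le_iff)
    ultimately have "indicator {0..2} a * cell_weight \<alpha> \<beta> (cell_pos h (x - a)) = g ((x / h - (2 * of_int ?z + 1)) + (-1/h) * a)"
      using True by simp
    also have "\<dots> \<le> (\<Sum>z\<in>Z. g ((x / h - (2 * of_int z + 1)) + (-1/h) * a))"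
      using \<open>?z \<in> Z\<close> by (intro member_le_sum) (auto simp: Z_def)
    finally show ?thesis .
  qed simp
  have scale_eq: "(\<integral>\<^sup>+a. g (c + (-1/h) * a) \<partial>lborel) = ennreal h * (\<integral>\<^sup>+y. g y \<partial>lborel)" for c
  proof -
    have "(\<integral>\<^sup>+y. g y \<partial>lborel) = ennreal \<bar>-1/h\<bar> * (\<integral>\<^sup>+a. g (c + (-1/h) * a) \<partial>lborel)"
      using h by (intro nn_integral_real_affine) auto
    then have "ennreal h * (\<integral>\<^sup>+y. g y \<partial>lborel) = (ennreal h * ennreal \<bar>-1/h\<bar>) * (\<integral>\<^sup>+a. g (c + (-1/h) * a) \<partial>lborel)"
      by (simp add: mult.assoc)
    also have "ennreal h * ennreal \<bar>-1/h\<bar> = 1" using h by (simp add: ennreal_mult[symmetric])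
    finally show ?thesis by simp
  qed
  \<comment> \<open>Shifts over an interval of length 2 meet at most \<open>1 / h + 2\<close> cells
    of width \<open>2 * h\<close>; multiplied by \<open>h\<close> this is at most 3 since
    \<open>h \<le> 1\<close>.\<close>
  have cardZ: "real (card Z) * h \<le> 3"
  proof -
    have "real (card Z) = of_int (\<lfloor>x / (2 * h)\<rfloor> - \<lfloor>(x - 2) / (2 * h)\<rfloor> + 1)"
    proof -
      have "\<lfloor>(x - 2) / (2 * h)\<rfloor> \<le> \<lfloor>x / (2 * h)\<rfloor>" using h by (intro floor_mono divide_right_mono) auto
      then show ?thesis by (simp add: Z_def)
    qed
    also have "\<dots> \<le> x / (2 * h) - (x - 2) / (2 * h) + 2" by linarith
    also have "\<dots> = 1 / h + 2" by (simp add: diff_divide_distrib[symmetric])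
    finally have "real (card Z) * h \<le> (1 / h + 2) * h" using h by (intro mult_right_mono) auto
    also have "\<dots> = 1 + 2 * h" using h by (simp add: field_simps)
    finally show ?thesis using h by simp
  qed
  have "(\<integral>\<^sup>+a. indicator {0..2} a * cell_weight \<alpha> \<beta> (cell_pos h (x - a)) \<partial>lborel)
     \<le> (\<integral>\<^sup>+a. (\<Sum>z\<in>Z. g ((x / h - (2 * of_int z + 1)) + (-1/h) * a)) \<partial>lborel)"
    by (intro nn_integral_mono ptw)
  also have "\<dots> = (\<Sum>z\<in>Z. \<integral>\<^sup>+a. g ((x / h - (2 * of_int z + 1)) + (-1/h) * a) \<partial>lborel)"
    by (rule nn_integral_sum) measurable
  also have "\<dots> = (\<Sum>z\<in>Z. ennreal h * (\<integral>\<^sup>+y. g y \<partial>lborel))"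
    by (simp only: scale_eq)
  also have "\<dots> = ennreal (real (card Z) * h) * (\<integral>\<^sup>+y. g y \<partial>lborel)"
    using h by (simp add: ennreal_mult ennreal_of_nat_eq_real_of_nat mult.assoc)
  also have "\<dots> \<le> ennreal 3 * (3 * ?K)" using cardZ by (intro mult_mono gK ennreal_leI) auto
  also have "\<dots> = 9 * ?K" by (simp add: mult.assoc[symmetric])
  finally show ?thesis .
qed

subsection \<open>Gluing along a dyadic grid\<close>

definition mesh :: "nat \<Rightarrow> real" where "mesh j = (1/2) ^ j"

lemma mesh_pos: "mesh j > 0" and mesh_le_1: "mesh j \<le> 1" and mesh_Suc: "mesh (Suc j) = mesh j / 2"
  by (auto simp: mesh_def power_le_one)

lemma mesh_antimono: "i \<le> j \<Longrightarrow> mesh j \<le> mesh i"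
  by (auto simp: mesh_def intro: power_decreasing)

lemma mesh_strict_antimono: "i < j \<Longrightarrow> mesh j < mesh i"
  by (auto simp: mesh_def intro: power_strict_decreasing)

lemma mesh_LIMSEQ: "mesh \<longlonglongrightarrow> 0"
  unfolding mesh_def[abs_def] by (intro LIMSEQ_realpow_zero) auto

text \<open>Two layers that contain \<open>t\<close>, half-open on opposite sides. When
  \<open>t\<close> is itself a mesh size they differ, and then the first admits slightly larger
  values and the second slightly smaller ones.\<close>

lemma mesh_layer:
  assumes "0 < t" "t < 1"
  obtains i j where "mesh (Suc i) \<le> t" "t < mesh i" "mesh (Suc j) < t" "t \<le> mesh j"
proof -
  have "\<forall>\<^sub>F m in sequentially. mesh m < t" using order_tendstoD(2)[OF mesh_LIMSEQ assms(1)] .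
  then obtain N where "mesh N < t" by (meson eventually_happens sequentially_bot)
  then have N: "mesh (Suc N) < t" using mesh_antimono[of N "Suc N"] by simp
  define i where "i = (LEAST i. mesh (Suc i) \<le> t)"
  define j where "j = (LEAST i. mesh (Suc i) < t)"
  have i: "mesh (Suc i) \<le> t" unfolding i_def by (rule LeastI[of _ N]) (use N in simp)
  have j: "mesh (Suc j) < t" unfolding j_def by (rule LeastI[of _ N]) (use N in simp)
  have "t < mesh i"
  proof (cases i)
    case 0 then show ?thesis using assms by (simp add: mesh_def)
  next
    case (Suc i') then show ?thesis using not_less_Least[of i' "\<lambda>i. mesh (Suc i) \<le> t"] by (simp add: i_def not_le)
  qed
  moreover have "t \<le> mesh j"
  proof (cases j)
    case 0 then show ?thesis using assms by (simp add: mesh_def)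
  next
    case (Suc j') then show ?thesis using not_less_Least[of j' "\<lambda>i. mesh (Suc i) < t"] by (simp add: j_def not_less)
  qed
  ultimately show thesis using that i j by blast
qed

text \<open>\<open>mesh j\<close> is half of the cell width, so the centres sit at odd multiples of
  \<open>mesh j\<close> from the origin \<open>a\<close> and the faces at even ones. In each
  coordinate, halving the mesh splits the cell \<open>z\<close> into the cells \<open>2 * z\<close>
  and \<open>2 * z + 1\<close>.\<close>

definition cen :: "real^'n \<Rightarrow> nat \<Rightarrow> ('n \<Rightarrow> int) \<Rightarrow> 'n \<Rightarrow> real" where
  "cen a j z i = a $ i + mesh j * (2 * of_int (z i) + 1)"

definition cpos :: "real^'n \<Rightarrow> nat \<Rightarrow> ('n \<Rightarrow> int) \<Rightarrow> real^'n \<Rightarrow> 'n \<Rightarrow> real" where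
  "cpos a j z x i = (x $ i - cen a j z i) / mesh j"

text \<open>The interpolation parameter across a layer: 0 at \<open>t = mesh j\<close>, the border
  to the coarser layer, and 1 at \<open>t = mesh (Suc j)\<close>, the border to the finer
  one.\<close>

definition lev :: "nat \<Rightarrow> real \<Rightarrow> real" where "lev j t = 2 - 2 * t / mesh j"

text \<open>\<open>t\<close> will be the distance from \<open>x\<close> to the boundary, so that the mesh is comparable to it.\<close>
definition valid :: "real^'n \<Rightarrow> nat \<Rightarrow> ('n \<Rightarrow> int) \<Rightarrow> real \<Rightarrow> real^'n \<Rightarrow> bool" where
  "valid a j z t x \<longleftrightarrow> mesh (Suc j) \<le> t \<and> t \<le> mesh j \<and> (\<forall>i. \<bar>cpos a j z x i\<bar> \<le> 1)"

definition scl :: "nat \<Rightarrow> real^'n \<Rightarrow> nat \<Rightarrow> ('n \<Rightarrow> int) \<Rightarrow> real \<Rightarrow> real^'n \<Rightarrow> real" where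
  "scl k a j z t x = cell_scale k (cpos a j z x) (lev j t)"

definition vmap :: "nat \<Rightarrow> real^'n \<Rightarrow> nat \<Rightarrow> ('n \<Rightarrow> int) \<Rightarrow> real \<Rightarrow> real^'n \<Rightarrow> real^'n" where
  "vmap k a j z t x = (\<chi> i. cen a j z i + mesh j * cell_map k (cpos a j z x) (lev j t) i)"

lemma valid_lev: "valid a j z t x \<Longrightarrow> 0 \<le> lev j t \<and> lev j t \<le> 1"
  using mesh_pos[of j] by (auto simp: valid_def lev_def mesh_Suc field_simps)

lemma clip_divide_sign:
  assumes "0 < c" "c \<le> b"
  shows "clip (b / c) = 1" "clip (- b / c) = -1"
  using assms by (auto intro!: clip_simps simp: field_simps)

context
  fixes k :: nat and a :: "real^'n"
  assumes k: "1 \<le> k" "k \<le> CARD('n)"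
begin

lemma scl_bounds: "valid a j z t x \<Longrightarrow> 0 \<le> scl k a j z t x \<and> scl k a j z t x \<le> 1"
  using cell_scale_bounds[OF k, of "cpos a j z x" "lev j t"] valid_lev[of a j z t x] by (auto simp: scl_def valid_def)

lemma scl_pos:
  assumes "valid a j z t x" "scl k a j z t x > 0"
  shows "cell_b k (cpos a j z x) (lev j t) > 0" "cell_c k (cpos a j z x) (lev j t) > 0"
proof -
  have "0 \<le> cell_b k (cpos a j z x) (lev j t)"
    using cell_b_bounds(1)[OF k, of "cpos a j z x" "lev j t"] valid_lev[OF assms(1)] assms(1) by (auto simp: valid_def)
  moreover have "0 \<le> cell_c k (cpos a j z x) (lev j t)" by (rule cell_c_bounds(1)[OF k])
  ultimately show "cell_b k (cpos a j z x) (lev j t) > 0" "cell_c k (cpos a j z x) (lev j t) > 0"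
    using assms(2) unfolding scl_def cell_scale_def by (auto simp: zero_less_mult_iff)
qed

text \<open>Two cells that share \<open>x\<close> see coordinates of equal modulus, so their values
  of \<open>cell_b\<close> and \<open>cell_c\<close> agree. A coordinate in which the cells differ
  sits on the common face, and both formulas fix it there.\<close>

lemma consistent_same_level:
  assumes v: "valid a j z t x" and v': "valid a j z' t x"
  shows "scl k a j z t x = scl k a j z' t x"
    and "scl k a j z t x > 0 \<Longrightarrow> vmap k a j z t x = vmap k a j z' t x"
proof -
  let ?r = "cpos a j z x" and ?r' = "cpos a j z' x" and ?\<beta> = "lev j t"
  have cases: "?r i = ?r' i \<and> z i = z' i \<or> (?r i = 1 \<and> ?r' i = -1 \<and> z' i = z i + 1) \<or> (?r i = -1 \<and> ?r' i = 1 \<and> z i = z' i + 1)" for i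
  proof -
    have b: "\<bar>?r i\<bar> \<le> 1" "\<bar>?r' i\<bar> \<le> 1" using v v' by (auto simp: valid_def)
    have d: "?r i - ?r' i = 2 * of_int (z' i - z i)"
      using mesh_pos[of j] by (simp add: cpos_def cen_def field_simps)
    have "\<bar>2 * real_of_int (z' i - z i)\<bar> \<le> 1 + 1"
      unfolding d[symmetric] by (rule order_trans[OF abs_triangle_ineq4 add_mono[OF b]])
    then have "\<bar>real_of_int (z' i - z i)\<bar> \<le> 1" by (simp add: abs_mult)
    then have "\<bar>z' i - z i\<bar> \<le> 1" by linarith
    then consider "z' i = z i" | "z' i = z i + 1" | "z i = z' i + 1" by linarith
    then show ?thesis
    proof cases
      case 1 then show ?thesis using d by simp
    next
      case 2 then show ?thesis using d b by simp
    next
      case 3 then show ?thesis using d b by simp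
    qed
  qed
  then have abs_eq: "\<bar>?r i\<bar> = \<bar>?r' i\<bar>" for i by (metis abs_1 abs_minus_cancel)
  have b: "cell_b k ?r ?\<beta> = cell_b k ?r' ?\<beta>" by (simp add: cell_b_def abs_eq)
  have s: "\<bar>cell_s k ?r ?\<beta> i\<bar> = \<bar>cell_s k ?r' ?\<beta> i\<bar>" for i
    by (simp add: cell_s_def b clip_abs abs_eq)
  have c: "cell_c k ?r ?\<beta> = cell_c k ?r' ?\<beta>" by (simp add: cell_c_def s)
  show "scl k a j z t x = scl k a j z' t x" by (simp add: scl_def cell_scale_def b c)
  assume pos: "scl k a j z t x > 0"
  note bc = scl_pos[OF v pos]
  have b1: "cell_b k ?r ?\<beta> \<le> 1"
    using cell_b_bounds(2)[OF k, of ?r ?\<beta>] valid_lev[OF v] v by (auto simp: valid_def)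
  have c1: "cell_c k ?r ?\<beta> \<le> 1" by (rule cell_c_bounds(2)[OF k])
  have edge: "cell_map k q ?\<beta> i = 1" if "q i = 1" "cell_b k q ?\<beta> = cell_b k ?r ?\<beta>" "cell_c k q ?\<beta> = cell_c k ?r ?\<beta>" for q i
  proof -
    have "cell_s k q ?\<beta> i = 1" using clip_divide_sign(1)[OF bc(1) b1] that by (simp add: cell_s_def)
    then show ?thesis
      using clip_divide_sign(1)[OF bc(2) c1] clip_divide_sign(1)[OF bc(2), of 3] c1 that by (simp add: cell_map_def)
  qed
  have edge': "cell_map k q ?\<beta> i = -1" if "q i = -1" "cell_b k q ?\<beta> = cell_b k ?r ?\<beta>" "cell_c k q ?\<beta> = cell_c k ?r ?\<beta>" for q i
  proof -
    have "cell_s k q ?\<beta> i = -1" using clip_divide_sign(2)[OF bc(1) b1] that by (simp add: cell_s_def)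
    then show ?thesis
      using clip_divide_sign(2)[OF bc(2) c1] clip_divide_sign(2)[OF bc(2), of 3] c1 that by (simp add: cell_map_def)
  qed
  have "cen a j z i + mesh j * cell_map k ?r ?\<beta> i = cen a j z' i + mesh j * cell_map k ?r' ?\<beta> i" for i
    using cases[of i]
  proof (elim disjE conjE)
    assume e: "?r i = ?r' i" "z i = z' i"
    have "cell_map k ?r ?\<beta> i = cell_map k ?r' ?\<beta> i" by (simp add: cell_map_def cell_s_def b c e)
    then show ?thesis using e by (simp add: cen_def)
  next
    assume "?r i = 1" "?r' i = -1" "z' i = z i + 1"
    then show ?thesis using edge[of ?r i] edge'[of ?r' i] b c by (simp add: cen_def algebra_simps)
  next
    assume "?r i = -1" "?r' i = 1" "z i = z' i + 1"
    then show ?thesis using edge'[of ?r i] edge[of ?r' i] b c by (simp add: cen_def algebra_simps)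
  qed
  then show "vmap k a j z t x = vmap k a j z' t x" by (simp add: vmap_def)
qed

text \<open>On the interface the coarse layer has \<open>\<beta> = 1\<close>, hence only the
  projection for the subdivision is left, and the finer layer has \<open>\<beta> = 0\<close>, hence
  the projection for its own grid. These are the same map.\<close>

lemma consistent_next_level:
  assumes v: "valid a j z t x" and t: "t = mesh (Suc j)"
  obtains z' where "valid a (Suc j) z' t x" "scl k a j z t x = scl k a (Suc j) z' t x"
    "scl k a j z t x > 0 \<Longrightarrow> vmap k a j z t x = vmap k a (Suc j) z' t x"
proof -
  let ?r = "cpos a j z x"
  define z' where "z' i = (if ?r i \<ge> 0 then 2 * z i + 1 else 2 * z i)" for i
  let ?r' = "cpos a (Suc j) z' x"
  have r1: "\<bar>?r i\<bar> \<le> 1" for i using v by (auto simp: valid_def)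
  have r': "?r' i = (if ?r i \<ge> 0 then 2 * ?r i - 1 else 2 * ?r i + 1)" for i
    using mesh_pos[of j] by (auto simp: z'_def cpos_def cen_def mesh_Suc field_simps)
  have ab: "\<bar>?r' i\<bar> = \<bar>2 * \<bar>?r i\<bar> - 1\<bar>" for i unfolding r' by auto
  have l: "lev j t = 1" "lev (Suc j) t = 0" using mesh_pos[of j] by (auto simp: lev_def t mesh_Suc)
  have 1: "valid a (Suc j) z' t x"
  proof -
    have "\<bar>?r' i\<bar> \<le> 1" for i using ab[of i] r1[of i] by linarith
    then show ?thesis using t mesh_pos[of "Suc j"] by (auto simp: valid_def mesh_Suc[of "Suc j"])
  qed
  have sc: "scl k a j z t x = ksmall k (\<lambda>i. \<bar>2 * \<bar>?r i\<bar> - 1\<bar>)"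
    unfolding scl_def l by (rule cell_beta_1(3)[OF k r1])
  have sc': "scl k a (Suc j) z' t x = ksmall k (\<lambda>i. \<bar>2 * \<bar>?r i\<bar> - 1\<bar>)"
    unfolding scl_def l cell_scale_beta_0[OF k] by (simp add: ab)
  have 2: "vmap k a j z t x = vmap k a (Suc j) z' t x" if pos: "scl k a j z t x > 0"
  proof -
    let ?c = "ksmall k (\<lambda>i. \<bar>2 * \<bar>?r i\<bar> - 1\<bar>)"
    have c: "cell_c k ?r 1 = ?c" using sc cell_beta_1(1)[OF k r1] unfolding scl_def l cell_scale_def by simp
    have c0: "?c > 0" using pos sc by simp
    have c1: "?c \<le> 1" using cell_c_bounds(2)[OF k, of ?r 1] c by simp
    have "cen a j z i + mesh j * cell_map k ?r 1 i = cen a (Suc j) z' i + mesh (Suc j) * cell_map k ?r' 0 i" for i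
    proof -
      have m: "cell_map k ?r 1 i = (clip ((2 * ?r i - 1) / ?c) + clip ((2 * ?r i + 1) / ?c)) / 2"
        using cell_beta_1(2)[OF k r1] by (simp add: cell_map_def c)
      have m': "cell_map k ?r' 0 i = clip (?r' i / ?c)"
        using cell_map_beta_0[OF k, of ?r' i] c0 by (simp add: ab)
      show ?thesis
      proof (cases "?r i \<ge> 0")
        case True
        then have "clip ((2 * ?r i + 1) / ?c) = 1" using c0 c1 by (intro clip_divide_sign) auto
        then show ?thesis unfolding m m' r' using True by (simp add: cen_def z'_def mesh_Suc field_simps)
      next
        case False
        then have "clip (- (1 - 2 * ?r i) / ?c) = -1" using c0 c1 by (intro clip_divide_sign) auto
        then have "clip ((2 * ?r i - 1) / ?c) = -1" by simp
        then show ?thesis unfolding m m' r' using False by (simp add: cen_def z'_def mesh_Suc field_simps)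
      qed
    qed
    then show ?thesis by (simp add: vmap_def l)
  qed
  show thesis using that[OF 1 _ 2] sc sc' by simp
qed

lemma consistent:
  assumes v: "valid a j z t x" and v': "valid a j' z' t x"
  shows "scl k a j z t x = scl k a j' z' t x"
    and "scl k a j z t x > 0 \<Longrightarrow> vmap k a j z t x = vmap k a j' z' t x"
proof -
  have *: "scl k a j z t x = scl k a j' z' t x \<and> (scl k a j z t x > 0 \<longrightarrow> vmap k a j z t x = vmap k a j' z' t x)"
    if v: "valid a j z t x" and v': "valid a j' z' t x" and le: "j \<le> j'" for j z j' z'
  proof (cases "j = j'")
    case True
    then show ?thesis using consistent_same_level[of j z t x z'] v v' by auto
  next
    case False
    \<comment> \<open>Layers are closed intervals of distances; two different ones that share
      \<open>t\<close> must be adjacent, with \<open>t\<close> as the common endpoint.\<close>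
    have "\<not> Suc j < j'" using v v' mesh_strict_antimono[of "Suc j" j'] by (auto simp: valid_def)
    with False le have j': "j' = Suc j" by simp
    have t: "t = mesh (Suc j)" using v v' j' by (auto simp: valid_def)
    obtain z'' where z'': "valid a (Suc j) z'' t x" "scl k a j z t x = scl k a (Suc j) z'' t x"
      "scl k a j z t x > 0 \<Longrightarrow> vmap k a j z t x = vmap k a (Suc j) z'' t x"
      using consistent_next_level[OF v t] by blast
    show ?thesis using consistent_same_level[OF z''(1), of z'] v' z'' unfolding j' by auto
  qed
  show "scl k a j z t x = scl k a j' z' t x"
    using *[OF v v'] *[OF v' v] by (cases "j \<le> j'") auto
  show "scl k a j z t x > 0 \<Longrightarrow> vmap k a j z t x = vmap k a j' z' t x"
    using *[OF v v'] *[OF v' v] by (cases "j \<le> j'") auto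
qed

lemma cpos_lipschitz: "\<bar>cpos a j z y i - cpos a j z x i\<bar> \<le> norm (y - x) / mesh j"
proof -
  have "cpos a j z y i - cpos a j z x i = ((y - x) $ i) / mesh j"
    by (simp add: cpos_def diff_divide_distrib[symmetric])
  then show ?thesis
    using component_le_norm_cart[of "y - x" i] mesh_pos[of j] by (simp add: abs_divide divide_right_mono)
qed

text \<open>With \<open>d = norm (y - x) / mesh j\<close> the position moves by at most
  \<open>d\<close> and the parameter by at most \<open>e = 2 * d\<close>. The cell estimates give
  \<open>5 * d + 3 * e = 11 * d\<close> and \<open>4 * (2 * d + e) = 16 * d\<close>; for
  \<open>vmap\<close> the outer factor \<open>mesh j\<close> cancels the one in
  \<open>d\<close>.\<close>

lemma valid_lipschitz:
  assumes v: "valid a j z t x" and v': "valid a j z t' y" and t: "\<bar>t' - t\<bar> \<le> norm (y - x)"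
  shows "\<bar>scl k a j z t' y - scl k a j z t x\<bar> \<le> 11 * (norm (y - x) / mesh j)"
    and "scl k a j z t x > 0 \<Longrightarrow> \<bar>vmap k a j z t' y $ i - vmap k a j z t x $ i\<bar> \<le> 16 * norm (y - x) / scl k a j z t x"
proof -
  let ?d = "norm (y - x) / mesh j"
  have l: "\<bar>lev j t' - lev j t\<bar> \<le> 2 * ?d"
  proof -
    have "lev j t' - lev j t = - (2 * ((t' - t) / mesh j))" by (simp add: lev_def right_diff_distrib diff_divide_distrib)
    then have "\<bar>lev j t' - lev j t\<bar> = 2 * (\<bar>t' - t\<bar> / mesh j)" using mesh_pos[of j]
      by (simp only: abs_minus_cancel abs_mult abs_divide)
    also have "\<dots> \<le> 2 * ?d" using t mesh_pos[of j] by (intro mult_left_mono divide_right_mono) auto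
    finally show ?thesis .
  qed
  have b: "cell_b k (cpos a j z x) (lev j t) \<ge> 0" "cell_b k (cpos a j z y) (lev j t') \<ge> 0"
    using cell_b_bounds(1)[OF k, of "cpos a j z x" "lev j t"] cell_b_bounds(1)[OF k, of "cpos a j z y" "lev j t'"]
      valid_lev[OF v] valid_lev[OF v'] v v' by (auto simp: valid_def)
  have "\<bar>scl k a j z t' y - scl k a j z t x\<bar> \<le> 5 * ?d + 3 * (2 * ?d)"
    unfolding scl_def by (rule cell_scale_lipschitz[OF k cpos_lipschitz l b])
  then show "\<bar>scl k a j z t' y - scl k a j z t x\<bar> \<le> 11 * ?d" by simp
  assume pos: "scl k a j z t x > 0"
  note bc = scl_pos[OF v pos]
  have "\<bar>cell_map k (cpos a j z y) (lev j t') i - cell_map k (cpos a j z x) (lev j t) i\<bar> \<le> 4 * (2 * ?d + 2 * ?d) / scl k a j z t x"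
    unfolding scl_def by (rule cell_map_lipschitz[OF k cpos_lipschitz l bc(1) b(2) bc(2)])
  then have "mesh j * \<bar>cell_map k (cpos a j z y) (lev j t') i - cell_map k (cpos a j z x) (lev j t) i\<bar> \<le> mesh j * (4 * (2 * ?d + 2 * ?d) / scl k a j z t x)"
    using mesh_pos[of j] by (intro mult_left_mono) auto
  also have "\<dots> = 16 * norm (y - x) / scl k a j z t x" using mesh_pos[of j] by (simp add: field_simps)
  also have "mesh j * \<bar>cell_map k (cpos a j z y) (lev j t') i - cell_map k (cpos a j z x) (lev j t) i\<bar>
     = \<bar>vmap k a j z t' y $ i - vmap k a j z t x $ i\<bar>"
    using mesh_pos[of j] by (simp add: vmap_def right_diff_distrib[symmetric] abs_mult)
  finally show "\<bar>vmap k a j z t' y $ i - vmap k a j z t x $ i\<bar> \<le> 16 * norm (y - x) / scl k a j z t x" .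
qed

text \<open>Points move only inside their cell, whose width \<open>2 * mesh j\<close> is at most
  \<open>4 * t\<close>. This is what makes the displacement vanish at the sphere.\<close>

lemma vmap_close:
  assumes "valid a j z t x"
  shows "\<bar>vmap k a j z t x $ i - x $ i\<bar> \<le> 4 * t"
proof -
  have "vmap k a j z t x $ i - x $ i = mesh j * (cell_map k (cpos a j z x) (lev j t) i - cpos a j z x i)"
    using mesh_pos[of j] by (simp add: vmap_def cpos_def field_simps)
  also have "\<bar>\<dots>\<bar> \<le> mesh j * 2"
  proof -
    have "\<bar>cpos a j z x i\<bar> \<le> 1" using assms by (simp add: valid_def)
    then have "\<bar>cell_map k (cpos a j z x) (lev j t) i - cpos a j z x i\<bar> \<le> 2"
      using cell_map_bound[OF k, of "cpos a j z x" "lev j t" i] by linarith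
    then show ?thesis unfolding abs_mult using mesh_pos[of j] by (intro mult_mono) auto
  qed
  also have "\<dots> \<le> 4 * t" using assms by (simp add: valid_def mesh_Suc)
  finally show ?thesis .
qed

end

lemma eventually_common_unit_interval:
  fixes u :: real
  shows "\<forall>\<^sub>F v in nhds u. \<exists>z::int. of_int z \<le> u \<and> u \<le> of_int z + 1 \<and> of_int z \<le> v \<and> v \<le> of_int z + 1"
proof -
  have "\<forall>\<^sub>F v in nhds u. v \<in> {of_int (\<lceil>u\<rceil> - 1) <..< of_int (\<lfloor>u\<rfloor> + 1)}"
    by (rule eventually_nhds_in_open) (auto, linarith+)
  then show ?thesis
  proof (rule eventually_mono)
    fix v :: real assume v: "v \<in> {of_int (\<lceil>u\<rceil> - 1) <..< of_int (\<lfloor>u\<rfloor> + 1)}"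
    show "\<exists>z::int. of_int z \<le> u \<and> u \<le> of_int z + 1 \<and> of_int z \<le> v \<and> v \<le> of_int z + 1"
    proof (cases "v \<ge> u")
      case True
      then show ?thesis using v by (intro exI[of _ "\<lfloor>u\<rfloor>"]) (auto, linarith+)
    next
      case False
      then show ?thesis using v by (intro exI[of _ "\<lceil>u\<rceil> - 1"]) (auto, linarith+)
    qed
  qed
qed

lemma cpos_le_1_iff:
  "\<bar>cpos a j z x i\<bar> \<le> 1 \<longleftrightarrow> of_int (z i) \<le> (x $ i - a $ i) / (2 * mesh j) \<and> (x $ i - a $ i) / (2 * mesh j) \<le> of_int (z i) + 1"
  using mesh_pos[of j] by (auto simp: cpos_def cen_def abs_le_iff field_simps)

text \<open>Every point near \<open>x\<close> shares some closed cell and layer with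
  \<open>x\<close>, although not always the same one. So a single formula covers each pair, and the
  estimates inside one cell become local estimates for the glued map, also at points on faces and
  interfaces.\<close>

lemma eventually_common_valid:
  fixes T :: "real^'n \<Rightarrow> real"
  assumes T: "continuous_on UNIV T" and Tx: "0 < T x" "T x < 1"
  shows "\<forall>\<^sub>F y in nhds x. \<exists>j z. valid a j z (T x) x \<and> valid a j z (T y) y"
proof -
  obtain j1 j2 where j: "mesh (Suc j1) \<le> T x" "T x < mesh j1" "mesh (Suc j2) < T x" "T x \<le> mesh j2"
    using mesh_layer[OF Tx] by metis
  have near: "\<forall>\<^sub>F y in nhds x. y \<in> {y. mesh (Suc j2) < T y} \<inter> {y. T y < mesh j1}"
    using j T by (intro eventually_nhds_in_open open_Int open_Collect_less continuous_intros) auto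
  have cells: "\<forall>\<^sub>F y in nhds x. \<forall>i. \<exists>z::int. of_int z \<le> (x $ i - a $ i) / (2 * mesh j) \<and> (x $ i - a $ i) / (2 * mesh j) \<le> of_int z + 1
     \<and> of_int z \<le> (y $ i - a $ i) / (2 * mesh j) \<and> (y $ i - a $ i) / (2 * mesh j) \<le> of_int z + 1" for j
  proof (rule eventually_all_finite)
    fix i
    have "isCont (\<lambda>y. (y $ i - a $ i) / (2 * mesh j)) x" using mesh_pos[of j] by (intro continuous_intros) auto
    then have "filterlim (\<lambda>y. (y $ i - a $ i) / (2 * mesh j)) (nhds ((x $ i - a $ i) / (2 * mesh j))) (nhds x)"
      by (simp add: isCont_def tendsto_nhds_iff)
    from filterlim_iff[THEN iffD1, OF this, rule_format, OF eventually_common_unit_interval]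
    show "\<forall>\<^sub>F y in nhds x. \<exists>z::int. of_int z \<le> (x $ i - a $ i) / (2 * mesh j) \<and> (x $ i - a $ i) / (2 * mesh j) \<le> of_int z + 1
     \<and> of_int z \<le> (y $ i - a $ i) / (2 * mesh j) \<and> (y $ i - a $ i) / (2 * mesh j) \<le> of_int z + 1" .
  qed
  show ?thesis
    using near cells[of j1] cells[of j2]
  proof eventually_elim
    case (elim y)
    \<comment> \<open>Points farther inside need the layer that reaches above \<open>T x\<close>,
      points closer to the sphere the one that reaches below it.\<close>
    define j where "j = (if T y \<ge> T x then j1 else j2)"
    have "\<forall>i. \<exists>z::int. of_int z \<le> (x $ i - a $ i) / (2 * mesh j) \<and> (x $ i - a $ i) / (2 * mesh j) \<le> of_int z + 1
     \<and> of_int z \<le> (y $ i - a $ i) / (2 * mesh j) \<and> (y $ i - a $ i) / (2 * mesh j) \<le> of_int z + 1"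
      using elim by (simp add: j_def)
    from choice[OF this] obtain z :: "'n \<Rightarrow> int" where z: "\<And>i. \<bar>cpos a j z x i\<bar> \<le> 1" "\<And>i. \<bar>cpos a j z y i\<bar> \<le> 1"
      unfolding cpos_le_1_iff by blast
    have "mesh (Suc j) \<le> T x \<and> T x \<le> mesh j \<and> mesh (Suc j) \<le> T y \<and> T y \<le> mesh j"
      using \<open>mesh (Suc j1) \<le> T x\<close> \<open>T x < mesh j1\<close> \<open>mesh (Suc j2) < T x\<close> \<open>T x \<le> mesh j2\<close> elim
      by (auto simp: j_def)
    with z show "\<exists>j z. valid a j z (T x) x \<and> valid a j z (T y) y"
      unfolding valid_def by blast
  qed
qed

subsection \<open>The displacement field on a ball\<close>

lemma rank_le_card_nonzero_rows:
  fixes M :: "real^'n^'m"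
  shows "rank M \<le> card {i. M $ i \<noteq> 0}"
proof -
  have "rows M \<subseteq> insert 0 ((\<lambda>i. M $ i) ` {i. M $ i \<noteq> 0})"
    by (auto simp: rows_def row_def image_iff)
  also have "\<dots> \<subseteq> span ((\<lambda>i. M $ i) ` {i. M $ i \<noteq> 0})"
    by (auto intro: span_base span_zero)
  finally have "dim (rows M) \<le> card ((\<lambda>i. M $ i) ` {i. M $ i \<noteq> 0})"
    by (rule dim_le_card) simp
  also have "\<dots> \<le> card {i. M $ i \<noteq> 0}" by (rule card_image_le) simp
  finally show ?thesis by (simp add: row_rank_def)
qed

lemma ae_diff_vec:
  fixes f :: "'i::finite \<Rightarrow> 'a::euclidean_space \<Rightarrow> real"
  assumes "\<And>i. ae_diff U (f i)"
  shows "ae_diff U (\<lambda>x. (\<chi> i. f i x) :: real^'i)"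
proof -
  have "ae_diff U (\<lambda>x. \<Sum>i\<in>I. f i x *\<^sub>R (axis i 1 :: real^'i))" if "finite I" for I
    using that
  proof (induction I rule: finite_induct)
    case (insert i I)
    then show ?case by (auto intro!: ae_diff_add ae_diff_scaleR assms)
  qed simp
  from this[of UNIV] have "ae_diff U (\<lambda>x. \<Sum>i\<in>UNIV. f i x *\<^sub>R (axis i 1 :: real^'i))" by simp
  moreover have "(\<Sum>i\<in>UNIV. f i x *\<^sub>R (axis i 1 :: real^'i)) = (\<chi> i. f i x)" for x
    using basis_expansion[of "\<chi> i. f i x"] by (simp add: scalar_mult_eq_scaleR)
  ultimately show ?thesis by (simp only:)
qed

lemma norm_le_card_max:
  fixes v :: "real^'n"
  assumes "\<And>i. \<bar>v $ i\<bar> \<le> K"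
  shows "norm v \<le> real CARD('n) * K"
proof -
  have "norm v \<le> (\<Sum>i\<in>UNIV. \<bar>v $ i\<bar>)" by (rule norm_le_l1_cart)
  also have "\<dots> \<le> (\<Sum>i\<in>(UNIV::'n set). K)" by (intro sum_mono assms)
  finally show ?thesis by simp
qed

lemma countable_index: "countable (UNIV :: ('n::finite \<times> nat \<times> int) set)"
proof -
  have "countable ((UNIV :: 'n set) \<times> (UNIV :: (nat \<times> int) set))"
    by (intro countable_SIGMA countable_finite[OF finite] countableI_type)
  then show ?thesis by simp
qed

definition bdist :: "'a::metric_space \<Rightarrow> real \<Rightarrow> 'a \<Rightarrow> real" where "bdist x0 \<rho> x = \<rho> - dist x0 x"

text \<open>A point on the boundary of a cell lies in several cells; by \<open>consistent\<close> the choice does not matter.\<close>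
definition sel_scl :: "nat \<Rightarrow> real^'n \<Rightarrow> real^'n \<Rightarrow> real \<Rightarrow> real^'n \<Rightarrow> real" where
  "sel_scl k a x0 \<rho> x = (let (j, z) = (SOME (j, z). valid a j z (bdist x0 \<rho> x) x) in scl k a j z (bdist x0 \<rho> x) x)"

definition sel_vmap :: "nat \<Rightarrow> real^'n \<Rightarrow> real^'n \<Rightarrow> real \<Rightarrow> real^'n \<Rightarrow> real^'n" where
  "sel_vmap k a x0 \<rho> x = (let (j, z) = (SOME (j, z). valid a j z (bdist x0 \<rho> x) x) in vmap k a j z (bdist x0 \<rho> x) x)"

text \<open>The factor \<open>bdist\<close> makes this vanish at the sphere as well as at the
  singular points, and it compensates the Lipschitz constant of order \<open>1 / mesh j\<close> of
  the cell scale. The gradient of the displacement is of order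
  \<open>bdist / reg_scale\<close>.\<close>

definition reg_scale :: "nat \<Rightarrow> real^'n \<Rightarrow> real^'n \<Rightarrow> real \<Rightarrow> real^'n \<Rightarrow> real" where
  "reg_scale k a x0 \<rho> x = (if bdist x0 \<rho> x > 0 then bdist x0 \<rho> x * sel_scl k a x0 \<rho> x else 0)"

text \<open>At singular points the different cell formulas need not agree, so the value there is set
  to 0; for a good shift these points form a null set.\<close>

definition displ :: "nat \<Rightarrow> real^'n \<Rightarrow> real^'n \<Rightarrow> real \<Rightarrow> real^'n \<Rightarrow> real^'n" where
  "displ k a x0 \<rho> x = (if reg_scale k a x0 \<rho> x > 0 then sel_vmap k a x0 \<rho> x - x else 0)"

lemma bdist_lipschitz: "\<bar>bdist x0 \<rho> y - bdist x0 \<rho> x\<bar> \<le> norm (y - x)" for x y :: "'a::real_normed_vector"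
  using dist_triangle2[of x0 y x] dist_triangle2[of x0 x y] by (simp add: bdist_def dist_norm norm_minus_commute abs_le_iff)

lemma continuous_on_bdist: "continuous_on S (bdist x0 \<rho>)"
  unfolding bdist_def[abs_def] by (intro continuous_intros)

context
  fixes k :: nat and a x0 :: "real^'n" and \<rho> :: real
  assumes k: "1 \<le> k" "k \<le> CARD('n)" and \<rho>: "\<rho> < 1"
begin

private abbreviation "T \<equiv> bdist x0 \<rho>"
private abbreviation "\<sigma> \<equiv> reg_scale k a x0 \<rho>"
private abbreviation "w \<equiv> displ k a x0 \<rho>"

lemma T_less_1: "T x < 1" using \<rho> zero_le_dist[of x0 x] by (simp add: bdist_def del: zero_le_dist)

lemma sel_eq:
  assumes v: "valid a j z (T x) x"
  shows "sel_scl k a x0 \<rho> x = scl k a j z (T x) x"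
    "scl k a j z (T x) x > 0 \<Longrightarrow> sel_vmap k a x0 \<rho> x = vmap k a j z (T x) x"
proof -
  obtain j' z' where e: "(SOME (j, z). valid a j z (T x) x) = (j', z')" by fastforce
  have "case (j', z') of (j, z) \<Rightarrow> valid a j z (T x) x"
    unfolding e[symmetric] by (rule someI[of _ "(j, z)"]) (use v in simp)
  then have v': "valid a j' z' (T x) x" by simp
  show "sel_scl k a x0 \<rho> x = scl k a j z (T x) x"
    unfolding sel_scl_def e using consistent(1)[OF k v v'] by simp
  show "scl k a j z (T x) x > 0 \<Longrightarrow> sel_vmap k a x0 \<rho> x = vmap k a j z (T x) x"
    unfolding sel_vmap_def e using consistent(2)[OF k v v'] by simp
qed

lemma obtain_valid:
  assumes "T x > 0"
  obtains j z where "valid a j z (T x) x"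
  using eventually_nhds_x_imp_x[OF eventually_common_valid[OF continuous_on_bdist[of UNIV x0 \<rho>] assms T_less_1, of a]] by blast

lemma sel_scl_bounds: "T x > 0 \<Longrightarrow> 0 \<le> sel_scl k a x0 \<rho> x \<and> sel_scl k a x0 \<rho> x \<le> 1"
  using obtain_valid[of x] scl_bounds[OF k] sel_eq(1) by metis

lemma reg_scale_props: "\<sigma> x \<ge> 0" "\<sigma> x > 0 \<Longrightarrow> T x > 0" "\<sigma> x > 0 \<Longrightarrow> sel_scl k a x0 \<rho> x > 0" "\<sigma> x > 0 \<Longrightarrow> sel_scl k a x0 \<rho> x = \<sigma> x / T x"
  "T x > 0 \<Longrightarrow> \<sigma> x = T x * sel_scl k a x0 \<rho> x"
  using sel_scl_bounds[of x] by (auto simp: reg_scale_def zero_less_mult_iff split: if_splits)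

text \<open>Product rule: the cell scale is at most 1, and its Lipschitz constant
  \<open>11 / mesh j\<close> is multiplied by \<open>T x \<le> mesh j\<close>, so
  \<open>12 = 1 + 11\<close>. If \<open>T x \<le> 0\<close>, then \<open>\<sigma> x = 0\<close>, and
  \<open>\<sigma> y\<close> is at most the positive part of \<open>T y\<close>.\<close>

lemma reg_scale_lipschitz: "\<forall>\<^sub>F y in nhds x. \<bar>\<sigma> y - \<sigma> x\<bar> \<le> 12 * norm (y - x)"
proof (cases "T x > 0")
  case True
  show ?thesis
    using eventually_common_valid[OF continuous_on_bdist[of UNIV x0 \<rho>] True T_less_1, of a]
  proof eventually_elim
    case (elim y)
    then obtain j z where v: "valid a j z (T x) x" and v': "valid a j z (T y) y" by blast
    have Ty: "T y > 0" using v' mesh_pos[of "Suc j"] by (auto simp: valid_def)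
    let ?s = "scl k a j z (T x) x" and ?s' = "scl k a j z (T y) y"
    have ss: "\<bar>?s' - ?s\<bar> \<le> 11 * (norm (y - x) / mesh j)" by (rule valid_lipschitz(1)[OF k v v' bdist_lipschitz])
    have "\<sigma> y - \<sigma> x = (T y - T x) * ?s' + T x * (?s' - ?s)"
      using reg_scale_props(5)[OF True] reg_scale_props(5)[OF Ty] sel_eq(1)[OF v] sel_eq(1)[OF v'] by (simp add: algebra_simps)
    then have "\<bar>\<sigma> y - \<sigma> x\<bar> \<le> \<bar>(T y - T x) * ?s'\<bar> + \<bar>T x * (?s' - ?s)\<bar>" by (simp only: abs_triangle_ineq)
    also have "\<bar>(T y - T x) * ?s'\<bar> \<le> norm (y - x) * 1"
      unfolding abs_mult using bdist_lipschitz[of x0 \<rho> y x] scl_bounds[OF k v'] by (intro mult_mono) auto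
    also have "\<bar>T x * (?s' - ?s)\<bar> \<le> mesh j * (11 * (norm (y - x) / mesh j))"
      unfolding abs_mult using ss v True mesh_pos[of j] by (intro mult_mono) (auto simp: valid_def)
    also have "\<dots> = 11 * norm (y - x)" using mesh_pos[of j] by simp
    finally show ?case by simp
  qed
next
  case False
  have "\<bar>\<sigma> y - \<sigma> x\<bar> \<le> 12 * norm (y - x)" for y
  proof -
    have "0 \<le> \<sigma> y" by (rule reg_scale_props)
    moreover have "\<sigma> y \<le> norm (y - x)"
    proof (cases "T y > 0")
      case True
      then have "\<sigma> y \<le> T y * 1" using sel_scl_bounds[OF True] reg_scale_props(5)[OF True] by (auto intro: mult_left_mono)
      then show ?thesis using False bdist_lipschitz[of x0 \<rho> y x] by linarith
    qed (simp add: reg_scale_def)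
    moreover have "\<sigma> x = 0" using False by (simp add: reg_scale_def)
    ultimately show ?thesis using norm_ge_zero[of "y - x"] by linarith
  qed
  then show ?thesis by (simp add: always_eventually)
qed

lemma continuous_reg_scale: "continuous_on UNIV \<sigma>"
  using reg_scale_lipschitz by (intro pointwise_lipschitz_imp_continuous[of \<sigma> 12]) simp

lemma reg_scale_eventually_pos: "\<sigma> x > 0 \<Longrightarrow> \<forall>\<^sub>F y in nhds x. \<sigma> y > 0"
  using eventually_nhds_in_open[of "{y. \<sigma> y > 0}" x] continuous_reg_scale by (auto simp: open_Collect_less)

lemma displ_valid:
  assumes "\<sigma> x > 0" "valid a j z (T x) x"
  shows "w x = vmap k a j z (T x) x - x" "scl k a j z (T x) x > 0"
proof -
  show p: "scl k a j z (T x) x > 0" using reg_scale_props(3)[OF assms(1)] sel_eq(1)[OF assms(2)] by simp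
  show "w x = vmap k a j z (T x) x - x" using sel_eq(2)[OF assms(2) p] assms(1) by (simp add: displ_def)
qed

lemma displ_bound:
  assumes "\<sigma> x > 0"
  shows "norm (w x) \<le> real CARD('n) * (4 * T x)"
proof -
  obtain j z where v: "valid a j z (T x) x" using obtain_valid[OF reg_scale_props(2)[OF assms]] by blast
  show ?thesis
    unfolding displ_valid(1)[OF assms v] using vmap_close[OF k v] by (intro norm_le_card_max) simp
qed

text \<open>The constant is \<open>17 = 16 + 1\<close>: 16 from \<open>valid_lipschitz\<close> and 1
  from the subtracted identity, which is absorbed because the scale is at most 1.\<close>

lemma displ_lipschitz:
  assumes pos: "\<sigma> x > 0"
  shows "\<forall>\<^sub>F y in nhds x. norm (w y - w x) \<le> (17 * real CARD('n) / sel_scl k a x0 \<rho> x) * norm (y - x)"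
  using eventually_common_valid[OF continuous_on_bdist[of UNIV x0 \<rho>] reg_scale_props(2)[OF pos] T_less_1, of a] reg_scale_eventually_pos[OF pos]
proof eventually_elim
  case (elim y)
  then obtain j z where v: "valid a j z (T x) x" and v': "valid a j z (T y) y" by blast
  let ?s = "scl k a j z (T x) x"
  have s: "?s > 0" "?s \<le> 1" using displ_valid(2)[OF pos v] scl_bounds[OF k v] by auto
  have "norm (w y - w x) \<le> real CARD('n) * (17 / ?s * norm (y - x))"
  proof (rule norm_le_card_max)
    fix i
    have "(w y - w x) $ i = (vmap k a j z (T y) y $ i - vmap k a j z (T x) x $ i) - (y - x) $ i"
      unfolding displ_valid(1)[OF pos v] displ_valid(1)[OF elim(2) v'] by simp
    then have "\<bar>(w y - w x) $ i\<bar> \<le> \<bar>vmap k a j z (T y) y $ i - vmap k a j z (T x) x $ i\<bar> + \<bar>(y - x) $ i\<bar>"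
      by (simp only: abs_triangle_ineq4)
    also have "\<dots> \<le> 16 * norm (y - x) / ?s + norm (y - x) / ?s"
    proof (rule add_mono)
      show "\<bar>vmap k a j z (T y) y $ i - vmap k a j z (T x) x $ i\<bar> \<le> 16 * norm (y - x) / ?s"
        by (rule valid_lipschitz(2)[OF k v v' bdist_lipschitz s(1)])
      have "\<bar>(y - x) $ i\<bar> \<le> norm (y - x)" by (rule component_le_norm_cart)
      also have "\<dots> \<le> norm (y - x) / ?s" using s by (simp add: field_simps mult_left_le)
      finally show "\<bar>(y - x) $ i\<bar> \<le> norm (y - x) / ?s" .
    qed
    also have "\<dots> = 17 / ?s * norm (y - x)" by (simp add: add_divide_distrib[symmetric])
    finally show "\<bar>(w y - w x) $ i\<bar> \<le> 17 / ?s * norm (y - x)" .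
  qed
  then show ?case by (simp add: sel_eq(1)[OF v] ac_simps)
qed

text \<open>The centre, where the distance is not differentiable, the interfaces between layers, and
  the faces of all grids. Off this set a point of the ball is interior to its cell and layer, so one
  formula holds in a neighbourhood (\<open>good_point\<close>).\<close>

definition bad_set :: "(real^'n) set" where
  "bad_set = {x0} \<union> (\<Union>j. sphere x0 (\<rho> - mesh j)) \<union> (\<Union>(i, j, z)\<in>UNIV. {x. x $ i = a $ i + mesh j * of_int z})"

lemma negligible_bad_set: "negligible bad_set"
proof -
  have "negligible {x. x $ i = a $ i + mesh j * of_int z}" for i j and z :: int
    using negligible_standard_hyperplane[of "axis i (1::real)" "a $ i + mesh j * of_int z"]
    by (simp add: axis_in_Basis_iff inner_axis)
  moreover have "countable (UNIV :: ('n \<times> nat \<times> int) set)" by (rule countable_index)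
  ultimately have "negligible (\<Union>(i, j, z)\<in>UNIV. {x. x $ i = a $ i + mesh j * of_int z})"
    by (intro negligible_countable_Union) auto
  moreover have "negligible (\<Union>j. sphere x0 (\<rho> - mesh j))"
    by (intro negligible_countable_Union) (auto simp: negligible_sphere)
  ultimately show ?thesis unfolding bad_set_def by (intro negligible_Un) auto
qed

lemma good_point:
  assumes x: "x \<notin> bad_set" and pos: "T x > 0"
  obtains j z where "valid a j z (T x) x" "\<forall>\<^sub>F y in nhds x. valid a j z (T y) y"
proof -
  obtain j z where v: "valid a j z (T x) x" using obtain_valid[OF pos] by blast
  have neq: "T x \<noteq> mesh m" for m
  proof
    assume "T x = mesh m"
    then have "x \<in> sphere x0 (\<rho> - mesh m)" by (simp add: bdist_def)
    with x show False by (auto simp: bad_set_def)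
  qed
  then have t: "mesh (Suc j) < T x" "T x < mesh j" using v neq[of j] neq[of "Suc j"] neq[of "Suc j", symmetric] by (auto simp: valid_def less_le)
  have c: "\<bar>cpos a j z x i\<bar> < 1" for i
  proof -
    have "\<bar>cpos a j z x i\<bar> \<noteq> 1"
    proof
      assume "\<bar>cpos a j z x i\<bar> = 1"
      then have "x $ i = a $ i + mesh j * of_int (2 * z i + 1 + 1) \<or> x $ i = a $ i + mesh j * of_int (2 * z i + 1 - 1)"
        using mesh_pos[of j] by (auto simp: cpos_def cen_def abs_if field_simps split: if_splits)
      then show False using x unfolding bad_set_def by blast
    qed
    then show ?thesis using v by (auto simp: valid_def less_le)
  qed
  have "\<forall>\<^sub>F y in nhds x. y \<in> {y. mesh (Suc j) < T y} \<inter> {y. T y < mesh j}"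
    using t by (intro eventually_nhds_in_open open_Int open_Collect_less continuous_intros continuous_on_bdist) auto
  moreover have "\<forall>\<^sub>F y in nhds x. \<forall>i. y \<in> {y. \<bar>cpos a j z y i\<bar> < 1}"
    using c mesh_pos[of j] unfolding cpos_def
    by (intro eventually_all_finite eventually_nhds_in_open open_Collect_less continuous_intros) (auto simp: less_imp_neq[THEN not_sym])
  ultimately have "\<forall>\<^sub>F y in nhds x. valid a j z (T y) y"
    by eventually_elim (auto simp: valid_def less_imp_le)
  with v show thesis by (rule that)
qed

lemma ae_diff_formula:
  fixes j :: nat and z :: "'n \<Rightarrow> int"
  defines "U \<equiv> {x. x \<noteq> x0 \<and> cell_b k (cpos a j z x) (lev j (T x)) \<noteq> 0 \<and> cell_c k (cpos a j z x) (lev j (T x)) \<noteq> 0}"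
  shows "ae_diff U (\<lambda>x. vmap k a j z (T x) x - x)" "ae_diff U (\<lambda>x. T x * scl k a j z (T x) x)"
proof -
  have T: "ae_diff U T"
  proof (rule ae_diffI)
    fix x assume "x \<in> U"
    then have "x - x0 \<noteq> 0" by (simp add: U_def)
    then have "(\<lambda>x. \<rho> - norm (x - x0)) differentiable (at x)"
      by (intro differentiable_diff differentiable_const differentiable_compose[of norm, OF differentiable_norm_at]
          differentiable_ident) auto
    then show "T differentiable (at x)" by (simp add: bdist_def[abs_def] dist_norm norm_minus_commute)
  qed
  have p: "ae_diff U (\<lambda>x. cpos a j z x i)" for i
  proof (rule ae_diffI)
    fix x :: "real^'n"
    have "((\<lambda>x. x $ i) has_derivative (\<lambda>v. v $ i)) (at x)"
      by (rule bounded_linear_imp_has_derivative[OF bounded_linear_vec_nth])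
    then have "(\<lambda>x. x $ i) differentiable (at x)" by (auto simp: differentiable_def)
    then show "(\<lambda>x. cpos a j z x i) differentiable (at x)"
      using mesh_pos[of j] unfolding cpos_def by (intro derivative_intros) auto
  qed
  have l: "ae_diff U (\<lambda>x. lev j (T x))"
    unfolding lev_def using mesh_pos[of j] by (intro ae_diff_diff ae_diff_divide ae_diff_mult ae_diff_const T) auto
  have ab: "ae_diff U (\<lambda>x. \<bar>f x\<bar>)" if "ae_diff U f" for f :: "real^'n \<Rightarrow> real"
  proof -
    have "ae_diff U (\<lambda>x. max (f x) (- f x))" by (intro ae_diff_max ae_diff_uminus that)
    moreover have "(\<lambda>x. max (f x) (- f x)) = (\<lambda>x. \<bar>f x\<bar>)" by (auto simp: max_def)
    ultimately show ?thesis by simp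
  qed
  have cl: "ae_diff U (\<lambda>x. clip (f x))" if "ae_diff U f" for f :: "real^'n \<Rightarrow> real"
    unfolding clip_def by (intro ae_diff_max ae_diff_min ae_diff_const that)
  have b: "ae_diff U (\<lambda>x. cell_b k (cpos a j z x) (lev j (T x)))"
    unfolding cell_b_def by (intro ae_diff_max ae_diff_ksmall[OF k] ab p l)
  have s: "ae_diff U (\<lambda>x. cell_s k (cpos a j z x) (lev j (T x)) i)" for i
    unfolding cell_s_def by (intro cl ae_diff_divide p b) (simp add: U_def)
  have c: "ae_diff U (\<lambda>x. cell_c k (cpos a j z x) (lev j (T x)))"
    unfolding cell_c_def by (intro ae_diff_ksmall[OF k] ab ae_diff_diff ae_diff_mult ae_diff_const s)
  have m: "ae_diff U (\<lambda>x. cell_map k (cpos a j z x) (lev j (T x)) i)" for i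
    unfolding cell_map_def
    by (intro ae_diff_divide ae_diff_add cl ae_diff_diff ae_diff_mult ae_diff_const s c) (simp_all add: U_def)
  have "ae_diff U (\<lambda>x::real^'n. x)" by (rule ae_diffI) simp
  then show "ae_diff U (\<lambda>x. vmap k a j z (T x) x - x)"
    unfolding vmap_def by (intro ae_diff_diff ae_diff_vec ae_diff_add ae_diff_mult ae_diff_const m)
  show "ae_diff U (\<lambda>x. T x * scl k a j z (T x) x)"
    unfolding scl_def cell_scale_def by (intro ae_diff_mult T b c)
qed

lemma countable_cells: "countable (UNIV :: (nat \<times> ('n \<Rightarrow> int)) set)"
proof -
  have "countable (PiE (UNIV :: 'n set) (\<lambda>_. UNIV :: int set))"
    by (rule countable_PiE) auto
  then have "countable (UNIV :: ('n \<Rightarrow> int) set)" by (simp add: PiE_UNIV_domain)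
  then have "countable ((UNIV :: nat set) \<times> (UNIV :: ('n \<Rightarrow> int) set))" by (intro countable_SIGMA) auto
  then show ?thesis by simp
qed

private abbreviation "formula_domain j z \<equiv> {x. x \<noteq> x0 \<and> cell_b k (cpos a j z x) (lev j (T x)) \<noteq> 0 \<and> cell_c k (cpos a j z x) (lev j (T x)) \<noteq> 0}"

text \<open>There are only countably many cell formulas, each differentiable almost everywhere on
  its domain; off \<open>bad_set\<close> one of them represents \<open>f\<close> near the
  point.\<close>

lemma ae_diff_from_formulas:
  fixes f :: "real^'n \<Rightarrow> 'c::real_normed_vector" and F :: "nat \<Rightarrow> ('n \<Rightarrow> int) \<Rightarrow> real^'n \<Rightarrow> 'c"
  assumes F: "\<And>j z. ae_diff (formula_domain j z) (F j z)"
    and eq: "\<And>x j z. \<sigma> x > 0 \<Longrightarrow> valid a j z (T x) x \<Longrightarrow> F j z x = f x"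
  shows "ae_diff {x. \<sigma> x > 0} f"
proof -
  let ?N = "\<lambda>(j, z). {x \<in> formula_domain j z. \<not> F j z differentiable (at x)}"
  have "negligible (\<Union>(range ?N))"
    using F countable_cells unfolding ae_diff_def by (intro negligible_countable_Union countable_image) auto
  then have "negligible (bad_set \<union> \<Union>(range ?N))" by (intro negligible_Un negligible_bad_set)
  moreover have "{x \<in> {x. \<sigma> x > 0}. \<not> f differentiable (at x)} \<subseteq> bad_set \<union> \<Union>(range ?N)"
  proof (rule subsetI, rule ccontr)
    fix x assume x: "x \<in> {x \<in> {x. \<sigma> x > 0}. \<not> f differentiable (at x)}" and nb: "x \<notin> bad_set \<union> \<Union>(range ?N)"
    then have pos: "\<sigma> x > 0" by simp
    obtain j z where v: "valid a j z (T x) x" and ev: "\<forall>\<^sub>F y in nhds x. valid a j z (T y) y"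
      using good_point[of x] nb reg_scale_props(2)[OF pos] by blast
    have "x \<noteq> x0" using nb by (auto simp: bad_set_def)
    moreover note scl_pos[OF k v displ_valid(2)[OF pos v]]
    ultimately have "x \<in> formula_domain j z" by simp
    with nb have "F j z differentiable (at x)" by blast
    moreover have "\<forall>\<^sub>F y in nhds x. F j z y = f y"
      using ev reg_scale_eventually_pos[OF pos] by eventually_elim (rule eq)
    ultimately have "f differentiable (at x)" by (rule differentiable_transform_eventually)
    with x show False by simp
  qed
  ultimately show ?thesis unfolding ae_diff_def by (rule negligible_subset)
qed

lemma ae_diff_displ: "ae_diff {x. \<sigma> x > 0} w" "ae_diff {x. \<sigma> x > 0} \<sigma>"
proof -
  show "ae_diff {x. \<sigma> x > 0} w"
    by (rule ae_diff_from_formulas[where F="\<lambda>j z x. vmap k a j z (T x) x - x"]) (use ae_diff_formula(1) displ_valid(1) in auto)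
  show "ae_diff {x. \<sigma> x > 0} \<sigma>"
    by (rule ae_diff_from_formulas[where F="\<lambda>j z x. T x * scl k a j z (T x) x"])
      (rule ae_diff_formula(2), metis sel_eq(1) reg_scale_props(2,5))
qed

text \<open>A coordinate that \<open>cell_map\<close> sends to -1, 0 or 1 takes a grid value
  \<open>a $ i + mesh j * of_int z\<close>. On the level set of each of these countably many values
  the derivative of that coordinate is zero almost everywhere, by
  \<open>negligible_zero_set_nonzero_derivative\<close>. So almost everywhere the gradient has fewer
  than \<open>k\<close> nonzero rows.\<close>

lemma rank_displ:
  "negligible {x. \<sigma> x > 0 \<and> \<not> rank (mat 1 + grad w x) \<le> k - 1}"
proof -
  let ?\<phi> = "\<lambda>i x. w x $ i + x $ i"
  let ?q = "\<lambda>(i, j, z). a $ i + mesh j * real_of_int z"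
  let ?Z = "\<lambda>(i, j, z). {x. ?\<phi> i x = ?q (i, j, z) \<and> ?\<phi> i differentiable (at x) \<and> frechet_derivative (?\<phi> i) (at x) \<noteq> (\<lambda>_. 0)}"
  have "countable (UNIV :: ('n \<times> nat \<times> int) set)" by (rule countable_index)
  then have "negligible (\<Union>(range ?Z))"
    by (intro negligible_countable_Union countable_image) (auto simp: negligible_zero_set_nonzero_derivative)
  then have "negligible (\<Union>(range ?Z) \<union> {x \<in> {x. \<sigma> x > 0}. \<not> w differentiable (at x)})"
    using ae_diff_displ(1) unfolding ae_diff_def by (intro negligible_Un)
  moreover have "{x. \<sigma> x > 0 \<and> \<not> rank (mat 1 + grad w x) \<le> k - 1} \<subseteq> \<Union>(range ?Z) \<union> {x \<in> {x. \<sigma> x > 0}. \<not> w differentiable (at x)}"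
  proof (rule subsetI, rule ccontr)
    fix x assume x: "x \<in> {x. \<sigma> x > 0 \<and> \<not> rank (mat 1 + grad w x) \<le> k - 1}"
      and nx: "x \<notin> \<Union>(range ?Z) \<union> {x \<in> {x. \<sigma> x > 0}. \<not> w differentiable (at x)}"
    then have pos: "\<sigma> x > 0" and d: "w differentiable (at x)" by auto
    obtain j z where v: "valid a j z (T x) x" using obtain_valid[OF reg_scale_props(2)[OF pos]] by blast
    have hd: "(?\<phi> i has_derivative (\<lambda>h. frechet_derivative w (at x) h $ i + h $ i)) (at x)" for i
      by (intro has_derivative_add bounded_linear.has_derivative[OF bounded_linear_vec_nth]
          differentiable_has_frechet[OF d] has_derivative_ident)
    have row0: "(mat 1 + grad w x) $ i = 0" if on: "cell_map k (cpos a j z x) (lev j (T x)) i \<in> {-1, 0, 1}" for i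
    proof -
      obtain o' :: int where o': "cell_map k (cpos a j z x) (lev j (T x)) i = of_int o'"
        using on by (metis insertE empty_iff of_int_0 of_int_1 of_int_minus)
      have "?\<phi> i x = ?q (i, j, 2 * z i + 1 + o')"
        unfolding displ_valid(1)[OF pos v] by (simp add: vmap_def o' cen_def algebra_simps)
      moreover have "?\<phi> i differentiable (at x)" using hd by (auto simp: differentiable_def)
      moreover have "x \<notin> ?Z (i, j, 2 * z i + 1 + o')" using nx by blast
      ultimately have "frechet_derivative (?\<phi> i) (at x) = (\<lambda>_. 0)" by simp
      then have f0: "frechet_derivative w (at x) h $ i + h $ i = 0" for h
        using frechet_derivative_eqI[OF hd, of i] by (metis)
      show ?thesis
      proof (subst vec_eq_iff, rule allI)
        fix l
        show "(mat 1 + grad w x) $ i $ l = 0 $ l"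
          using f0[of "axis l 1"] by (auto simp: grad_component mat_def axis_def)
      qed
    qed
    have "{i. (mat 1 + grad w x) $ i \<noteq> 0} \<subseteq> {i. cell_map k (cpos a j z x) (lev j (T x)) i \<notin> {-1, 0, 1}}"
      using row0 by blast
    then have "card {i. (mat 1 + grad w x) $ i \<noteq> 0} \<le> card {i. cell_map k (cpos a j z x) (lev j (T x)) i \<notin> {-1, 0, 1}}"
      by (intro card_mono) auto
    also have "\<dots> < k" by (rule card_cell_map_off_grid[OF k scl_pos(2)[OF k v displ_valid(2)[OF pos v]]])
    finally have "rank (mat 1 + grad w x) < k" using rank_le_card_nonzero_rows[of "mat 1 + grad w x"] by linarith
    with x show False by auto
  qed
  ultimately show ?thesis by (rule negligible_subset)
qed

text \<open>The pointwise Lipschitz bound gives continuity on the open set where the scale is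
  positive; elsewhere the field is 0.\<close>

lemma borel_measurable_displ: "w \<in> borel_measurable borel"
proof -
  let ?P = "{x. \<sigma> x > 0}"
  have P: "open ?P" using continuous_reg_scale by (simp add: open_Collect_less)
  have "continuous_on ?P w"
  proof (subst continuous_on_eq_continuous_at[OF P], rule ballI)
    fix x assume "x \<in> ?P"
    then have ev: "\<forall>\<^sub>F y in nhds x. norm (w y - w x) \<le> (17 * real CARD('n) / sel_scl k a x0 \<rho> x) * norm (y - x)"
      by (intro displ_lipschitz) simp
    have "((\<lambda>y. (17 * real CARD('n) / sel_scl k a x0 \<rho> x) * norm (y - x)) \<longlongrightarrow> (17 * real CARD('n) / sel_scl k a x0 \<rho> x) * norm (x - x)) (nhds x)"
      by (intro tendsto_intros filterlim_ident)
    then have "((\<lambda>y. (17 * real CARD('n) / sel_scl k a x0 \<rho> x) * norm (y - x)) \<longlongrightarrow> 0) (nhds x)" by simp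
    from Lim_null_comparison[OF ev this] have "(w \<longlongrightarrow> w x) (nhds x)" by (rule LIM_zero_cancel)
    then show "isCont w x" by (simp add: isCont_def tendsto_nhds_iff)
  qed
  then have "(\<lambda>x. if x \<in> ?P then w x else 0) \<in> borel_measurable borel"
    using P by (intro borel_measurable_continuous_on_if) auto
  moreover have "(\<lambda>x. if x \<in> ?P then w x else 0) = w" by (auto simp: displ_def)
  ultimately show ?thesis by simp
qed

end

subsection \<open>Averaging over translations of the grid\<close>

lemma nn_integral_lborel_prod_cart:
  fixes g :: "'n::finite \<Rightarrow> real \<Rightarrow> ennreal"
  assumes [measurable]: "\<And>i. g i \<in> borel_measurable borel"
  shows "(\<integral>\<^sup>+a. (\<Prod>i\<in>UNIV. g i (a $ i)) \<partial>(lborel :: (real^'n) measure)) = (\<Prod>i\<in>UNIV. \<integral>\<^sup>+x. g i x \<partial>lborel)"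
proof -
  define e where "e i = (axis i 1 :: real^'n)" for i
  have inj: "inj e" by (auto simp: inj_def e_def axis_eq_axis)
  have B: "(Basis :: (real^'n) set) = range e" by (auto simp: Basis_vec_def e_def)
  have "(\<integral>\<^sup>+a. (\<Prod>b\<in>Basis. g (inv e b) (a \<bullet> b)) \<partial>(lborel :: (real^'n) measure)) = (\<Prod>b\<in>(Basis :: (real^'n) set). \<integral>\<^sup>+x. g (inv e b) x \<partial>lborel)"
    by (rule nn_integral_lborel_prod) auto
  moreover have "(\<Prod>b\<in>Basis. g (inv e b) (a \<bullet> b)) = (\<Prod>i\<in>UNIV. g i (a $ i))" for a
    unfolding B by (simp add: prod.reindex[OF inj] inv_f_f[OF inj]) (simp add: e_def inner_axis)
  moreover have "(\<Prod>b\<in>(Basis :: (real^'n) set). \<integral>\<^sup>+x. g (inv e b) x \<partial>lborel) = (\<Prod>i\<in>UNIV. \<integral>\<^sup>+x. g i x \<partial>lborel)"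
    unfolding B by (simp add: prod.reindex[OF inj] inv_f_f[OF inj])
  ultimately show ?thesis by simp
qed

text \<open>An explicit, Borel measurable choice of the mesh level. The choice by
  \<open>SOME\<close> in \<open>sel_scl\<close> agrees with it by consistency but gives no
  measurability by itself.\<close>

definition layer :: "real \<Rightarrow> nat" where "layer t = nat \<lfloor>log (1/2) t\<rfloor>"

lemma layer_bounds:
  assumes "0 < t" "t \<le> 1"
  shows "mesh (Suc (layer t)) \<le> t" "t \<le> mesh (layer t)"
proof -
  have "log (1/2) t \<ge> 0" using assms by (simp add: log_def divide_nonpos_neg)
  then have "real (layer t) = of_int \<lfloor>log (1/2) t\<rfloor>" by (simp add: layer_def)
  then have b: "real (layer t) \<le> log (1/2) t" "log (1/2) t \<le> real (Suc (layer t))" by linarith+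
  have t: "(1/2) powr (log (1/2) t) = t" using assms by (intro powr_log_cancel) auto
  have "mesh (Suc (layer t)) = (1/2) powr (real (Suc (layer t)))" unfolding mesh_def by (subst powr_realpow) auto
  also have "\<dots> \<le> (1/2) powr (log (1/2) t)" using b by (intro powr_mono') auto
  finally show "mesh (Suc (layer t)) \<le> t" by (simp only: t)
  have "(1/2) powr (log (1/2) t) \<le> (1/2) powr (real (layer t))" using b by (intro powr_mono') auto
  also have "\<dots> = mesh (layer t)" unfolding mesh_def by (subst powr_realpow) auto
  finally show "t \<le> mesh (layer t)" by (simp only: t)
qed

lemma mesh_layer_measurable [measurable]: "(\<lambda>t. mesh (layer t)) \<in> borel_measurable borel"
proof -
  have "layer \<in> measurable borel (count_space UNIV)" unfolding layer_def[abs_def] by measurable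
  then show ?thesis by (rule measurable_compose) simp
qed

text \<open>A majorant of the singular power of \<open>sel_scl\<close> that is jointly measurable in
  shift and point and factors over the coordinates, so that its average over shifts reduces to
  one-dimensional integrals.\<close>

definition shift_weight :: "real \<Rightarrow> real^'n \<Rightarrow> real \<Rightarrow> real^'n \<Rightarrow> real^'n \<Rightarrow> ennreal" where
  "shift_weight \<alpha> x0 \<rho> a x = (\<Prod>i\<in>UNIV. cell_weight \<alpha> (lev (layer (bdist x0 \<rho> x)) (bdist x0 \<rho> x))
     (cell_pos (mesh (layer (bdist x0 \<rho> x))) (x $ i - a $ i)))"

lemma shift_weight_measurable:
  fixes x0 :: "real^'n"
  shows "(\<lambda>(a, x). shift_weight \<alpha> x0 \<rho> a x) \<in> borel_measurable (borel \<Otimes>\<^sub>M borel)"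
proof -
  have [measurable]: "bdist x0 \<rho> \<in> borel_measurable borel"
    by (intro borel_measurable_continuous_onI continuous_on_bdist)
  have [measurable]: "(\<lambda>x::real^'n. x $ i) \<in> borel_measurable borel" for i
    by (intro borel_measurable_continuous_onI continuous_intros)
  have [measurable]: "(\<lambda>(a :: real^'n, x :: real^'n). cell_pos (mesh (layer (bdist x0 \<rho> x))) (x $ i - a $ i)) \<in> borel_measurable (borel \<Otimes>\<^sub>M borel)" for i
    unfolding cell_pos_def frac_def by measurable
  show ?thesis
    unfolding shift_weight_def lev_def by measurable
qed

lemma sing_powr_sel_scl_le:
  fixes x0 :: "real^'n"
  assumes k: "1 \<le> k" "k \<le> CARD('n)" and \<rho>: "\<rho> < 1" and s: "s \<ge> 0" and x: "bdist x0 \<rho> x > 0"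
  shows "sing_powr s (sel_scl k a x0 \<rho> x) \<le> shift_weight (s / k) x0 \<rho> a x"
proof -
  let ?T = "bdist x0 \<rho> x"
  let ?j = "layer ?T"
  let ?z = "\<lambda>i. \<lfloor>(x $ i - a $ i) / (2 * mesh ?j)\<rfloor>"
  have T: "?T \<le> 1" using T_less_1[OF k \<rho>, of x0 x] by simp
  have c: "cpos a ?j ?z x i = cell_pos (mesh ?j) (x $ i - a $ i)" for i
    using mesh_pos[of ?j] by (subst cell_pos_eq) (auto simp: cpos_def cen_def field_simps)
  have v: "valid a ?j ?z ?T x"
    unfolding valid_def c using layer_bounds[OF x T] cell_pos_bound by blast
  have "sel_scl k a x0 \<rho> x = cell_scale k (\<lambda>i. cell_pos (mesh ?j) (x $ i - a $ i)) (lev ?j ?T)"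
    unfolding sel_eq(1)[OF k \<rho> v] scl_def c ..
  then show ?thesis
    unfolding shift_weight_def using valid_lev[OF v] cell_pos_bound
    by (simp only:) (intro sing_powr_cell_scale_le[OF k s], auto)
qed

lemma nn_integral_shift_weight:
  fixes x0 :: "real^'n"
  assumes \<alpha>: "0 \<le> \<alpha>" and x: "0 < bdist x0 \<rho> x" "bdist x0 \<rho> x \<le> 1"
  shows "(\<integral>\<^sup>+a. (\<Prod>i\<in>UNIV. indicator {0..2} (a $ i)) * shift_weight \<alpha> x0 \<rho> a x \<partial>lborel)
    \<le> (9 * (\<integral>\<^sup>+y. indicator {-2..2} y * sing_powr \<alpha> y \<partial>lborel)) ^ CARD('n)"
proof -
  let ?h = "mesh (layer (bdist x0 \<rho> x))" and ?\<beta> = "lev (layer (bdist x0 \<rho> x)) (bdist x0 \<rho> x)"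
  let ?g = "\<lambda>i y. indicator {0..2} y * cell_weight \<alpha> ?\<beta> (cell_pos ?h (x $ i - y))"
  have \<beta>: "0 \<le> ?\<beta>" "?\<beta> \<le> 1"
    using layer_bounds[OF x] mesh_pos[of "layer (bdist x0 \<rho> x)"] by (auto simp: lev_def mesh_Suc field_simps)
  have "(\<integral>\<^sup>+a. (\<Prod>i\<in>UNIV. indicator {0..2} (a $ i)) * shift_weight \<alpha> x0 \<rho> a x \<partial>lborel)
    = (\<integral>\<^sup>+a. (\<Prod>i\<in>UNIV. ?g i (a $ i)) \<partial>(lborel :: (real^'n) measure))"
    by (simp add: shift_weight_def prod.distrib)
  also have "\<dots> = (\<Prod>i\<in>UNIV. \<integral>\<^sup>+y. ?g i y \<partial>lborel)"
    by (rule nn_integral_lborel_prod_cart) measurable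
  also have "\<dots> \<le> (\<Prod>i\<in>(UNIV :: 'n set). 9 * (\<integral>\<^sup>+y. indicator {-2..2} y * sing_powr \<alpha> y \<partial>lborel))"
    by (intro prod_mono_ennreal nn_integral_cell_weight_shift \<alpha> \<beta> mesh_pos mesh_le_1)
  finally show ?thesis by simp
qed

text \<open>For each point the integral of the weight over all shifts in a cube is at most
  \<open>K\<close>. By Fubini the integral over shifts of \<open>?\<Phi>\<close> is at most
  \<open>K\<close> times the volume of the ball, so not every shift can exceed \<open>K + 1\<close>
  times that volume. The constant depends neither on the centre nor on the radius.\<close>

lemma exists_good_shift:
  fixes s :: real
  assumes k: "1 \<le> k" "k \<le> CARD('n)" and s: "0 \<le> s" "s < k"
  obtains C where "C \<ge> 0" "\<And>(x0 :: real^'n) \<rho>. 0 < \<rho> \<Longrightarrow> \<rho> < 1 \<Longrightarrow>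
    \<exists>a. (\<integral>\<^sup>+x. indicator (ball x0 \<rho>) x * sing_powr s (reg_scale k a x0 \<rho> x / bdist x0 \<rho> x) \<partial>lborel)
      \<le> ennreal (C * measure lborel (ball x0 \<rho>))"
proof -
  let ?K = "(9 * (\<integral>\<^sup>+y. indicator {-2..2} y * sing_powr (s / k) y \<partial>lborel)) ^ CARD('n)"
  have "(\<integral>\<^sup>+y. indicator {-2..2} y * sing_powr (s / k) y \<partial>lborel) < \<infinity>"
    using s k by (intro nn_integral_sing_powr_finite) auto
  then have "?K < \<infinity>" by (simp add: ennreal_mult_less_top power_less_top_ennreal)
  then obtain K where K: "K \<ge> 0" "?K = ennreal K" by (cases ?K) auto
  have "\<exists>a. (\<integral>\<^sup>+x. indicator (ball x0 \<rho>) x * sing_powr s (reg_scale k a x0 \<rho> x / bdist x0 \<rho> x) \<partial>lborel)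
      \<le> ennreal ((K + 1) * measure lborel (ball x0 \<rho>))" if \<rho>: "0 < \<rho>" "\<rho> < 1" for x0 :: "real^'n" and \<rho>
  proof -
    let ?B = "ball x0 \<rho>" and ?m = "measure lborel (ball x0 \<rho>)"
    let ?Q = "\<lambda>a :: real^'n. (\<Prod>i\<in>UNIV. indicator {0..2} (a $ i)) :: ennreal"
    let ?\<Phi> = "\<lambda>a. \<integral>\<^sup>+x. indicator ?B x * shift_weight (s / k) x0 \<rho> a x \<partial>lborel"
    have m0: "?m > 0" using content_ball_pos[OF \<rho>(1), of x0] by simp
    have em: "emeasure lborel ?B = ennreal ?m" by (intro emeasure_eq_ennreal_measure) (use emeasure_bounded_finite[OF bounded_ball, of x0 \<rho>] in simp)
    have T: "0 < bdist x0 \<rho> x \<and> bdist x0 \<rho> x \<le> 1" if "x \<in> ?B" for x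
      using that T_less_1[OF k \<rho>(2), of x0 x] by (auto simp: bdist_def)
    have [measurable]: "(\<lambda>(a, x). shift_weight (s / k) x0 \<rho> a x) \<in> borel_measurable (borel \<Otimes>\<^sub>M borel)"
      by (rule shift_weight_measurable)
    have [measurable]: "?B \<in> sets borel" by simp
    have [measurable]: "(\<lambda>x::real^'n. x $ i) \<in> borel_measurable borel" for i
      by (intro borel_measurable_continuous_onI continuous_intros)
    have [measurable]: "?\<Phi> \<in> borel_measurable borel" by measurable
    have "\<exists>a. ?\<Phi> a \<le> ennreal ((K + 1) * ?m)"
    proof (rule ccontr)
      assume "\<not> ?thesis"
      then have big: "ennreal ((K + 1) * ?m) \<le> ?\<Phi> a" for a by (meson linear)
      have "ennreal ((K + 1) * ?m) \<le> ennreal ((K + 1) * ?m) * 2 ^ CARD('n)"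
        using mult_left_mono[of 1 "2 ^ CARD('n)" "ennreal ((K + 1) * ?m)"] by (simp add: one_le_power)
      also have "2 ^ CARD('n) = (\<integral>\<^sup>+a. ?Q a \<partial>lborel)"
        by (subst nn_integral_lborel_prod_cart) auto
      also have "ennreal ((K + 1) * ?m) * (\<integral>\<^sup>+a. ?Q a \<partial>lborel) = (\<integral>\<^sup>+a. ennreal ((K + 1) * ?m) * ?Q a \<partial>lborel)"
        by (rule nn_integral_cmult[symmetric]) measurable
      also have "\<dots> \<le> (\<integral>\<^sup>+a. ?\<Phi> a * ?Q a \<partial>lborel)"
        by (intro nn_integral_mono mult_right_mono big) simp
      also have "\<dots> = (\<integral>\<^sup>+a. (\<integral>\<^sup>+x. ?Q a * (indicator ?B x * shift_weight (s / k) x0 \<rho> a x) \<partial>lborel) \<partial>lborel)"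
        by (intro nn_integral_cong) (simp add: nn_integral_cmult mult.commute)
      also have "\<dots> = (\<integral>\<^sup>+x. (\<integral>\<^sup>+a. ?Q a * (indicator ?B x * shift_weight (s / k) x0 \<rho> a x) \<partial>lborel) \<partial>lborel)"
        by (rule lborel_pair.Fubini'[symmetric]) measurable
      also have "\<dots> \<le> (\<integral>\<^sup>+x. ennreal K * indicator ?B x \<partial>lborel)"
      proof (rule nn_integral_mono)
        fix x
        have "(\<integral>\<^sup>+a. ?Q a * shift_weight (s / k) x0 \<rho> a x \<partial>lborel) \<le> ennreal K" if "x \<in> ?B"
          unfolding K(2)[symmetric] using T[OF that] s k by (intro nn_integral_shift_weight) auto
        then show "(\<integral>\<^sup>+a. ?Q a * (indicator ?B x * shift_weight (s / k) x0 \<rho> a x) \<partial>lborel) \<le> ennreal K * indicator ?B x"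
          by (cases "x \<in> ?B") auto
      qed
      also have "\<dots> = ennreal (K * ?m)" using K(1) em by (simp add: nn_integral_cmult ennreal_mult)
      finally have "(K + 1) * ?m \<le> K * ?m" using K(1) m0 by (subst (asm) ennreal_le_iff) auto
      then show False using m0 by (simp add: algebra_simps)
    qed
    then obtain a where a: "?\<Phi> a \<le> ennreal ((K + 1) * ?m)" ..
    have "(\<integral>\<^sup>+x. indicator ?B x * sing_powr s (reg_scale k a x0 \<rho> x / bdist x0 \<rho> x) \<partial>lborel) \<le> ?\<Phi> a"
    proof (intro nn_integral_mono)
      fix x
      have "reg_scale k a x0 \<rho> x / bdist x0 \<rho> x = sel_scl k a x0 \<rho> x" if "x \<in> ?B"
        using T[OF that] reg_scale_props(5)[OF k \<rho>(2), of x0 x a] by simp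
      then show "indicator ?B x * sing_powr s (reg_scale k a x0 \<rho> x / bdist x0 \<rho> x) \<le> indicator ?B x * shift_weight (s / k) x0 \<rho> a x"
        using T[of x] sing_powr_sel_scl_le[OF k \<rho>(2) s(1), of x0 x a] by (cases "x \<in> ?B") auto
    qed
    with a show ?thesis by (meson order_trans)
  qed
  then show thesis using K(1) by (intro that[of "K + 1"]) auto
qed

subsection \<open>Growth from growth at low rank\<close>

lemma AE_lebesgue_on_negligible:
  assumes "\<Omega> \<in> sets lebesgue" "negligible N" "{x \<in> \<Omega>. \<not> P x} \<subseteq> N"
  shows "AE x in lebesgue_on \<Omega>. P x"
proof -
  have "AE x in lebesgue. x \<in> \<Omega> \<longrightarrow> P x"
    using assms(2) unfolding negligible_iff_null_sets by (rule AE_not_in[THEN eventually_mono]) (use assms(3) in auto)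
  then show ?thesis using assms(1) by (subst AE_restrict_space_iff) auto
qed

lemma nn_integral_lebesgue_on_le:
  assumes [measurable]: "g \<in> borel_measurable borel" and \<Omega>: "\<Omega> \<in> sets lebesgue" and le: "\<And>x. h x \<le> g x"
  shows "(\<integral>\<^sup>+x. h x \<partial>lebesgue_on \<Omega>) \<le> (\<integral>\<^sup>+x. g x \<partial>lborel)"
proof -
  have "(\<integral>\<^sup>+x. h x \<partial>lebesgue_on \<Omega>) = (\<integral>\<^sup>+x. h x * indicator \<Omega> x \<partial>lebesgue)"
    using \<Omega> by (simp add: nn_integral_restrict_space)
  also have "\<dots> \<le> (\<integral>\<^sup>+x. g x \<partial>lebesgue)"
    by (intro nn_integral_mono) (auto simp: indicator_def le)
  also have "\<dots> = (\<integral>\<^sup>+x. g x \<partial>lborel)" by (simp add: nn_integral_completion)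
  finally show ?thesis .
qed

text \<open>The finite singular integral is used twice: it makes the singular points in the ball a
  null set, and, since \<open>p \<le> s\<close>, it makes the regularity bound \<open>R\<close>
  integrable to the power \<open>p\<close>. This is all that
  \<open>approx_W1p_regularity_scale\<close> asks for besides the Lipschitz estimates.\<close>

lemma displacement_test_function:
  fixes \<xi> :: "real^'n^'N" and x0 :: "real^'n"
  assumes k: "1 \<le> k" "k \<le> CARD('n)" and \<rho>0: "0 < \<rho>" and \<rho>: "\<rho> < 1"
    and \<Omega>: "open \<Omega>" "bounded \<Omega>" "ball x0 \<rho> \<subseteq> \<Omega>" and p: "1 \<le> p" "p \<le> s"
    and fin: "(\<integral>\<^sup>+x. indicator (ball x0 \<rho>) x * sing_powr s (reg_scale k a x0 \<rho> x / bdist x0 \<rho> x) \<partial>lborel) < \<infinity>"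
  defines "u \<equiv> \<lambda>x. \<xi> *v displ k a x0 \<rho> x"
  shows "u \<in> W1p0 p \<Omega>" "weak_grad \<Omega> u (grad u)" "grad u \<in> borel_measurable (lebesgue_on \<Omega>)"
    "AE x in lebesgue_on \<Omega>. if x \<in> ball x0 \<rho>
       then reg_scale k a x0 \<rho> x > 0 \<and> rank (mat 1 + grad (displ k a x0 \<rho>) x) \<le> k - 1
         \<and> grad u x = \<xi> ** grad (displ k a x0 \<rho>) x
         \<and> norm (grad (displ k a x0 \<rho>) x) \<le> real CARD('n) * (real CARD('n) * (17 * real CARD('n) / (reg_scale k a x0 \<rho> x / bdist x0 \<rho> x)))
       else grad u x = 0"
proof -
  define T where "T = bdist x0 \<rho>"
  define \<sigma> where "\<sigma> = reg_scale k a x0 \<rho>"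
  define w where "w = displ k a x0 \<rho>"
  note defs = T_def[symmetric] \<sigma>_def[symmetric] w_def[symmetric]
  note props = reg_scale_props[OF k \<rho>, of a x0, unfolded defs]
  have O: "\<Omega> \<in> sets lebesgue" using lmeasurable_bounded_open[OF \<Omega>(1,2)] by (rule fmeasurableD)
  have ball: "x \<in> ball x0 \<rho> \<longleftrightarrow> T x > 0" for x by (simp add: T_def bdist_def)
  have cT: "continuous_on UNIV T" unfolding T_def by (rule continuous_on_bdist)
  have c\<sigma>: "continuous_on UNIV \<sigma>" unfolding \<sigma>_def by (rule continuous_reg_scale[OF k \<rho>])
  have [measurable]: "T \<in> borel_measurable borel" "\<sigma> \<in> borel_measurable borel"
    using cT c\<sigma> by (auto intro: borel_measurable_continuous_onI)
  have wm: "w \<in> borel_measurable borel" unfolding w_def by (rule borel_measurable_displ[OF k \<rho>])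
  have Bm[measurable]: "ball x0 \<rho> \<in> sets borel" by simp
  have y1: "\<sigma> x / T x > 0" "\<sigma> x / T x \<le> 1" "sel_scl k a x0 \<rho> x = \<sigma> x / T x" if "\<sigma> x > 0" for x
    using props(2-4)[OF that] that sel_scl_bounds[OF k \<rho>, of x0 x a, unfolded defs] by auto
  define N0 where "N0 = {x. x \<in> ball x0 \<rho> \<and> \<sigma> x = 0}"
  have N0: "negligible N0"
  proof -
    have "AE x in lborel. indicator (ball x0 \<rho>) x * sing_powr s (\<sigma> x / T x) \<noteq> \<infinity>"
      using fin unfolding defs by (intro nn_integral_PInf_AE) auto
    then have "AE x in lborel. x \<notin> N0"
      by eventually_elim (auto simp: N0_def sing_powr_def)
    moreover have "N0 \<in> sets lborel" unfolding N0_def by measurable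
    ultimately have "N0 \<in> null_sets lborel" by (simp add: AE_iff_null_sets)
    then show ?thesis unfolding negligible_iff_null_sets by (rule null_sets_completionI)
  qed
  define N where "N = N0 \<union> sphere x0 \<rho>"
  have N: "negligible N" unfolding N_def by (intro negligible_Un N0 negligible_sphere)
  \<comment> \<open>Off \<open>N\<close> there are two kinds of points: regular points of the ball,
    and points strictly outside the closed ball, near which \<open>u\<close> vanishes
    identically.\<close>
  have u0: "\<sigma> x > 0 \<or> (T x < 0 \<and> (\<forall>\<^sub>F y in nhds x. u y = 0))" if "x \<notin> N" for x
  proof (cases "T x > 0")
    case True
    then have "x \<in> ball x0 \<rho>" using ball by blast
    then have "\<sigma> x \<noteq> 0" using that by (simp add: N_def N0_def)
    then show ?thesis using props(1)[of x] by linarith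
  next
    case False
    moreover have "T x \<noteq> 0" using that by (auto simp: N_def T_def bdist_def)
    ultimately have "T x < 0" by simp
    then have "\<forall>\<^sub>F y in nhds x. y \<in> {y. T y < 0}"
      using cT by (intro eventually_nhds_in_open open_Collect_less continuous_intros) auto
    then have "\<forall>\<^sub>F y in nhds x. u y = 0"
      by eventually_elim (simp add: u_def displ_def reg_scale_def T_def)
    with \<open>T x < 0\<close> show ?thesis by simp
  qed
  have hu: "(u has_derivative (\<lambda>h. \<xi> *v frechet_derivative w (at x) h)) (at x)" if "w differentiable (at x)" for x
    unfolding u_def defs by (rule bounded_linear.has_derivative[OF matrix_vector_mul_bounded_linear differentiable_has_frechet[OF that]])
  have dw: "ae_diff {x. \<sigma> x > 0} w" "ae_diff {x. \<sigma> x > 0} \<sigma>"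
    unfolding \<sigma>_def w_def by (rule ae_diff_displ[OF k \<rho>])+
  have du: "ae_diff {x. \<sigma> x > 0} u"
    by (rule ae_diff_lift[OF dw(1)]) (use hu in \<open>auto simp: differentiable_def\<close>)
  have du0: "(u has_derivative (\<lambda>_. 0)) (at x)" if ev: "\<forall>\<^sub>F y in nhds x. u y = 0" for x
  proof -
    obtain S where S: "open S" "x \<in> S" "\<And>y. y \<in> S \<Longrightarrow> u y = 0" using ev unfolding eventually_nhds by blast
    show ?thesis
      by (rule has_derivative_transform_within_open[OF has_derivative_const S(1,2)]) (use S(3) in simp)
  qed
  have dO: "ae_diff \<Omega> u"
    unfolding ae_diff_def
  proof (rule negligible_subset[OF negligible_Un[OF N du[unfolded ae_diff_def]]], rule subsetI, rule ccontr)
    fix x assume x: "x \<in> {x \<in> \<Omega>. \<not> u differentiable (at x)}" and n: "x \<notin> N \<union> {x \<in> {x. \<sigma> x > 0}. \<not> u differentiable (at x)}"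
    then have "\<not> \<sigma> x > 0" "x \<notin> N" by auto
    with u0 du0 have "u differentiable (at x)" unfolding differentiable_def by blast
    with x show False by simp
  qed
  have um: "u \<in> borel_measurable borel"
    unfolding u_def defs
    by (rule borel_measurable_continuous_on[OF _ wm]) (intro linear_continuous_on matrix_vector_mul_bounded_linear)
  show gm: "grad u \<in> borel_measurable (lebesgue_on \<Omega>)" by (rule grad_measurable[OF um dO O])
  obtain K where K: "K > 0" "\<And>v. norm (\<xi> *v v) \<le> norm v * K"
    using bounded_linear.pos_bounded[OF matrix_vector_mul_bounded_linear[of \<xi>]] by blast
  let ?n = "real CARD('n)"
  \<comment> \<open>The local Lipschitz constant of \<open>u\<close>. As
    \<open>R x * \<sigma> x\<close> is a multiple of \<open>T x\<close> with factor 17, the bound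
    \<open>4 * T x\<close> of \<open>displ_bound\<close> also fits below it.\<close>
  define R where "R x = K * (17 * ?n / (\<sigma> x / T x))" for x
  have lip: "\<forall>\<^sub>F y in nhds x. norm (w y - w x) \<le> 17 * ?n / (\<sigma> x / T x) * norm (y - x)" if "\<sigma> x > 0" for x
    using displ_lipschitz[OF k \<rho>, of a x0 x, unfolded defs] y1(3)[OF that] that by simp
  have app: "approx_W1p p \<Omega> u (grad u) e" if e: "e > 0" for e
  proof (rule approx_W1p_regularity_scale[OF \<Omega>(1,2) p(1) e])
    show "\<sigma> x \<ge> 0" for x by (rule props)
    show "{x. \<sigma> x > 0} \<subseteq> \<Omega>" using props(2) ball \<Omega>(3) by blast
    show "\<forall>\<^sub>F y in nhds x. \<bar>\<sigma> y - \<sigma> x\<bar> \<le> 12 * norm (y - x)" for x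
      unfolding \<sigma>_def by (rule reg_scale_lipschitz[OF k \<rho>])
    show "R x \<ge> 0" if "\<sigma> x > 0" for x unfolding R_def using y1(1)[OF that] K(1) by (intro mult_nonneg_nonneg divide_nonneg_pos) auto
    have R\<sigma>: "R x * \<sigma> x = K * (17 * ?n * T x)" if "\<sigma> x > 0" for x using that by (simp add: R_def)
    show "R x * \<sigma> x \<le> K * (17 * ?n * 1)" if "\<sigma> x > 0" for x
      unfolding R\<sigma>[OF that] using T_less_1[OF k \<rho>, of x0 x, unfolded defs] K(1) by (intro mult_left_mono) auto
    show "norm (u x) \<le> R x * \<sigma> x" if "\<sigma> x > 0" for x
    proof -
      have "norm (u x) \<le> norm (w x) * K" unfolding u_def defs by (rule K(2))
      also have "\<dots> \<le> (?n * (4 * T x)) * K"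
        using displ_bound[OF k \<rho>, of a x0 x, unfolded defs] that K(1) by (intro mult_right_mono) auto
      also have "\<dots> \<le> K * (17 * ?n * T x)" using K(1) props(2)[OF that] by (simp add: algebra_simps)
      finally show ?thesis unfolding R\<sigma>[OF that] .
    qed
    show "\<forall>\<^sub>F y in nhds x. norm (u y - u x) \<le> R x * norm (y - x)" if "\<sigma> x > 0" for x
      using lip[OF that]
    proof eventually_elim
      case (elim y)
      have "norm (u y - u x) \<le> norm (w y - w x) * K"
        using K(2)[of "w y - w x"] by (simp add: u_def defs matrix_vector_mult_diff_distrib)
      also have "\<dots> \<le> (17 * ?n / (\<sigma> x / T x) * norm (y - x)) * K" using K(1) by (intro mult_right_mono elim) auto
      finally show ?case by (simp only: R_def ac_simps)
    qed
    show "ae_diff {x. \<sigma> x > 0} u" "ae_diff {x. \<sigma> x > 0} \<sigma>" by (rule du dw)+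
    show "negligible {x \<in> \<Omega>. \<sigma> x = 0 \<and> \<not> (\<forall>\<^sub>F y in nhds x. u y = 0)}"
      by (rule negligible_subset[OF N]) (use u0 in force)
    have Rm[measurable]: "R \<in> borel_measurable borel" unfolding R_def[abs_def] by measurable
    then show "R \<in> borel_measurable (lebesgue_on \<Omega>)" by (intro measurable_restrict_space1 measurable_completion) simp
    have "(\<integral>\<^sup>+x. ennreal ((indicator {x. \<sigma> x > 0} x * R x) powr p) \<partial>lebesgue_on \<Omega>)
      \<le> (\<integral>\<^sup>+x. ennreal ((K * (17 * ?n)) powr p) * (indicator (ball x0 \<rho>) x * sing_powr s (\<sigma> x / T x)) \<partial>lborel)"
    proof (rule nn_integral_lebesgue_on_le[OF _ O])
      show "ennreal ((indicator {x. \<sigma> x > 0} x * R x) powr p)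
        \<le> ennreal ((K * (17 * ?n)) powr p) * (indicator (ball x0 \<rho>) x * sing_powr s (\<sigma> x / T x))" for x
      proof (cases "\<sigma> x > 0")
        case True
        note y = y1(1,2)[OF True]
        have "R x powr p = (K * (17 * ?n)) powr p * (\<sigma> x / T x) powr - p"
          using K(1) y(1) by (simp only: R_def times_divide_eq_right powr_divide powr_minus_divide mult_1_right)
        also have "\<dots> \<le> (K * (17 * ?n)) powr p * (\<sigma> x / T x) powr - s"
          using y p by (intro mult_left_mono powr_mono') auto
        finally have "ennreal (R x powr p) \<le> ennreal ((K * (17 * ?n)) powr p) * ennreal ((\<sigma> x / T x) powr - s)"
          by (simp add: ennreal_mult[symmetric] ennreal_leI)
        moreover have "x \<in> ball x0 \<rho>" using props(2)[OF True] ball by blast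
        moreover have "sing_powr s (\<sigma> x / T x) = ennreal ((\<sigma> x / T x) powr - s)" unfolding sing_powr_def using y by (simp only: abs_of_pos less_imp_neq[THEN not_sym] if_False)
        ultimately show ?thesis using True by simp
      qed simp
    qed measurable
    also have "\<dots> = ennreal ((K * (17 * ?n)) powr p) * (\<integral>\<^sup>+x. indicator (ball x0 \<rho>) x * sing_powr s (\<sigma> x / T x) \<partial>lborel)"
      by (rule nn_integral_cmult) measurable
    also have "\<dots> < \<infinity>" using fin unfolding defs by (simp add: ennreal_mult_less_top)
    finally show "(\<integral>\<^sup>+x. ennreal ((indicator {x. \<sigma> x > 0} x * R x) powr p) \<partial>lebesgue_on \<Omega>) < \<infinity>" .
  qed
  have um': "u \<in> borel_measurable (lebesgue_on \<Omega>)"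
    using um by (intro measurable_restrict_space1 measurable_completion) simp
  show "u \<in> W1p0 p \<Omega>" by (rule W1p0I(1)[OF \<Omega>(1,2) p(1) um' gm app])
  show "weak_grad \<Omega> u (grad u)" by (rule W1p0I(2)[OF \<Omega>(1,2) p(1) um' gm app])
  have rk: "negligible {x. \<sigma> x > 0 \<and> \<not> rank (mat 1 + grad w x) \<le> k - 1}"
    unfolding \<sigma>_def w_def by (rule rank_displ[OF k \<rho>])
  show "AE x in lebesgue_on \<Omega>. if x \<in> ball x0 \<rho>
       then reg_scale k a x0 \<rho> x > 0 \<and> rank (mat 1 + grad (displ k a x0 \<rho>) x) \<le> k - 1
         \<and> grad u x = \<xi> ** grad (displ k a x0 \<rho>) x
         \<and> norm (grad (displ k a x0 \<rho>) x) \<le> ?n * (?n * (17 * ?n / (reg_scale k a x0 \<rho> x / bdist x0 \<rho> x)))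
       else grad u x = 0"
    unfolding defs
  proof (rule AE_lebesgue_on_negligible[OF O negligible_Un[OF N negligible_Un[OF rk dw(1)[unfolded ae_diff_def]]]],
      rule subsetI, rule ccontr)
    fix x
    let ?P = "if x \<in> ball x0 \<rho> then \<sigma> x > 0 \<and> rank (mat 1 + grad w x) \<le> k - 1 \<and> grad u x = \<xi> ** grad w x
        \<and> norm (grad w x) \<le> ?n * (?n * (17 * ?n / (\<sigma> x / T x))) else grad u x = 0"
    assume "x \<in> {x \<in> \<Omega>. \<not> (if x \<in> ball x0 \<rho> then \<sigma> x > 0 \<and> rank (mat 1 + grad w x) \<le> k - 1 \<and> grad u x = \<xi> ** grad w x
        \<and> norm (grad w x) \<le> ?n * (?n * (17 * ?n / (\<sigma> x / T x))) else grad u x = 0)}"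
    then have np: "\<not> ?P" by simp
    assume n: "x \<notin> N \<union> ({x. \<sigma> x > 0 \<and> \<not> rank (mat 1 + grad w x) \<le> k - 1} \<union> {x \<in> {x. \<sigma> x > 0}. \<not> w differentiable (at x)})"
    then have nN: "x \<notin> N" by simp
    have ?P
    proof (cases "x \<in> ball x0 \<rho>")
      case True
      then have pos: "\<sigma> x > 0" using u0[OF nN] ball by force
      then have d: "w differentiable (at x)" and r: "rank (mat 1 + grad w x) \<le> k - 1" using n by auto
      have "grad u x = \<xi> ** grad w x"
        by (simp add: vec_eq_iff grad_component frechet_derivative_eqI[OF hu[OF d]] matrix_matrix_mult_def matrix_vector_mult_def)
      moreover have "norm (grad w x) \<le> ?n * (?n * (17 * ?n / (\<sigma> x / T x)))"
        using norm_frechet_le_pointwise_lipschitz[OF d lip[OF pos]]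
        by (intro norm_grad_le) (metis norm_axis_1 mult.right_neutral)
      ultimately show ?thesis using True pos r by simp
    next
      case False
      then have "\<forall>\<^sub>F y in nhds x. u y = 0" using u0[OF nN] props(2)[of x] ball by blast
      from frechet_derivative_eqI[OF du0[OF this]] have "grad u x = 0" by (simp add: vec_eq_iff grad_component)
      then show ?thesis using False by simp
    qed
    with np show False by contradiction
  qed
qed

text \<open>On the ball the test gradient added to \<open>\<xi>\<close> is
  \<open>\<xi> ** (mat 1 + grad w x)\<close>, whose rank is at most that of the second factor, so
  only the growth at low rank is used. Outside, the integrand is \<open>f \<xi>\<close> and cancels
  against the left-hand side.\<close>

lemma low_rank_growth_at:
  fixes f :: "real^'n^'N \<Rightarrow> real" and \<xi> :: "real^'n^'N"
  assumes k: "1 \<le> k" "k \<le> CARD('n)" and cf: "continuous_on UNIV f" and bd: "bdd_below (range f)"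
    and p: "1 \<le> p" "p \<le> s" and q: "0 \<le> q" "q \<le> s" and L: "L \<ge> 0"
    and low: "\<And>\<xi>. rank \<xi> \<le> k - 1 \<Longrightarrow> f \<xi> \<le> L * (1 + norm \<xi> powr q)"
    and qc: "W1p_quasiconvex_at p (\<lambda>\<xi>. ereal (f \<xi>)) \<xi>"
    and C: "C \<ge> 0" "\<And>(x0 :: real^'n) \<rho>. 0 < \<rho> \<Longrightarrow> \<rho> < 1 \<Longrightarrow>
      \<exists>a. (\<integral>\<^sup>+x. indicator (ball x0 \<rho>) x * sing_powr s (reg_scale k a x0 \<rho> x / bdist x0 \<rho> x) \<partial>lborel)
        \<le> ennreal (C * measure lborel (ball x0 \<rho>))"
    and c: "c > 0" "\<And>(A :: real^'n^'N) (B :: real^'n^'n). norm (A ** B) \<le> norm A * norm B * c"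
  shows "f \<xi> \<le> L + L * (norm \<xi> * (norm (mat 1 :: real^'n^'n) + 17 * real CARD('n) ^ 3) * c) powr q * C"
proof -
  obtain \<Omega> :: "(real^'n) set" where *: "\<Omega> \<noteq> {} \<and> bounded \<Omega> \<and> open \<Omega> \<and> emeasure lebesgue (frontier \<Omega>) = 0 \<and>
      (\<forall>\<phi> G. \<phi> \<in> W1p0 p \<Omega> \<and> weak_grad \<Omega> \<phi> G \<longrightarrow>
        ext_integral (lebesgue_on \<Omega>) (\<lambda>x. ereal (f (\<xi> + G x))) \<ge> ereal (measure lebesgue \<Omega>) * ereal (f \<xi>))"
    using qc unfolding W1p_quasiconvex_at_def by (rule exE)
  then have \<Omega>: "\<Omega> \<noteq> {}" "bounded \<Omega>" "open \<Omega>" by simp_all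
  have tst: "ext_integral (lebesgue_on \<Omega>) (\<lambda>x. ereal (f (\<xi> + G x))) \<ge> ereal (measure lebesgue \<Omega>) * ereal (f \<xi>)"
    if "\<phi> \<in> W1p0 p \<Omega>" "weak_grad \<Omega> \<phi> G" for \<phi> G
    using *[THEN conjunct2, THEN conjunct2, THEN conjunct2, THEN conjunct2] that by blast
  have O: "\<Omega> \<in> lmeasurable" "\<Omega> \<in> sets lebesgue"
    using lmeasurable_bounded_open[OF \<Omega>(3,2)] by (auto simp: fmeasurableD)
  interpret finite_measure "lebesgue_on \<Omega>" by (rule finite_measure_lebesgue_on[OF O(1)])
  obtain x0 r where x0: "x0 \<in> \<Omega>" "r > 0" "ball x0 r \<subseteq> \<Omega>" using \<Omega>(1,3) openE by (metis ex_in_conv)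
  \<comment> \<open>A radius below 1 keeps all distances to the sphere below
    \<open>mesh 0 = 1\<close>, where the layers begin.\<close>
  define \<rho> where "\<rho> = min r (1/2)"
  have \<rho>: "0 < \<rho>" "\<rho> < 1" and B\<Omega>: "ball x0 \<rho> \<subseteq> \<Omega>" using x0 by (auto simp: \<rho>_def)
  let ?B = "ball x0 \<rho>"
  obtain a where a: "(\<integral>\<^sup>+x. indicator ?B x * sing_powr s (reg_scale k a x0 \<rho> x / bdist x0 \<rho> x) \<partial>lborel)
        \<le> ennreal (C * measure lborel ?B)" using C(2)[OF \<rho>] by blast
  define y where "y x = reg_scale k a x0 \<rho> x / bdist x0 \<rho> x" for x
  define w where "w = displ k a x0 \<rho>"
  define G where "G = grad (\<lambda>x. \<xi> *v displ k a x0 \<rho> x)"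
  let ?n = "real CARD('n)" and ?I = "norm (mat 1 :: real^'n^'n)"
  have fin: "(\<integral>\<^sup>+x. indicator ?B x * sing_powr s (reg_scale k a x0 \<rho> x / bdist x0 \<rho> x) \<partial>lborel) < \<infinity>"
    using a by (rule le_less_trans) simp
  note dt = displacement_test_function[OF k \<rho> \<Omega>(3,2) B\<Omega> p fin, of \<xi>]
  have G[measurable]: "G \<in> borel_measurable (lebesgue_on \<Omega>)" unfolding G_def by (rule dt(3))
  have [measurable]: "bdist x0 \<rho> \<in> borel_measurable borel" "reg_scale k a x0 \<rho> \<in> borel_measurable borel"
    using continuous_on_bdist[of UNIV x0 \<rho>] continuous_reg_scale[OF k \<rho>(2), of a x0] by (auto intro: borel_measurable_continuous_onI)
  have ym[measurable]: "y \<in> borel_measurable borel" unfolding y_def[abs_def] by measurable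
  have Bm[measurable]: "?B \<in> sets borel" by simp
  define V where "V x = indicator ?B x * y x powr - s" for x
  have Vm: "V \<in> borel_measurable borel" unfolding V_def[abs_def] by measurable
  then have Vm'[measurable]: "V \<in> borel_measurable (lebesgue_on \<Omega>)"
    by (intro measurable_restrict_space1 measurable_completion) simp
  have V0: "V x \<ge> 0" for x by (simp add: V_def)
  define m where "m = measure lebesgue ?B"
  have mB: "m = measure lborel ?B" "m > 0" using content_ball_pos[OF \<rho>(1), of x0] by (auto simp: m_def)
  have Vnn: "(\<integral>\<^sup>+x. ennreal (V x) \<partial>lebesgue_on \<Omega>) \<le> ennreal (C * m)"
  proof -
    have "(\<integral>\<^sup>+x. ennreal (V x) \<partial>lebesgue_on \<Omega>) \<le> (\<integral>\<^sup>+x. indicator ?B x * sing_powr s (y x) \<partial>lborel)"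
    proof (rule nn_integral_lebesgue_on_le[OF _ O(2)])
      fix x
      have "y x \<ge> 0" if "x \<in> ?B"
        unfolding y_def using reg_scale_props(1)[OF k \<rho>(2)] that by (intro divide_nonneg_nonneg) (auto simp: bdist_def)
      then show "ennreal (V x) \<le> indicator ?B x * sing_powr s (y x)"
        by (cases "x \<in> ?B") (auto simp: V_def sing_powr_def)
    qed measurable
    also have "\<dots> \<le> ennreal (C * m)" using a unfolding y_def mB .
    finally show ?thesis .
  qed
  have Vi: "integrable (lebesgue_on \<Omega>) V"
    by (rule integrableI_nonneg) (use V0 Vnn le_less_trans[OF Vnn] in auto)
  have Vint: "(\<integral>x. V x \<partial>lebesgue_on \<Omega>) \<le> C * m"
    using Vnn C(1) mB by (intro integral_real_bounded) auto
  \<comment> \<open>\<open>?I + 17 * ?n ^ 3\<close> bounds the norm of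
    \<open>mat 1 + grad w x\<close> up to the factor \<open>1 / y x\<close>: one \<open>?n\<close>
    comes from the vector norm in \<open>displ_lipschitz\<close>, two from passing to the matrix
    norm.\<close>
  define A where "A = L * (norm \<xi> * (?I + 17 * ?n ^ 3) * c) powr q"
  have A0: "A \<ge> 0" using L by (simp add: A_def)
  \<comment> \<open>The majorant is \<open>f \<xi>\<close> off the ball and
    \<open>L + A * V x\<close> on it. After integration the measure of the domain cancels and
    \<open>f \<xi> * m \<le> (L + A * C) * m\<close> remains.\<close>
  define h where "h x = f \<xi> + (L - f \<xi>) * indicator ?B x + A * V x" for x
  have hi: "integrable (lebesgue_on \<Omega>) h"
    unfolding h_def[abs_def] using Vi B\<Omega>
    by (intro Bochner_Integration.integrable_add integrable_mult_right integrable_const integrable_real_indicator)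
      (auto simp: sets_restrict_space_iff[of \<Omega> lebesgue] O less_top[symmetric] emeasure_eq_measure)
  have le: "AE x in lebesgue_on \<Omega>. f (\<xi> + G x) \<le> h x"
    using dt(4)
  proof eventually_elim
    case (elim x)
    show ?case
    proof (cases "x \<in> ?B")
      case True
      then have pos: "reg_scale k a x0 \<rho> x > 0" and r: "rank (mat 1 + grad w x) \<le> k - 1" and g: "G x = \<xi> ** grad w x"
        and nw: "norm (grad w x) \<le> ?n * (?n * (17 * ?n / y x))"
        using elim by (simp_all add: w_def G_def y_def)
      have y: "y x > 0" "y x \<le> 1"
        using reg_scale_props(2)[OF k \<rho>(2) pos] reg_scale_props(3)[OF k \<rho>(2) pos] reg_scale_props(4)[OF k \<rho>(2) pos] sel_scl_bounds[OF k \<rho>(2), of x0 x a] by (auto simp: y_def)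
      have e: "\<xi> + G x = \<xi> ** (mat 1 + grad w x)" by (simp add: g matrix_add_ldistrib)
      have "?I * 1 \<le> ?I * (1 / y x)" using y by (intro mult_left_mono) (auto simp: field_simps)
      then have "norm (mat 1 + grad w x) \<le> ?I * (1 / y x) + ?n * (?n * (17 * ?n / y x))"
        using norm_triangle_ineq[of "mat 1" "grad w x"] nw by linarith
      also have "\<dots> = (?I + 17 * ?n ^ 3) / y x" by (simp add: power3_eq_cube add_divide_distrib)
      finally have I: "norm (mat 1 + grad w x) \<le> (?I + 17 * ?n ^ 3) / y x" .
      have "norm (\<xi> + G x) \<le> norm \<xi> * norm (mat 1 + grad w x) * c" unfolding e by (rule c(2))
      also have "\<dots> \<le> norm \<xi> * ((?I + 17 * ?n ^ 3) / y x) * c" using c(1) by (intro mult_right_mono mult_left_mono I) auto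
      finally have "norm (\<xi> + G x) powr q \<le> ((norm \<xi> * (?I + 17 * ?n ^ 3) * c) / y x) powr q"
        using q by (intro powr_mono2) (auto simp: ac_simps)
      also have "\<dots> = (norm \<xi> * (?I + 17 * ?n ^ 3) * c) powr q * y x powr - q"
        using y c(1) by (simp add: powr_divide powr_minus_divide)
      also have "\<dots> \<le> (norm \<xi> * (?I + 17 * ?n ^ 3) * c) powr q * y x powr - s"
        using y q by (intro mult_left_mono powr_mono') auto
      finally have "L * norm (\<xi> + G x) powr q \<le> A * y x powr - s"
        unfolding A_def mult.assoc[of L] by (rule mult_left_mono[OF _ L])
      moreover have "f (\<xi> + G x) \<le> L * (1 + norm (\<xi> + G x) powr q)"
        using rank_mul_le_right[of \<xi> "mat 1 + grad w x"] r unfolding e by (intro low) linarith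
      ultimately show ?thesis using True by (simp add: h_def V_def algebra_simps)
    next
      case False
      then show ?thesis using elim by (simp add: G_def h_def V_def)
    qed
  qed
  obtain b where b: "\<And>\<zeta>. b \<le> f \<zeta>" using bd by (auto simp: bdd_below_def)
  have [measurable]: "f \<in> borel_measurable borel" using cf by (rule borel_measurable_continuous_onI)
  have gi: "integrable (lebesgue_on \<Omega>) (\<lambda>x. f (\<xi> + G x))"
  proof (rule Bochner_Integration.integrable_bound[of _ "\<lambda>x. \<bar>b\<bar> + \<bar>h x\<bar>"])
    show "AE x in lebesgue_on \<Omega>. norm (f (\<xi> + G x)) \<le> norm (\<bar>b\<bar> + \<bar>h x\<bar>)"
      using le
    proof eventually_elim
      case (elim x)
      then show ?case using b[of "\<xi> + G x"] by simp
    qed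
  qed (use hi in auto)
  have "measure lebesgue \<Omega> * f \<xi> \<le> (\<integral>x. f (\<xi> + G x) \<partial>lebesgue_on \<Omega>)"
    using tst[OF dt(1,2)] unfolding G_def[symmetric] ext_integral_real[OF gi] by simp
  also have "\<dots> \<le> (\<integral>x. h x \<partial>lebesgue_on \<Omega>)" by (rule integral_mono_AE[OF gi hi le])
  also have "\<dots> = f \<xi> * measure lebesgue \<Omega> + (L - f \<xi>) * m + A * (\<integral>x. V x \<partial>lebesgue_on \<Omega>)"
  proof -
    have "measure (lebesgue_on \<Omega>) ?B = m"
      unfolding m_def using B\<Omega> O(2) by (intro measure_restrict_space) auto
    moreover have "measure (lebesgue_on \<Omega>) \<Omega> = measure lebesgue \<Omega>"
      using O(2) by (intro measure_restrict_space) auto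
    moreover have "integrable (lebesgue_on \<Omega>) (\<lambda>x. indicator ?B x :: real)"
      using B\<Omega> by (intro integrable_real_indicator)
        (auto simp: sets_restrict_space_iff[of \<Omega> lebesgue] O less_top[symmetric] emeasure_eq_measure)
    moreover have "?B \<inter> \<Omega> = ?B" using B\<Omega> by blast
    ultimately show ?thesis unfolding h_def[abs_def] using Vi by (simp add: mult.commute)
  qed
  finally have "f \<xi> * m \<le> L * m + A * (\<integral>x. V x \<partial>lebesgue_on \<Omega>)" by (simp add: algebra_simps)
  also have "\<dots> \<le> L * m + A * (C * m)" using Vint A0 by (intro add_left_mono mult_left_mono)
  finally have "f \<xi> * m \<le> (L + A * C) * m" by (simp add: algebra_simps)
  then show ?thesis using mB(2) by (simp add: A_def)
qed

text \<open>Neither \<open>C\<close>, from the good shifts, nor \<open>c\<close>, from the matrix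
  product, depends on \<open>\<xi>\<close>, although the domain and the shift do. So the pointwise
  bounds share one constant.\<close>

lemma low_rank_growth:
  fixes f :: "real^'n^'N \<Rightarrow> real"
  assumes k: "1 \<le> k" "k \<le> CARD('n)" and cf: "continuous_on UNIV f" and bd: "bdd_below (range f)"
    and p: "1 \<le> p" "p < real k" and q: "0 \<le> q" "q < real k" and L: "L \<ge> 0"
    and low: "\<And>\<xi>. rank \<xi> \<le> k - 1 \<Longrightarrow> f \<xi> \<le> L * (1 + norm \<xi> powr q)"
    and qc: "W1p_quasiconvex p (\<lambda>\<xi>. ereal (f \<xi>))"
  obtains L' where "L' \<ge> 0" "\<And>\<xi>. f \<xi> \<le> L' * (1 + norm \<xi> powr q)"
proof -
  let ?s = "max p q"
  obtain C where C: "C \<ge> 0" "\<And>(x0 :: real^'n) \<rho>. 0 < \<rho> \<Longrightarrow> \<rho> < 1 \<Longrightarrow>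
      \<exists>a. (\<integral>\<^sup>+x. indicator (ball x0 \<rho>) x * sing_powr ?s (reg_scale k a x0 \<rho> x / bdist x0 \<rho> x) \<partial>lborel)
        \<le> ennreal (C * measure lborel (ball x0 \<rho>))"
    by (rule exists_good_shift[OF k, of ?s]) (use p q in auto)
  have "bilinear (\<lambda>(A :: real^'n^'N) (B :: real^'n^'n). A ** B)"
    unfolding bilinear_def
    by (auto intro!: linearI simp: vec_eq_iff matrix_matrix_mult_def sum.distrib sum_distrib_left algebra_simps)
  then obtain c where c: "c > 0" "\<And>(A :: real^'n^'N) (B :: real^'n^'n). norm (A ** B) \<le> norm A * norm B * c"
    using bounded_bilinear.pos_bounded unfolding bilinear_conv_bounded_bilinear by blast
  let ?c = "(norm (mat 1 :: real^'n^'n) + 17 * real CARD('n) ^ 3) * c"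
  have c0: "?c \<ge> 0" using c(1) by simp
  define L' where "L' = L * (1 + ?c powr q * C)"
  have "f \<xi> \<le> L' * (1 + norm \<xi> powr q)" for \<xi>
  proof -
    have "W1p_quasiconvex_at p (\<lambda>\<xi>. ereal (f \<xi>)) \<xi>" using qc unfolding W1p_quasiconvex_def by (rule spec)
    from low_rank_growth_at[OF k cf bd p(1) _ q(1) _ L low this C c]
    have "f \<xi> \<le> L + L * (norm \<xi> * ?c) powr q * C" by (simp add: mult.assoc)
    also have "\<dots> = L * 1 + L * (?c powr q * C) * norm \<xi> powr q"
      using c0 by (simp add: powr_mult)
    also have "\<dots> \<le> L * (1 + ?c powr q * C) + L * (1 + ?c powr q * C) * norm \<xi> powr q"
      using L C(1) by (intro add_mono mult_right_mono mult_left_mono) auto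
    finally show ?thesis by (simp add: L'_def algebra_simps)
  qed
  moreover have "L' \<ge> 0" using L C(1) by (simp add: L'_def)
  ultimately show thesis using that by blast
qed

section \<open>Change of norm and conclusion\<close>

lemma is_norm_equivalent:
  fixes \<nu> :: "'a::euclidean_space \<Rightarrow> real"
  assumes "is_norm \<nu>"
  obtains c where "c > 0" "\<And>x. \<nu> x \<le> c * norm x" "\<And>x. norm x \<le> c * \<nu> x"
proof -
  have pos: "0 \<le> \<nu> x" and zero: "\<nu> x = 0 \<longleftrightarrow> x = 0" and hom: "\<nu> (t *\<^sub>R x) = \<bar>t\<bar> * \<nu> x"
    and tri: "\<nu> (x + y) \<le> \<nu> x + \<nu> y" for x y t using assms unfolding is_norm_def by blast+
  define c1 where "c1 = (\<Sum>b\<in>Basis. \<nu> (b :: 'a))"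
  have c1: "c1 \<ge> 0" unfolding c1_def by (intro sum_nonneg pos)
  have upper: "\<nu> x \<le> c1 * norm x" for x
  proof -
    have fs: "\<nu> (\<Sum>b\<in>S. g b) \<le> (\<Sum>b\<in>S. \<nu> (g b))" if "finite S" for S and g :: "'a \<Rightarrow> 'a"
      using that
    proof (induction S rule: finite_induct)
      case empty then show ?case using zero[of 0] by simp
    next
      case (insert b S) then show ?case using tri[of "g b" "\<Sum>b\<in>S. g b"] by simp
    qed
    have "\<nu> x = \<nu> (\<Sum>b\<in>Basis. (x \<bullet> b) *\<^sub>R b)" by (simp add: euclidean_representation)
    also have "\<dots> \<le> (\<Sum>b\<in>Basis. \<nu> ((x \<bullet> b) *\<^sub>R b))" by (rule fs) simp
    also have "\<dots> \<le> (\<Sum>b\<in>Basis. norm x * \<nu> b)"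
      unfolding hom by (intro sum_mono mult_right_mono Basis_le_norm pos)
    finally show ?thesis by (simp add: c1_def sum_distrib_left mult.commute)
  qed
  have lip: "dist (\<nu> y) (\<nu> x) \<le> c1 * dist y x" for x y
  proof -
    have "\<nu> (x - y) = \<nu> (y - x)" using hom[of "-1" "x - y"] by simp
    then have "\<bar>\<nu> y - \<nu> x\<bar> \<le> \<nu> (y - x)" using tri[of "x - y" y] tri[of "y - x" x] by simp
    then show ?thesis using upper[of "y - x"] by (simp add: dist_real_def dist_norm)
  qed
  have "continuous_on (sphere 0 1) \<nu>"
    using lip by (intro lipschitz_on_continuous_on[of c1] lipschitz_onI c1) auto
  moreover have "(sphere 0 1 :: 'a set) \<noteq> {}" by simp
  ultimately obtain z where z: "norm z = 1" "\<And>x. norm x = 1 \<Longrightarrow> \<nu> z \<le> \<nu> x"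
    using continuous_attains_inf[of "sphere 0 1" \<nu>] by auto
  have z0: "\<nu> z > 0" using pos[of z] zero[of z] z(1) by (auto simp: less_le)
  have lower: "norm x \<le> 1 / \<nu> z * \<nu> x" for x
  proof (cases "x = 0")
    case False
    have "\<nu> z \<le> \<nu> ((1 / norm x) *\<^sub>R x)" using False by (intro z(2)) simp
    then show ?thesis unfolding hom using False z0 by (simp add: field_simps)
  qed (use zero[of 0] in simp)
  show thesis
  proof (rule that[of "c1 + 1 / \<nu> z"])
    show "c1 + 1 / \<nu> z > 0" using c1 z0 by (simp add: add_nonneg_pos)
    show "\<nu> x \<le> (c1 + 1 / \<nu> z) * norm x" for x
      using upper[of x] z0 by (simp add: distrib_right add_increasing2)
    show "norm x \<le> (c1 + 1 / \<nu> z) * \<nu> x" for x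
      using lower[of x] mult_nonneg_nonneg[OF c1 pos[of x]] by (simp add: distrib_right)
  qed
qed

theorem theorem1p4:
  fixes f :: "real^'n^'N \<Rightarrow> real"
    and nrm :: "real^'n^'N \<Rightarrow> real"
    and k :: nat
    and p q L :: real
  assumes "CARD('n) \<ge> 2" and "CARD('N) \<ge> 2"
    and "2 \<le> k" and "k \<le> min CARD('n) CARD('N)"
    and "1 \<le> p" and "p < real k"
    and "is_norm nrm"
    and "continuous_on UNIV f"
    and "bdd_below (range f)"
    and "W1p_quasiconvex p (\<lambda>\<xi>. ereal (f \<xi>))"
    and "1 \<le> q" and "q < real k"
    and "L > 0"
    and "\<forall>\<xi>. rank \<xi> \<le> k - 1 \<longrightarrow> f \<xi> \<le> L * (1 + nrm \<xi> powr q)"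
  shows "(\<exists>L'>0. \<forall>\<xi>. f \<xi> \<le> L' * (1 + nrm \<xi> powr q)) \<and>
         W1p_quasiconvex q (\<lambda>\<xi>. ereal (f \<xi>))"
proof -
  obtain c where c: "c > 0" "\<And>x. nrm x \<le> c * norm x" "\<And>x. norm x \<le> c * nrm x"
    using is_norm_equivalent[OF assms(7)] by blast
  have nrm0: "0 \<le> nrm x" for x using assms(7) unfolding is_norm_def by blast
  \<comment> \<open>Used in both directions: to bring the hypothesis from \<open>nrm\<close> to the
    Euclidean norm, and to bring the resulting bound back.\<close>
  have conv: "M * (1 + \<nu> \<xi> powr q) \<le> (M * (1 + c powr q)) * (1 + \<nu>' \<xi> powr q)"
    if "M \<ge> 0" "0 \<le> \<nu> \<xi>" "0 \<le> \<nu>' \<xi>" "\<nu> \<xi> \<le> c * \<nu>' \<xi>" for M \<nu> \<nu>' and \<xi> :: "real^'n^'N"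
  proof -
    have "\<nu> \<xi> powr q \<le> (c * \<nu>' \<xi>) powr q" using that assms(11) by (intro powr_mono2) auto
    also have "\<dots> = c powr q * \<nu>' \<xi> powr q" using c(1) that by (simp add: powr_mult)
    finally have "1 + \<nu> \<xi> powr q \<le> 1 + c powr q * \<nu>' \<xi> powr q" by simp
    also have "\<dots> \<le> (1 + c powr q) * (1 + \<nu>' \<xi> powr q)" by (simp add: distrib_left distrib_right)
    finally have "1 + \<nu> \<xi> powr q \<le> (1 + c powr q) * (1 + \<nu>' \<xi> powr q)" .
    then show ?thesis using that(1) by (simp add: mult.assoc mult_left_mono)
  qed
  have low: "f \<xi> \<le> L * (1 + c powr q) * (1 + norm \<xi> powr q)" if "rank \<xi> \<le> k - 1" for \<xi>
  proof -
    have "f \<xi> \<le> L * (1 + nrm \<xi> powr q)" using assms(14) that by blast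
    also have "\<dots> \<le> L * (1 + c powr q) * (1 + norm \<xi> powr q)" using assms(13) c(2) nrm0 by (intro conv) auto
    finally show ?thesis .
  qed
  obtain M where M: "M \<ge> 0" "\<And>\<xi>. f \<xi> \<le> M * (1 + norm \<xi> powr q)"
    by (rule low_rank_growth[OF _ _ assms(8,9,5,6) _ assms(12) _ low assms(10)]) (use assms in auto)
  \<comment> \<open>The added 1 makes the constant strictly positive even if
    \<open>M = 0\<close>.\<close>
  have "f \<xi> \<le> (M * (1 + c powr q) + 1) * (1 + nrm \<xi> powr q)" for \<xi>
  proof -
    have "f \<xi> \<le> M * (1 + norm \<xi> powr q)" by (rule M(2))
    also have "\<dots> \<le> M * (1 + c powr q) * (1 + nrm \<xi> powr q)" using M(1) c(3) nrm0 by (intro conv) auto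
    also have "\<dots> \<le> (M * (1 + c powr q) + 1) * (1 + nrm \<xi> powr q)" by (intro mult_right_mono) auto
    finally show ?thesis .
  qed
  moreover have "M * (1 + c powr q) + 1 > 0" using M(1) by (intro add_nonneg_pos mult_nonneg_nonneg) auto
  moreover have "W1p_quasiconvex q (\<lambda>\<xi>. ereal (f \<xi>))"
    by (rule quasiconvex_of_growth[OF assms(5,11,8,9,10) M])
  ultimately show ?thesis by blast
qed

end
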